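(* Let $\rho_8$ be a density matrix on $\mathcal{F}_4$ supported on the even (vacuum) sector, i.e. $Q\rho_8=\rho_8Q=\rho_8$, and suppose that $\epsilon_8=1-\langle a_8|\rho_8|a_8\rangle<0.38$. Assume that all TQC operations are perfect. Then TQC operations together with a supply of copies of $\rho_8$ allow one to implement any Clifford gates (that is, the CNOT gate, the Hadamard gate, and the one-qubit $\pi/4$-rotation $\mathrm{diag}(1,i)$) on logical qubits: for every $\delta>0$, each of these gates can be implemented on logical qubits, up to an overall phase, with error probability at most $\delta$, using TQC operations and finitely many copies of $\rho_8$.
   Context: Let $\mathcal{F}_n=(\mathbb{C}^2)^{\otimes n}$, representing $2n$ particles ($\sigma$-particles, "Ising anyons"). The Majorana operators $\hat c_1,\dots,\hat c_{2n}$ on $\mathcal{F}_n$ are $$\hat c_{2j-1}=\sigma^z_1\otimes\cdots\otimes\sigma^z_{j-1}\otimes\sigma^x_j\otimes I\otimes\cdots\otimes I,\qquad \hat c_{2j}=\sigma^z_1\otimes\cdots\otimes\sigma^z_{j-1}\otimes\sigma^y_j\otimes I\otimes\cdots\otimes I,$$ for $j=1,\dots,n$, where $\sigma^x,\sigma^y,\sigma^z$ are the Pauli matrices. The parity operator is $Q=\sigma^z_1\otimes\cdots\otimes\sigma^z_n$. TQC operations are: preparation of (fresh) pairs of particles in the state $|0\rangle$; the braid gates $B_{p,q}=\exp(-\frac{\pi}{4}\hat c_p\hat c_q)$ for $p<q$; and non-destructive projective measurements of the observables $F_{p,q}=-i\hat c_p\hat c_q$ for $p<q$. Operations may be chosen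 adaptively depending on previous measurement outcomes and on classical randomness; particles may be discarded. A logical qubit is encoded in four particles, i.e. in $\mathcal{F}_2$, by $|\bar 0\rangle=|0,0\rangle$ and $|\bar 1\rangle=|1,1\rangle$. The target ancillary state is $$|a_8\rangle=\tfrac1{\sqrt2}(|\bar0,\bar0\rangle+|\bar1,\bar1\rangle)=\tfrac1{\sqrt2}(|0,0,0,0\rangle+|1,1,1,1\rangle)\in\mathcal{F}_4 .$$ *)

theory Defs
  imports
    Complex_Main
    "Jordan_Normal_Form.Matrix"
    "Jordan_Normal_Form.Schur_Decomposition"
begin

section \<open>Matrices\<close>

text \<open>Kronecker product; the right factor is the least significant one in the index.\<close>

definition kron :: "complex mat \<Rightarrow> complex mat \<Rightarrow> complex mat" (infixr \<open>\<otimes>\<^sub>K\<close> 72) where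
  "A \<otimes>\<^sub>K B = mat (dim_row A * dim_row B) (dim_col A * dim_col B)
     (\<lambda>(i, j). A $$ (i div dim_row B, j div dim_col B) * B $$ (i mod dim_row B, j mod dim_col B))"

definition tensor :: "complex mat list \<Rightarrow> complex mat" where
  "tensor As = foldr kron As (1\<^sub>m 1)"

text \<open>Exponential of a square matrix by its power series, which converges entrywise.\<close>

definition mat_exp :: "complex mat \<Rightarrow> complex mat" where
  "mat_exp A = mat (dim_row A) (dim_row A) (\<lambda>(i, j). \<Sum>k. (A ^\<^sub>m k) $$ (i, j) / fact k)"

definition conj_by :: "complex mat \<Rightarrow> complex mat \<Rightarrow> complex mat" where
  "conj_by K \<rho> = K * \<rho> * mat_adjoint K"

definition density_op :: "nat \<Rightarrow> complex mat \<Rightarrow> bool" where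
  "density_op n \<rho> \<longleftrightarrow> \<rho> \<in> carrier_mat (2 ^ n) (2 ^ n) \<and> mat_adjoint \<rho> = \<rho> \<and>
     (\<forall>v \<in> carrier_vec (2 ^ n). Re ((\<rho> *\<^sub>v v) \<bullet>c v) \<ge> 0) \<and>
     (\<Sum>i<2 ^ n. \<rho> $$ (i, i)) = 1"

section \<open>Ising anyons\<close>

definition sigma_x :: "complex mat" where
  "sigma_x = mat_of_rows_list 2 [[0, 1], [1, 0]]"

definition sigma_y :: "complex mat" where
  "sigma_y = mat_of_rows_list 2 [[0, - \<i>], [\<i>, 0]]"

definition sigma_z :: "complex mat" where
  "sigma_z = mat_of_rows_list 2 [[1, 0], [0, - 1]]"

text \<open>Majorana operators on \<open>n\<close> pairs of particles, for particle numbers \<open>1 \<le> p \<le> 2 * n\<close>.\<close>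

definition majorana :: "nat \<Rightarrow> nat \<Rightarrow> complex mat" where
  "majorana n p = (let j = (p + 1) div 2 in
     tensor (replicate (j - 1) sigma_z @ [if odd p then sigma_x else sigma_y]
             @ replicate (n - j) (1\<^sub>m 2)))"

definition parity_op :: "nat \<Rightarrow> complex mat" where
  "parity_op n = tensor (replicate n sigma_z)"

definition braid_gate :: "nat \<Rightarrow> nat \<Rightarrow> nat \<Rightarrow> complex mat" where
  "braid_gate n p q = mat_exp (complex_of_real (- pi / 4) \<cdot>\<^sub>m (majorana n p * majorana n q))"

definition pair_obs :: "nat \<Rightarrow> nat \<Rightarrow> nat \<Rightarrow> complex mat" where
  "pair_obs n p q = (- \<i>) \<cdot>\<^sub>m (majorana n p * majorana n q)"

text \<open>For \<open>p < q\<close> the observable \<open>pair_obs n p q\<close> is Hermitian and squares to the identity, so these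
  (for \<open>s = 1\<close> and \<open>s = - 1\<close>) are its spectral projectors.\<close>

definition pair_proj :: "nat \<Rightarrow> nat \<Rightarrow> nat \<Rightarrow> complex \<Rightarrow> complex mat" where
  "pair_proj n p q s = (1 / 2) \<cdot>\<^sub>m (1\<^sub>m (2 ^ n) + s \<cdot>\<^sub>m pair_obs n p q)"

definition ket :: "nat \<Rightarrow> complex mat" where
  "ket b = mat 2 1 (\<lambda>(i, _). if i = b then 1 else 0)"

definition kets :: "nat list \<Rightarrow> complex mat" where
  "kets bs = tensor (map ket bs)"

definition proj :: "complex mat \<Rightarrow> complex mat" where
  "proj \<psi> = \<psi> * mat_adjoint \<psi>"

definition trace_last :: "nat \<Rightarrow> complex mat \<Rightarrow> complex mat" where
  "trace_last n \<rho> = mat (2 ^ (n - 1)) (2 ^ (n - 1))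
     (\<lambda>(i, j). \<rho> $$ (2 * i, 2 * j) + \<rho> $$ (2 * i + 1, 2 * j + 1))"

section \<open>Adaptive topological protocols\<close>

text \<open>A protocol is a finite decision tree. \<open>Measure p q P M\<close> continues with \<open>P\<close> on outcome \<open>+1\<close> and
  with \<open>M\<close> on outcome \<open>-1\<close>; \<open>Coin r P R\<close> continues with \<open>P\<close> with probability \<open>r\<close> and with \<open>R\<close>
  otherwise. New particles (a fresh pair, or the eight particles of a copy of the supplied state)
  get the highest numbers, and \<open>Discard\<close> removes the pair with the highest numbers; since
  conjugation by a braid gate exchanges two Majorana operators up to sign, any other pair can be
  brought there first. As the tree is finite, a protocol consumes finitely many supplied copies.\<close>

datatype protocol =
    Done
  | Prepare protocol
  | Supply protocol
  | Discard protocol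
  | Braid nat nat protocol
  | Measure nat nat protocol protocol
  | Coin real protocol protocol

text \<open>\<open>well_formed P n m\<close>: the protocol is applicable to \<open>n\<close> pairs and leaves \<open>m\<close> pairs on each branch.\<close>

primrec well_formed :: "protocol \<Rightarrow> nat \<Rightarrow> nat \<Rightarrow> bool" where
  "well_formed Done n m \<longleftrightarrow> n = m"
| "well_formed (Prepare P) n m \<longleftrightarrow> well_formed P (n + 1) m"
| "well_formed (Supply P) n m \<longleftrightarrow> well_formed P (n + 4) m"
| "well_formed (Discard P) n m \<longleftrightarrow> n \<ge> 1 \<and> well_formed P (n - 1) m"
| "well_formed (Braid p q P) n m \<longleftrightarrow> 1 \<le> p \<and> p < q \<and> q \<le> 2 * n \<and> well_formed P n m"
| "well_formed (Measure p q P M) n m \<longleftrightarrow>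
     1 \<le> p \<and> p < q \<and> q \<le> 2 * n \<and> well_formed P n m \<and> well_formed M n m"
| "well_formed (Coin r P R) n m \<longleftrightarrow> 0 \<le> r \<and> r \<le> 1 \<and> well_formed P n m \<and> well_formed R n m"

text \<open>\<open>run \<rho>\<^sub>8 P n \<rho>\<close> is the output, averaged over measurement outcomes and coins, of \<open>P\<close> run on the
  state \<open>\<rho>\<close> of \<open>n\<close> pairs with supplied state \<open>\<rho>\<^sub>8\<close>. Post-measurement states are left unnormalized, so
  their traces carry the outcome probabilities.\<close>

primrec run :: "complex mat \<Rightarrow> protocol \<Rightarrow> nat \<Rightarrow> complex mat \<Rightarrow> complex mat" where
  "run \<rho>\<^sub>8 Done n \<rho> = \<rho>"
| "run \<rho>\<^sub>8 (Prepare P) n \<rho> = run \<rho>\<^sub>8 P (n + 1) (\<rho> \<otimes>\<^sub>K proj (ket 0))"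
| "run \<rho>\<^sub>8 (Supply P) n \<rho> = run \<rho>\<^sub>8 P (n + 4) (\<rho> \<otimes>\<^sub>K \<rho>\<^sub>8)"
| "run \<rho>\<^sub>8 (Discard P) n \<rho> = run \<rho>\<^sub>8 P (n - 1) (trace_last n \<rho>)"
| "run \<rho>\<^sub>8 (Braid p q P) n \<rho> = run \<rho>\<^sub>8 P n (conj_by (braid_gate n p q) \<rho>)"
| "run \<rho>\<^sub>8 (Measure p q P M) n \<rho> =
     run \<rho>\<^sub>8 P n (conj_by (pair_proj n p q 1) \<rho>) + run \<rho>\<^sub>8 M n (conj_by (pair_proj n p q (- 1)) \<rho>)"
| "run \<rho>\<^sub>8 (Coin r P R) n \<rho> =
     complex_of_real r \<cdot>\<^sub>m run \<rho>\<^sub>8 P n \<rho> + complex_of_real (1 - r) \<cdot>\<^sub>m run \<rho>\<^sub>8 R n \<rho>"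

section \<open>Logical qubits\<close>

text \<open>The isometry \<open>|b\<rangle> \<mapsto> |b, b\<rangle>\<close>, applied to each of \<open>N\<close> qubits. Logical qubit \<open>i < N\<close> thus lives on
  particles \<open>4 * i + 1, \<dots>, 4 * i + 4\<close>.\<close>

definition encode1 :: "complex mat" where
  "encode1 = kets [0, 0] * mat_adjoint (ket 0) + kets [1, 1] * mat_adjoint (ket 1)"

definition encoder :: "nat \<Rightarrow> complex mat" where
  "encoder N = tensor (replicate N encode1)"

definition a8 :: "complex mat" where
  "a8 = complex_of_real (1 / sqrt 2) \<cdot>\<^sub>m (kets [0, 0, 0, 0] + kets [1, 1, 1, 1])"

definition on_qubit :: "nat \<Rightarrow> nat \<Rightarrow> complex mat \<Rightarrow> complex mat" where
  "on_qubit N i G = tensor (replicate i (1\<^sub>m 2) @ [G] @ replicate (N - 1 - i) (1\<^sub>m 2))"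

definition hadamard :: "complex mat" where
  "hadamard = complex_of_real (1 / sqrt 2) \<cdot>\<^sub>m mat_of_rows_list 2 [[1, 1], [1, - 1]]"

definition phase_gate :: "complex mat" where
  "phase_gate = mat_of_rows_list 2 [[1, 0], [0, \<i>]]"

text \<open>Controlled-NOT on \<open>N\<close> qubits with control \<open>i\<close> and target \<open>j\<close>.\<close>

definition cnot :: "nat \<Rightarrow> nat \<Rightarrow> nat \<Rightarrow> complex mat" where
  "cnot N i j = on_qubit N i (proj (ket 0)) + on_qubit N i (proj (ket 1)) * on_qubit N j sigma_x"

text \<open>The unitary \<open>U\<close> on \<open>N\<close> logical qubits is realized, up to an overall phase (to which the action
  on density matrices is insensitive), with error probability at most \<open>\<delta>\<close>: on every encoded state,
  with probability \<open>1 - p \<ge> 1 - \<delta>\<close> the output is the correct encoded state, and with probability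
  \<open>p\<close> it is an arbitrary state \<open>\<tau>\<close>.\<close>

definition implementable :: "complex mat \<Rightarrow> nat \<Rightarrow> complex mat \<Rightarrow> real \<Rightarrow> bool" where
  "implementable \<rho>\<^sub>8 N U \<delta> \<longleftrightarrow>
     (\<exists>P. well_formed P (2 * N) (2 * N) \<and>
       (\<forall>\<rho>. density_op N \<rho> \<longrightarrow>
         (\<exists>p \<tau>. 0 \<le> p \<and> p \<le> \<delta> \<and> p \<le> 1 \<and> density_op (2 * N) \<tau> \<and>
           run \<rho>\<^sub>8 P (2 * N) (conj_by (encoder N) \<rho>) =
             complex_of_real (1 - p) \<cdot>\<^sub>m conj_by (encoder N) (conj_by U \<rho>)
             + complex_of_real p \<cdot>\<^sub>m \<tau>)))"

end

theory Submission
  imports Defs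
begin

text \<open>
  The Hadamard and phase gates are products of braids. For the controlled NOT one needs in addition
  the gate \<open>U = (1 - \<i> c\<^sub>p c\<^sub>q c\<^sub>r c\<^sub>s) / sqrt 2\<close>, and the state \<open>a8\<close> encodes it: \<open>a8\<close> is stabilized by four
  quartic Majorana monomials, and measuring four data particles against four of its particles,
  correcting with stabilizers and braiding with the other four particles applies \<open>U\<close> to the data.

  The even sector of four pairs has an orthonormal basis of eight states, obtained from \<open>a8\<close> by
  the faults \<open>c\<^sub>1 c\<^sub>3\<close>, \<open>c\<^sub>1 c\<^sub>5\<close>, \<open>c\<^sub>1 c\<^sub>8\<close>. Randomly applied stabilizers turn the supplied state into a mixture
  of these with weight \<open>1 - \<epsilon>\<^sub>8\<close> on \<open>a8\<close>, and a faulty ancilla amounts to a fault of the data before the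
  gate. Applying the noisy gate to another ancilla and a fresh pair measures a parity: the ancilla
  survives if the third fault bits of both ancillas agree, and then the first two bits add up
  (shifted by the third one). Fault bits can be permuted by braids. Three rounds in three different
  directions, followed by averaging over a cyclic group that permutes the seven faults
  transitively, map the ratio \<open>r\<close> of the weight of each fault to the weight of \<open>a8\<close> to some
  \<open>phi r \<le> 0.98 * r\<close>, provided that \<open>r \<le> 0.0876\<close>; initially \<open>r = \<epsilon>\<^sub>8 / (7 * (1 - \<epsilon>\<^sub>8))\<close>. Iterating
  this, and retrying after failures, produces \<open>a8\<close> with probability arbitrarily close to \<open>1\<close>.
\<close>

section \<open>Operators on infinitely many sites\<close>

text \<open>The controlled NOT contains a ZZ rotation, and since \<open>c1 c2\<close> of a block is
  \<open>i\<close> times its logical Pauli Z, this is the exponential of a product of four Majorana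
  operators. Braids cannot supply it, because conjugation by them maps single Majorana operators to
  single ones. Each of the four stabilizers contains exactly one measured ancilla particle, so every
  wrong outcome can be corrected and the gate needs no postselection. A parity round sees one fault
  bit only; to first order it doubles the weight of the faults that it does not see, hence one round
  per direction in each step. The resulting distribution is not uniform, and the averaging brings it
  back to a family with the single parameter \<open>r\<close>. The bound 0.0876 is 0.38 / (7 * 0.62)
  rounded up; \<open>phi r\<close> behaves like 48 r^2 / 7 near 0 and is still below
  \<open>r\<close> at this bound, and the slope 0.98 turns this into geometric decay. With finitely
  many copies the preparation may fail. Failed and faulty branches must still output states; for
  this it suffices that each of them is some unitary conjugation of the input.\<close>

text \<open>Linear endomorphisms of the functions on all bit sequences. The matrices of every system size
  embed into this one ring, where appending a subsystem is multiplication by commuting operators.\<close>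

typedef op = "{f :: ((nat \<Rightarrow> bool) \<Rightarrow> complex) \<Rightarrow> (nat \<Rightarrow> bool) \<Rightarrow> complex.
  (\<forall>u v. f (\<lambda>x. u x + v x) = (\<lambda>x. f u x + f v x)) \<and> (\<forall>a u. f (\<lambda>x. a * u x) = (\<lambda>x. a * f u x))}"
  morphisms app Op
  by (rule exI[of _ "\<lambda>u. u"]) simp

setup_lifting type_definition_op

lemma app_add: "app f (\<lambda>x. u x + v x) = (\<lambda>x. app f u x + app f v x)"
  and app_mult: "app f (\<lambda>x. a * u x) = (\<lambda>x. a * app f u x)"
  using app[of f] by auto

lemma op_eqI: "(\<And>u x. app f u x = app g u x) \<Longrightarrow> f = g"
  by (metis app_inject ext)

instantiation op :: real_algebra_1
begin

lift_definition zero_op :: op is "\<lambda>u x. 0" by simp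
lift_definition one_op :: op is "\<lambda>u. u" by simp
lift_definition plus_op :: "op \<Rightarrow> op \<Rightarrow> op" is "\<lambda>f g u x. f u x + g u x"
  by (auto simp: algebra_simps fun_eq_iff)
lift_definition minus_op :: "op \<Rightarrow> op \<Rightarrow> op" is "\<lambda>f g u x. f u x - g u x"
  by (auto simp: algebra_simps fun_eq_iff)
lift_definition uminus_op :: "op \<Rightarrow> op" is "\<lambda>f u x. - f u x"
  by (auto simp: algebra_simps fun_eq_iff)
lift_definition times_op :: "op \<Rightarrow> op \<Rightarrow> op" is "\<lambda>f g u. f (g u)"
  by simp
lift_definition scaleR_op :: "real \<Rightarrow> op \<Rightarrow> op" is "\<lambda>r f u x. complex_of_real r * f u x"
  by (auto simp: algebra_simps fun_eq_iff)

instance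
proof
  show "(0::op) \<noteq> 1"
    by transfer (metis zero_neq_one)
qed (rule op_eqI; simp add: zero_op.rep_eq one_op.rep_eq plus_op.rep_eq minus_op.rep_eq
      uminus_op.rep_eq times_op.rep_eq scaleR_op.rep_eq app_add app_mult algebra_simps)+

end

lemmas app_simps = zero_op.rep_eq one_op.rep_eq plus_op.rep_eq minus_op.rep_eq
  uminus_op.rep_eq times_op.rep_eq scaleR_op.rep_eq app_add app_mult

text \<open>The type class provides real scalars only; complex ones enter as central elements of the
  ring.\<close>

lift_definition sc :: "complex \<Rightarrow> op" is "\<lambda>a u x. a * u x"
  by (auto simp: algebra_simps fun_eq_iff)

lemma sc_mult: "sc (a * b) = sc a * sc b"
  and sc_add: "sc (a + b) = sc a + sc b"
  and sc_minus: "sc (- a) = - sc a"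
  and sc_0 [simp]: "sc 0 = 0"
  and sc_1 [simp]: "sc 1 = 1"
  and sc_real: "sc (complex_of_real r) = r *\<^sub>R 1"
  and sc_central: "f * sc a = sc a * f"
  by (rule op_eqI; simp add: app_simps sc.rep_eq algebra_simps)+

lemma sc_inject: "sc a = sc b \<longleftrightarrow> a = b"
proof
  assume "sc a = sc b"
  then have "app (sc a) (\<lambda>_. 1) undefined = app (sc b) (\<lambda>_. 1) undefined" by simp
  then show "a = b" by (simp add: sc.rep_eq)
qed simp

abbreviation bit :: "bool \<Rightarrow> nat" where "bit \<equiv> of_bool"

lift_definition site :: "nat \<Rightarrow> complex mat \<Rightarrow> op" is
  "\<lambda>k M u x. \<Sum>b\<in>UNIV. M $$ (bit (x k), bit b) * u (x(k := b))"
  by (auto simp: algebra_simps fun_eq_iff sum.distrib UNIV_bool)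

lemma site_one [simp]: "site k (1\<^sub>m 2) = 1"
proof (rule op_eqI)
  fix u :: "(nat \<Rightarrow> bool) \<Rightarrow> complex" and x :: "nat \<Rightarrow> bool"
  have "x(k := x k) = x" by simp
  then show "app (site k (1\<^sub>m 2)) u x = app 1 u x"
    by (cases "x k") (simp_all add: site.rep_eq one_op.rep_eq UNIV_bool)
qed

lemma site_mult:
  assumes "A \<in> carrier_mat 2 2" "B \<in> carrier_mat 2 2"
  shows "site k A * site k B = site k (A * B)"
  using assms
  by (intro op_eqI)
     (auto simp: site.rep_eq times_op.rep_eq UNIV_bool scalar_prod_def algebra_simps numeral_2_eq_2)

lemma site_add:
  assumes "A \<in> carrier_mat 2 2" "B \<in> carrier_mat 2 2"
  shows "site k (A + B) = site k A + site k B"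
  using assms
  by (intro op_eqI) (auto simp: site.rep_eq plus_op.rep_eq UNIV_bool algebra_simps)

lemma site_smult:
  assumes "A \<in> carrier_mat 2 2"
  shows "site k (a \<cdot>\<^sub>m A) = sc a * site k A"
  using assms
  by (intro op_eqI) (auto simp: site.rep_eq sc.rep_eq times_op.rep_eq UNIV_bool algebra_simps)

lemma site_commute:
  assumes "k \<noteq> l"
  shows "site k A * site l B = site l B * site k A"
  using assms
  by (intro op_eqI) (simp add: site.rep_eq times_op.rep_eq UNIV_bool algebra_simps fun_upd_twist[of k l])

definition E2 :: "bool \<Rightarrow> bool \<Rightarrow> complex mat" where
  "E2 b c = mat 2 2 (\<lambda>(i, j). if i = bit b \<and> j = bit c then 1 else 0)"

lemma E2_carrier [simp]: "E2 b c \<in> carrier_mat 2 2"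
  by (simp add: E2_def)

lemma E2_mult: "E2 a b * E2 c d = (if b = c then E2 a d else 0\<^sub>m 2 2)"
  by (rule eq_matI) (auto simp: E2_def scalar_prod_def numeral_2_eq_2)

lemma site_zero [simp]: "site k (0\<^sub>m 2 2) = 0"
  by (rule op_eqI) (auto simp: site.rep_eq zero_op.rep_eq UNIV_bool)

lemma site_E2_mult: "site k (E2 a b) * site k (E2 c d) = (if b = c then site k (E2 a d) else 0)"
  by (simp add: site_mult E2_mult)

lemma site_E2_one: "(\<Sum>b\<in>UNIV. site k (E2 b b)) = 1"
proof -
  have "E2 True True + E2 False False = 1\<^sub>m 2"
    by (rule eq_matI) (auto simp: E2_def)
  then show ?thesis
    by (simp add: UNIV_bool site_add[symmetric] comm_add_mat[of "E2 False False" 2 2])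
qed

lemma site_E2_expand:
  assumes "M \<in> carrier_mat 2 2"
  shows "site k M = (\<Sum>b\<in>UNIV. \<Sum>c\<in>UNIV. sc (M $$ (bit b, bit c)) * site k (E2 b c))"
  using assms
  by (intro op_eqI) (auto simp: site.rep_eq sc.rep_eq times_op.rep_eq plus_op.rep_eq UNIV_bool algebra_simps E2_def)

text \<open>The last site is the least significant bit of an index, so this is the block of
  \<open>A\<close> at entry \<open>(b, c)\<close> of the last tensor factor.\<close>

definition blk :: "bool \<Rightarrow> bool \<Rightarrow> complex mat \<Rightarrow> complex mat" where
  "blk b c A = mat (dim_row A div 2) (dim_col A div 2) (\<lambda>(i, j). A $$ (2 * i + bit b, 2 * j + bit c))"

text \<open>\<open>emb m n A\<close> lets \<open>A\<close> act on the sites \<open>m, \<dots>, m + n - 1\<close>.\<close>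

primrec emb :: "nat \<Rightarrow> nat \<Rightarrow> complex mat \<Rightarrow> op" where
  "emb m 0 A = sc (A $$ (0, 0))"
| "emb m (Suc n) A = (\<Sum>b\<in>UNIV. \<Sum>c\<in>UNIV. emb m n (blk b c A) * site (m + n) (E2 b c))"

abbreviation cm :: "nat \<Rightarrow> complex mat set" where "cm n \<equiv> carrier_mat (2 ^ n) (2 ^ n)"

lemma blk_carrier [simp]: "A \<in> cm (Suc n) \<Longrightarrow> blk b c A \<in> cm n"
  by (auto simp: blk_def)

lemma index2: "i < 2 ^ n \<Longrightarrow> 2 * i + bit b < 2 * 2 ^ n"
  by (cases b) auto

lemma blk_mult:
  assumes "A \<in> cm (Suc n)" "B \<in> cm (Suc n)"
  shows "blk b c (A * B) = blk b False A * blk False c B + blk b True A * blk True c B"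
proof (rule eq_matI)
  have s: "sum f {0..<2 * m} = (\<Sum>i = 0..<m. f (2 * i)) + (\<Sum>i = 0..<m. f (2 * i + 1))"
    for f :: "nat \<Rightarrow> complex" and m :: nat
    by (induction m) (simp_all add: algebra_simps)
  fix i j
  assume "i < dim_row (blk b False A * blk False c B + blk b True A * blk True c B)"
    "j < dim_col (blk b False A * blk False c B + blk b True A * blk True c B)"
  then have ij: "i < 2 ^ n" "j < 2 ^ n"
    using assms by (auto simp: blk_def)
  have lt: "2 * i + bit b < 2 * 2 ^ n" "2 * j + bit c < 2 * 2 ^ n"
    using ij by (auto intro: index2)
  show "blk b c (A * B) $$ (i, j) = (blk b False A * blk False c B + blk b True A * blk True c B) $$ (i, j)"
    using assms ij lt by (simp add: blk_def scalar_prod_def s)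
qed (use assms in \<open>auto simp: blk_def\<close>)

lemma blk_add: "A \<in> cm (Suc n) \<Longrightarrow> B \<in> cm (Suc n) \<Longrightarrow> blk b c (A + B) = blk b c A + blk b c B"
  by (rule eq_matI) (auto simp: blk_def index2)

lemma blk_smult: "A \<in> cm (Suc n) \<Longrightarrow> blk b c (a \<cdot>\<^sub>m A) = a \<cdot>\<^sub>m blk b c A"
  by (rule eq_matI) (auto simp: blk_def index2)

lemma emb_add: "A \<in> cm n \<Longrightarrow> B \<in> cm n \<Longrightarrow> emb m n (A + B) = emb m n A + emb m n B"
  by (induction n arbitrary: A B)
     (simp_all add: sc_add blk_add[simplified] sum.distrib distrib_right UNIV_bool algebra_simps)

lemma emb_smult: "A \<in> cm n \<Longrightarrow> emb m n (a \<cdot>\<^sub>m A) = sc a * emb m n A"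
  by (induction n arbitrary: A) (simp_all add: sc_mult blk_smult[simplified] sum_distrib_left mult.assoc)

lemma site_emb_commute: "k \<ge> m + n \<or> k < m \<Longrightarrow> emb m n A * site k M = site k M * emb m n A"
proof (induction n arbitrary: A)
  case 0
  then show ?case by (simp add: sc_central)
next
  case (Suc n)
  have *: "emb m n B * site (m + n) F * site k M = site k M * (emb m n B * site (m + n) F)" for B F
  proof -
    have c: "site (m + n) F * site k M = site k M * site (m + n) F"
      using Suc.prems by (intro site_commute) auto
    have d: "emb m n B * site k M = site k M * emb m n B"
      using Suc.prems by (intro Suc.IH) auto
    show ?thesis
      by (metis c d mult.assoc)
  qed
  show ?case
    by (simp only: emb.simps sum_distrib_left sum_distrib_right *)
qed

lemma emb_mult: "A \<in> cm n \<Longrightarrow> B \<in> cm n \<Longrightarrow> emb m n (A * B) = emb m n A * emb m n B"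
proof (induction n arbitrary: A B)
  case 0
  then show ?case by (simp add: sc_mult scalar_prod_def)
next
  case (Suc n)
  let ?e = "\<lambda>b c A. emb m n (blk b c A)" and ?s = "\<lambda>b c. site (m + n) (E2 b c)"
  have comm: "?s a b * (?e c d B * X) = ?e c d B * (?s a b * X)" for a b c d X
    by (simp add: mult.assoc[symmetric] site_emb_commute)
  have AB: "?e b c (A * B) = ?e b False A * ?e False c B + ?e b True A * ?e True c B" for b c
    using Suc.prems
    by (simp add: blk_mult[of A n B] emb_add[of _ n] Suc.IH mult_carrier_mat[of _ "2^n" "2^n"])
  show ?case
    unfolding emb.simps AB
    by (simp add: UNIV_bool algebra_simps comm site_E2_mult)
qed

lemma emb_one [simp]: "emb m n (1\<^sub>m (2 ^ n)) = 1"
proof (induction n)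
  case (Suc n)
  have "blk b c (1\<^sub>m (2 ^ Suc n)) = (if b = c then 1\<^sub>m (2 ^ n) else 0 \<cdot>\<^sub>m 1\<^sub>m (2 ^ n))" for b c
  proof (cases "b = c")
    case True
    then show ?thesis by (intro eq_matI) (auto simp: blk_def index2)
  next
    case False
    have "odd (2 * i + bit b) \<noteq> odd (2 * j + bit c)" for i j :: nat
      using False by (cases b; cases c) simp_all
    then have "2 * i + bit b \<noteq> 2 * j + bit c" for i j :: nat
      by metis
    then show ?thesis using False by (intro eq_matI) (auto simp: blk_def index2)
  qed
  then show ?case
    using Suc site_E2_one[of "m + n"] by (simp add: UNIV_bool emb_smult del: smult_zero_mat)
qed simp

text \<open>The matrix units pick the coefficient of \<open>E2 b c\<close> out of the block
  expansion, and the sum over \<open>d\<close> makes the result the identity on the last site. Thus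
  the embedded operator determines the blocks, which yields injectivity and the partial
  trace.\<close>

lemma emb_blk:
  "emb m n (blk b c A) = (\<Sum>d\<in>UNIV. site (m + n) (E2 d b) * emb m (Suc n) A * site (m + n) (E2 c d))"
proof -
  let ?s = "\<lambda>b c. site (m + n) (E2 b c)"
  have comm: "?s a b * (emb m n B * X) = emb m n B * (?s a b * X)" for a b B X
    by (simp add: mult.assoc[symmetric] site_emb_commute)
  have "(\<Sum>d\<in>UNIV. ?s d b * emb m (Suc n) A * ?s c d) = emb m n (blk b c A) * (\<Sum>d\<in>UNIV. ?s d d)"
    by (cases b; cases c) (simp_all add: UNIV_bool algebra_simps comm site_E2_mult)
  then show ?thesis by (simp add: site_E2_one)
qed

text \<open>Because of this, equations between matrices of one size can be checked in the ring
  \<open>op\<close>, where commutation rules replace Kronecker products.\<close>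

lemma emb_inject:
  assumes "A \<in> cm n" "B \<in> cm n" "emb m n A = emb m n B"
  shows "A = B"
  using assms
proof (induction n arbitrary: A B)
  case 0
  then show ?case by (intro eq_matI) (auto simp: sc_inject)
next
  case (Suc n)
  have e: "blk b c A = blk b c B" for b c
    using Suc.prems by (intro Suc.IH) (simp_all add: emb_blk del: emb.simps)
  show ?case
  proof (rule eq_matI)
    fix i j
    assume "i < dim_row B" "j < dim_col B"
    then have ij: "i div 2 < 2 ^ n" "j div 2 < 2 ^ n" using Suc.prems by auto
    have "X $$ (i, j) = blk (odd i) (odd j) X $$ (i div 2, j div 2)" if "X \<in> cm (Suc n)" for X
      using that ij by (simp add: blk_def)
    then show "A $$ (i, j) = B $$ (i, j)"
      using Suc.prems e by metis
  qed (use Suc.prems in auto)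
qed

declare emb.simps(2) [simp del]

section \<open>Adjoints, Kronecker products and traces\<close>

lemma adj_dim [simp]: "dim_row (mat_adjoint A) = dim_col A" "dim_col (mat_adjoint A) = dim_row A"
  by (simp_all add: mat_adjoint_def)

lemma adj_index [simp]:
  "i < dim_col A \<Longrightarrow> j < dim_row A \<Longrightarrow> mat_adjoint A $$ (i, j) = cnj (A $$ (j, i))" for A :: "complex mat"
  by (simp add: mat_adjoint_def mat_of_rows_index)

lemma adj_carrier [simp]: "A \<in> carrier_mat a b \<Longrightarrow> mat_adjoint A \<in> carrier_mat b a" for A :: "complex mat"
  by (metis carrier_matD carrier_matI adj_dim)

lemma adj_mult: "A \<in> carrier_mat a b \<Longrightarrow> B \<in> carrier_mat b c \<Longrightarrow> mat_adjoint (A * B) = mat_adjoint B * mat_adjoint A"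
  for A B :: "complex mat"
  by (rule eq_matI) (auto simp: scalar_prod_def intro!: sum.cong)

lemma adj_add: "A \<in> carrier_mat a b \<Longrightarrow> B \<in> carrier_mat a b \<Longrightarrow> mat_adjoint (A + B) = mat_adjoint A + mat_adjoint B"
  for A B :: "complex mat"
  by (rule eq_matI) auto

lemma adj_smult: "mat_adjoint (c \<cdot>\<^sub>m A) = cnj c \<cdot>\<^sub>m mat_adjoint A" for A :: "complex mat"
  by (rule eq_matI) auto

lemma adj_one [simp]: "mat_adjoint (1\<^sub>m n) = (1\<^sub>m n :: complex mat)"
  by (rule eq_matI) auto

lemma adj_adj [simp]: "mat_adjoint (mat_adjoint A) = (A :: complex mat)"
  by (rule eq_matI) auto

lemma kron_dim [simp]: "dim_row (A \<otimes>\<^sub>K B) = dim_row A * dim_row B" "dim_col (A \<otimes>\<^sub>K B) = dim_col A * dim_col B"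
  by (simp_all add: kron_def)

lemma kron_carrier [simp]:
  "A \<in> carrier_mat a b \<Longrightarrow> B \<in> carrier_mat c d \<Longrightarrow> A \<otimes>\<^sub>K B \<in> carrier_mat (a * c) (b * d)"
  by (metis carrier_matD carrier_matI kron_dim)

lemma kron_index [simp]:
  "i < dim_row A * dim_row B \<Longrightarrow> j < dim_col A * dim_col B \<Longrightarrow>
   (A \<otimes>\<^sub>K B) $$ (i, j) = A $$ (i div dim_row B, j div dim_col B) * B $$ (i mod dim_row B, j mod dim_col B)"
  by (simp add: kron_def)

lemma div_mod_lt: "i < a * c \<Longrightarrow> i div c < a \<and> i mod c < c" for i :: nat
  by (metis less_mult_imp_div_less mod_less_divisor mult_0_right not_less_zero gr0I)

lemma sum_div_mod: "(\<Sum>k = 0..<b * d. f (k div d) (k mod d)) = (\<Sum>k = 0..<b. \<Sum>l = 0..<d. f k l)"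
  for d :: nat and f :: "nat \<Rightarrow> nat \<Rightarrow> 'a :: comm_monoid_add"
proof -
  have "(\<Sum>k = 0..<b * d. f (k div d) (k mod d)) = (\<Sum>k<b. \<Sum>i = k * d..<k * d + d. f (i div d) (i mod d))"
    using sum.nat_group[of "\<lambda>k. f (k div d) (k mod d)" d b] by (simp add: lessThan_atLeast0)
  also have "\<dots> = (\<Sum>k<b. \<Sum>l = 0..<d. f k l)"
  proof (rule sum.cong[OF refl])
    fix k
    have "(\<Sum>i = k * d..<k * d + d. f (i div d) (i mod d)) = (\<Sum>l = 0..<d. f ((l + k * d) div d) ((l + k * d) mod d))"
      using sum.shift_bounds_nat_ivl[of "\<lambda>i. f (i div d) (i mod d)" 0 "k * d" d] by (simp add: add.commute)
    also have "\<dots> = (\<Sum>l = 0..<d. f k l)"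
      by (intro sum.cong) auto
    finally show "(\<Sum>i = k * d..<k * d + d. f (i div d) (i mod d)) = (\<Sum>l = 0..<d. f k l)" .
  qed
  finally show ?thesis by (simp add: lessThan_atLeast0)
qed

lemma kron_mult:
  assumes "A \<in> carrier_mat a b" "C \<in> carrier_mat b c" "B \<in> carrier_mat a' b'" "D \<in> carrier_mat b' c'"
  shows "(A \<otimes>\<^sub>K B) * (C \<otimes>\<^sub>K D) = (A * C) \<otimes>\<^sub>K (B * D)"
proof (rule eq_matI)
  fix i j
  assume "i < dim_row ((A * C) \<otimes>\<^sub>K (B * D))" "j < dim_col ((A * C) \<otimes>\<^sub>K (B * D))"
  then have ij: "i < a * a'" "j < c * c'" using assms by auto
  note l = div_mod_lt[OF ij(1)] div_mod_lt[OF ij(2)]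
  have "((A \<otimes>\<^sub>K B) * (C \<otimes>\<^sub>K D)) $$ (i, j) = (\<Sum>k = 0..<b * b'. (A $$ (i div a', k div b') * B $$ (i mod a', k mod b'))
      * (C $$ (k div b', j div c') * D $$ (k mod b', j mod c')))"
    using assms ij by (auto simp: scalar_prod_def intro!: sum.cong)
  also have "\<dots> = (\<Sum>k = 0..<b. \<Sum>l = 0..<b'. (A $$ (i div a', k) * B $$ (i mod a', l))
      * (C $$ (k, j div c') * D $$ (l, j mod c')))"
    by (rule sum_div_mod)
  also have "\<dots> = ((A * C) \<otimes>\<^sub>K (B * D)) $$ (i, j)"
    using assms ij l by (auto simp: scalar_prod_def sum_product algebra_simps intro!: sum.cong)
  finally show "((A \<otimes>\<^sub>K B) * (C \<otimes>\<^sub>K D)) $$ (i, j) = ((A * C) \<otimes>\<^sub>K (B * D)) $$ (i, j)" .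
qed (use assms in auto)

lemma kron_adj: "mat_adjoint (A \<otimes>\<^sub>K B) = mat_adjoint A \<otimes>\<^sub>K mat_adjoint B"
proof (rule eq_matI)
  fix i j
  assume "i < dim_row (mat_adjoint A \<otimes>\<^sub>K mat_adjoint B)" "j < dim_col (mat_adjoint A \<otimes>\<^sub>K mat_adjoint B)"
  then have ij: "i < dim_col A * dim_col B" "j < dim_row A * dim_row B" by auto
  then show "mat_adjoint (A \<otimes>\<^sub>K B) $$ (i, j) = (mat_adjoint A \<otimes>\<^sub>K mat_adjoint B) $$ (i, j)"
    using div_mod_lt[OF ij(1)] div_mod_lt[OF ij(2)] by simp
qed auto

lemma kron_assoc: "(A \<otimes>\<^sub>K B) \<otimes>\<^sub>K C = A \<otimes>\<^sub>K (B \<otimes>\<^sub>K C)"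
proof (rule eq_matI)
  fix i j
  assume "i < dim_row (A \<otimes>\<^sub>K (B \<otimes>\<^sub>K C))" "j < dim_col (A \<otimes>\<^sub>K (B \<otimes>\<^sub>K C))"
  then have ij: "i < dim_row A * (dim_row B * dim_row C)" "j < dim_col A * (dim_col B * dim_col C)" by auto
  then have ij2: "i < (dim_row A * dim_row B) * dim_row C" "j < (dim_col A * dim_col B) * dim_col C"
    by (simp_all add: mult.assoc)
  have a: "i div dim_row C < dim_row A * dim_row B" "j div dim_col C < dim_col A * dim_col B"
    using ij2 div_mod_lt by blast+
  have b: "i mod (dim_row B * dim_row C) < dim_row B * dim_row C"
    "j mod (dim_col B * dim_col C) < dim_col B * dim_col C"
    using ij div_mod_lt by blast+
  have c: "i mod (r * s) div s = i div s mod r \<and> i mod (r * s) mod s = i mod s" for i r s :: nat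
    using mod_mult2_eq[of i s r] by (cases "s = 0") (simp_all add: mult.commute[of r])
  show "((A \<otimes>\<^sub>K B) \<otimes>\<^sub>K C) $$ (i, j) = (A \<otimes>\<^sub>K (B \<otimes>\<^sub>K C)) $$ (i, j)"
    using ij ij2 a b by (simp add: div_mult2_eq[symmetric] c mult.commute[of "dim_row C"] mult.commute[of "dim_col C"])
qed (auto simp: mult.assoc)

lemma kron_one [simp]: "1\<^sub>m a \<otimes>\<^sub>K 1\<^sub>m b = 1\<^sub>m (a * b)"
proof (rule eq_matI)
  fix i j
  assume "i < dim_row (1\<^sub>m (a * b) :: complex mat)" "j < dim_col (1\<^sub>m (a * b) :: complex mat)"
  then have ij: "i < a * b" "j < a * b" by auto
  have "i = j" if "i div b = j div b" "i mod b = j mod b"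
    using that by (metis div_mult_mod_eq)
  then show "((1\<^sub>m a :: complex mat) \<otimes>\<^sub>K 1\<^sub>m b) $$ (i, j) = 1\<^sub>m (a * b) $$ (i, j)"
    using ij div_mod_lt[OF ij(1)] div_mod_lt[OF ij(2)] by auto
qed auto

lemma kron_unit_right [simp]: "A \<otimes>\<^sub>K 1\<^sub>m 1 = A" and kron_unit_left [simp]: "1\<^sub>m 1 \<otimes>\<^sub>K A = A"
  by (rule eq_matI; auto simp: kron_def)+

lemmas kron_unit_Suc [simp] = kron_unit_left[simplified] kron_unit_right[simplified]

lemma blk_kron:
  assumes "B \<in> cm (Suc k)"
  shows "blk b c (A \<otimes>\<^sub>K B) = A \<otimes>\<^sub>K blk b c B"
proof (rule eq_matI)
  fix i j
  assume "i < dim_row (A \<otimes>\<^sub>K blk b c B)" "j < dim_col (A \<otimes>\<^sub>K blk b c B)"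
  then have ij: "i < dim_row A * 2 ^ k" "j < dim_col A * 2 ^ k" using assms by (auto simp: blk_def)
  have d: "(2 * i + bit b) div (2 * 2 ^ k) = i div 2 ^ k" "(2 * i + bit b) mod (2 * 2 ^ k) = 2 * (i mod 2 ^ k) + bit b" for i :: nat and b
    by (simp_all add: div_mult2_eq mod_mult2_eq)
  have l: "2 * i + bit b < 2 * (dim_row A * 2 ^ k)" "2 * j + bit c < 2 * (dim_col A * 2 ^ k)"
    using ij by (cases b; cases c; simp)+
  show "blk b c (A \<otimes>\<^sub>K B) $$ (i, j) = (A \<otimes>\<^sub>K blk b c B) $$ (i, j)"
    using assms ij l div_mod_lt[OF ij(1)] div_mod_lt[OF ij(2)]
    by (simp add: blk_def d mult.left_commute[of _ 2])
qed (use assms in \<open>auto simp: blk_def\<close>)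

lemma emb_kron:
  assumes "A \<in> cm n" "B \<in> cm k"
  shows "emb m (n + k) (A \<otimes>\<^sub>K B) = emb m n A * emb (m + n) k B"
  using assms(2)
proof (induction k arbitrary: B)
  case 0
  then have "A \<otimes>\<^sub>K B = B $$ (0, 0) \<cdot>\<^sub>m A"
    by (intro eq_matI) (auto simp: kron_def)
  then show ?case
    using assms(1) by (simp add: emb_smult sc_central)
next
  case (Suc k)
  have "emb m (n + k) (A \<otimes>\<^sub>K blk b c B) = emb m n A * emb (m + n) k (blk b c B)" for b c
    using Suc by simp
  then show ?case
    by (simp add: emb.simps(2) blk_kron[OF Suc.prems] sum_distrib_left mult.assoc add.assoc)
qed

lemma emb_site: "M \<in> carrier_mat 2 2 \<Longrightarrow> emb m (Suc 0) M = site m M"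
  by (subst site_E2_expand) (auto simp: emb.simps(2) blk_def UNIV_bool)

lemma emb_kron_site: "A \<in> cm n \<Longrightarrow> B \<in> carrier_mat 2 2 \<Longrightarrow> emb m (Suc n) (A \<otimes>\<^sub>K B) = emb m n A * site (m + n) B"
  using emb_kron[of A n B 1 m] by (simp add: emb_site)

lemma emb_kron_site_left: "A \<in> carrier_mat 2 2 \<Longrightarrow> B \<in> cm n \<Longrightarrow> emb m (Suc n) (A \<otimes>\<^sub>K B) = site m A * emb (Suc m) n B"
  using emb_kron[of A 1 B n m] by (simp add: emb_site)

section \<open>Traces and partial traces\<close>

definition mat_tr :: "complex mat \<Rightarrow> complex" where
  "mat_tr A = (\<Sum>i<dim_row A. A $$ (i, i))"

lemma sum_even_odd: "sum f {..<2 * m} = (\<Sum>i<m. f (2 * i)) + (\<Sum>i<m. f (2 * i + 1))"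
  for f :: "nat \<Rightarrow> complex" and m :: nat
  by (induction m) (simp_all add: algebra_simps)

lemma mat_tr_add: "A \<in> cm n \<Longrightarrow> B \<in> cm n \<Longrightarrow> mat_tr (A + B) = mat_tr A + mat_tr B"
  by (simp add: mat_tr_def sum.distrib)

lemma mat_tr_comm: "A \<in> carrier_mat a b \<Longrightarrow> B \<in> carrier_mat b a \<Longrightarrow> mat_tr (A * B) = mat_tr (B * A)"
  by (auto simp: mat_tr_def scalar_prod_def lessThan_atLeast0 mult.commute intro: sum.swap)

lemma mat_tr_blk: "A \<in> cm (Suc n) \<Longrightarrow> mat_tr A = mat_tr (blk False False A) + mat_tr (blk True True A)"
  by (simp add: mat_tr_def blk_def sum_even_odd)

text \<open>There is no trace on \<open>op\<close>. Conjugating with matrix units and summing gives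
  instead the unnormalized partial trace over site \<open>k\<close>, tensored with the identity
  there.\<close>

definition ptr :: "nat \<Rightarrow> op \<Rightarrow> op" where
  "ptr k X = (\<Sum>b\<in>UNIV. \<Sum>d\<in>UNIV. site k (E2 d b) * X * site k (E2 b d))"

primrec ptrs :: "nat \<Rightarrow> nat \<Rightarrow> op \<Rightarrow> op" where
  "ptrs n 0 X = X"
| "ptrs n (Suc k) X = ptrs n k (ptr (n + k) X)"

lemma ptr_emb: "ptr (m + n) (emb m (Suc n) A) = emb m n (blk False False A) + emb m n (blk True True A)"
  by (simp add: ptr_def emb_blk UNIV_bool)

lemma ptr_trace_last:
  assumes "A \<in> cm n" "n \<ge> 1"
  shows "trace_last n A \<in> cm (n - 1)" and "emb 0 (n - 1) (trace_last n A) = ptr (n - 1) (emb 0 n A)"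
proof -
  obtain k where n: "n = Suc k" using assms by (cases n) auto
  have "trace_last n A = blk False False A + blk True True A"
    using assms n by (intro eq_matI) (auto simp: trace_last_def blk_def)
  then show "emb 0 (n - 1) (trace_last n A) = ptr (n - 1) (emb 0 n A)"
    using assms n ptr_emb[of 0 k A] by (simp add: emb_add)
qed (simp add: trace_last_def)

lemma ptr_left:
  assumes "\<And>M. X * site k M = site k M * X"
  shows "ptr k (X * Y) = X * ptr k Y"
  unfolding ptr_def sum_distrib_left
  by (intro sum.cong refl) (metis assms mult.assoc)

lemma ptrs_emb:
  assumes "\<And>k M. k \<ge> n \<Longrightarrow> X * site k M = site k M * X" and "A \<in> cm k"
  shows "ptrs n k (X * emb n k A) = X * sc (mat_tr A)"
  using assms(2)
proof (induction k arbitrary: A)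
  case 0
  then show ?case by (simp add: mat_tr_def)
next
  case (Suc k)
  have "ptr (n + k) (X * emb n (Suc k) A) = X * emb n k (blk False False A + blk True True A)"
    using Suc.prems by (simp add: ptr_left assms(1) ptr_emb emb_add[of _ k])
  then show ?case
    using Suc by (simp add: mat_tr_blk[of A k] mat_tr_add[of _ k])
qed

section \<open>Pauli and Majorana operators\<close>

lemma sigma_carrier [simp]: "sigma_x \<in> carrier_mat 2 2" "sigma_y \<in> carrier_mat 2 2" "sigma_z \<in> carrier_mat 2 2"
  by (rule carrier_matI; simp add: sigma_x_def sigma_y_def sigma_z_def mat_of_rows_list_def)+

lemma sigma_index:
  "sigma_x $$ (0, 0) = 0" "sigma_x $$ (0, Suc 0) = 1" "sigma_x $$ (Suc 0, 0) = 1" "sigma_x $$ (Suc 0, Suc 0) = 0"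
  "sigma_y $$ (0, 0) = 0" "sigma_y $$ (0, Suc 0) = - \<i>" "sigma_y $$ (Suc 0, 0) = \<i>" "sigma_y $$ (Suc 0, Suc 0) = 0"
  "sigma_z $$ (0, 0) = 1" "sigma_z $$ (0, Suc 0) = 0" "sigma_z $$ (Suc 0, 0) = 0" "sigma_z $$ (Suc 0, Suc 0) = - 1"
  by (simp_all add: sigma_x_def sigma_y_def sigma_z_def mat_of_rows_list_def)

lemma eq_mat2I:
  assumes "A \<in> carrier_mat 2 2" "B \<in> carrier_mat 2 2" "A $$ (0, 0) = B $$ (0, 0)" "A $$ (0, Suc 0) = B $$ (0, Suc 0)"
    "A $$ (Suc 0, 0) = B $$ (Suc 0, 0)" "A $$ (Suc 0, Suc 0) = B $$ (Suc 0, Suc 0)"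
  shows "A = B"
proof (rule eq_matI)
  fix i j assume "i < dim_row B" "j < dim_col B"
  then have "(i = 0 \<or> i = Suc 0) \<and> (j = 0 \<or> j = Suc 0)" using assms(2) by auto
  then show "A $$ (i, j) = B $$ (i, j)" using assms by auto
qed (use assms in auto)

lemma mult_index2:
  assumes "A \<in> carrier_mat 2 2" "B \<in> carrier_mat 2 2" "i < 2" "j < 2"
  shows "(A * B) $$ (i, j) = A $$ (i, 0) * B $$ (0, j) + A $$ (i, Suc 0) * B $$ (Suc 0, j)"
  using assms by (auto simp: scalar_prod_def numeral_2_eq_2)

lemma sigma_dim [simp]: "dim_row sigma_x = 2" "dim_col sigma_x = 2" "dim_row sigma_y = 2" "dim_col sigma_y = 2"
   "dim_row sigma_z = 2" "dim_col sigma_z = 2"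
  by (simp_all add: sigma_carrier[THEN carrier_matD(1)] sigma_carrier[THEN carrier_matD(2)])

lemma sigma_mult:
  "sigma_x * sigma_x = 1\<^sub>m 2" "sigma_y * sigma_y = 1\<^sub>m 2" "sigma_z * sigma_z = 1\<^sub>m 2"
  "sigma_x * sigma_y = \<i> \<cdot>\<^sub>m sigma_z" "sigma_y * sigma_x = - \<i> \<cdot>\<^sub>m sigma_z"
  "sigma_z * sigma_x = \<i> \<cdot>\<^sub>m sigma_y" "sigma_x * sigma_z = - \<i> \<cdot>\<^sub>m sigma_y"
  "sigma_z * sigma_y = - \<i> \<cdot>\<^sub>m sigma_x" "sigma_y * sigma_z = \<i> \<cdot>\<^sub>m sigma_x"
  by (rule eq_mat2I; simp add: mult_index2 sigma_index mult_carrier_mat[of _ 2 2 _ 2] del: index_mult_mat(1))+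

lemma sigma_adj: "mat_adjoint sigma_x = sigma_x" "mat_adjoint sigma_y = sigma_y" "mat_adjoint sigma_z = sigma_z"
  by (rule eq_mat2I; simp add: sigma_index)+

definition J :: op where "J = sc \<i>"

lemma J_J: "J * J = - 1"
  by (simp add: J_def sc_mult[symmetric] sc_minus[of 1, simplified])

lemma J_J': "J * (J * X) = - X"
  using J_J by (simp add: mult.assoc[symmetric])

lemma J_central: "X * J = J * X"
  by (simp add: J_def sc_central)

lemma J_central': "X * (J * Y) = J * (X * Y)"
  by (metis J_central mult.assoc)

abbreviation sX :: "nat \<Rightarrow> op" where "sX k \<equiv> site k sigma_x"
abbreviation sY :: "nat \<Rightarrow> op" where "sY k \<equiv> site k sigma_y"
abbreviation sZ :: "nat \<Rightarrow> op" where "sZ k \<equiv> site k sigma_z"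

lemma site_sigma_mult:
  "sX k * sX k = 1" "sY k * sY k = 1" "sZ k * sZ k = 1"
  "sX k * sY k = J * sZ k" "sY k * sX k = - (J * sZ k)"
  "sZ k * sX k = J * sY k" "sX k * sZ k = - (J * sY k)"
  "sZ k * sY k = - (J * sX k)" "sY k * sZ k = J * sX k"
  by (simp_all add: site_mult sigma_mult site_smult J_def sc_minus)

lemma tensor_Nil [simp]: "tensor [] = 1\<^sub>m 1" and tensor_Cons [simp]: "tensor (A # As) = A \<otimes>\<^sub>K tensor As"
  by (simp_all add: tensor_def)

lemma tensor_append: "tensor (As @ Bs) = tensor As \<otimes>\<^sub>K tensor Bs"
  by (induction As) (simp_all add: kron_assoc)

lemma tensor_carrier:
  "(\<And>A. A \<in> set As \<Longrightarrow> A \<in> carrier_mat a b) \<Longrightarrow> tensor As \<in> carrier_mat (a ^ length As) (b ^ length As)"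
  by (induction As) simp_all

lemma tensor_mult:
  assumes "length As = length Bs" "\<And>A. A \<in> set As \<Longrightarrow> A \<in> carrier_mat a b" "\<And>B. B \<in> set Bs \<Longrightarrow> B \<in> carrier_mat b c"
  shows "tensor As * tensor Bs = tensor (map2 (*) As Bs)"
  using assms
proof (induction As Bs rule: list_induct2)
  case (Cons A As B Bs)
  have "tensor As \<in> carrier_mat (a ^ length As) (b ^ length As)" "tensor Bs \<in> carrier_mat (b ^ length As) (c ^ length As)"
    using Cons tensor_carrier[of As a b] tensor_carrier[of Bs b c] by auto
  then show ?case
    using Cons kron_mult[of A a b B c "tensor As" "a ^ length As" "b ^ length As" "tensor Bs" "c ^ length As"] by simp
qed simp

lemma tensor_adj: "mat_adjoint (tensor As) = tensor (map mat_adjoint As)"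
  by (induction As) (simp_all add: kron_adj)

primrec sites :: "nat \<Rightarrow> complex mat list \<Rightarrow> op" where
  "sites m [] = 1"
| "sites m (A # As) = site m A * sites (Suc m) As"

lemma sites_append: "sites m (As @ Bs) = sites m As * sites (m + length As) Bs"
  by (induction As arbitrary: m) (simp_all add: mult.assoc)

lemma sites_one [simp]: "sites m (replicate k (1\<^sub>m 2)) = 1"
  by (induction k arbitrary: m) simp_all

lemma emb_tensor:
  assumes "\<And>A. A \<in> set As \<Longrightarrow> A \<in> carrier_mat 2 2"
  shows "emb m (length As) (tensor As) = sites m As"
  using assms
proof (induction As arbitrary: m)
  case (Cons A As)
  then show ?case
    by (simp add: emb_kron_site_left tensor_carrier)
qed simp

lemma commute_mult: "X * A = A * X \<Longrightarrow> X * B = B * X \<Longrightarrow> X * (A * B) = A * B * X" for X :: "'a :: semigroup_mult"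
  by (metis mult.assoc)

lemma sites_commute:
  assumes "k < m \<or> k \<ge> m + length As"
  shows "sites m As * site k M = site k M * sites m As"
  using assms
proof (induction As arbitrary: m)
  case (Cons A As)
  have a: "sites (Suc m) As * site k M = site k M * sites (Suc m) As"
    using Cons.prems by (intro Cons.IH) auto
  have b: "site m A * site k M = site k M * site m A"
    using Cons.prems by (intro site_commute) auto
  show ?case by (simp, metis a b mult.assoc)
qed simp

abbreviation Zs :: "nat \<Rightarrow> nat \<Rightarrow> op" where "Zs m k \<equiv> sites m (replicate k sigma_z)"

lemma Zs_sq: "Zs m k * Zs m k = 1"
proof (induction k arbitrary: m)
  case (Suc k)
  have "Zs (Suc m) k * site m sigma_z = site m sigma_z * Zs (Suc m) k"
    by (rule sites_commute) simp
  then have "Zs m (Suc k) * Zs m (Suc k) = (sZ m * sZ m) * (Zs (Suc m) k * Zs (Suc m) k)"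
    by (simp add: mult.assoc) (metis mult.assoc)
  then show ?case using Suc by (simp add: site_sigma_mult)
qed simp

lemma Zs_commuteI:
  assumes "\<And>k. k < m \<Longrightarrow> Q * sZ k = sZ k * Q"
  shows "Q * Zs 0 m = Zs 0 m * Q"
  using assms
proof (induction m)
  case (Suc m)
  have "Zs 0 (Suc m) = Zs 0 m * sZ m"
    using sites_append[of 0 "replicate m sigma_z" "[sigma_z]"] by (simp add: replicate_append_same)
  then show ?case using Suc by (simp add: commute_mult del: sites.simps replicate_Suc)
qed simp

lemma smult_smult_mat: "a \<cdot>\<^sub>m (b \<cdot>\<^sub>m A) = (a * b) \<cdot>\<^sub>m A" for a b :: complex
  by (rule eq_matI) auto

definition pauli :: "nat \<Rightarrow> complex mat" where
  "pauli p = (if odd p then sigma_x else sigma_y)"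

lemma pauli_carrier [simp]: "pauli p \<in> carrier_mat 2 2"
  by (simp add: pauli_def)

text \<open>The Majorana operators of all systems at once: \<open>gam p\<close> acts on an unbounded string of sites.\<close>

definition gam :: "nat \<Rightarrow> op" where
  "gam p = Zs 0 ((p - 1) div 2) * site ((p - 1) div 2) (pauli p)"

lemma gam_sq: "gam p * gam p = 1"
proof -
  define i where "i = (p - 1) div 2"
  have c: "Zs 0 i * site i (pauli p) = site i (pauli p) * Zs 0 i"
    by (rule sites_commute) simp
  have "gam p * gam p = Zs 0 i * Zs 0 i * (site i (pauli p) * site i (pauli p))"
    unfolding gam_def i_def[symmetric] by (metis c mult.assoc)
  then show ?thesis by (simp add: Zs_sq pauli_def site_sigma_mult)
qed

text \<open>On the same site two different Pauli matrices anticommute. On different sites the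
  Z-string of the later operator crosses the Pauli matrix of the earlier one and gives the sign. The
  bound \<open>1 \<le> p\<close> matters: by truncated subtraction \<open>gam 0\<close> equals
  \<open>gam 2\<close>.\<close>

lemma gam_anti_less:
  assumes "1 \<le> p" "p < q"
  shows "gam p * gam q = - (gam q * gam p)"
proof -
  define i j where "i = (p - 1) div 2" and "j = (q - 1) div 2"
  have ij: "i \<le> j" using assms by (simp add: i_def j_def div_le_mono)
  let ?Z = "Zs 0 i" and ?P = "site i (pauli p)"
  have ZP: "?Z * ?P = ?P * ?Z" by (rule sites_commute) simp
  show ?thesis
  proof (cases "i = j")
    case True
    have "p - 1 = 2 * i + (p - 1) mod 2" "q - 1 = 2 * j + (q - 1) mod 2"
      by (simp_all add: i_def j_def)
    moreover have "(p - 1) mod 2 < 2" "(q - 1) mod 2 < 2" by simp_all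
    ultimately have pq: "p = 2 * i + 1" "q = 2 * i + 2" using assms True by linarith+
    have anti: "sX i * sY i = - (sY i * sX i)" by (simp add: site_sigma_mult)
    have Zc: "?Z * site i M = site i M * ?Z" for M by (rule sites_commute) simp
    have "gam p * gam q = ?Z * ?Z * (sX i * sY i)" "gam q * gam p = ?Z * ?Z * (sY i * sX i)"
      unfolding gam_def pq by (simp_all add: pauli_def) (metis Zc mult.assoc)+
    then show ?thesis by (simp add: anti)
  next
    case False
    define Q where "Q = Zs (Suc i) (j - Suc i) * site j (pauli q)"
    have "replicate j sigma_z = replicate i sigma_z @ sigma_z # replicate (j - Suc i) sigma_z"
      using ij False by (metis Suc_diff_Suc le_neq_implies_less le_add_diff_inverse replicate_Suc replicate_add)
    then have q: "gam q = ?Z * sZ i * Q"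
      unfolding gam_def Q_def j_def[symmetric] by (simp add: sites_append mult.assoc)
    have c: "Q * site k M = site k M * Q" if "k \<le> i" for k M
    proof -
      have "Zs (Suc i) (j - Suc i) * site k M = site k M * Zs (Suc i) (j - Suc i)"
        using that by (intro sites_commute) auto
      moreover have "site j (pauli q) * site k M = site k M * site j (pauli q)"
        using that ij False by (intro site_commute) auto
      ultimately show ?thesis unfolding Q_def by (metis mult.assoc)
    qed
    have QZ: "Q * ?Z = ?Z * Q"
    proof -
      have "Q * sZ k = sZ k * Q" if "k < i" for k using that by (intro c) simp
      then show ?thesis by (rule Zs_commuteI)
    qed
    have ZZ: "?Z * sZ i = sZ i * ?Z" by (rule sites_commute) simp
    have PZ: "?P * sZ i = - (sZ i * ?P)" by (simp add: pauli_def site_sigma_mult)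
    have p: "gam p = ?Z * ?P" by (simp add: gam_def i_def)
    have "gam p * gam q = ?Z * (?P * ?Z) * (sZ i * Q)"
      unfolding p q by (simp add: mult.assoc)
    also have "\<dots> = (?P * sZ i) * Q"
      unfolding ZP[symmetric] by (simp add: mult.assoc[symmetric] Zs_sq)
    also have "\<dots> = - (sZ i * ?P * Q)" by (simp add: PZ)
    also have "sZ i * ?P * Q = sZ i * (?Z * ?Z) * (Q * ?P)" by (simp add: Zs_sq c mult.assoc)
    also have "\<dots> = ?Z * sZ i * Q * (?Z * ?P)" by (metis ZZ QZ mult.assoc)
    also have "\<dots> = gam q * gam p"
      unfolding p q by (simp add: mult.assoc)
    finally show ?thesis .
  qed
qed

lemma gam_anti: "1 \<le> p \<Longrightarrow> 1 \<le> q \<Longrightarrow> p \<noteq> q \<Longrightarrow> gam p * gam q = - (gam q * gam p)"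
  using gam_anti_less[of p q] gam_anti_less[of q p] by (cases "p < q") (auto simp: minus_equation_iff)

lemma majorana_list:
  assumes "1 \<le> p" "p \<le> 2 * n"
  shows "majorana n p = tensor (replicate ((p - 1) div 2) sigma_z @ [pauli p] @ replicate (n - Suc ((p - 1) div 2)) (1\<^sub>m 2))"
    and "(p - 1) div 2 < n"
proof -
  have "(p + 1) div 2 = Suc ((p - 1) div 2)" using assms by (cases p) auto
  then show "majorana n p = tensor (replicate ((p - 1) div 2) sigma_z @ [pauli p] @ replicate (n - Suc ((p - 1) div 2)) (1\<^sub>m 2))"
    by (simp add: majorana_def pauli_def Let_def)
  show "(p - 1) div 2 < n" using assms by linarith
qed

lemma majorana_carrier:
  assumes "1 \<le> p" "p \<le> 2 * n" shows "majorana n p \<in> cm n"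
proof -
  let ?l = "replicate ((p - 1) div 2) sigma_z @ [pauli p] @ replicate (n - Suc ((p - 1) div 2)) (1\<^sub>m 2)"
  have l: "length ?l = n"
    using majorana_list(2)[OF assms] by simp
  have "tensor ?l \<in> carrier_mat (2 ^ length ?l) (2 ^ length ?l)"
    by (rule tensor_carrier) auto
  then show ?thesis
    unfolding majorana_list(1)[OF assms] l by simp
qed

lemma majorana_adj:
  assumes "1 \<le> p" "p \<le> 2 * n" shows "mat_adjoint (majorana n p) = majorana n p"
  unfolding majorana_list(1)[OF assms] by (simp add: tensor_adj sigma_adj pauli_def)

text \<open>A Majorana operator of an appended subsystem lacks the Z-string over the first
  \<open>m\<close> sites; \<open>Zs 0 m\<close> converts between the two.\<close>

lemma emb_majorana:
  assumes "1 \<le> p" "p \<le> 2 * n"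
  shows "emb m n (majorana n p) = Zs 0 m * gam (2 * m + p)"
proof -
  define i where "i = (p - 1) div 2"
  let ?l = "replicate i sigma_z @ [pauli p] @ replicate (n - Suc i) (1\<^sub>m 2)"
  have l: "length ?l = n" using majorana_list(2)[OF assms] by (simp add: i_def)
  have "emb m (length ?l) (tensor ?l) = sites m ?l"
    by (rule emb_tensor) auto
  then have "emb m n (majorana n p) = sites m ?l"
    unfolding l majorana_list(1)[OF assms] i_def[symmetric] by simp
  also have "\<dots> = Zs m i * site (m + i) (pauli p)"
    by (simp add: sites_append)
  also have "\<dots> = Zs 0 m * (Zs 0 m * Zs m i * site (m + i) (pauli p))"
    by (simp add: mult.assoc[symmetric] Zs_sq)
  also have "Zs 0 m * Zs m i = Zs 0 (m + i)"
    by (simp add: replicate_add sites_append)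
  also have "Zs 0 (m + i) * site (m + i) (pauli p) = gam (2 * m + p)"
  proof -
    have "(2 * m + p - 1) div 2 = m + i" using assms(1) by (simp add: i_def)
    then show ?thesis by (simp add: gam_def pauli_def)
  qed
  finally show ?thesis .
qed

text \<open>In a product of two the missing strings cancel, so even products embed to the global
  operators with shifted numbers. Braids and measurements involve such products only.\<close>

lemma emb_pair:
  assumes "1 \<le> p" "p \<le> 2 * n" "1 \<le> q" "q \<le> 2 * n"
  shows "emb m n (majorana n p * majorana n q) = gam (2 * m + p) * gam (2 * m + q)"
proof -
  let ?M = "\<lambda>p. emb m n (majorana n p)" and ?Z = "Zs 0 m"
  have c: "?M p * ?Z = ?Z * ?M p"
  proof -
    have "?M p * sZ k = sZ k * ?M p" if "k < m" for k using that by (intro site_emb_commute) simp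
    then show ?thesis by (rule Zs_commuteI)
  qed
  have g: "gam (2 * m + p) = ?Z * ?M p" "gam (2 * m + q) = ?Z * ?M q"
    using assms by (simp_all add: emb_majorana mult.assoc[symmetric] Zs_sq)
  have "gam (2 * m + p) * gam (2 * m + q) = ?Z * (?Z * ?M p) * ?M q"
    unfolding g by (metis c mult.assoc)
  then show ?thesis
    using assms by (simp add: emb_mult majorana_carrier mult.assoc[symmetric] Zs_sq)
qed

lemma emb_gam: "1 \<le> p \<Longrightarrow> p \<le> 2 * n \<Longrightarrow> emb 0 n (majorana n p) = gam p"
  by (simp add: emb_majorana)

lemma pair_carrier: "1 \<le> p \<Longrightarrow> p \<le> 2 * n \<Longrightarrow> 1 \<le> q \<Longrightarrow> q \<le> 2 * n \<Longrightarrow> majorana n p * majorana n q \<in> cm n"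
  using majorana_carrier[of p n] majorana_carrier[of q n] by (rule mult_carrier_mat)

lemma pair_sq:
  assumes "1 \<le> p" "p \<le> 2 * n" "1 \<le> q" "q \<le> 2 * n" "p \<noteq> q"
  shows "(majorana n p * majorana n q) * (majorana n p * majorana n q) = - 1 \<cdot>\<^sub>m 1\<^sub>m (2 ^ n)"
proof (rule emb_inject[of _ n _ 0])
  note c = pair_carrier[OF assms(1-4)]
  show "majorana n p * majorana n q * (majorana n p * majorana n q) \<in> cm n" "- 1 \<cdot>\<^sub>m 1\<^sub>m (2 ^ n) \<in> cm n"
    using c by (auto intro: mult_carrier_mat)
  have "gam p * gam q * (gam p * gam q) = gam p * (gam q * gam p) * gam q" by (simp add: mult.assoc)
  also have "gam q * gam p = - (gam p * gam q)" using assms by (intro gam_anti) auto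
  also have "gam p * - (gam p * gam q) * gam q = - (gam p * gam p * (gam q * gam q))" by (simp add: mult.assoc)
  finally show "emb 0 n (majorana n p * majorana n q * (majorana n p * majorana n q)) = emb 0 n (- 1 \<cdot>\<^sub>m 1\<^sub>m (2 ^ n))"
    using c assms by (simp add: emb_mult[of _ n] emb_pair gam_sq emb_smult[of _ n] sc_minus[of 1, simplified] del: smult_one)
qed

lemma pair_adj:
  assumes "1 \<le> p" "p \<le> 2 * n" "1 \<le> q" "q \<le> 2 * n"
  shows "mat_adjoint (majorana n p * majorana n q) = majorana n q * majorana n p"
  using assms by (simp add: adj_mult[of _ "2^n" "2^n" _ "2^n"] majorana_carrier majorana_adj)

section \<open>Braid gates from the exponential series\<close>

lemma pow_smult_imaginary:
  fixes K :: "complex mat"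
  assumes K: "K \<in> carrier_mat d d" "K * K = - 1 \<cdot>\<^sub>m 1\<^sub>m d"
  shows "(a \<cdot>\<^sub>m K) ^\<^sub>m (2 * k) = (a ^ (2 * k) * (- 1) ^ k) \<cdot>\<^sub>m 1\<^sub>m d"
    and "(a \<cdot>\<^sub>m K) ^\<^sub>m (Suc (2 * k)) = (a ^ (Suc (2 * k)) * (- 1) ^ k) \<cdot>\<^sub>m K"
proof -
  have s: "(a ^ Suc (2 * k) * (- 1) ^ k) \<cdot>\<^sub>m K * (a \<cdot>\<^sub>m K) = (a ^ (2 * Suc k) * (- 1) ^ Suc k) \<cdot>\<^sub>m 1\<^sub>m d" for k
  proof -
    have "(b \<cdot>\<^sub>m K) * (a \<cdot>\<^sub>m K) = (b * a) \<cdot>\<^sub>m (K * K)" for b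
      using K(1) by (simp add: mult_smult_distrib[of _ d d _ d] mult_smult_assoc_mat[of _ d d _ d] smult_smult_mat mult.commute)
    then show ?thesis unfolding K(2) by (simp add: smult_smult_mat algebra_simps)
  qed
  have t: "(b \<cdot>\<^sub>m 1\<^sub>m d) * (a \<cdot>\<^sub>m K) = (b * a) \<cdot>\<^sub>m K" for b
    using K(1) by (simp add: mult_smult_distrib[of _ d d _ d] mult_smult_assoc_mat[of _ d d _ d] smult_smult_mat mult.commute)
  have e: "(a \<cdot>\<^sub>m K) ^\<^sub>m (2 * k) = (a ^ (2 * k) * (- 1) ^ k) \<cdot>\<^sub>m 1\<^sub>m d" for k
  proof (induction k)
    case 0 show ?case using K(1) by (intro eq_matI) simp_all
  next
    case (Suc k)
    have "(a \<cdot>\<^sub>m K) ^\<^sub>m (2 * Suc k) = (a \<cdot>\<^sub>m K) ^\<^sub>m (2 * k) * (a \<cdot>\<^sub>m K) * (a \<cdot>\<^sub>m K)" by simp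
    then show ?case unfolding Suc t using s[of k] by (simp add: algebra_simps)
  qed
  show "(a \<cdot>\<^sub>m K) ^\<^sub>m (2 * k) = (a ^ (2 * k) * (- 1) ^ k) \<cdot>\<^sub>m 1\<^sub>m d" by (rule e)
  show "(a \<cdot>\<^sub>m K) ^\<^sub>m (Suc (2 * k)) = (a ^ (Suc (2 * k)) * (- 1) ^ k) \<cdot>\<^sub>m K"
    using e[of k] by (simp add: t algebra_simps)
qed

text \<open>Euler's formula: \<open>K\<close> acts as an imaginary unit, so the even powers sum to
  the cosine series and the odd ones to the sine series, entry by entry.\<close>

lemma mat_exp_imaginary:
  fixes K :: "complex mat" and t :: real
  assumes K: "K \<in> carrier_mat d d" "K * K = - 1 \<cdot>\<^sub>m 1\<^sub>m d"
  shows "mat_exp (complex_of_real t \<cdot>\<^sub>m K) = complex_of_real (cos t) \<cdot>\<^sub>m 1\<^sub>m d + complex_of_real (sin t) \<cdot>\<^sub>m K"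
proof (rule eq_matI)
  fix i j
  assume "i < dim_row (complex_of_real (cos t) \<cdot>\<^sub>m 1\<^sub>m d + complex_of_real (sin t) \<cdot>\<^sub>m K)"
    "j < dim_col (complex_of_real (cos t) \<cdot>\<^sub>m 1\<^sub>m d + complex_of_real (sin t) \<cdot>\<^sub>m K)"
  then have ij: "i < d" "j < d" using K by auto
  let ?o = "1\<^sub>m d $$ (i, j) :: complex"
  have e: "((complex_of_real t \<cdot>\<^sub>m K) ^\<^sub>m k) $$ (i, j) / fact k
     = complex_of_real (cos_coeff k *\<^sub>R t ^ k) * ?o + complex_of_real (sin_coeff k *\<^sub>R t ^ k) * K $$ (i, j)" for k
  proof (cases "even k")
    case True
    then obtain l where "k = 2 * l" by blast
    then show ?thesis using pow_smult_imaginary(1)[OF K, of "complex_of_real t" l] ij K(1)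
      by (simp add: cos_coeff_def sin_coeff_def)
  next
    case False
    then obtain l where "k = Suc (2 * l)" by (metis oddE Suc_eq_plus1)
    then show ?thesis using pow_smult_imaginary(2)[OF K, of "complex_of_real t" l] ij K(1)
      by (simp add: cos_coeff_def sin_coeff_def del: pow_mat.simps power_Suc)
  qed
  have "(\<lambda>k. ((complex_of_real t \<cdot>\<^sub>m K) ^\<^sub>m k) $$ (i, j) / fact k) sums
      (complex_of_real (cos t) * ?o + complex_of_real (sin t) * K $$ (i, j))"
    unfolding e by (intro sums_add sums_mult2 sums_of_real cos_converges sin_converges)
  then show "mat_exp (complex_of_real t \<cdot>\<^sub>m K) $$ (i, j)
      = (complex_of_real (cos t) \<cdot>\<^sub>m 1\<^sub>m d + complex_of_real (sin t) \<cdot>\<^sub>m K) $$ (i, j)"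
    using K(1) ij by (simp add: mat_exp_def sums_iff)
qed (use K in \<open>auto simp: mat_exp_def\<close>)

lemma braid_gate_eq:
  assumes "1 \<le> p" "p < q" "q \<le> 2 * n"
  shows "braid_gate n p q = complex_of_real (1 / sqrt 2) \<cdot>\<^sub>m (1\<^sub>m (2 ^ n) + (- 1) \<cdot>\<^sub>m (majorana n p * majorana n q))"
proof -
  have c: "majorana n p * majorana n q \<in> cm n" using assms by (intro pair_carrier) auto
  define K where "K = majorana n p * majorana n q"
  have s: "cos (pi / 4) = 1 / sqrt 2" "sin (pi / 4) = 1 / sqrt 2"
    by (simp_all add: cos_45 sin_45 real_div_sqrt divide_simps)
  have e: "braid_gate n p q = complex_of_real (cos (- pi / 4)) \<cdot>\<^sub>m 1\<^sub>m (2 ^ n) + complex_of_real (sin (- pi / 4)) \<cdot>\<^sub>m (majorana n p * majorana n q)"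
    unfolding braid_gate_def using assms by (intro mat_exp_imaginary[OF c pair_sq]) auto
  show ?thesis
    unfolding e K_def[symmetric]
  proof (rule eq_matI)
    fix i j
    assume "i < dim_row (complex_of_real (1 / sqrt 2) \<cdot>\<^sub>m (1\<^sub>m (2 ^ n) + (- 1) \<cdot>\<^sub>m K))"
      "j < dim_col (complex_of_real (1 / sqrt 2) \<cdot>\<^sub>m (1\<^sub>m (2 ^ n) + (- 1) \<cdot>\<^sub>m K))"
    then have "i < 2 ^ n" "j < 2 ^ n" using c[folded K_def] by auto
    then show "(complex_of_real (cos (- pi / 4)) \<cdot>\<^sub>m 1\<^sub>m (2 ^ n) + complex_of_real (sin (- pi / 4)) \<cdot>\<^sub>m K) $$ (i, j)
      = (complex_of_real (1 / sqrt 2) \<cdot>\<^sub>m (1\<^sub>m (2 ^ n) + (- 1) \<cdot>\<^sub>m K)) $$ (i, j)"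
      using c[folded K_def] by (simp add: s algebra_simps del: index_mult_mat(1))
  qed (use c in \<open>auto simp: K_def[symmetric]\<close>)
qed

definition Fo :: "nat \<Rightarrow> nat \<Rightarrow> op" where "Fo p q = - (J * gam p * gam q)"

text \<open>The counterpart of \<open>run\<close> for embedded states.\<close>

primrec run_op :: "complex mat \<Rightarrow> protocol \<Rightarrow> nat \<Rightarrow> op \<Rightarrow> op" where
  "run_op \<rho> Done n X = X"
| "run_op \<rho> (Prepare P) n X = run_op \<rho> P (n + 1) (X * site n (proj (ket 0)))"
| "run_op \<rho> (Supply P) n X = run_op \<rho> P (n + 4) (X * emb n 4 \<rho>)"
| "run_op \<rho> (Discard P) n X = run_op \<rho> P (n - 1) (ptr (n - 1) X)"
| "run_op \<rho> (Braid p q P) n X = run_op \<rho> P n ((1 / 2) *\<^sub>R ((1 - gam p * gam q) * X * (1 + gam p * gam q)))"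
| "run_op \<rho> (Measure p q P M) n X = run_op \<rho> P n ((1 / 4) *\<^sub>R ((1 + Fo p q) * X * (1 + Fo p q)))
    + run_op \<rho> M n ((1 / 4) *\<^sub>R ((1 - Fo p q) * X * (1 - Fo p q)))"
| "run_op \<rho> (Coin r P R) n X = r *\<^sub>R run_op \<rho> P n X + (1 - r) *\<^sub>R run_op \<rho> R n X"

lemma sc_scaleR: "sc (complex_of_real r) * X = r *\<^sub>R X"
  by (simp add: sc_real)

lemma ptr_add: "ptr k (X + Y) = ptr k X + ptr k Y"
  and ptr_scaleR: "ptr k (r *\<^sub>R X) = r *\<^sub>R ptr k X"
  by (simp_all add: ptr_def algebra_simps sum.distrib scaleR_sum_right)

lemma sandwich_add: "A * (X + Y) * B = A * X * B + A * Y * B" for A B X Y :: "'a :: ring"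
  by (simp add: distrib_left distrib_right)

lemma run_op_add: "run_op \<rho> P n (X + Y) = run_op \<rho> P n X + run_op \<rho> P n Y"
  by (induction P arbitrary: n X Y) (simp_all only: run_op.simps ptr_add sandwich_add distrib_right scaleR_add_right add_ac)

lemma sandwich_scaleR: "A * (r *\<^sub>R X) * B = r *\<^sub>R (A * X * B)" for A B X :: "'a :: real_algebra"
  by simp

lemma run_op_scaleR: "run_op \<rho> P n (r *\<^sub>R X) = r *\<^sub>R run_op \<rho> P n X"
  by (induction P arbitrary: n X)
     (simp_all only: run_op.simps ptr_scaleR sandwich_scaleR mult_scaleR_left scaleR_add_right
       scaleR_left_commute[of "1 / 2" r] scaleR_left_commute[of "1 / 4" r] scaleR_left_commute[of _ r])

lemma run_op_0 [simp]: "run_op \<rho> P n 0 = 0"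
  using run_op_scaleR[of \<rho> P n 0 0] by simp

lemma run_op_sum: "run_op \<rho> P n (sum f A) = (\<Sum>x\<in>A. run_op \<rho> P n (f x))"
  by (induction A rule: infinite_finite_induct) (simp_all add: run_op_add)

lemma conj_by_carrier: "K \<in> carrier_mat a b \<Longrightarrow> \<rho> \<in> carrier_mat b b \<Longrightarrow> conj_by K \<rho> \<in> carrier_mat a a"
  unfolding conj_by_def by (metis mult_carrier_mat adj_carrier)

lemma emb_conj_by:
  "K \<in> cm n \<Longrightarrow> \<rho> \<in> cm n \<Longrightarrow> emb m n (conj_by K \<rho>) = emb m n K * emb m n \<rho> * emb m n (mat_adjoint K)"
  by (simp add: conj_by_def emb_mult[of _ n] mult_carrier_mat[of _ "2^n" "2^n"])

lemma emb_braid_gate: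
  assumes "1 \<le> p" "p < q" "q \<le> 2 * n"
  shows "braid_gate n p q \<in> cm n"
    and "emb m n (braid_gate n p q) = (1 / sqrt 2) *\<^sub>R (1 - gam (2 * m + p) * gam (2 * m + q))"
    and "emb m n (mat_adjoint (braid_gate n p q)) = (1 / sqrt 2) *\<^sub>R (1 + gam (2 * m + p) * gam (2 * m + q))"
proof -
  have c: "majorana n p * majorana n q \<in> cm n" "majorana n q * majorana n p \<in> cm n"
    using assms by (auto intro!: pair_carrier)
  show "braid_gate n p q \<in> cm n" using c assms by (simp add: braid_gate_eq)
  have a: "gam (2 * m + q) * gam (2 * m + p) = - (gam (2 * m + p) * gam (2 * m + q))"
    using assms by (intro gam_anti) auto
  have m1: "sc (- 1) = - 1" using sc_minus[of 1] by simp
  show "emb m n (braid_gate n p q) = (1 / sqrt 2) *\<^sub>R (1 - gam (2 * m + p) * gam (2 * m + q))"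
    using c assms by (simp add: braid_gate_eq emb_smult[of _ n] emb_add[of _ n] emb_pair sc_scaleR m1 del: of_real_divide)
  show "emb m n (mat_adjoint (braid_gate n p q)) = (1 / sqrt 2) *\<^sub>R (1 + gam (2 * m + p) * gam (2 * m + q))"
    using c assms by (simp add: braid_gate_eq adj_smult adj_add[of _ "2^n" "2^n"] pair_adj emb_smult[of _ n] emb_add[of _ n]
        emb_pair sc_scaleR m1 a del: of_real_divide complex_cnj_divide)
qed

lemma emb_pair_proj:
  assumes "1 \<le> p" "p < q" "q \<le> 2 * n" "s = 1 \<or> s = - 1"
  shows "pair_proj n p q (complex_of_real s) \<in> cm n"
    and "emb m n (pair_proj n p q (complex_of_real s)) = (1 / 2) *\<^sub>R (1 + s *\<^sub>R Fo (2 * m + p) (2 * m + q))"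
    and "emb m n (mat_adjoint (pair_proj n p q (complex_of_real s))) = (1 / 2) *\<^sub>R (1 + s *\<^sub>R Fo (2 * m + p) (2 * m + q))"
proof -
  have c: "majorana n p * majorana n q \<in> cm n" "majorana n q * majorana n p \<in> cm n"
    using assms by (auto intro!: pair_carrier)
  then show pc: "pair_proj n p q (complex_of_real s) \<in> cm n" by (simp add: pair_proj_def pair_obs_def)
  have a: "gam (2 * m + q) * gam (2 * m + p) = - (gam (2 * m + p) * gam (2 * m + q))"
    using assms by (intro gam_anti) auto
  have h: "sc (1 / 2) * X = (1 / 2) *\<^sub>R X" for X using sc_scaleR[of "1/2" X] by simp
  have i: "sc \<i> = J" "sc (- \<i>) = - J" by (simp_all add: J_def sc_minus)
  show "emb m n (pair_proj n p q (complex_of_real s)) = (1 / 2) *\<^sub>R (1 + s *\<^sub>R Fo (2 * m + p) (2 * m + q))"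
    using c assms by (simp add: pair_proj_def pair_obs_def emb_smult[of _ n] emb_add[of _ n] emb_pair sc_scaleR Fo_def h i mult.assoc)
  show "emb m n (mat_adjoint (pair_proj n p q (complex_of_real s))) = (1 / 2) *\<^sub>R (1 + s *\<^sub>R Fo (2 * m + p) (2 * m + q))"
    using c assms by (simp add: pair_proj_def pair_obs_def adj_smult adj_add[of _ "2^n" "2^n"] pair_adj emb_smult[of _ n] emb_add[of _ n]
       emb_pair sc_scaleR Fo_def h i mult.assoc a)
qed

lemma proj_ket_carrier [simp]: "proj (ket b) \<in> carrier_mat 2 2"
  unfolding proj_def by (rule mult_carrier_mat[of _ 2 1]) (auto simp: ket_def intro: adj_carrier)

text \<open>The bridge to the definitions: with \<open>emb_inject\<close> it reduces every claim
  about \<open>run\<close> to one about \<open>run_op\<close>, that is, to algebra in a single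
  ring.\<close>

lemma run_emb:
  assumes "\<rho>\<^sub>8 \<in> cm 4" "well_formed P n m" "\<rho> \<in> cm n"
  shows "run \<rho>\<^sub>8 P n \<rho> \<in> cm m \<and> emb 0 m (run \<rho>\<^sub>8 P n \<rho>) = run_op \<rho>\<^sub>8 P n (emb 0 n \<rho>)"
  using assms(2,3)
proof (induction P arbitrary: n \<rho>)
  case (Prepare P)
  have "\<rho> \<otimes>\<^sub>K proj (ket 0) \<in> cm (n + 1)" using Prepare.prems by (simp add: mult.commute[of 2])
  then show ?case using Prepare by (simp add: emb_kron_site)
next
  case (Supply P)
  have "\<rho> \<otimes>\<^sub>K \<rho>\<^sub>8 \<in> cm (n + 4)" using Supply.prems assms(1) unfolding power_add by (intro kron_carrier)
  then show ?case using Supply assms(1) by (simp add: emb_kron)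
next
  case (Discard P)
  then show ?case using ptr_trace_last[of \<rho> n] by simp
next
  case (Braid p q P)
  then have pq: "1 \<le> p" "p < q" "q \<le> 2 * n" by auto
  have "emb 0 n (conj_by (braid_gate n p q) \<rho>) = (1 / 2) *\<^sub>R ((1 - gam p * gam q) * emb 0 n \<rho> * (1 + gam p * gam q))"
    using Braid.prems by (simp add: emb_conj_by emb_braid_gate(2,3)[OF pq, of 0, simplified] emb_braid_gate(1)[OF pq])
  then show ?case
    using Braid conj_by_carrier[OF emb_braid_gate(1)[OF pq], of \<rho>] by simp
next
  case (Measure p q P M)
  then have pq: "1 \<le> p" "p < q" "q \<le> 2 * n" by auto
  note e = emb_pair_proj(1)[OF pq, of 1, simplified] emb_pair_proj(2,3)[OF pq, of 1 0, simplified]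
    emb_pair_proj(1)[OF pq, of "- 1", simplified] emb_pair_proj(2,3)[OF pq, of "- 1" 0, simplified]
  have "emb 0 n (conj_by (pair_proj n p q 1) \<rho>) = (1 / 4) *\<^sub>R ((1 + Fo p q) * emb 0 n \<rho> * (1 + Fo p q))"
     "emb 0 n (conj_by (pair_proj n p q (- 1)) \<rho>) = (1 / 4) *\<^sub>R ((1 - Fo p q) * emb 0 n \<rho> * (1 - Fo p q))"
    using Measure.prems by (simp_all add: emb_conj_by e)
  moreover have "conj_by (pair_proj n p q 1) \<rho> \<in> cm n" "conj_by (pair_proj n p q (- 1)) \<rho> \<in> cm n"
    using Measure.prems by (auto intro!: conj_by_carrier e)
  moreover have "well_formed P n m" "well_formed M n m" using Measure.prems by auto
  ultimately show ?case
    using Measure.IH by (simp add: emb_add)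
next
  case (Coin r P R)
  then have "complex_of_real (1 - r) \<cdot>\<^sub>m run \<rho>\<^sub>8 R n \<rho> \<in> cm m" "complex_of_real r \<cdot>\<^sub>m run \<rho>\<^sub>8 P n \<rho> \<in> cm m" by auto
  then show ?case using Coin
    by (simp add: emb_add emb_smult sc_scaleR del: of_real_diff)
qed simp

section \<open>Stabilizers of the ancilla\<close>

text \<open>Twice the spectral projector of an involution. With the factors 1/2 kept outside,
  products expand into signed monomials.\<close>

definition pj :: "bool \<Rightarrow> op \<Rightarrow> op" where
  "pj b T = (if b then 1 - T else 1 + T)"

text \<open>Each of the four monomials contains exactly one of the particles 1, 3, 5, 8, which will
  be measured and which gives it its number, and three of the particles 2, 4, 6, 7, which will be
  braided. Hence it anticommutes with one measured observable and commutes with the other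
  three.\<close>

definition T1 :: "(nat \<Rightarrow> op) \<Rightarrow> op" where "T1 g = - (g 1 * g 4 * g 6 * g 7)"
definition T3 :: "(nat \<Rightarrow> op) \<Rightarrow> op" where "T3 g = - (g 2 * g 3 * g 6 * g 7)"
definition T5 :: "(nat \<Rightarrow> op) \<Rightarrow> op" where "T5 g = - (g 2 * g 4 * g 5 * g 7)"
definition T8 :: "(nat \<Rightarrow> op) \<Rightarrow> op" where "T8 g = g 2 * g 4 * g 6 * g 8"

text \<open>The projector onto the state with faults \<open>a\<close>, \<open>b\<close>, \<open>c\<close>, that is, with eigenvalue \<open>-1\<close> of \<open>T3\<close>, \<open>T5\<close>,
  \<open>T8\<close>, respectively; the even parity then determines the sign of \<open>T1\<close>.\<close>

definition stab :: "(nat \<Rightarrow> op) \<Rightarrow> bool \<Rightarrow> bool \<Rightarrow> bool \<Rightarrow> op" where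
  "stab g a b c = (1 / 16) *\<^sub>R (pj (a \<noteq> (b \<noteq> c)) (T1 g) * pj a (T3 g) * pj b (T5 g) * pj c (T8 g))"

lemma pj_flip: "E * T = - (T * E) \<Longrightarrow> E * pj b T = pj (\<not> b) T * E"
  by (simp add: pj_def algebra_simps)

lemma pj_commute: "E * T = T * E \<Longrightarrow> E * pj b T = pj b T * E"
  by (simp add: pj_def algebra_simps)

locale clifford =
  fixes g :: "nat \<Rightarrow> op"
  assumes sq: "i \<ge> 1 \<Longrightarrow> g i * g i = 1"
    and anti_raw: "i \<ge> 1 \<Longrightarrow> j \<ge> 1 \<Longrightarrow> i \<noteq> j \<Longrightarrow> g i * g j = - (g j * g i)"
begin

lemma sq': "i \<ge> 1 \<Longrightarrow> g i * (g i * x) = x"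
  using sq[of i] by (simp add: mult.assoc[symmetric])

lemma anti: "1 \<le> j \<Longrightarrow> j < i \<Longrightarrow> g i * g j = - (g j * g i)"
  by (rule anti_raw) auto

lemma anti': "1 \<le> j \<Longrightarrow> j < i \<Longrightarrow> g i * (g j * x) = - (g j * (g i * x))"
  using anti[of j i] by (simp add: mult.assoc[symmetric])

lemma gJ: "g i * J = J * g i" and gJ': "g i * (J * x) = J * (g i * x)"
  by (rule J_central J_central')+

lemmas cl = sq sq' anti anti' gJ gJ' J_J J_J' mult.assoc
lemmas T_defs = T1_def T3_def T5_def T8_def

lemma T_sq: "T1 g * T1 g = 1" "T3 g * T3 g = 1" "T5 g * T5 g = 1" "T8 g * T8 g = 1"
  by (simp_all add: T_defs cl)

lemma T_comm:
  "T3 g * T1 g = T1 g * T3 g" "T5 g * T1 g = T1 g * T5 g" "T8 g * T1 g = T1 g * T8 g"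
  "T5 g * T3 g = T3 g * T5 g" "T8 g * T3 g = T3 g * T8 g" "T8 g * T5 g = T5 g * T8 g"
  by (simp_all add: T_defs cl)

text \<open>Another generating set of the same stabilizer group, adapted to the parity check: only
  \<open>g 1 * g 3 * g 5 * g 7\<close> anticommutes with the monomial
  \<open>g 1 * g 3 * g 5 * g 10\<close> of the gate used there.\<close>

lemma stab_eq_VTHL:
  "stab g a b c = (1 / 16) *\<^sub>R (pj c (g 1 * g 3 * g 5 * g 7) * pj c (T8 g) * pj b (- (g 1 * g 3 * g 6 * g 8)) * pj a (- (g 1 * g 4 * g 5 * g 8)))"
  unfolding stab_def T_defs
  by (cases a; cases b; cases c; simp add: pj_def cl algebra_simps)

text \<open>The generators that can be read off from the state vector: the first three are products
  of Z on neighbouring sites, the last one is X on all four sites.\<close>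

lemma stab_eq_Z:
  "stab g False False False = (1 / 16) *\<^sub>R ((1 - g 1 * g 2 * g 3 * g 4) * (1 - g 3 * g 4 * g 5 * g 6) * (1 - g 5 * g 6 * g 7 * g 8)
     * (1 - g 2 * g 3 * g 6 * g 7))"
  unfolding stab_def T_defs
  by (simp add: pj_def cl algebra_simps)

text \<open>Each fault operator anticommutes with \<open>T1\<close> and with exactly one of
  \<open>T3\<close>, \<open>T5\<close>, \<open>T8\<close>, so it flips one bit and keeps the sign of
  \<open>T1\<close> consistent with the even parity.\<close>

lemma stab_err:
  "g 1 * g 3 * stab g a b c = stab g (\<not> a) b c * (g 1 * g 3)"
  "g 1 * g 5 * stab g a b c = stab g a (\<not> b) c * (g 1 * g 5)"
  "g 1 * g 8 * stab g a b c = stab g a b (\<not> c) * (g 1 * g 8)"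
proof -
  have *: "E * stab g a b c = (1 / 16) *\<^sub>R (T * T' * T'' * T''') * E"
    if "E * pj (a \<noteq> (b \<noteq> c)) (T1 g) = T * E" "E * pj a (T3 g) = T' * E" "E * pj b (T5 g) = T'' * E" "E * pj c (T8 g) = T''' * E"
    for E T T' T'' T'''
  proof -
    have "E * (pj (a \<noteq> (b \<noteq> c)) (T1 g) * pj a (T3 g) * pj b (T5 g) * pj c (T8 g)) = T * T' * T'' * T''' * E"
      by (metis that mult.assoc)
    then show ?thesis by (simp add: stab_def)
  qed
  have f: "g 1 * g 3 * T1 g = - (T1 g * (g 1 * g 3))" "g 1 * g 3 * T3 g = - (T3 g * (g 1 * g 3))"
    "g 1 * g 3 * T5 g = T5 g * (g 1 * g 3)" "g 1 * g 3 * T8 g = T8 g * (g 1 * g 3)"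
    "g 1 * g 5 * T1 g = - (T1 g * (g 1 * g 5))" "g 1 * g 5 * T3 g = T3 g * (g 1 * g 5)"
    "g 1 * g 5 * T5 g = - (T5 g * (g 1 * g 5))" "g 1 * g 5 * T8 g = T8 g * (g 1 * g 5)"
    "g 1 * g 8 * T1 g = - (T1 g * (g 1 * g 8))" "g 1 * g 8 * T3 g = T3 g * (g 1 * g 8)"
    "g 1 * g 8 * T5 g = T5 g * (g 1 * g 8)" "g 1 * g 8 * T8 g = - (T8 g * (g 1 * g 8))"
    by (simp_all add: T_defs cl)
  have x: "(\<not> (a \<noteq> (b \<noteq> c))) = ((\<not> a) \<noteq> (b \<noteq> c))" "(\<not> (a \<noteq> (b \<noteq> c))) = (a \<noteq> ((\<not> b) \<noteq> c))"
    "(\<not> (a \<noteq> (b \<noteq> c))) = (a \<noteq> (b \<noteq> (\<not> c)))" by auto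
  show "g 1 * g 3 * stab g a b c = stab g (\<not> a) b c * (g 1 * g 3)"
    unfolding stab_def[of g "\<not> a"] x(1)[symmetric] by (intro * pj_flip pj_commute f)
  show "g 1 * g 5 * stab g a b c = stab g a (\<not> b) c * (g 1 * g 5)"
    unfolding stab_def[of g a "\<not> b"] x(2)[symmetric] by (intro * pj_flip pj_commute f)
  show "g 1 * g 8 * stab g a b c = stab g a b (\<not> c) * (g 1 * g 8)"
    unfolding stab_def[of g a b "\<not> c"] x(3)[symmetric] by (intro * pj_flip pj_commute f)
qed

lemma stab_T:
  "T1 g * stab g a b c = (if a \<noteq> (b \<noteq> c) then -1 else 1) * stab g a b c"
  "T3 g * stab g a b c = (if a then -1 else 1) * stab g a b c"
  "T5 g * stab g a b c = (if b then -1 else 1) * stab g a b c"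
  "T8 g * stab g a b c = (if c then -1 else 1) * stab g a b c"
proof -
  have p: "T * pj x T = (if x then -1 else 1) * pj x T" if "T * T = 1" for T :: op and x
    using that by (simp add: pj_def algebra_simps)
  have mv: "T * (A * B) = c * (A * B)" if "T * A = A * T" "T * B = c * B" "c = 1 \<or> c = -1" for T A B c :: op
    using that by (metis mult.assoc mult_1 mult_minus1 mult_minus_right)
  have fi: "T * (A * B) = c * (A * B)" if "T * A = c * A" for T A B c :: op
    using that by (metis mult.assoc)
  have s: "T * (X * Y * Z * W) = c * (X * Y * Z * W)"
    if "T * X = X * T \<and> T * Y = Y * T \<and> T * Z = Z * T \<and> T * W = c * W \<or> T * X = X * T \<and> T * Y = Y * T \<and> T * Z = c * Z
      \<or> T * X = X * T \<and> T * Y = c * Y \<or> T * X = c * X" "c = 1 \<or> c = -1" for T X Y Z W c :: op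
    using that(1)
  proof (elim disjE conjE)
    assume "T * X = X * T" "T * Y = Y * T" "T * Z = Z * T" "T * W = c * W"
    then show ?thesis by (intro mv commute_mult that(2))
  next
    assume "T * X = X * T" "T * Y = Y * T" "T * Z = c * Z"
    then show ?thesis by (intro fi mv[of T "X * Y" Z] commute_mult that(2))
  next
    assume "T * X = X * T" "T * Y = c * Y"
    then show ?thesis by (intro fi[of T "X * Y * Z"] fi[of T "X * Y"] mv[of T X Y] that(2))
  next
    assume "T * X = c * X"
    then show ?thesis by (intro fi)
  qed
  note pc = pj_commute[OF T_comm(1)] pj_commute[OF T_comm(2)] pj_commute[OF T_comm(3)]
    pj_commute[OF T_comm(4)] pj_commute[OF T_comm(5)] pj_commute[OF T_comm(6)]
  show "T1 g * stab g a b c = (if a \<noteq> (b \<noteq> c) then -1 else 1) * stab g a b c"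
    unfolding stab_def mult_scaleR_right by (subst s[where c = "if a \<noteq> (b \<noteq> c) then -1 else 1"]) (use p[OF T_sq(1)] in auto)
  show "T3 g * stab g a b c = (if a then -1 else 1) * stab g a b c"
    unfolding stab_def mult_scaleR_right by (subst s[where c = "if a then -1 else 1"]) (use p[OF T_sq(2), of a] pc in auto)
  show "T5 g * stab g a b c = (if b then -1 else 1) * stab g a b c"
    unfolding stab_def mult_scaleR_right by (subst s[where c = "if b then -1 else 1"]) (use p[OF T_sq(3), of b] pc in auto)
  show "T8 g * stab g a b c = (if c then -1 else 1) * stab g a b c"
    unfolding stab_def mult_scaleR_right by (subst s[where c = "if c then -1 else 1"]) (use p[OF T_sq(4), of c] pc in auto)
qed

end

lemma mult_commute: "A * x = x * A \<Longrightarrow> B * x = x * B \<Longrightarrow> A * B * x = x * (A * B)" for x :: "'a :: semigroup_mult"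
  by (metis mult.assoc)

section \<open>The algebra of teleporting the quartic gate\<close>

context clifford
begin

abbreviation Fg :: "nat \<Rightarrow> nat \<Rightarrow> op" where "Fg i j \<equiv> - (J * g i * g j)"

text \<open>Within this locale, the generators \<open>1, \<dots>, 8\<close> belong to the ancilla and \<open>9, \<dots>, 12\<close> to the data.
  \<open>Bm\<close> is (up to a factor) the projector of the four measurements, and \<open>Wm\<close>, with inverse \<open>Wi\<close>, the
  braiding that follows them.\<close>

definition Bm :: op where
  "Bm = (1 - Fg 12 8) * (1 + Fg 11 5) * (1 + Fg 10 3) * (1 + Fg 9 1)"

definition Wm :: op where
  "Wm = (1 - g 12 * g 7) * (1 - g 11 * g 6) * (1 - g 10 * g 4) * (1 - g 9 * g 2)"

definition Wi :: op where
  "Wi = (1 + g 9 * g 2) * (1 + g 10 * g 4) * (1 + g 11 * g 6) * (1 + g 12 * g 7)"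

lemma Bm_rev: "(1 + Fg 9 1) * (1 + Fg 10 3) * (1 + Fg 11 5) * (1 - Fg 12 8) = Bm"
proof -
  have c: "(1 + Fg 9 1) * (1 + Fg 10 3) = (1 + Fg 10 3) * (1 + Fg 9 1)"
    "(1 + Fg 9 1) * (1 + Fg 11 5) = (1 + Fg 11 5) * (1 + Fg 9 1)"
    "(1 + Fg 9 1) * (1 - Fg 12 8) = (1 - Fg 12 8) * (1 + Fg 9 1)"
    "(1 + Fg 10 3) * (1 + Fg 11 5) = (1 + Fg 11 5) * (1 + Fg 10 3)"
    "(1 + Fg 10 3) * (1 - Fg 12 8) = (1 - Fg 12 8) * (1 + Fg 10 3)"
    "(1 + Fg 11 5) * (1 - Fg 12 8) = (1 - Fg 12 8) * (1 + Fg 11 5)"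
    by (simp_all add: cl algebra_simps)
  define P1 P2 P3 P4 where defs: "P1 = 1 + Fg 9 1" "P2 = 1 + Fg 10 3" "P3 = 1 + Fg 11 5" "P4 = 1 - Fg 12 8"
  note c = c[folded defs]
  have "P1 * (P2 * (P3 * P4)) = P1 * (P2 * (P4 * P3))" by (simp only: c)
  also have "P2 * (P4 * P3) = P4 * P3 * P2" by (intro commute_mult c)
  also have "P1 * (P4 * P3 * P2) = P4 * P3 * P2 * P1" by (intro commute_mult c)
  finally show ?thesis unfolding Bm_def defs[symmetric] by (simp only: mult.assoc)
qed

text \<open>On the range of a spectral projector of \<open>Fg 9 1\<close> the operators
  \<open>g 9\<close> and \<open>g 1\<close> agree up to a factor \<open>\<i>\<close> or
  \<open>- \<i>\<close>; a measurement thus identifies a data mode with an ancilla mode.\<close>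

lemma Bm_d:
  "Bm * g 9 = J * (Bm * g 1)" "Bm * g 10 = J * (Bm * g 3)" "Bm * g 11 = J * (Bm * g 5)" "Bm * g 12 = - (J * (Bm * g 8))"
proof -
  let ?P1 = "1 + Fg 9 1" and ?P2 = "1 + Fg 10 3" and ?P3 = "1 + Fg 11 5" and ?P4 = "1 - Fg 12 8"
  have p: "?P1 * g 9 = J * (?P1 * g 1)" "?P2 * g 10 = J * (?P2 * g 3)" "?P3 * g 11 = J * (?P3 * g 5)" "?P4 * g 12 = - (J * (?P4 * g 8))"
    by (simp_all add: cl algebra_simps)
  have c: "?P1 * g 10 = g 10 * ?P1" "?P1 * g 11 = g 11 * ?P1" "?P1 * g 12 = g 12 * ?P1"
    "?P1 * g 3 = g 3 * ?P1" "?P1 * g 5 = g 5 * ?P1" "?P1 * g 8 = g 8 * ?P1"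
    "?P2 * g 11 = g 11 * ?P2" "?P2 * g 12 = g 12 * ?P2" "?P2 * g 5 = g 5 * ?P2" "?P2 * g 8 = g 8 * ?P2"
    "?P3 * g 12 = g 12 * ?P3" "?P3 * g 8 = g 8 * ?P3"
    by (simp_all add: cl algebra_simps)
  define P1 P2 P3 P4 where defs: "P1 = ?P1" "P2 = ?P2" "P3 = ?P3" "P4 = ?P4"
  note p = p[folded defs] and c = c[folded defs]
  have j: "X * (J * y) = J * (X * y)" for X y by (rule J_central')
  have B: "Bm = P4 * P3 * P2 * P1" by (simp add: Bm_def defs)
  show "Bm * g 9 = J * (Bm * g 1)" unfolding B by (simp add: mult.assoc p j)
  have "Bm * g 10 = P4 * P3 * (P2 * g 10) * P1" unfolding B by (simp add: mult.assoc c)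
  also have "\<dots> = J * (Bm * g 3)" unfolding B by (simp add: mult.assoc p c j)
  finally show "Bm * g 10 = J * (Bm * g 3)" .
  have "P2 * P1 * g 11 = g 11 * (P2 * P1)" by (intro mult_commute c)
  then have "Bm * g 11 = P4 * (P3 * g 11) * P2 * P1" unfolding B by (simp only: mult.assoc)
  also have "\<dots> = J * (P4 * P3 * (g 5 * (P2 * P1)))" by (simp add: mult.assoc p j)
  also have "g 5 * (P2 * P1) = P2 * P1 * g 5" by (intro commute_mult c[symmetric])
  finally show "Bm * g 11 = J * (Bm * g 5)" unfolding B by (simp add: mult.assoc)
  have "P3 * P2 * P1 * g 12 = g 12 * (P3 * P2 * P1)" by (intro mult_commute c)
  then have "Bm * g 12 = P4 * g 12 * (P3 * P2 * P1)" unfolding B by (simp only: mult.assoc)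
  also have "\<dots> = - (J * (P4 * (g 8 * (P3 * P2 * P1))))" unfolding p by (simp add: mult.assoc)
  also have "g 8 * (P3 * P2 * P1) = P3 * P2 * P1 * g 8" by (intro commute_mult c[symmetric])
  finally show "Bm * g 12 = - (J * (Bm * g 8))" unfolding B by (simp add: mult.assoc)
qed

lemma d_Bm:
  "g 9 * Bm = - (J * (g 1 * Bm))" "g 10 * Bm = - (J * (g 3 * Bm))" "g 11 * Bm = - (J * (g 5 * Bm))" "g 12 * Bm = J * (g 8 * Bm)"
proof -
  let ?P1 = "1 + Fg 9 1" and ?P2 = "1 + Fg 10 3" and ?P3 = "1 + Fg 11 5" and ?P4 = "1 - Fg 12 8"
  have p: "g 9 * ?P1 = - (J * (g 1 * ?P1))" "g 10 * ?P2 = - (J * (g 3 * ?P2))" "g 11 * ?P3 = - (J * (g 5 * ?P3))" "g 12 * ?P4 = J * (g 8 * ?P4)"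
    by (simp_all add: cl algebra_simps)
  have c: "?P1 * g 10 = g 10 * ?P1" "?P1 * g 11 = g 11 * ?P1" "?P1 * g 12 = g 12 * ?P1"
    "?P1 * g 3 = g 3 * ?P1" "?P1 * g 5 = g 5 * ?P1" "?P1 * g 8 = g 8 * ?P1"
    "?P2 * g 11 = g 11 * ?P2" "?P2 * g 12 = g 12 * ?P2" "?P2 * g 5 = g 5 * ?P2" "?P2 * g 8 = g 8 * ?P2"
    "?P3 * g 12 = g 12 * ?P3" "?P3 * g 8 = g 8 * ?P3"
    by (simp_all add: cl algebra_simps)
  define P1 P2 P3 P4 where defs: "P1 = ?P1" "P2 = ?P2" "P3 = ?P3" "P4 = ?P4"
  note p = p[folded defs] and c = c[folded defs]
  have j: "X * (J * y) = J * (X * y)" for X y by (rule J_central')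
  have B: "Bm = P1 * P2 * P3 * P4" using Bm_rev by (simp add: defs)
  have pull: "x * (A * (y * Z)) = z * (J * (u * (A * (y * Z))))"
    if "A * x = x * A" "x * y = z * (J * (u * y))" "A * u = u * A" "z = 1 \<or> z = -1" for x y z u A Z :: op
  proof -
    have "x * (A * (y * Z)) = A * (x * y) * Z" using that(1) by (simp add: mult.assoc[symmetric])
    also have "\<dots> = z * (J * (A * u * (y * Z)))" unfolding that(2) using that(4) by (auto simp: mult.assoc j)
    also have "A * u = u * A" by (rule that(3))
    finally show ?thesis by (simp add: mult.assoc)
  qed
  show "g 9 * Bm = - (J * (g 1 * Bm))"
    unfolding B using arg_cong[OF p(1), where f = "\<lambda>x. x * (P2 * P3 * P4)"] by (simp add: mult.assoc)
  show "g 10 * Bm = - (J * (g 3 * Bm))"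
    unfolding B using pull[of P1 "g 10" P2 "-1" "g 3" "P3 * P4"] p c by (simp add: mult.assoc)
  have "P1 * P2 * g 11 = g 11 * (P1 * P2)" "P1 * P2 * g 5 = g 5 * (P1 * P2)" by (intro mult_commute c)+
  then show "g 11 * Bm = - (J * (g 5 * Bm))"
    unfolding B using pull[of "P1 * P2" "g 11" P3 "-1" "g 5" P4] p by (simp add: mult.assoc)
  have "P1 * P2 * P3 * g 12 = g 12 * (P1 * P2 * P3)" "P1 * P2 * P3 * g 8 = g 8 * (P1 * P2 * P3)" by (intro mult_commute c)+
  then show "g 12 * Bm = J * (g 8 * Bm)"
    unfolding B using pull[of "P1 * P2 * P3" "g 12" P4 "1" "g 8" 1] p by (simp add: mult.assoc)
qed

definition conj_pair :: "nat \<Rightarrow> nat \<Rightarrow> op \<Rightarrow> op" where "conj_pair i j X = g i * g j * X * (g j * g i)"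

text \<open>Between two copies of the measurement projector ancilla modes may be traded for data
  modes. This is how a faulty ancilla becomes a fault of the data.\<close>

lemma Bm_conj_pair:
  "Bm * conj_pair 1 3 X * Bm = Bm * conj_pair 9 10 X * Bm" "Bm * conj_pair 1 5 X * Bm = Bm * conj_pair 9 11 X * Bm" "Bm * conj_pair 1 8 X * Bm = Bm * conj_pair 9 12 X * Bm"
proof -
  have l: "Bm * (g 9 * x) = J * (Bm * (g 1 * x))" "Bm * (g 10 * x) = J * (Bm * (g 3 * x))" "Bm * (g 11 * x) = J * (Bm * (g 5 * x))"
    "Bm * (g 12 * x) = - (J * (Bm * (g 8 * x)))" for x
    using Bm_d by (simp_all add: mult.assoc[symmetric])
  have sw: "g 9 * g 10 = - (g 10 * g 9)" "g 9 * g 11 = - (g 11 * g 9)" "g 9 * g 12 = - (g 12 * g 9)"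
     "g 9 * g 3 = - (g 3 * g 9)" "g 9 * g 5 = - (g 5 * g 9)" "g 9 * g 8 = - (g 8 * g 9)"
     "g 10 * g 1 = - (g 1 * g 10)" "g 11 * g 1 = - (g 1 * g 11)" "g 12 * g 1 = - (g 1 * g 12)"
    by (rule anti_raw; simp)+
  have L: "Bm * (g 9 * g 10) = s * (Bm * (g 1 * g 3))" "Bm * (g 9 * g 11) = s * (Bm * (g 1 * g 5))"
    "Bm * (g 9 * g 12) = - s * (Bm * (g 1 * g 8))"
    "g 10 * g 9 * Bm = s * (g 3 * g 1 * Bm)" "g 11 * g 9 * Bm = s * (g 5 * g 1 * Bm)" "g 12 * g 9 * Bm = - s * (g 8 * g 1 * Bm)"
    if "s = -1" for s
  proof -
    have j: "X * (J * y) = J * (X * y)" for X y by (rule J_central')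
    have 1: "g 1 * g 10 = - (g 10 * g 1)" "g 1 * g 11 = - (g 11 * g 1)" "g 1 * g 12 = - (g 12 * g 1)" by (rule anti_raw; simp)+
    have 2: "g 1 * g 3 = - (g 3 * g 1)" "g 1 * g 5 = - (g 5 * g 1)" "g 1 * g 8 = - (g 8 * g 1)" by (rule anti_raw; simp)+
    show "Bm * (g 9 * g 10) = s * (Bm * (g 1 * g 3))" "Bm * (g 9 * g 11) = s * (Bm * (g 1 * g 5))"
      "Bm * (g 9 * g 12) = - s * (Bm * (g 1 * g 8))"
      unfolding that l 1 2 by (simp_all add: l J_J')
    show "g 10 * g 9 * Bm = s * (g 3 * g 1 * Bm)" "g 11 * g 9 * Bm = s * (g 5 * g 1 * Bm)" "g 12 * g 9 * Bm = - s * (g 8 * g 1 * Bm)"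
      unfolding that by (simp_all add: mult.assoc d_Bm anti' gJ' J_J' del: One_nat_def)
  qed
  have x: "Bm * (E * X * E') * Bm = (Bm * E) * X * (E' * Bm)" for E E' by (simp only: mult.assoc)
  show "Bm * conj_pair 1 3 X * Bm = Bm * conj_pair 9 10 X * Bm" "Bm * conj_pair 1 5 X * Bm = Bm * conj_pair 9 11 X * Bm" "Bm * conj_pair 1 8 X * Bm = Bm * conj_pair 9 12 X * Bm"
    unfolding conj_pair_def x L[OF refl] by simp_all
qed

lemma conj_pair_swap:
  assumes "i \<ge> 1" "j \<ge> 1" "k \<ge> 1" "l \<ge> 1"
  shows "conj_pair i j (conj_pair k l X) = conj_pair k l (conj_pair i j X)"
proof -
  have sw: "g x * (g y * Z * g y) * g x = g y * (g x * Z * g x) * g y" if "x \<ge> 1" "y \<ge> 1" for x y Z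
  proof (cases "x = y")
    case False
    have "g x * (g y * Z * g y) * g x = (g x * g y) * Z * (g y * g x)" by (simp only: mult.assoc)
    also have "\<dots> = (g y * g x) * Z * (g x * g y)"
      using anti_raw[OF that False] by simp
    finally show ?thesis by (simp only: mult.assoc)
  qed simp
  have d: "conj_pair x y Z = g x * (g y * Z * g y) * g x" for x y Z by (simp add: conj_pair_def mult.assoc)
  show ?thesis
    unfolding d sw[OF assms(2,3)] sw[OF assms(1,3)] sw[OF assms(2,4)] sw[OF assms(1,4)] ..
qed

definition faults :: "nat \<Rightarrow> nat \<Rightarrow> nat \<Rightarrow> nat \<Rightarrow> bool \<Rightarrow> bool \<Rightarrow> bool \<Rightarrow> op \<Rightarrow> op" where
  "faults i j k l a b c X = (if a then conj_pair i j else id) ((if b then conj_pair i k else id) ((if c then conj_pair i l else id) X))"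

lemma Bm_faults: "Bm * faults 1 3 5 8 a b c X * Bm = Bm * faults 9 10 11 12 a b c X * Bm"
proof -
  have s: "conj_pair 9 10 (conj_pair 1 5 X) = conj_pair 1 5 (conj_pair 9 10 X)" "conj_pair 9 10 (conj_pair 1 8 X) = conj_pair 1 8 (conj_pair 9 10 X)"
     "conj_pair 9 11 (conj_pair 1 8 X) = conj_pair 1 8 (conj_pair 9 11 X)" "conj_pair 9 12 (conj_pair 9 11 X) = conj_pair 9 11 (conj_pair 9 12 X)"
     "conj_pair 9 12 (conj_pair 9 10 X) = conj_pair 9 10 (conj_pair 9 12 X)" "conj_pair 9 11 (conj_pair 9 10 X) = conj_pair 9 10 (conj_pair 9 11 X)" for X
    by (rule conj_pair_swap; simp)+
  show ?thesis
    unfolding faults_def by (cases a; cases b; cases c) (simp_all add: Bm_conj_pair s del: One_nat_def)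
qed

text \<open>The braids carry the unmeasured ancilla modes 2, 4, 6, 7 to the data positions 9 to 12;
  after the measurements the data live in those modes.\<close>

lemma Wm_c: "Wm * g 2 = - (g 9 * Wm)" "Wm * g 4 = - (g 10 * Wm)" "Wm * g 6 = - (g 11 * Wm)" "Wm * g 7 = - (g 12 * Wm)"
proof -
  let ?W1 = "1 - g 9 * g 2" and ?W2 = "1 - g 10 * g 4" and ?W3 = "1 - g 11 * g 6" and ?W4 = "1 - g 12 * g 7"
  have w: "?W1 * g 2 = - (g 9 * ?W1)" "?W2 * g 4 = - (g 10 * ?W2)" "?W3 * g 6 = - (g 11 * ?W3)" "?W4 * g 7 = - (g 12 * ?W4)"
    by (simp_all add: cl algebra_simps)
  have c: "?W1 * g 4 = g 4 * ?W1" "?W1 * g 6 = g 6 * ?W1" "?W1 * g 7 = g 7 * ?W1" "?W2 * g 6 = g 6 * ?W2" "?W2 * g 7 = g 7 * ?W2"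
    "?W3 * g 7 = g 7 * ?W3" "?W2 * g 9 = g 9 * ?W2" "?W3 * g 9 = g 9 * ?W3" "?W4 * g 9 = g 9 * ?W4"
    "?W3 * g 10 = g 10 * ?W3" "?W4 * g 10 = g 10 * ?W4" "?W4 * g 11 = g 11 * ?W4"
    by (simp_all add: cl algebra_simps)
  define W1 W2 W3 W4 where defs: "W1 = ?W1" "W2 = ?W2" "W3 = ?W3" "W4 = ?W4"
  note w = w[folded defs] and c = c[folded defs]
  have W: "Wm = W4 * W3 * W2 * W1" by (simp add: Wm_def defs)
  have "W4 * W3 * W2 * g 9 = g 9 * (W4 * W3 * W2)" by (intro mult_commute c)
  then have "W4 * (W3 * (W2 * (g 9 * W1))) = g 9 * (W4 * (W3 * (W2 * W1)))" by (simp only: mult.assoc[symmetric])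
  then show "Wm * g 2 = - (g 9 * Wm)" unfolding W by (simp add: mult.assoc w)
  have a: "W4 * W3 * g 10 = g 10 * (W4 * W3)" by (intro mult_commute c)
  have "Wm * g 4 = W4 * W3 * (W2 * g 4) * W1" unfolding W by (simp add: mult.assoc c)
  also have "\<dots> = - (W4 * W3 * g 10 * W2 * W1)" unfolding w by (simp add: mult.assoc)
  finally show "Wm * g 4 = - (g 10 * Wm)" unfolding W a by (simp add: mult.assoc)
  have b: "W2 * W1 * g 6 = g 6 * (W2 * W1)" by (intro mult_commute c)
  have "Wm * g 6 = W4 * (W3 * (W2 * W1 * g 6))" unfolding W by (simp add: mult.assoc)
  also have "\<dots> = W4 * (W3 * g 6) * (W2 * W1)" unfolding b by (simp add: mult.assoc)
  also have "\<dots> = - (W4 * g 11 * W3 * (W2 * W1))" unfolding w by (simp add: mult.assoc)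
  finally show "Wm * g 6 = - (g 11 * Wm)" unfolding W c by (simp add: mult.assoc)
  have d: "W3 * W2 * W1 * g 7 = g 7 * (W3 * W2 * W1)" by (intro mult_commute c)
  have "Wm * g 7 = W4 * (W3 * W2 * W1 * g 7)" unfolding W by (simp add: mult.assoc)
  also have "\<dots> = W4 * g 7 * (W3 * W2 * W1)" unfolding d by (simp add: mult.assoc)
  finally show "Wm * g 7 = - (g 12 * Wm)" unfolding W w by (simp add: mult.assoc)
qed

lemma Bm_sq_free:
  "Bm * (g 4 * g 6 * g 7) = g 4 * g 6 * g 7 * Bm" "Bm * (g 2 * g 6 * g 7) = g 2 * g 6 * g 7 * Bm"
  "Bm * (g 2 * g 4 * g 7) = g 2 * g 4 * g 7 * Bm" "Bm * (g 2 * g 4 * g 6) = g 2 * g 4 * g 6 * Bm"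
proof -
  have c: "g i * Fg j k = Fg j k * g i" if "i \<in> {2, 4, 6, 7}" "(j, k) \<in> {(9, 1), (10, 3), (11, 5), (12, 8)}" for i j k
    using that by (auto simp: cl)
  then have "g i * Bm = Bm * g i" if "i \<in> {2, 4, 6, 7}" for i
    unfolding Bm_def using that by (intro commute_mult) (simp_all add: algebra_simps)
  then show "Bm * (g 4 * g 6 * g 7) = g 4 * g 6 * g 7 * Bm" "Bm * (g 2 * g 6 * g 7) = g 2 * g 6 * g 7 * Bm"
  "Bm * (g 2 * g 4 * g 7) = g 2 * g 4 * g 7 * Bm" "Bm * (g 2 * g 4 * g 6) = g 2 * g 4 * g 6 * Bm"
    by (intro commute_mult; simp)+
qed

abbreviation A0 :: op where "A0 \<equiv> stab g False False False"

lemma A0_T: "T1 g * A0 = A0" "T3 g * A0 = A0" "T5 g * A0 = A0" "T8 g * A0 = A0"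
  by (simp_all add: stab_T)

lemma A0_idem: "A0 * A0 = A0"
proof -
  have "(1 + T) * A0 = 2 *\<^sub>R A0" if "T * A0 = A0" for T
    using that by (simp add: distrib_right scaleR_2)
  then have "(1 + T1 g) * ((1 + T3 g) * ((1 + T5 g) * ((1 + T8 g) * A0))) = 16 *\<^sub>R A0"
    by (simp add: A0_T)
  moreover have "A0 * A0 = (1 / 16) *\<^sub>R ((1 + T1 g) * ((1 + T3 g) * ((1 + T5 g) * ((1 + T8 g) * A0))))"
    by (subst (1) stab_def) (simp add: pj_def mult.assoc)
  ultimately show ?thesis by simp
qed

text \<open>Each measurement factor anticommutes with its own stabilizer \<open>T\<close> and
  commutes with the others, so that it satisfies \<open>P * (1 + T) * P = 2 * P\<close>; the four
  factors 2 cancel the 1/16 in \<open>stab\<close>. As \<open>Bm\<close> is 16 times a projector,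
  this outcome has probability 1/16 whatever the data are.\<close>

lemma Bm_A0_Bm: "Bm * A0 * Bm = Bm"
proof -
  let ?P1 = "1 + Fg 9 1" and ?P2 = "1 + Fg 10 3" and ?P3 = "1 + Fg 11 5" and ?P4 = "1 - Fg 12 8"
  let ?T1 = "1 + T1 g" and ?T2 = "1 + T3 g" and ?T3 = "1 + T5 g" and ?T4 = "1 + T8 g"
  have pp: "?P1 * ?T1 * ?P1 = 2 *\<^sub>R ?P1" "?P2 * ?T2 * ?P2 = 2 *\<^sub>R ?P2" "?P3 * ?T3 * ?P3 = 2 *\<^sub>R ?P3" "?P4 * ?T4 * ?P4 = 2 *\<^sub>R ?P4"
    by (simp_all add: T_defs cl algebra_simps scaleR_2)
  have c: "?P1 * ?T2 = ?T2 * ?P1" "?P1 * ?T3 = ?T3 * ?P1" "?P1 * ?T4 = ?T4 * ?P1"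
     "?P2 * ?T3 = ?T3 * ?P2" "?P2 * ?T4 = ?T4 * ?P2" "?P3 * ?T4 = ?T4 * ?P3"
     "?P2 * ?T1 = ?T1 * ?P2" "?P3 * ?T1 = ?T1 * ?P3" "?P4 * ?T1 = ?T1 * ?P4"
     "?P3 * ?T2 = ?T2 * ?P3" "?P4 * ?T2 = ?T2 * ?P4" "?P4 * ?T3 = ?T3 * ?P4"
    by (simp_all add: T_defs cl algebra_simps)
  have d: "?P1 * ?P2 = ?P2 * ?P1" "?P1 * ?P3 = ?P3 * ?P1" "?P2 * ?P3 = ?P3 * ?P2"
    by (simp_all add: cl algebra_simps)
  define P1 P2 P3 P4 S1 S2 S3 S4 where defs: "P1 = ?P1" "P2 = ?P2" "P3 = ?P3" "P4 = ?P4" "S1 = ?T1" "S2 = ?T2" "S3 = ?T3" "S4 = ?T4"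
  note pp = pp[folded defs] and c = c[folded defs] and d = d[folded defs]
  have a1: "S1 * (S2 * S3 * S4) * P1 = S1 * P1 * (S2 * S3 * S4)"
    using commute_mult[of P1 "S2 * S3" S4] commute_mult[of P1 S2 S3] c(1-3) by (simp only: mult.assoc)
  have a2: "S2 * (S3 * S4) * P2 = S2 * P2 * (S3 * S4)"
    using commute_mult[of P2 S3 S4] c(4,5) by (simp only: mult.assoc)
  have a3: "S3 * S4 * P3 = S3 * P3 * S4"
    using c(6) by (simp only: mult.assoc)
  have "P4 * P3 * P2 * P1 * (S1 * S2 * S3 * S4) * (P1 * P2 * P3 * P4)
     = P4 * P3 * P2 * P1 * (S1 * (S2 * S3 * S4) * P1) * P2 * P3 * P4"
    by (simp only: mult.assoc)
  also have "\<dots> = P4 * P3 * P2 * (P1 * S1 * P1) * (S2 * (S3 * S4) * P2) * P3 * P4"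
    unfolding a1 by (simp only: mult.assoc)
  also have "\<dots> = 2 *\<^sub>R (P4 * P3 * (P2 * P1) * S2 * P2 * (S3 * S4) * P3 * P4)"
    unfolding pp a2 by (simp add: mult.assoc)
  also have "P4 * P3 * (P2 * P1) * S2 * P2 * (S3 * S4) * P3 * P4 = P4 * P3 * P1 * (P2 * S2 * P2) * (S3 * S4 * P3) * P4"
    unfolding d(1)[symmetric] by (simp add: mult.assoc)
  also have "\<dots> = 2 *\<^sub>R (P4 * (P3 * (P1 * P2)) * S3 * P3 * S4 * P4)"
    unfolding pp a3 by (simp add: mult.assoc)
  also have "P3 * (P1 * P2) = P1 * P2 * P3"
    by (intro commute_mult d[symmetric])
  also have "P4 * (P1 * P2 * P3) * S3 * P3 * S4 * P4 = P4 * P1 * P2 * (P3 * S3 * P3) * S4 * P4"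
    by (simp add: mult.assoc)
  also have "\<dots> = 2 *\<^sub>R (P4 * (P1 * P2 * P3) * S4 * P4)"
    unfolding pp by (simp add: mult.assoc)
  also have "P4 * (P1 * P2 * P3) = P1 * P2 * P3 * P4"
  proof -
    have "P4 * P1 = P1 * P4" "P4 * P2 = P2 * P4" "P4 * P3 = P3 * P4"
      unfolding defs by (simp_all add: cl algebra_simps)
    then show ?thesis by (metis commute_mult)
  qed
  also have "P1 * P2 * P3 * P4 * S4 * P4 = P1 * P2 * P3 * (P4 * S4 * P4)" by (simp add: mult.assoc)
  also have "\<dots> = 2 *\<^sub>R (P1 * P2 * P3 * P4)" unfolding pp by (simp add: mult.assoc)
  finally have "Bm * (S1 * S2 * S3 * S4) * Bm = 16 *\<^sub>R Bm"
    using Bm_rev unfolding defs Bm_def by simp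
  then show ?thesis
    unfolding stab_def pj_def by (simp add: defs)
qed

text \<open>After the braids the measured observables are those of the pairs (1, 2), (3, 4), (5, 6),
  (7, 8), all with eigenvalue -1. The used ancilla ends in a product of states \<open>ket 1\<close>
  and can be discarded.\<close>

lemma W_B_W:
  "Wm * Bm * Wi = 16 *\<^sub>R ((1 - Fg 1 2) * (1 - Fg 3 4) * (1 - Fg 5 6) * (1 - Fg 7 8))"
proof -
  let ?P1 = "1 + Fg 9 1" and ?P2 = "1 + Fg 10 3" and ?P3 = "1 + Fg 11 5" and ?P4 = "1 - Fg 12 8"
  let ?W1 = "1 - g 9 * g 2" and ?W2 = "1 - g 10 * g 4" and ?W3 = "1 - g 11 * g 6" and ?W4 = "1 - g 12 * g 7"
  let ?V1 = "1 + g 9 * g 2" and ?V2 = "1 + g 10 * g 4" and ?V3 = "1 + g 11 * g 6" and ?V4 = "1 + g 12 * g 7"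
  let ?Q1 = "1 - Fg 1 2" and ?Q2 = "1 - Fg 3 4" and ?Q3 = "1 - Fg 5 6" and ?Q4 = "1 - Fg 7 8"
  have w: "?W1 * ?P1 * ?V1 = 2 *\<^sub>R ?Q1" "?W2 * ?P2 * ?V2 = 2 *\<^sub>R ?Q2" "?W3 * ?P3 * ?V3 = 2 *\<^sub>R ?Q3" "?W4 * ?P4 * ?V4 = 2 *\<^sub>R ?Q4"
    by (simp_all add: cl algebra_simps scaleR_2)
  have c: "?W1 * ?P2 = ?P2 * ?W1" "?W1 * ?P3 = ?P3 * ?W1" "?W1 * ?P4 = ?P4 * ?W1"
     "?W2 * ?P3 = ?P3 * ?W2" "?W2 * ?P4 = ?P4 * ?W2" "?W3 * ?P4 = ?P4 * ?W3"
     "?W2 * ?Q1 = ?Q1 * ?W2" "?W3 * ?Q1 = ?Q1 * ?W3" "?W4 * ?Q1 = ?Q1 * ?W4"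
     "?W3 * ?Q2 = ?Q2 * ?W3" "?W4 * ?Q2 = ?Q2 * ?W4" "?W4 * ?Q3 = ?Q3 * ?W4"
     "?V2 * ?Q1 = ?Q1 * ?V2" "?V3 * ?Q1 = ?Q1 * ?V3" "?V4 * ?Q1 = ?Q1 * ?V4"
     "?V3 * ?Q2 = ?Q2 * ?V3" "?V4 * ?Q2 = ?Q2 * ?V4" "?V4 * ?Q3 = ?Q3 * ?V4"
     "?P2 * ?Q1 = ?Q1 * ?P2" "?P3 * ?Q1 = ?Q1 * ?P3" "?P4 * ?Q1 = ?Q1 * ?P4"
     "?P3 * ?Q2 = ?Q2 * ?P3" "?P4 * ?Q2 = ?Q2 * ?P4" "?P4 * ?Q3 = ?Q3 * ?P4"
    by (simp_all add: cl algebra_simps)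
  define P1 P2 P3 P4 W1 W2 W3 W4 V1 V2 V3 V4 Q1 Q2 Q3 Q4 where
    defs: "P1 = ?P1" "P2 = ?P2" "P3 = ?P3" "P4 = ?P4" "W1 = ?W1" "W2 = ?W2" "W3 = ?W3" "W4 = ?W4"
      "V1 = ?V1" "V2 = ?V2" "V3 = ?V3" "V4 = ?V4" "Q1 = ?Q1" "Q2 = ?Q2" "Q3 = ?Q3" "Q4 = ?Q4"
  note w = w[folded defs] and c = c[folded defs]
  have "Wm * Bm * Wi = W4 * W3 * W2 * (W1 * (P4 * P3 * P2)) * P1 * V1 * V2 * V3 * V4"
    unfolding Wm_def Bm_def Wi_def defs by (simp only: mult.assoc)
  also have "W1 * (P4 * P3 * P2) = P4 * P3 * P2 * W1" by (intro commute_mult c)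
  also have "W4 * W3 * W2 * (P4 * P3 * P2 * W1) * P1 * V1 * V2 * V3 * V4 = W4 * W3 * (W2 * (P4 * P3)) * P2 * (W1 * P1 * V1) * V2 * V3 * V4"
    by (simp only: mult.assoc)
  also have "W2 * (P4 * P3) = P4 * P3 * W2" by (intro commute_mult c)
  also have "W4 * W3 * (P4 * P3 * W2) * P2 * (W1 * P1 * V1) * V2 * V3 * V4 = 2 *\<^sub>R (W4 * (W3 * P4) * P3 * (W2 * (P2 * Q1)) * V2 * V3 * V4)"
    unfolding w by (simp add: mult.assoc)
  also have "W2 * (P2 * Q1) = Q1 * (W2 * P2)" using commute_mult[of Q1 W2 P2] c(7,19) by (simp only: mult.assoc)
  also have "W4 * (W3 * P4) * P3 * (Q1 * (W2 * P2)) * V2 * V3 * V4 = W4 * P4 * (W3 * (P3 * Q1)) * (W2 * P2 * V2) * V3 * V4"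
    unfolding c(6) by (simp only: mult.assoc)
  also have "W3 * (P3 * Q1) = Q1 * (W3 * P3)" using commute_mult[of Q1 W3 P3] c(8,20) by (simp only: mult.assoc)
  also have "W4 * P4 * (Q1 * (W3 * P3)) * (W2 * P2 * V2) * V3 * V4 = 2 *\<^sub>R (W4 * (P4 * Q1) * (W3 * (P3 * Q2)) * V3 * V4)"
    unfolding w by (simp add: mult.assoc)
  also have "W3 * (P3 * Q2) = Q2 * (W3 * P3)" using commute_mult[of Q2 W3 P3] c(10,22) by (simp only: mult.assoc)
  also have "W4 * (P4 * Q1) * (Q2 * (W3 * P3)) * V3 * V4 = W4 * (P4 * (Q1 * Q2)) * (W3 * P3 * V3) * V4"
    by (simp only: mult.assoc)
  also have "\<dots> = 2 *\<^sub>R (W4 * (P4 * (Q1 * Q2 * Q3)) * V4)"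
    unfolding w by (simp add: mult.assoc)
  also have "P4 * (Q1 * Q2 * Q3) = Q1 * Q2 * Q3 * P4" by (intro commute_mult c)
  also have "W4 * (Q1 * Q2 * Q3 * P4) * V4 = W4 * (Q1 * Q2 * Q3) * (P4 * V4)" by (simp only: mult.assoc)
  also have "W4 * (Q1 * Q2 * Q3) = Q1 * Q2 * Q3 * W4" by (intro commute_mult c)
  also have "Q1 * Q2 * Q3 * W4 * (P4 * V4) = Q1 * Q2 * Q3 * (W4 * P4 * V4)" by (simp only: mult.assoc)
  also have "\<dots> = 2 *\<^sub>R (Q1 * Q2 * Q3 * Q4)" unfolding w by simp
  finally show ?thesis unfolding defs by simp
qed

definition Um :: op where "Um = (1 / sqrt 2) *\<^sub>R (1 - J * (g 9 * g 10 * g 11 * g 12))"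
definition Ui :: op where "Ui = (1 / sqrt 2) *\<^sub>R (1 + J * (g 9 * g 10 * g 11 * g 12))"

lemma Ui_Um: "Ui * Um = 1" "Um * Ui = 1"
  unfolding Um_def Ui_def by (simp_all add: cl algebra_simps flip: scaleR_add_left)

lemma U_d:
  "Um * g 9 * Ui = J * (g 10 * g 11 * g 12)" "Um * g 10 * Ui = - (J * (g 9 * g 11 * g 12))"
  "Um * g 11 * Ui = J * (g 9 * g 10 * g 12)" "Um * g 12 * Ui = - (J * (g 9 * g 10 * g 11))"
  unfolding Um_def Ui_def by (simp_all add: cl algebra_simps flip: scaleR_add_left)

text \<open>The unnormalized Kraus operator of measuring and braiding with a perfect ancilla. It
  intertwines each data operator with its conjugate under \<open>Um\<close>, which the following
  lemmas check on the generators.\<close>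

definition Ym :: op where "Ym = Wm * Bm * A0"

lemma A0_d: "A0 * g i = g i * A0" if "i \<ge> 9"
proof -
  have "g i * T = T * g i" if "T \<in> {T1 g, T3 g, T5 g, T8 g}" for T
    using that \<open>i \<ge> 9\<close> by (auto simp: T_defs cl anti'[of _ i] anti[of _ i])
  then have "g i * A0 = A0 * g i"
    unfolding stab_def mult_scaleR_left mult_scaleR_right
    by (intro arg_cong[where f = "(*\<^sub>R) (1 / 16)"] commute_mult pj_commute) auto
  then show ?thesis by simp
qed

text \<open>The measurement replaces a data mode by one of \<open>g 1\<close>, \<open>g 3\<close>,
  \<open>g 5\<close>, \<open>g 8\<close>, a stabilizer replaces that by a cubic monomial in the
  other four ancilla modes, and the braids move this onto the other three data modes. The outcome -1
  of the pair (12, 8) supplies the sign needed for all four images to come from one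
  \<open>Um\<close>.\<close>

lemma Y_d:
  assumes "9 \<le> i" "i \<le> 12"
  shows "Ym * g i = Um * g i * Ui * Ym"
proof -
  have a: "g 1 * A0 = - (g 4 * g 6 * g 7 * A0)" "g 3 * A0 = g 2 * g 6 * g 7 * A0" "g 5 * A0 = - (g 2 * g 4 * g 7 * A0)"
    "g 8 * A0 = - (g 2 * g 4 * g 6 * A0)"
  proof -
    have "g 1 * (T1 g * A0) = - (g 4 * g 6 * g 7 * A0)" "g 3 * (T3 g * A0) = g 2 * g 6 * g 7 * A0"
      "g 5 * (T5 g * A0) = - (g 2 * g 4 * g 7 * A0)" "g 8 * (T8 g * A0) = - (g 2 * g 4 * g 6 * A0)"
      by (simp_all add: T_defs cl)
    then show "g 1 * A0 = - (g 4 * g 6 * g 7 * A0)" "g 3 * A0 = g 2 * g 6 * g 7 * A0" "g 5 * A0 = - (g 2 * g 4 * g 7 * A0)"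
    "g 8 * A0 = - (g 2 * g 4 * g 6 * A0)" by (simp_all only: A0_T)
  qed
  have w: "Wm * (g a * x) = - (g b * (Wm * x))" if "Wm * g a = - (g b * Wm)" for a b x
    using that by (metis minus_mult_left mult.assoc)
  note W = w[OF Wm_c(1)] w[OF Wm_c(2)] w[OF Wm_c(3)] w[OF Wm_c(4)]
  have b: "Bm * (g a * (g b * (g c * x))) = g a * (g b * (g c * (Bm * x)))" if "Bm * (g a * g b * g c) = g a * g b * g c * Bm" for a b c x
    using that by (metis mult.assoc)
  note B = b[OF Bm_sq_free(1)] b[OF Bm_sq_free(2)] b[OF Bm_sq_free(3)] b[OF Bm_sq_free(4)]
  have y: "Ym * g i = Wm * (Bm * g i) * A0"
    unfolding Ym_def using A0_d[OF assms(1)] by (simp add: mult.assoc)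
  have wj: "Wm * (J * x) = J * (Wm * x)" for x by (rule J_central')
  consider "i = 9" | "i = 10" | "i = 11" | "i = 12" using assms by linarith
  then show ?thesis
    unfolding y by cases (simp_all only: U_d, simp_all add: Bm_d mult.assoc a B W wj Ym_def del: One_nat_def)
qed

text \<open>For the data modes that are not touched: \<open>Wm\<close>, \<open>Bm\<close>,
  \<open>A0\<close> and \<open>Um\<close> are even in the twelve generators, so they commute with
  anything that anticommutes with each of these.\<close>

lemma Y_other:
  assumes "\<And>i. 1 \<le> i \<Longrightarrow> i \<le> 12 \<Longrightarrow> x * g i = - (g i * x)"
  shows "Ym * x = Um * x * Ui * Ym"
proof -
  have gx: "g i * x = - (x * g i)" "g i * (x * y) = - (x * (g i * y))" if "1 \<le> i" "i \<le> 12" for i y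
  proof -
    show s: "g i * x = - (x * g i)" using assms[OF that] by simp
    show "g i * (x * y) = - (x * (g i * y))" using s by (metis minus_mult_left mult.assoc)
  qed
  have c2: "x * (1 + g i * g j) = (1 + g i * g j) * x" "x * (1 - g i * g j) = (1 - g i * g j) * x"
     "x * (1 + Fg i j) = (1 + Fg i j) * x" "x * (1 - Fg i j) = (1 - Fg i j) * x"
    if "1 \<le> i" "i \<le> 12" "1 \<le> j" "j \<le> 12" for i j
    using that J_central'[of x] by (simp_all add: algebra_simps gx)
  have W: "x * Wm = Wm * x" unfolding Wm_def by (intro commute_mult c2) auto
  have B: "x * Bm = Bm * x" unfolding Bm_def by (intro commute_mult c2) auto
  have T: "x * T1 g = T1 g * x" "x * T3 g = T3 g * x" "x * T5 g = T5 g * x" "x * T8 g = T8 g * x"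
    unfolding T_defs by (simp_all add: mult.assoc gx)
  have A: "x * A0 = A0 * x"
    unfolding stab_def mult_scaleR_left mult_scaleR_right by (intro arg_cong[where f = "(*\<^sub>R) (1 / 16)"] commute_mult pj_commute T)
  have U: "x * Um = Um * x"
    unfolding Um_def using J_central'[of x] by (simp add: algebra_simps gx)
  have "Ym * x = x * Ym" unfolding Ym_def by (metis W B A mult.assoc)
  then show ?thesis using U Ui_Um by (metis mult.assoc mult_1_right)
qed

end

section \<open>Operators supported on finitely many sites\<close>

definition locm :: "nat \<Rightarrow> nat \<Rightarrow> op set" where "locm n k = emb n k ` cm k"

lemma locm_emb: "A \<in> cm k \<Longrightarrow> emb n k A \<in> locm n k"
  by (simp add: locm_def)

lemma locm_add: "X \<in> locm n k \<Longrightarrow> Y \<in> locm n k \<Longrightarrow> X + Y \<in> locm n k"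
  unfolding locm_def by (auto simp: emb_add[symmetric])

lemma locm_mult: "X \<in> locm n k \<Longrightarrow> Y \<in> locm n k \<Longrightarrow> X * Y \<in> locm n k"
  unfolding locm_def by (auto simp: emb_mult[symmetric] intro!: imageI mult_carrier_mat)

lemma locm_sc: "sc a \<in> locm n k"
proof -
  have "emb n k (a \<cdot>\<^sub>m 1\<^sub>m (2 ^ k)) = sc a" by (simp add: emb_smult)
  then show ?thesis unfolding locm_def by (metis imageI one_carrier_mat smult_carrier_mat)
qed

lemma locm_consts: "1 \<in> locm n k" "J \<in> locm n k" "0 \<in> locm n k"
  using locm_sc[of 1 n k] locm_sc[of \<i> n k] locm_sc[of 0 n k] by (simp_all add: J_def)

lemma locm_scaleR: "X \<in> locm n k \<Longrightarrow> r *\<^sub>R X \<in> locm n k"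
  using locm_mult[OF locm_sc[of "complex_of_real r"], of X] by (simp add: sc_scaleR)

lemma locm_minus: "X \<in> locm n k \<Longrightarrow> Y \<in> locm n k \<Longrightarrow> X - Y \<in> locm n k"
  using locm_add[OF _ locm_scaleR[of Y n k "-1"], of X] by simp

abbreviation loc :: "nat \<Rightarrow> op set" where "loc \<equiv> locm 0"

lemma loc_gam: "1 \<le> p \<Longrightarrow> p \<le> 2 * n \<Longrightarrow> gam p \<in> loc n"
  using locm_emb[OF majorana_carrier[of p n], of 0] by (simp add: emb_gam)

lemma loc_sum: "(\<And>x. x \<in> S \<Longrightarrow> f x \<in> loc n) \<Longrightarrow> sum f S \<in> loc n"
  by (induction S rule: infinite_finite_induct) (auto intro: locm_add simp: locm_consts)

lemmas loc_intros = locm_add locm_mult locm_sc locm_consts locm_scaleR locm_minus loc_gam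

lemma loc_site: "X \<in> loc n \<Longrightarrow> k \<ge> n \<Longrightarrow> X * site k M = site k M * X"
  unfolding locm_def using site_emb_commute[of 0 n k] by auto

lemma commute_emb:
  assumes "\<And>k M. k \<ge> m \<Longrightarrow> X * site k M = site k M * X"
  shows "X * emb m n A = emb m n A * X"
proof (induction n arbitrary: A)
  case 0 then show ?case by (simp add: sc_central)
next
  case (Suc n)
  have "X * (emb m n B * site (m + n) M) = emb m n B * site (m + n) M * X" for B M
    by (intro commute_mult Suc assms) simp
  then show ?case by (simp add: emb.simps(2) sum_distrib_left sum_distrib_right)
qed

lemma loc_commute_emb: "X \<in> loc n \<Longrightarrow> X * emb n k A = emb n k A * X"
  by (rule commute_emb) (rule loc_site)

text \<open>A single new Majorana operator does not commute with the old system, since its Z-string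
  runs through it; in a pair the strings cancel.\<close>

lemma loc_commute_pair:
  assumes "X \<in> loc n" "1 \<le> p" "1 \<le> q"
  shows "X * (gam (2 * n + p) * gam (2 * n + q)) = gam (2 * n + p) * gam (2 * n + q) * X"
  using loc_commute_emb[OF assms(1), of "p + q" "majorana (p + q) p * majorana (p + q) q"] assms(2,3)
    emb_pair[of p "p + q" q n] by simp

lemma loc_mono: "X \<in> loc n \<Longrightarrow> n \<le> m \<Longrightarrow> X \<in> loc m"
proof -
  assume X: "X \<in> loc n" "n \<le> m"
  then obtain A where A: "A \<in> cm n" "X = emb 0 n A" by (auto simp: locm_def)
  have c: "A \<otimes>\<^sub>K 1\<^sub>m (2 ^ (m - n)) \<in> cm m"
    using kron_carrier[OF A(1) one_carrier_mat[of "2 ^ (m - n)"]] X(2) by (simp flip: power_add)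
  have "emb 0 (n + (m - n)) (A \<otimes>\<^sub>K 1\<^sub>m (2 ^ (m - n))) = X"
    using A by (subst emb_kron[OF A(1)]) auto
  then show ?thesis using c X(2) by (auto simp: locm_def intro!: image_eqI)
qed

lemma gam_pair_Z: "gam (2 * k + 1) * gam (2 * k + 2) = J * sZ k"
proof -
  have c: "sX k * Zs 0 k = Zs 0 k * sX k" by (rule sites_commute[symmetric]) simp
  have "gam (2 * k + 1) * gam (2 * k + 2) = Zs 0 k * (sX k * Zs 0 k) * sY k"
    by (simp add: gam_def pauli_def mult.assoc)
  also have "\<dots> = (Zs 0 k * Zs 0 k) * (sX k * sY k)" unfolding c by (simp only: mult.assoc)
  finally show ?thesis by (simp add: Zs_sq site_sigma_mult)
qed

text \<open>The Majorana operators generate the full matrix algebra: pairs give the Z's, these give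
  the strings, which can then be stripped off to obtain X and Y, and the Pauli matrices span the
  matrix units.\<close>

lemma loc_induct [consumes 1, case_names add mult sc gam]:
  assumes "X \<in> loc n"
    and "\<And>X Y. P X \<Longrightarrow> P Y \<Longrightarrow> P (X + Y)" "\<And>X Y. P X \<Longrightarrow> P Y \<Longrightarrow> P (X * Y)" "\<And>a. P (sc a)"
    and gam: "\<And>p. 1 \<le> p \<Longrightarrow> p \<le> 2 * n \<Longrightarrow> P (gam p)"
  shows "P X"
proof -
  have J: "P J" using assms(4) by (simp add: J_def)
  have neg: "P (- X)" if "P X" for X
    using assms(3)[OF assms(4)[of "- 1"] that] by (simp add: sc_minus[of 1, simplified])
  have Z: "P (sZ k)" if "k < n" for k
  proof -
    have "sZ k = - (J * (gam (2 * k + 1) * gam (2 * k + 2)))" using gam_pair_Z[of k] by (simp add: J_J')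
    then show ?thesis using that by (auto intro!: neg assms(3) J gam)
  qed
  have Zs: "P (Zs 0 k)" if "k \<le> n" for k
    using that
  proof (induction k)
    case 0 then show ?case using assms(4)[of 1] by simp
  next
    case (Suc k)
    have "Zs 0 (Suc k) = Zs 0 k * sZ k"
      using sites_append[of 0 "replicate k sigma_z" "[sigma_z]"] by (simp add: replicate_append_same)
    then show ?case using Suc by (auto intro!: assms(3) Z simp del: sites.simps replicate_Suc)
  qed
  have XY: "P (sX k)" "P (sY k)" if "k < n" for k
  proof -
    have "sX k = Zs 0 k * gam (2 * k + 1)" "sY k = Zs 0 k * gam (2 * k + 2)"
      by (simp_all add: gam_def pauli_def mult.assoc[symmetric] Zs_sq)
    then show "P (sX k)" "P (sY k)" using that by (auto intro!: assms(3) Zs gam)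
  qed
  have S: "P (site k (E2 b c))" if "k < n" for k b c
  proof -
    define u v w x where "u = (if b = c then 1 / 2 else 0 :: complex)" "v = (if b = c then (if b then - 1 / 2 else 1 / 2) else 0 :: complex)"
      "w = (if b = c then 0 else 1 / 2 :: complex)" "x = (if b = c then 0 else (if b then - \<i> / 2 else \<i> / 2) :: complex)"
    have "E2 b c = u \<cdot>\<^sub>m 1\<^sub>m 2 + v \<cdot>\<^sub>m sigma_z + (w \<cdot>\<^sub>m sigma_x + x \<cdot>\<^sub>m sigma_y)"
      unfolding u_v_w_x_def by (rule eq_mat2I; cases b; cases c; simp add: E2_def sigma_index)
    then have "site k (E2 b c) = sc u * 1 + sc v * sZ k + (sc w * sX k + sc x * sY k)"
      by (simp add: site_add site_smult)
    then show ?thesis using assms(4)[of 1] that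
      by (simp only:) (intro assms(2,3,4) Z XY; simp)
  qed
  have E: "P (emb 0 k A)" if "k \<le> n" for k A
    using that
  proof (induction k arbitrary: A)
    case 0 then show ?case using assms(4) by simp
  next
    case (Suc k)
    then show ?case
      by (auto simp: emb.simps(2) UNIV_bool intro!: assms(2,3) S)
  qed
  show ?thesis using assms(1) E by (auto simp: locm_def)
qed

section \<open>Gate teleportation\<close>

definition fam :: "nat \<Rightarrow> nat list \<Rightarrow> nat \<Rightarrow> op" where
  "fam m ds i = gam (if 9 \<le> i \<and> i \<le> 12 then ds ! (i - 9) else m + i)"

abbreviation gm :: "nat \<Rightarrow> nat \<Rightarrow> op" where "gm m \<equiv> \<lambda>i. gam (m + i)"

lemma clifford_gm: "clifford (gm m)"
  by standard (auto simp: gam_sq intro: gam_anti)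

definition distinct_modes :: "nat \<Rightarrow> nat list \<Rightarrow> bool" where
  "distinct_modes m ds \<longleftrightarrow> length ds = 4 \<and> distinct ds \<and> set ds \<subseteq> {1..m}"

lemma distinct_modes_nth:
  assumes "distinct_modes m ds" "i < 4"
  shows "1 \<le> ds ! i" "ds ! i \<le> m"
proof -
  have "ds ! i \<in> set ds" using assms by (auto simp: distinct_modes_def)
  then have "ds ! i \<in> {1..m}" using assms(1) unfolding distinct_modes_def by blast
  then show "1 \<le> ds ! i" "ds ! i \<le> m" by auto
qed

lemma clifford_fam:
  assumes "distinct_modes m ds"
  shows "clifford (fam m ds)"
proof
  let ?f = "\<lambda>i. if 9 \<le> i \<and> i \<le> 12 then ds ! (i - 9) else m + i"
  have d: "1 \<le> ds ! i" "ds ! i \<le> m" if "i < 4" for i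
    using distinct_modes_nth[OF assms that] by auto
  have f: "1 \<le> ?f i" if "1 \<le> i" for i
  proof (cases "9 \<le> i \<and> i \<le> 12")
    case True
    then have "i - 9 < 4" by arith
    then show ?thesis using True d(1) by simp
  qed (use that in auto)
  fix i j :: nat assume ij: "1 \<le> i"
  show "fam m ds i * fam m ds i = 1" by (simp add: fam_def gam_sq)
  assume "1 \<le> j" "i \<noteq> j"
  moreover have "?f i \<noteq> ?f j"
  proof (cases "9 \<le> i \<and> i \<le> 12"; cases "9 \<le> j \<and> j \<le> 12")
    assume a: "9 \<le> i \<and> i \<le> 12" "9 \<le> j \<and> j \<le> 12"
    then have "i - 9 < 4" "j - 9 < 4" "i - 9 \<noteq> j - 9" using \<open>i \<noteq> j\<close> by arith+
    then have "ds ! (i - 9) \<noteq> ds ! (j - 9)" using assms by (simp add: distinct_modes_def nth_eq_iff_index_eq)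
    then show ?thesis using a by simp
  next
    assume "9 \<le> i \<and> i \<le> 12" "\<not> (9 \<le> j \<and> j \<le> 12)"
    moreover from this have "i - 9 < 4" by arith
    ultimately show ?thesis using d(2)[of "i - 9"] \<open>1 \<le> j\<close> by auto
  next
    assume "\<not> (9 \<le> i \<and> i \<le> 12)" "9 \<le> j \<and> j \<le> 12"
    moreover from this have "j - 9 < 4" by arith
    ultimately show ?thesis using d(2)[of "j - 9"] ij by auto
  qed (use \<open>i \<noteq> j\<close> in auto)
  ultimately show "fam m ds i * fam m ds j = - (fam m ds j * fam m ds i)"
    unfolding fam_def using f[of i] f[of j] ij by (intro gam_anti) auto
qed

definition conj_gam :: "nat \<Rightarrow> nat \<Rightarrow> op \<Rightarrow> op" where "conj_gam p q X = gam p * gam q * X * (gam q * gam p)"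

definition data_faults :: "nat list \<Rightarrow> bool \<Rightarrow> bool \<Rightarrow> bool \<Rightarrow> op \<Rightarrow> op" where
  "data_faults ds a b c X = (if a then conj_gam (ds ! 0) (ds ! 1) else id) ((if b then conj_gam (ds ! 0) (ds ! 2) else id)
     ((if c then conj_gam (ds ! 0) (ds ! 3) else id) X))"

definition gate :: "nat list \<Rightarrow> op \<Rightarrow> op" where
  "gate ds X = (1 / 2) *\<^sub>R ((1 - J * (gam (ds ! 0) * gam (ds ! 1) * gam (ds ! 2) * gam (ds ! 3))) * X *
     (1 + J * (gam (ds ! 0) * gam (ds ! 1) * gam (ds ! 2) * gam (ds ! 3))))"

text \<open>The square of a braid gate is \<open>- gam p * gam q\<close>, so two equal braids apply
  a pair of Majorana operators; this is how faults and stabilizers are applied.\<close>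

definition flipP :: "nat \<Rightarrow> nat \<Rightarrow> protocol \<Rightarrow> protocol" where
  "flipP p q K = Braid p q (Braid p q K)"

lemma run_op_flipP:
  assumes "1 \<le> p" "1 \<le> q" "p \<noteq> q"
  shows "run_op \<rho> (flipP p q K) n X = run_op \<rho> K n (conj_gam p q X)"
proof -
  let ?k = "gam p * gam q"
  have a: "gam q * gam p = - ?k" using assms by (intro gam_anti) auto
  have kk: "?k * ?k = -1"
  proof -
    have "?k * ?k = gam p * (gam q * gam p) * gam q" by (simp only: mult.assoc)
    also have "\<dots> = - (gam p * gam p * (gam q * gam q))" unfolding a by (simp add: mult.assoc)
    finally show ?thesis by (simp add: gam_sq)
  qed
  have "(1 - ?k) * (1 - ?k) = - (2 *\<^sub>R ?k)" "(1 + ?k) * (1 + ?k) = 2 *\<^sub>R ?k"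
    by (simp_all only: left_diff_distrib right_diff_distrib distrib_left distrib_right kk) (simp_all add: scaleR_2)
  then have "(1 - ?k) * ((1 - ?k) * X * (1 + ?k)) * (1 + ?k) = - (4 *\<^sub>R (?k * X * ?k))"
    by (simp only: mult.assoc[symmetric]) (simp add: mult.assoc)
  then show ?thesis by (simp add: flipP_def conj_gam_def a)
qed

definition corrP :: "nat \<Rightarrow> nat \<Rightarrow> nat \<Rightarrow> nat \<Rightarrow> protocol \<Rightarrow> protocol" where
  "corrP p q r s K = flipP r s (flipP p q K)"

text \<open>The stabilizer used as correction anticommutes with the measured observable.\<close>

definition mstep :: "bool \<Rightarrow> nat \<Rightarrow> nat \<Rightarrow> nat \<Rightarrow> nat \<Rightarrow> nat \<Rightarrow> nat \<Rightarrow> protocol \<Rightarrow> protocol" where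
  "mstep good d c p q r s K = (if good then Measure d c K (corrP p q r s K) else Measure d c (corrP p q r s K) K)"

text \<open>On the wrong outcome the correction passes through the projector, flipping its sign, and
  leaves \<open>X\<close> itself fixed. Both branches become equal, and two quarters add up to the
  factor 1/2: no weight is lost.\<close>

lemma run_op_mstep:
  assumes "1 \<le> p" "1 \<le> q" "p \<noteq> q" "1 \<le> r" "1 \<le> s" "r \<noteq> s"
    and X: "conj_gam p q (conj_gam r s X) = X"
    and F: "gam p * gam q * (gam r * gam s) * Fo d c = - (Fo d c * (gam p * gam q * (gam r * gam s)))"
      "gam s * gam r * (gam q * gam p) * Fo d c = - (Fo d c * (gam s * gam r * (gam q * gam p)))"
  shows "run_op \<rho> (mstep good d c p q r s K) n X
    = run_op \<rho> K n ((1 / 2) *\<^sub>R ((if good then 1 + Fo d c else 1 - Fo d c) * X * (if good then 1 + Fo d c else 1 - Fo d c)))"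
proof -
  let ?S = "gam p * gam q * (gam r * gam s)" and ?S' = "gam s * gam r * (gam q * gam p)" and ?F = "Fo d c"
  have c: "conj_gam p q (conj_gam r s Y) = ?S * Y * ?S'" for Y by (simp add: conj_gam_def mult.assoc)
  have f: "?S * (1 - ?F) = (1 + ?F) * ?S" "?S * (1 + ?F) = (1 - ?F) * ?S"
     "(1 - ?F) * ?S' = ?S' * (1 + ?F)" "(1 + ?F) * ?S' = ?S' * (1 - ?F)"
    by (simp_all add: left_diff_distrib right_diff_distrib distrib_left distrib_right F)
  have 1: "conj_gam p q (conj_gam r s ((1 / 4) *\<^sub>R ((1 - ?F) * X * (1 - ?F)))) = (1 / 4) *\<^sub>R ((1 + ?F) * X * (1 + ?F))"
  proof -
    have "?S * ((1 - ?F) * X * (1 - ?F)) * ?S' = (?S * (1 - ?F)) * X * ((1 - ?F) * ?S')" by (simp only: mult.assoc)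
    also have "\<dots> = (1 + ?F) * (?S * X * ?S') * (1 + ?F)" unfolding f by (simp only: mult.assoc)
    finally show ?thesis using X unfolding c by simp
  qed
  have 2: "conj_gam p q (conj_gam r s ((1 / 4) *\<^sub>R ((1 + ?F) * X * (1 + ?F)))) = (1 / 4) *\<^sub>R ((1 - ?F) * X * (1 - ?F))"
  proof -
    have "?S * ((1 + ?F) * X * (1 + ?F)) * ?S' = (?S * (1 + ?F)) * X * ((1 + ?F) * ?S')" by (simp only: mult.assoc)
    also have "\<dots> = (1 - ?F) * (?S * X * ?S') * (1 - ?F)" unfolding f by (simp only: mult.assoc)
    finally show ?thesis using X unfolding c by simp
  qed
  show ?thesis
    using assms(1-6) by (cases good) (simp_all add: mstep_def corrP_def run_op_flipP 1 2 run_op_add[symmetric] flip: scaleR_add_left)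
qed

definition tele :: "nat \<Rightarrow> nat list \<Rightarrow> protocol \<Rightarrow> protocol" where
  "tele n ds K = (let m = 2 * n in
     mstep True (ds ! 0) (m + 1) (m + 1) (m + 4) (m + 6) (m + 7)
    (mstep True (ds ! 1) (m + 3) (m + 2) (m + 3) (m + 6) (m + 7)
    (mstep True (ds ! 2) (m + 5) (m + 2) (m + 4) (m + 5) (m + 7)
    (mstep False (ds ! 3) (m + 8) (m + 2) (m + 4) (m + 6) (m + 8)
    (Braid (ds ! 0) (m + 2) (Braid (ds ! 1) (m + 4) (Braid (ds ! 2) (m + 6) (Braid (ds ! 3) (m + 7)
    (Discard (Discard (Discard (Discard K))))))))))))"

lemma proj_ket_index:
  "i < 2 \<Longrightarrow> j < 2 \<Longrightarrow> proj (ket b) $$ (i, j) = (if i = b \<and> j = b then 1 else 0)"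
  by (auto simp: proj_def ket_def scalar_prod_def)

lemma site_proj_ket: "site k (proj (ket 0)) = (1 / 2) *\<^sub>R (1 + sZ k)" "site k (proj (ket 1)) = (1 / 2) *\<^sub>R (1 - sZ k)"
proof -
  have "proj (ket 0) = complex_of_real (1 / 2) \<cdot>\<^sub>m (1\<^sub>m 2 + sigma_z)"
    "proj (ket 1) = complex_of_real (1 / 2) \<cdot>\<^sub>m (1\<^sub>m 2 + (- 1) \<cdot>\<^sub>m sigma_z)"
    by (rule eq_mat2I; simp add: proj_ket_index sigma_index)+
  then show "site k (proj (ket 0)) = (1 / 2) *\<^sub>R (1 + sZ k)" "site k (proj (ket 1)) = (1 / 2) *\<^sub>R (1 - sZ k)"
    by (simp_all only: site_smult site_add sc_scaleR sigma_carrier one_carrier_mat add_carrier_mat smult_carrier_mat)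
       (simp_all add: sc_minus[of 1, simplified])
qed

lemma ptr_site: "M \<in> carrier_mat 2 2 \<Longrightarrow> ptr k (site k M) = sc (M $$ (0, 0) + M $$ (1, 1))"
  using ptr_emb[of k 0 M] by (simp add: emb_site blk_def sc_add)

lemma ptr_drop_ket:
  assumes "\<And>M. X * site k M = site k M * X" "b < 2"
  shows "ptr k (X * site k (proj (ket b))) = X"
  using assms(2) by (auto simp: ptr_left[OF assms(1)] ptr_site proj_ket_index less_2_cases_iff)

text \<open>The stabilizers reserved for later corrections commute with the earlier measurements,
  hence they still fix the state when they are needed.\<close>

lemma invariant_sandwich:
  fixes S P X :: op
  assumes "S * P = P * S" "S * X * S = X"
  shows "S * (r *\<^sub>R (P * X * P)) * S = r *\<^sub>R (P * X * P)"
proof -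
  have "S * (P * X * P) * S = (S * P) * X * (P * S)" by (simp only: mult.assoc)
  also have "\<dots> = (P * S) * X * (S * P)" by (simp only: assms(1))
  also have "\<dots> = P * (S * X * S) * P" by (simp only: mult.assoc)
  finally show ?thesis using assms(2) by simp
qed

context clifford
begin

lemma T_stab_comm: "T \<in> {T1 g, T3 g, T5 g, T8 g} \<Longrightarrow> T * stab g a b c = stab g a b c * T"
  unfolding stab_def mult_scaleR_left mult_scaleR_right
  using T_comm by (intro arg_cong[where f = "(*\<^sub>R) (1 / 16)"] commute_mult pj_commute) auto

lemma T_conj_stab: "T \<in> {T1 g, T3 g, T5 g, T8 g} \<Longrightarrow> T * stab g a b c * T = stab g a b c"
proof -
  assume T: "T \<in> {T1 g, T3 g, T5 g, T8 g}"
  then have "T * T = 1" using T_sq by auto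
  then show ?thesis unfolding T_stab_comm[OF T] by (simp add: mult.assoc)
qed

abbreviation G1 :: op where "G1 \<equiv> g 1 * g 4 * (g 6 * g 7)"
abbreviation G2 :: op where "G2 \<equiv> g 2 * g 3 * (g 6 * g 7)"
abbreviation G3 :: op where "G3 \<equiv> g 2 * g 4 * (g 5 * g 7)"
abbreviation G4 :: op where "G4 \<equiv> g 2 * g 4 * (g 6 * g 8)"

lemma G_rev: "g 7 * g 6 * (g 4 * g 1) = G1" "g 7 * g 6 * (g 3 * g 2) = G2" "g 7 * g 5 * (g 4 * g 2) = G3" "g 8 * g 6 * (g 4 * g 2) = G4"
  by (simp_all add: cl)

lemma G_conj_stab: "G1 * stab g a b c * G1 = stab g a b c" "G2 * stab g a b c * G2 = stab g a b c"
    "G3 * stab g a b c * G3 = stab g a b c" "G4 * stab g a b c * G4 = stab g a b c"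
  using T_conj_stab[of "T1 g" a b c] T_conj_stab[of "T3 g" a b c] T_conj_stab[of "T5 g" a b c] T_conj_stab[of "T8 g" a b c]
  unfolding T_defs by (simp_all add: mult.assoc del: One_nat_def)

lemma G_F:
  "G1 * Fg 9 1 = - (Fg 9 1 * G1)" "G2 * Fg 9 1 = Fg 9 1 * G2" "G3 * Fg 9 1 = Fg 9 1 * G3" "G4 * Fg 9 1 = Fg 9 1 * G4"
  "G2 * Fg 10 3 = - (Fg 10 3 * G2)" "G3 * Fg 10 3 = Fg 10 3 * G3" "G4 * Fg 10 3 = Fg 10 3 * G4"
  "G3 * Fg 11 5 = - (Fg 11 5 * G3)" "G4 * Fg 11 5 = Fg 11 5 * G4"
  "G4 * Fg 12 8 = - (Fg 12 8 * G4)"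
  by (simp_all add: cl)

lemma stab_faults: "stab g a b c = faults 1 3 5 8 a b c A0"
proof -
  have s: "g 3 * g 1 = - (g 1 * g 3)" "g 5 * g 1 = - (g 1 * g 5)" "g 8 * g 1 = - (g 1 * g 8)" by (rule anti_raw; simp)+
  have q: "g 1 * g i * (g i * g 1) = 1" if "i \<ge> 1" for i using that by (simp add: mult.assoc sq' sq)
  have e: "conj_pair 1 3 (stab g x y z) = stab g (\<not> x) y z" "conj_pair 1 5 (stab g x y z) = stab g x (\<not> y) z" "conj_pair 1 8 (stab g x y z) = stab g x y (\<not> z)" for x y z
    unfolding conj_pair_def stab_err by (simp_all add: mult.assoc sq' sq)
  show ?thesis unfolding faults_def by (cases a; cases b; cases c) (simp_all add: e del: One_nat_def)
qed

lemma faults_mult_right: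
  assumes "\<And>i j. i \<in> {9..12} \<Longrightarrow> j \<in> {9..12} \<Longrightarrow> Y * (g i * g j) = g i * g j * Y"
  shows "faults 9 10 11 12 a b c (X * Y) = faults 9 10 11 12 a b c X * Y"
proof -
  have "conj_pair 9 j (X * Y) = conj_pair 9 j X * Y" if "j \<in> {10..12}" for j X
  proof -
    have "Y * (g j * g 9) = g j * g 9 * Y" using that by (intro assms) auto
    then show ?thesis unfolding conj_pair_def by (simp only: mult.assoc)
  qed
  then show ?thesis by (simp add: faults_def)
qed

lemma faults_mult_left:
  assumes "\<And>i j. i \<in> {1..8} \<Longrightarrow> j \<in> {1..8} \<Longrightarrow> X * (g i * g j) = g i * g j * X"
  shows "faults 1 3 5 8 a b c (X * Y) = X * faults 1 3 5 8 a b c Y"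
proof -
  have "conj_pair 1 j (X * Y) = X * conj_pair 1 j Y" if "j \<in> {3..8}" for j Y
  proof -
    have "X * (g 1 * g j) = g 1 * g j * X" using that by (intro assms) auto
    then show ?thesis unfolding conj_pair_def by (metis mult.assoc)
  qed
  then show ?thesis by (simp add: faults_def del: One_nat_def)
qed

lemma commute_stab:
  assumes "\<And>i j. i \<in> {1..8} \<Longrightarrow> j \<in> {1..8} \<Longrightarrow> X * (g i * g j) = g i * g j * X"
  shows "X * stab g a b c = stab g a b c * X"
proof -
  have q: "X * (g i * g j * g k * g l) = g i * g j * g k * g l * X"
    if "i \<in> {1..8}" "j \<in> {1..8}" "k \<in> {1..8}" "l \<in> {1..8}" for i j k l
    using commute_mult[OF assms[OF that(1,2)] assms[OF that(3,4)]] by (simp only: mult.assoc)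
  have "X * T1 g = T1 g * X" "X * T3 g = T3 g * X" "X * T5 g = T5 g * X" "X * T8 g = T8 g * X"
    unfolding T_defs mult_minus_left mult_minus_right
    using q[of 1 4 6 7] q[of 2 3 6 7] q[of 2 4 5 7] q[of 2 4 6 8] by (simp_all del: One_nat_def)
  then show ?thesis
    unfolding stab_def mult_scaleR_left mult_scaleR_right
    by (intro arg_cong[where f = "(*\<^sub>R) (1 / 16)"] commute_mult pj_commute)
qed

text \<open>The faults pass from the ancilla to \<open>R\<close> through the measurement projector.
  What remains is a perfect ancilla, where \<open>Ym\<close> conjugates by the gate and the rest
  collapses to \<open>Wm * Bm * Wi\<close>.\<close>

lemma teleport_core:
  assumes R: "\<And>i j. i \<in> {1..8} \<Longrightarrow> j \<in> {1..8} \<Longrightarrow> R * (g i * g j) = g i * g j * R"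
    and Y: "Ym * faults 9 10 11 12 a b c R = Um * faults 9 10 11 12 a b c R * Ui * Ym"
  shows "Wm * (Bm * (R * stab g a b c) * Bm) * Wi
    = 16 *\<^sub>R (Um * faults 9 10 11 12 a b c R * Ui * ((1 - Fg 1 2) * (1 - Fg 3 4) * (1 - Fg 5 6) * (1 - Fg 7 8)))"
proof -
  define R' where "R' = faults 9 10 11 12 a b c R"
  have AR: "A0 * (g i * g j) = g i * g j * A0" if "i \<in> {9..12}" "j \<in> {9..12}" for i j
    using A0_d[of i] A0_d[of j] that by (intro commute_mult) auto
  have L: "faults 1 3 5 8 a b c (R * Y) = R * faults 1 3 5 8 a b c Y" for Y
    by (rule faults_mult_left) (rule R)
  have RR: "faults 9 10 11 12 a b c (X * A0) = faults 9 10 11 12 a b c X * A0" for X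
    by (rule faults_mult_right) (rule AR)
  have RA: "R' * A0 = A0 * R'"
  proof -
    have "R * A0 = A0 * R" by (rule commute_stab) (rule R)
    then have "faults 9 10 11 12 a b c (A0 * R) = R' * A0"
      using RR[of R] by (simp add: R'_def)
    moreover have "faults 9 10 11 12 a b c (A0 * R) = A0 * R'"
    proof -
      have "conj_pair 9 j (A0 * X) = A0 * conj_pair 9 j X" if "j \<in> {10..12}" for j X
      proof -
        have "A0 * (g 9 * g j) = g 9 * g j * A0" using that by (intro AR) auto
        then show ?thesis unfolding conj_pair_def by (metis mult.assoc)
      qed
      then show ?thesis by (simp add: faults_def R'_def)
    qed
    ultimately show ?thesis by simp
  qed
  have "Bm * (R * stab g a b c) * Bm = Bm * faults 1 3 5 8 a b c (R * A0) * Bm"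
    unfolding L stab_faults[of a b c, symmetric] ..
  also have "\<dots> = Bm * (R' * A0) * Bm"
    by (simp only: Bm_faults RR R'_def)
  \<comment> \<open>A second copy of the projector \<open>A0\<close> is put to the left of
    \<open>R'\<close>, so that \<open>Wm * Bm * A0\<close> can be read as the intertwiner
    \<open>Ym\<close>.\<close>
  also have "R' * A0 = A0 * R' * A0"
    unfolding RA[symmetric] by (simp only: mult.assoc A0_idem)
  finally have "Wm * (Bm * (R * stab g a b c) * Bm) * Wi = (Ym * R') * A0 * Bm * Wi"
    by (simp only: Ym_def mult.assoc)
  also have "\<dots> = Um * R' * Ui * (Wm * (Bm * (A0 * A0) * Bm) * Wi)"
    using Y by (simp only: R'_def[symmetric]) (simp only: Ym_def mult.assoc)
  also have "\<dots> = Um * R' * Ui * (Wm * Bm * Wi)"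
    by (simp only: A0_idem Bm_A0_Bm)
  finally show ?thesis unfolding W_B_W R'_def by simp
qed

end

text \<open>The signs of the stabilizers on a faulty ancilla cancel in a conjugation, so the
  corrections work for every fault pattern alike, and the faults reappear on the data before the
  gate.\<close>

lemma run_op_tele:
  assumes ds: "distinct_modes (2 * n) ds" and R: "R \<in> loc n"
  shows "run_op \<rho> (tele n ds K) (n + 4) (R * stab (gm (2 * n)) a b c) = run_op \<rho> K n (gate ds (data_faults ds a b c R))"
proof -
  define m where "m = 2 * n"
  define g where "g = fam m ds"
  interpret clifford g unfolding g_def m_def by (rule clifford_fam[OF ds])
  have g: "gam (m + 1) = g 1" "gam (m + 2) = g 2" "gam (m + 3) = g 3" "gam (m + 4) = g 4" "gam (m + 5) = g 5"
    "gam (m + 6) = g 6" "gam (m + 7) = g 7" "gam (m + 8) = g 8"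
    by (simp_all add: g_def fam_def)
  have gd: "gam (ds ! 0) = g 9" "gam (ds ! 1) = g 10" "gam (ds ! 2) = g 11" "gam (ds ! 3) = g 12"
    by (simp_all add: g_def fam_def)
  have d: "1 \<le> ds ! i" "ds ! i \<le> m" if "i < 4" for i
    using distinct_modes_nth[OF ds that] by (auto simp: m_def)
  have Fo: "Fo (ds ! 0) (m + 1) = Fg 9 1" "Fo (ds ! 1) (m + 3) = Fg 10 3" "Fo (ds ! 2) (m + 5) = Fg 11 5" "Fo (ds ! 3) (m + 8) = Fg 12 8"
    by (simp_all only: Fo_def g gd)
  have st: "stab (gm m) a b c = stab g a b c"
    by (simp add: stab_def T_defs T1_def T3_def T5_def T8_def g_def fam_def)
  have Rg: "R * (g i * g j) = g i * g j * R" if "i \<in> {1..8}" "j \<in> {1..8}" for i j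
  proof -
    have "g i = gam (m + i)" "g j = gam (m + j)" using that by (auto simp: g_def fam_def)
    then show ?thesis using loc_commute_pair[OF R, of i j] that by (simp add: m_def)
  qed
  have RG: "R * G1 = G1 * R" "R * G2 = G2 * R" "R * G3 = G3 * R" "R * G4 = G4 * R"
    by (intro commute_mult[of R] Rg; simp)+
  define X0 where "X0 = R * stab g a b c"
  have inv: "S * X0 * S = X0" if "R * S = S * R" "S * stab g a b c * S = stab g a b c" for S
    using that unfolding X0_def by (metis mult.assoc)
  note i0 = inv[OF RG(1) G_conj_stab(1)] inv[OF RG(2) G_conj_stab(2)] inv[OF RG(3) G_conj_stab(3)] inv[OF RG(4) G_conj_stab(4)]
  have PG: "S * F = F * S \<Longrightarrow> S * (1 + F) = (1 + F) * S" for S F :: op by (simp add: algebra_simps)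
  have cjs: "conj_gam (m + 1) (m + 4) (conj_gam (m + 6) (m + 7) Y) = G1 * Y * G1" "conj_gam (m + 2) (m + 3) (conj_gam (m + 6) (m + 7) Y) = G2 * Y * G2"
     "conj_gam (m + 2) (m + 4) (conj_gam (m + 5) (m + 7) Y) = G3 * Y * G3" "conj_gam (m + 2) (m + 4) (conj_gam (m + 6) (m + 8) Y) = G4 * Y * G4" for Y
  proof -
    show "conj_gam (m + 1) (m + 4) (conj_gam (m + 6) (m + 7) Y) = G1 * Y * G1"
    proof -
      have "conj_gam (m + 1) (m + 4) (conj_gam (m + 6) (m + 7) Y) = G1 * Y * (g 7 * g 6 * (g 4 * g 1))"
        unfolding conj_gam_def g by (simp only: mult.assoc)
      then show ?thesis unfolding G_rev .
    qed
    show "conj_gam (m + 2) (m + 3) (conj_gam (m + 6) (m + 7) Y) = G2 * Y * G2"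
    proof -
      have "conj_gam (m + 2) (m + 3) (conj_gam (m + 6) (m + 7) Y) = G2 * Y * (g 7 * g 6 * (g 3 * g 2))"
        unfolding conj_gam_def g by (simp only: mult.assoc)
      then show ?thesis unfolding G_rev .
    qed
    show "conj_gam (m + 2) (m + 4) (conj_gam (m + 5) (m + 7) Y) = G3 * Y * G3"
    proof -
      have "conj_gam (m + 2) (m + 4) (conj_gam (m + 5) (m + 7) Y) = G3 * Y * (g 7 * g 5 * (g 4 * g 2))"
        unfolding conj_gam_def g by (simp only: mult.assoc)
      then show ?thesis unfolding G_rev .
    qed
    show "conj_gam (m + 2) (m + 4) (conj_gam (m + 6) (m + 8) Y) = G4 * Y * G4"
    proof -
      have "conj_gam (m + 2) (m + 4) (conj_gam (m + 6) (m + 8) Y) = G4 * Y * (g 8 * g 6 * (g 4 * g 2))"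
        unfolding conj_gam_def g by (simp only: mult.assoc)
      then show ?thesis unfolding G_rev .
    qed
  qed
  define X1 X2 X3 X4 where "X1 = (1 / 2) *\<^sub>R ((1 + Fg 9 1) * X0 * (1 + Fg 9 1))"
    and "X2 = (1 / 2) *\<^sub>R ((1 + Fg 10 3) * X1 * (1 + Fg 10 3))"
    and "X3 = (1 / 2) *\<^sub>R ((1 + Fg 11 5) * X2 * (1 + Fg 11 5))"
    and "X4 = (1 / 2) *\<^sub>R ((1 - Fg 12 8) * X3 * (1 - Fg 12 8))"
  have i1: "G2 * X1 * G2 = X1" "G3 * X1 * G3 = X1" "G4 * X1 * G4 = X1"
    unfolding X1_def by (intro invariant_sandwich PG G_F i0)+
  have i2: "G3 * X2 * G3 = X2" "G4 * X2 * G4 = X2"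
    unfolding X2_def by (intro invariant_sandwich PG G_F i1)+
  have i3: "G4 * X3 * G4 = X3"
    unfolding X3_def by (intro invariant_sandwich PG G_F i2)+
  define KD where "KD = Discard (Discard (Discard (Discard K)))"
  define KB where "KB = Braid (ds ! 0) (m + 2) (Braid (ds ! 1) (m + 4) (Braid (ds ! 2) (m + 6) (Braid (ds ! 3) (m + 7) KD)))"
  have ms: "run_op \<rho> (mstep True (ds ! 0) (m + 1) (m + 1) (m + 4) (m + 6) (m + 7) K') N X0 = run_op \<rho> K' N X1"
    "run_op \<rho> (mstep True (ds ! 1) (m + 3) (m + 2) (m + 3) (m + 6) (m + 7) K') N X1 = run_op \<rho> K' N X2"
    "run_op \<rho> (mstep True (ds ! 2) (m + 5) (m + 2) (m + 4) (m + 5) (m + 7) K') N X2 = run_op \<rho> K' N X3"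
    "run_op \<rho> (mstep False (ds ! 3) (m + 8) (m + 2) (m + 4) (m + 6) (m + 8) K') N X3 = run_op \<rho> K' N X4" for K' N
  proof -
    note u = cjs i0 i1 i2 i3 Fo g G_rev G_F if_True if_False
    show "run_op \<rho> (mstep True (ds ! 0) (m + 1) (m + 1) (m + 4) (m + 6) (m + 7) K') N X0 = run_op \<rho> K' N X1"
      unfolding X1_def by (subst run_op_mstep; (simp only: u)?; simp?)
    show "run_op \<rho> (mstep True (ds ! 1) (m + 3) (m + 2) (m + 3) (m + 6) (m + 7) K') N X1 = run_op \<rho> K' N X2"
      unfolding X2_def by (subst run_op_mstep; (simp only: u)?; simp?)
    show "run_op \<rho> (mstep True (ds ! 2) (m + 5) (m + 2) (m + 4) (m + 5) (m + 7) K') N X2 = run_op \<rho> K' N X3"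
      unfolding X3_def by (subst run_op_mstep; (simp only: u)?; simp?)
    show "run_op \<rho> (mstep False (ds ! 3) (m + 8) (m + 2) (m + 4) (m + 6) (m + 8) K') N X3 = run_op \<rho> K' N X4"
      unfolding X4_def by (subst run_op_mstep; (simp only: u)?; simp?)
  qed
  have "run_op \<rho> (tele n ds K) (n + 4) (R * stab (gm (2 * n)) a b c) = run_op \<rho> KB (n + 4) X4"
    unfolding tele_def Let_def m_def[symmetric] st X0_def[symmetric] ms KB_def KD_def ..
  also have "X4 = (1 / 16) *\<^sub>R (Bm * X0 * Bm)"
  proof -
    have "X4 = (1 / 16) *\<^sub>R ((1 - Fg 12 8) * ((1 + Fg 11 5) * ((1 + Fg 10 3) * ((1 + Fg 9 1) * X0 * (1 + Fg 9 1)) * (1 + Fg 10 3)) * (1 + Fg 11 5)) * (1 - Fg 12 8))"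
      unfolding X4_def X3_def X2_def X1_def by (simp only: mult_scaleR_left mult_scaleR_right scaleR_scaleR) simp
    also have "\<dots> = (1 / 16) *\<^sub>R (((1 - Fg 12 8) * (1 + Fg 11 5) * (1 + Fg 10 3) * (1 + Fg 9 1)) * X0 * ((1 + Fg 9 1) * (1 + Fg 10 3) * (1 + Fg 11 5) * (1 - Fg 12 8)))"
      by (simp only: mult.assoc)
    finally show ?thesis unfolding Bm_rev Bm_def[symmetric] .
  qed
  also have "run_op \<rho> KB (n + 4) ((1 / 16) *\<^sub>R (Bm * X0 * Bm)) = run_op \<rho> KD (n + 4) ((1 / 256) *\<^sub>R (Wm * (Bm * X0 * Bm) * Wi))"
  proof -
    have "run_op \<rho> KB (n + 4) Z = run_op \<rho> KD (n + 4) ((1 / 16) *\<^sub>R (Wm * Z * Wi))" for Z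
    proof -
      have "run_op \<rho> KB (n + 4) Z = run_op \<rho> KD (n + 4) ((1 / 16) *\<^sub>R ((1 - g 12 * g 7) * ((1 - g 11 * g 6) * ((1 - g 10 * g 4) * ((1 - g 9 * g 2) * Z * (1 + g 9 * g 2)) * (1 + g 10 * g 4)) * (1 + g 11 * g 6)) * (1 + g 12 * g 7)))"
        unfolding KB_def run_op.simps g gd mult_scaleR_left mult_scaleR_right scaleR_scaleR by simp
      then show ?thesis unfolding Wm_def Wi_def by (simp only: mult.assoc)
    qed
    then show ?thesis by simp
  qed
  also have "Wm * (Bm * X0 * Bm) * Wi = 16 *\<^sub>R (Um * faults 9 10 11 12 a b c R * Ui * ((1 - Fg 1 2) * (1 - Fg 3 4) * (1 - Fg 5 6) * (1 - Fg 7 8)))"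
  proof -
    have R': "faults 9 10 11 12 a b c R \<in> loc n"
      unfolding faults_def conj_pair_def gd[symmetric] using R d
      by (auto intro!: locm_mult loc_gam simp: m_def)
    \<comment> \<open>Both sides are compatible with sums and products because
      \<open>Ui * Um = 1\<close>, so the relation extends from the generators to all local
      operators.\<close>
    have "Ym * Z = Um * Z * Ui * Ym" if "Z \<in> loc n" for Z
      using that
    proof (induction rule: loc_induct)
      case (add X Y)
      then show ?case by (simp add: algebra_simps)
    next
      case (mult X Y)
      have "Ym * (X * Y) = Um * X * Ui * (Ym * Y)" using mult(1) by (simp only: mult.assoc[symmetric])
      also have "\<dots> = Um * X * (Ui * Um) * Y * Ui * Ym" unfolding mult(2) by (simp only: mult.assoc)
      finally show ?case by (simp add: Ui_Um mult.assoc)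
    next
      case (sc a)
      have "Um * sc a * Ui * Ym = sc a * (Um * Ui) * Ym" by (simp add: sc_central[of Um] mult.assoc)
      then show ?case by (simp add: Ui_Um sc_central)
    next
      case (gam p)
      show ?case
      proof (cases "p \<in> set ds")
        case True
        then obtain k where "k < 4" "p = ds ! k" using ds by (auto simp: in_set_conv_nth distinct_modes_def)
        then have "gam p = g (k + 9)" "k + 9 \<le> 12" by (auto simp: g_def fam_def)
        then show ?thesis using Y_d[of "k + 9"] by simp
      next
        case False
        show ?thesis
        proof (rule Y_other)
          fix i :: nat assume i: "1 \<le> i" "i \<le> 12"
          show "gam p * g i = - (g i * gam p)"
          proof (cases "i \<le> 8")
            case True
            then show ?thesis using i gam by (auto simp: g_def fam_def m_def intro!: gam_anti)
          next
            case F: False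
            then have "ds ! (i - 9) \<in> set ds" using i ds by (intro nth_mem) (auto simp: distinct_modes_def)
            then show ?thesis using F i gam False d[of "i - 9"] by (auto simp: g_def fam_def intro!: gam_anti)
          qed
        qed
      qed
    qed
    then have "Ym * faults 9 10 11 12 a b c R = Um * faults 9 10 11 12 a b c R * Ui * Ym"
      using R' by blast
    then show ?thesis unfolding X0_def by (intro teleport_core Rg)
  qed
  also have "Um * faults 9 10 11 12 a b c R * Ui = gate ds (data_faults ds a b c R)"
  proof -
    have "faults 9 10 11 12 a b c R = data_faults ds a b c R"
      unfolding faults_def data_faults_def conj_pair_def[abs_def] conj_gam_def[abs_def] gd ..
    then show ?thesis unfolding gate_def gd Um_def Ui_def by (simp add: mult.assoc)
  qed
  finally have 1: "run_op \<rho> (tele n ds K) (n + 4) (R * stab (gm (2 * n)) a b c)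
    = run_op \<rho> KD (n + 4) ((1 / 256) *\<^sub>R (16 *\<^sub>R (gate ds (data_faults ds a b c R) * ((1 - Fg 1 2) * (1 - Fg 3 4) * (1 - Fg 5 6) * (1 - Fg 7 8)))))" .
  define Q where "Q = gate ds (data_faults ds a b c R)"
  have Q: "Q \<in> loc n"
    unfolding Q_def gate_def data_faults_def conj_gam_def[abs_def] using R d by (auto intro!: loc_intros simp: m_def)
  have s: "site (n + k) (proj (ket 1)) = (1 / 2) *\<^sub>R (1 - - (J * gam (m + 2 * k + 1) * gam (m + 2 * k + 2)))" for k
    using gam_pair_Z[of "n + k"] by (simp add: site_proj_ket(2)[simplified] m_def algebra_simps J_J')
  \<comment> \<open>The remaining factor 16 / 256 = 1 / 16 is the normalization of four projectors
    onto \<open>ket 1\<close>, so the discarded pairs take no weight with them.\<close>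
  have s4: "(1 / 256) *\<^sub>R (16 *\<^sub>R (Q * ((1 - Fg 1 2) * (1 - Fg 3 4) * (1 - Fg 5 6) * (1 - Fg 7 8))))
    = Q * site n (proj (ket 1)) * site (n + 1) (proj (ket 1)) * site (n + 2) (proj (ket 1)) * site (n + 3) (proj (ket 1))"
  proof -
    have e: "m + 2 * 0 + 1 = m + 1" "m + 2 * 0 + 2 = m + 2" "m + 2 * 1 + 1 = m + 3" "m + 2 * 1 + 2 = m + 4"
      "m + 2 * 2 + 1 = m + 5" "m + 2 * 2 + 2 = m + 6" "m + 2 * 3 + 1 = m + 7" "m + 2 * 3 + 2 = m + 8" "n + 0 = n" by simp_all
    note s' = s[of 0, unfolded e g] s[of 1, unfolded e g] s[of 2, unfolded e g] s[of 3, unfolded e g]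
    show ?thesis unfolding s' by (simp add: mult.assoc)
  qed
  have c: "Q * site n A * site (n + 1) B * site (n + 2) C * site (n + 3) M = site (n + 3) M * (Q * site n A * site (n + 1) B * site (n + 2) C)"
    "Q * site n A * site (n + 1) B * site (n + 2) M = site (n + 2) M * (Q * site n A * site (n + 1) B)"
    "Q * site n A * site (n + 1) M = site (n + 1) M * (Q * site n A)" "Q * site n M = site n M * Q" for A B C M
  proof -
    have q: "Q * site k M = site k M * Q" if "k \<ge> n" for k M using loc_site[OF Q that] .
    have t: "site k M * site l M' = site l M' * site k M" if "k < l" for k l M M' using that by (intro site_commute) simp
    show "Q * site n A * site (n + 1) B * site (n + 2) C * site (n + 3) M = site (n + 3) M * (Q * site n A * site (n + 1) B * site (n + 2) C)"
      "Q * site n A * site (n + 1) B * site (n + 2) M = site (n + 2) M * (Q * site n A * site (n + 1) B)"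
      "Q * site n A * site (n + 1) M = site (n + 1) M * (Q * site n A)" "Q * site n M = site n M * Q"
      by (intro mult_commute q t; simp)+
  qed
  have n: "n + 4 - 1 = n + 3" "n + 3 - 1 = n + 2" "n + 2 - 1 = n + 1" "n + 1 - 1 = n" by simp_all
  have p: "ptr (n + 3) (Q * site n (proj (ket 1)) * site (n + 1) (proj (ket 1)) * site (n + 2) (proj (ket 1)) * site (n + 3) (proj (ket 1)))
      = Q * site n (proj (ket 1)) * site (n + 1) (proj (ket 1)) * site (n + 2) (proj (ket 1))"
    "ptr (n + 2) (Q * site n (proj (ket 1)) * site (n + 1) (proj (ket 1)) * site (n + 2) (proj (ket 1)))
      = Q * site n (proj (ket 1)) * site (n + 1) (proj (ket 1))"
    "ptr (n + 1) (Q * site n (proj (ket 1)) * site (n + 1) (proj (ket 1))) = Q * site n (proj (ket 1))"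
    "ptr n (Q * site n (proj (ket 1))) = Q"
    by (intro ptr_drop_ket c; simp)+
  show ?thesis
    unfolding 1 Q_def[symmetric] s4 KD_def run_op.simps n p ..
qed

lemma conj_move:
  fixes u v X Y :: op
  assumes "u * X = Y * u" "u * v = 2"
  shows "(1 / 2) *\<^sub>R (u * X * v) = Y"
proof -
  have "u * X * v = Y * 2" unfolding assms(1) by (simp add: mult.assoc assms(2))
  also have "Y * 2 = 2 *\<^sub>R Y" by (simp add: scaleR_2 mult_2_right)
  finally show ?thesis by simp
qed

section \<open>Braids and parity checks on the ancilla\<close>

lemma move_mult: "u * X = X' * u \<Longrightarrow> u * Y = Y' * u \<Longrightarrow> u * (X * Y) = X' * Y' * u" for u :: op
  by (metis mult.assoc)

lemma pj_move: "E * T = T' * E \<Longrightarrow> E * pj b T = pj b T' * E"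
  by (simp add: pj_def algebra_simps)

context clifford
begin

abbreviation bw :: "nat \<Rightarrow> nat \<Rightarrow> op \<Rightarrow> op" where "bw i j X \<equiv> (1 / 2) *\<^sub>R ((1 - g i * g j) * X * (1 + g i * g j))"
abbreviation ub :: "nat \<Rightarrow> nat \<Rightarrow> op \<Rightarrow> op" where "ub i j X \<equiv> (1 / 2) *\<^sub>R ((1 + g i * g j) * X * (1 - g i * g j))"

lemma braid_inverse:
  assumes "1 \<le> i" "1 \<le> j" "i \<noteq> j"
  shows "(1 - g i * g j) * (1 + g i * g j) = 2" "(1 + g i * g j) * (1 - g i * g j) = 2"
proof -
  have "g i * g j * (g i * g j) = - 1"
  proof -
    have "g i * g j * (g i * g j) = - (g j * (g i * (g i * g j)))"
      unfolding anti_raw[OF assms] by (simp add: mult.assoc)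
    then show ?thesis using assms by (simp add: sq sq')
  qed
  then show "(1 - g i * g j) * (1 + g i * g j) = 2" "(1 + g i * g j) * (1 - g i * g j) = 2"
    by (simp_all only: left_diff_distrib right_diff_distrib distrib_left distrib_right) simp_all
qed

text \<open>The braids fix \<open>T1\<close> and \<open>T5\<close> and send \<open>T3\<close> and
  \<open>T8\<close> to \<open>g 1 * g 3 * g 5 * g 7\<close> and
  \<open>- (g 1 * g 4 * g 5 * g 8)\<close>. In \<open>stab_eq_VTHL\<close> these two monomials carry
  the bits \<open>c\<close> and \<open>a\<close>, so the two bits change places. The closing
  simplification expands both projectors into monomials.\<close>

lemma stab_perm_ac: "bw 2 5 (ub 1 6 (stab g a b c)) = stab g c b a"
proof -
  let ?u = "1 + g 1 * g 6" and ?w = "1 - g 2 * g 5"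
  have 1: "?u * T1 g = T1 g * ?u" "?u * T3 g = (- (g 1 * g 2 * g 3 * g 7)) * ?u" "?u * T5 g = T5 g * ?u" "?u * T8 g = (g 1 * g 2 * g 4 * g 8) * ?u"
    by (simp_all add: T_defs cl algebra_simps)
  have 2: "?w * T1 g = T1 g * ?w" "?w * (- (g 1 * g 2 * g 3 * g 7)) = g 1 * g 3 * g 5 * g 7 * ?w"
     "?w * T5 g = T5 g * ?w" "?w * (g 1 * g 2 * g 4 * g 8) = (- (g 1 * g 4 * g 5 * g 8)) * ?w"
    by (simp_all add: T_defs cl algebra_simps)
  let ?Y = "(1 / 16) *\<^sub>R (pj (a \<noteq> (b \<noteq> c)) (T1 g) * pj a (- (g 1 * g 2 * g 3 * g 7)) * pj b (T5 g) * pj c (g 1 * g 2 * g 4 * g 8))"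
  have y: "ub 1 6 (stab g a b c) = ?Y"
    by (rule conj_move) (unfold stab_def mult_scaleR_left mult_scaleR_right, intro arg_cong[where f = "(*\<^sub>R) (1 / 16)"] move_mult pj_move 1, intro braid_inverse, auto)
  have z: "bw 2 5 ?Y = (1 / 16) *\<^sub>R (pj (a \<noteq> (b \<noteq> c)) (T1 g) * pj a (g 1 * g 3 * g 5 * g 7) * pj b (T5 g) * pj c (- (g 1 * g 4 * g 5 * g 8)))"
    by (rule conj_move) (unfold mult_scaleR_left mult_scaleR_right, intro arg_cong[where f = "(*\<^sub>R) (1 / 16)"] move_mult pj_move 2, intro braid_inverse, auto)
  show ?thesis
    unfolding y z unfolding stab_def T_defs
    by (cases a; cases b; cases c; simp add: pj_def cl algebra_simps)
qed

lemma stab_perm_bc: "bw 2 3 (ub 1 4 (stab g a b c)) = stab g a c b"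
proof -
  let ?u = "1 + g 1 * g 4" and ?w = "1 - g 2 * g 3"
  have 1: "?u * T1 g = T1 g * ?u" "?u * T3 g = T3 g * ?u" "?u * T5 g = (g 1 * g 2 * g 5 * g 7) * ?u" "?u * T8 g = (- (g 1 * g 2 * g 6 * g 8)) * ?u"
    by (simp_all add: T_defs cl algebra_simps)
  have 2: "?w * T1 g = T1 g * ?w" "?w * T3 g = T3 g * ?w"
     "?w * (g 1 * g 2 * g 5 * g 7) = g 1 * g 3 * g 5 * g 7 * ?w" "?w * (- (g 1 * g 2 * g 6 * g 8)) = (- (g 1 * g 3 * g 6 * g 8)) * ?w"
    by (simp_all add: T_defs cl algebra_simps)
  let ?Y = "(1 / 16) *\<^sub>R (pj (a \<noteq> (b \<noteq> c)) (T1 g) * pj a (T3 g) * pj b (g 1 * g 2 * g 5 * g 7) * pj c (- (g 1 * g 2 * g 6 * g 8)))"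
  have y: "ub 1 4 (stab g a b c) = ?Y"
    by (rule conj_move) (unfold stab_def mult_scaleR_left mult_scaleR_right, intro arg_cong[where f = "(*\<^sub>R) (1 / 16)"] move_mult pj_move 1, intro braid_inverse, auto)
  have z: "bw 2 3 ?Y = (1 / 16) *\<^sub>R (pj (a \<noteq> (b \<noteq> c)) (T1 g) * pj a (T3 g) * pj b (g 1 * g 3 * g 5 * g 7) * pj c (- (g 1 * g 3 * g 6 * g 8)))"
    by (rule conj_move) (unfold mult_scaleR_left mult_scaleR_right, intro arg_cong[where f = "(*\<^sub>R) (1 / 16)"] move_mult pj_move 2, intro braid_inverse, auto)
  show ?thesis
    unfolding y z unfolding stab_def T_defs
    by (cases a; cases b; cases c; simp add: pj_def cl algebra_simps)
qed

text \<open>\<open>T5\<close> and \<open>T8\<close> stay fixed, while \<open>T3\<close> goes to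
  \<open>- (g 1 * g 2 * g 5 * g 6)\<close>, whose sign is the sum of the first and the third
  bit.\<close>

lemma stab_perm_add: "bw 5 7 (bw 1 3 (stab g a b c)) = stab g (a \<noteq> c) b c"
proof -
  let ?u = "1 - g 1 * g 3" and ?w = "1 - g 5 * g 7"
  have 1: "?u * T1 g = (- (g 3 * g 4 * g 6 * g 7)) * ?u" "?u * T3 g = (- (g 1 * g 2 * g 6 * g 7)) * ?u" "?u * T5 g = T5 g * ?u" "?u * T8 g = T8 g * ?u"
    by (simp_all add: T_defs cl algebra_simps)
  have 2: "?w * (- (g 3 * g 4 * g 6 * g 7)) = (- (g 3 * g 4 * g 5 * g 6)) * ?w" "?w * (- (g 1 * g 2 * g 6 * g 7)) = (- (g 1 * g 2 * g 5 * g 6)) * ?w"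
     "?w * T5 g = T5 g * ?w" "?w * T8 g = T8 g * ?w"
    by (simp_all add: T_defs cl algebra_simps)
  let ?Y = "(1 / 16) *\<^sub>R (pj (a \<noteq> (b \<noteq> c)) (- (g 3 * g 4 * g 6 * g 7)) * pj a (- (g 1 * g 2 * g 6 * g 7)) * pj b (T5 g) * pj c (T8 g))"
  have y: "bw 1 3 (stab g a b c) = ?Y"
    by (rule conj_move) (unfold stab_def mult_scaleR_left mult_scaleR_right, intro arg_cong[where f = "(*\<^sub>R) (1 / 16)"] move_mult pj_move 1, intro braid_inverse, auto)
  have z: "bw 5 7 ?Y = (1 / 16) *\<^sub>R (pj (a \<noteq> (b \<noteq> c)) (- (g 3 * g 4 * g 5 * g 6)) * pj a (- (g 1 * g 2 * g 5 * g 6)) * pj b (T5 g) * pj c (T8 g))"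
    by (rule conj_move) (unfold mult_scaleR_left mult_scaleR_right, intro arg_cong[where f = "(*\<^sub>R) (1 / 16)"] move_mult pj_move 2, intro braid_inverse, auto)
  show ?thesis
    unfolding y z unfolding stab_def T_defs
    by (cases a; cases b; cases c; simp add: pj_def cl algebra_simps)
qed

section \<open>The parity check on an ancilla and a fresh pair\<close>

abbreviation SV :: op where "SV \<equiv> g 1 * g 3 * g 5 * g 7"
abbreviation SH :: op where "SH \<equiv> - (g 1 * g 3 * g 6 * g 8)"
abbreviation SL :: op where "SL \<equiv> - (g 1 * g 4 * g 5 * g 8)"
abbreviation SV9 :: op where "SV9 \<equiv> g 1 * g 3 * g 5 * g 9"

text \<open>The faults of a second ancilla as they appear on the modes 1, 3, 5 of the first ancilla
  and the mode 10 of the fresh pair, which serve as its data.\<close>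

definition erd :: "bool \<Rightarrow> bool \<Rightarrow> bool \<Rightarrow> op \<Rightarrow> op" where
  "erd a b c X = (if a then conj_pair 1 3 else id) ((if b then conj_pair 1 5 else id) ((if c then conj_pair 1 10 else id) X))"

text \<open>The signs of five commuting generators of ancilla and fresh pair are kept as independent
  bits, because the faults of the second ancilla flip them separately.\<close>

definition round_in :: "bool \<Rightarrow> bool \<Rightarrow> bool \<Rightarrow> bool \<Rightarrow> bool \<Rightarrow> op" where
  "round_in x y z v w = (1 / 32) *\<^sub>R (pj x SV * pj y (T8 g) * pj z SH * pj v SL * pj w (Fg 9 10))"

lemma round_in_stab: "stab g a b c * ((1 / 2) *\<^sub>R (1 + Fg 9 10)) = round_in c c b a False"
  unfolding stab_eq_VTHL round_in_def by (simp add: pj_def)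

lemma conj_pair_move:
  assumes "g i * g j * X = Y * (g i * g j)" "1 \<le> i" "1 \<le> j"
  shows "conj_pair i j X = Y"
  unfolding conj_pair_def assms(1) using assms(2,3) by (simp add: mult.assoc sq sq')

lemma conj_pair_round_in:
  "conj_pair 1 3 (round_in x y z v w) = round_in x y z (\<not> v) w"
  "conj_pair 1 5 (round_in x y z v w) = round_in x y (\<not> z) v w"
  "conj_pair 1 10 (round_in x y z v w) = round_in (\<not> x) y (\<not> z) (\<not> v) (\<not> w)"
proof -
  have c: "g 1 * g 3 * SV = SV * (g 1 * g 3)" "g 1 * g 3 * T8 g = T8 g * (g 1 * g 3)" "g 1 * g 3 * SH = SH * (g 1 * g 3)"
    "g 1 * g 3 * SL = - (SL * (g 1 * g 3))" "g 1 * g 3 * Fg 9 10 = Fg 9 10 * (g 1 * g 3)"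
    "g 1 * g 5 * SV = SV * (g 1 * g 5)" "g 1 * g 5 * T8 g = T8 g * (g 1 * g 5)" "g 1 * g 5 * SH = - (SH * (g 1 * g 5))"
    "g 1 * g 5 * SL = SL * (g 1 * g 5)" "g 1 * g 5 * Fg 9 10 = Fg 9 10 * (g 1 * g 5)"
    "g 1 * g 10 * SV = - (SV * (g 1 * g 10))" "g 1 * g 10 * T8 g = T8 g * (g 1 * g 10)" "g 1 * g 10 * SH = - (SH * (g 1 * g 10))"
    "g 1 * g 10 * SL = - (SL * (g 1 * g 10))" "g 1 * g 10 * Fg 9 10 = - (Fg 9 10 * (g 1 * g 10))"
    by (simp_all add: T_defs cl)
  show "conj_pair 1 3 (round_in x y z v w) = round_in x y z (\<not> v) w"
    by (rule conj_pair_move; (unfold round_in_def mult_scaleR_left mult_scaleR_right)?; (intro arg_cong[where f = "(*\<^sub>R) (1 / 32)"] move_mult pj_flip pj_commute c)?; simp)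
  show "conj_pair 1 5 (round_in x y z v w) = round_in x y (\<not> z) v w"
    by (rule conj_pair_move; (unfold round_in_def mult_scaleR_left mult_scaleR_right)?; (intro arg_cong[where f = "(*\<^sub>R) (1 / 32)"] move_mult pj_flip pj_commute c)?; simp)
  show "conj_pair 1 10 (round_in x y z v w) = round_in (\<not> x) y (\<not> z) (\<not> v) (\<not> w)"
    by (rule conj_pair_move; (unfold round_in_def mult_scaleR_left mult_scaleR_right)?; (intro arg_cong[where f = "(*\<^sub>R) (1 / 32)"] move_mult pj_flip pj_commute c)?; simp)
qed

text \<open>The fault \<open>g 1 * g 10\<close> flips, besides the fresh pair, all generators that
  contain mode 1. This causes the shift of the first two bits by the third one.\<close>

lemma erd_round_in:
  "erd a' b' c' (round_in c c b a False) = round_in (c \<noteq> c') c (b \<noteq> (b' \<noteq> c')) (a \<noteq> (a' \<noteq> c')) c'"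
  unfolding erd_def by (cases a'; cases b'; cases c') (simp_all add: conj_pair_round_in del: One_nat_def)

abbreviation P4 :: op where "P4 \<equiv> g 1 * g 3 * g 5 * g 10"

text \<open>\<open>P4\<close> anticommutes with \<open>SV\<close> and with the observable of the
  fresh pair and commutes with the other generators. The gate turns \<open>SV\<close> into an
  observable of the pair (7, 10), so its sign, which is the sum of both third fault bits, becomes
  measurable.\<close>

lemma gate_round_in:
  "(1 / 2) *\<^sub>R ((1 - J * P4) * round_in x y z v w * (1 + J * P4))
    = (1 / 32) *\<^sub>R (pj x (- Fg 7 10) * pj y (T8 g) * pj z SH * pj v SL * pj w SV9)"
proof (rule conj_move)
  have m: "(1 - J * P4) * SV = - Fg 7 10 * (1 - J * P4)" "(1 - J * P4) * T8 g = T8 g * (1 - J * P4)"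
    "(1 - J * P4) * SH = SH * (1 - J * P4)" "(1 - J * P4) * SL = SL * (1 - J * P4)" "(1 - J * P4) * Fg 9 10 = SV9 * (1 - J * P4)"
    by (simp_all add: T_defs cl algebra_simps)
  show "(1 - J * P4) * round_in x y z v w
     = (1 / 32) *\<^sub>R (pj x (- Fg 7 10) * pj y (T8 g) * pj z SH * pj v SL * pj w SV9) * (1 - J * P4)"
    unfolding round_in_def mult_scaleR_left mult_scaleR_right
    by (intro arg_cong[where f = "(*\<^sub>R) (1 / 32)"] move_mult pj_move m)
  show "(1 - J * P4) * (1 + J * P4) = 2"
    by (simp add: cl algebra_simps)
qed

text \<open>The outcome -1 on the pair (7, 10) survives exactly if \<open>c = c'\<close>. Then
  \<open>SV9\<close> carries the sign that \<open>SV\<close> had on the first ancilla, and a single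
  braid restores the original arrangement.\<close>

lemma round_out:
  "ub 7 9 ((1 / 4) *\<^sub>R ((1 - Fg 7 10) * ((1 / 2) *\<^sub>R ((1 - J * P4) * erd a' b' c' (stab g a b c * ((1 / 2) *\<^sub>R (1 + Fg 9 10))) * (1 + J * P4))) * (1 - Fg 7 10)))
   = (if c = c' then stab g (a \<noteq> (a' \<noteq> c)) (b \<noteq> (b' \<noteq> c)) c * ((1 / 2) *\<^sub>R (1 + Fg 9 10)) else 0)"
proof -
  define x z v where "x = (c \<noteq> c')" "z = (b \<noteq> (b' \<noteq> c'))" "v = (a \<noteq> (a' \<noteq> c'))"
  let ?F = "Fg 7 10"
  define W where "W = pj c (T8 g) * pj z SH * pj v SL * pj c' SV9"
  have cF: "?F * T8 g = T8 g * ?F" "?F * SH = SH * ?F" "?F * SL = SL * ?F" "?F * SV9 = SV9 * ?F" "?F * ?F = 1"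
    by (simp_all add: T_defs cl)
  have FW: "?F * W = W * ?F" unfolding W_def by (intro commute_mult pj_commute cF)
  have sqF: "(1 - ?F) * (1 - ?F) = 2 *\<^sub>R (1 - ?F)" "(1 - ?F) * (1 + ?F) = 0"
    by (simp_all only: left_diff_distrib right_diff_distrib distrib_left distrib_right cF) (simp_all add: scaleR_2)
  have "(1 / 2) *\<^sub>R ((1 - J * P4) * erd a' b' c' (stab g a b c * ((1 / 2) *\<^sub>R (1 + Fg 9 10))) * (1 + J * P4))
    = (1 / 32) *\<^sub>R (pj x (- ?F) * W)"
    unfolding round_in_stab erd_round_in gate_round_in x_z_v_def W_def by (simp only: mult.assoc)
  moreover have "(1 - ?F) * (pj x (- ?F) * W) * (1 - ?F) = (if x then 0 else 4 *\<^sub>R ((1 - ?F) * W))"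
  proof (cases x)
    case True
    have "(1 - ?F) * (pj x (- ?F) * W) * (1 - ?F) = ((1 - ?F) * (1 + ?F)) * W * (1 - ?F)"
      using True by (simp add: pj_def mult.assoc)
    then show ?thesis using True unfolding sqF by simp
  next
    case False
    have c: "W * (1 - ?F) = (1 - ?F) * W" using FW by (simp add: algebra_simps)
    have "(1 - ?F) * (pj x (- ?F) * W) * (1 - ?F) = ((1 - ?F) * (1 - ?F)) * (W * (1 - ?F))"
      using False by (simp add: pj_def mult.assoc)
    also have "\<dots> = 2 *\<^sub>R (((1 - ?F) * (1 - ?F)) * W)"
      unfolding c unfolding sqF(1) mult_scaleR_left mult.assoc[of "1 - ?F" "1 - ?F" W, symmetric] ..
    also have "\<dots> = 4 *\<^sub>R ((1 - ?F) * W)"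
      unfolding sqF by simp
    finally show ?thesis using False by simp
  qed
  ultimately have 1: "(1 / 4) *\<^sub>R ((1 - ?F) * ((1 / 2) *\<^sub>R ((1 - J * P4) * erd a' b' c' (stab g a b c * ((1 / 2) *\<^sub>R (1 + Fg 9 10))) * (1 + J * P4))) * (1 - ?F))
     = (if x then 0 else (1 / 32) *\<^sub>R ((1 - ?F) * W))"
    by simp
  show ?thesis
  proof (cases "c = c'")
    case False
    then show ?thesis unfolding 1 by (simp add: x_z_v_def)
  next
    case True
    let ?u = "1 + g 7 * g 9"
    have m: "?u * (1 - ?F) = (1 + Fg 9 10) * ?u" "?u * T8 g = T8 g * ?u" "?u * SH = SH * ?u" "?u * SL = SL * ?u" "?u * SV9 = SV * ?u"
      by (simp_all add: T_defs cl algebra_simps)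
    \<comment> \<open>The inverse braid puts mode 9 into slot 7, so \<open>SV9\<close> becomes
      \<open>SV\<close> again and the pair (9, 10) returns to \<open>ket 0\<close>.\<close>
    have "ub 7 9 ((1 / 32) *\<^sub>R ((1 - ?F) * W)) = (1 / 32) *\<^sub>R ((1 + Fg 9 10) * (pj c (T8 g) * pj z SH * pj v SL * pj c' SV))"
    proof (rule conj_move)
      show "?u * ((1 / 32) *\<^sub>R ((1 - ?F) * W)) = (1 / 32) *\<^sub>R ((1 + Fg 9 10) * (pj c (T8 g) * pj z SH * pj v SL * pj c' SV)) * ?u"
        unfolding mult_scaleR_left mult_scaleR_right W_def
        by (intro arg_cong[where f = "(*\<^sub>R) (1 / 32)"] move_mult pj_move m)
      show "?u * (1 - g 7 * g 9) = 2" by (rule braid_inverse) auto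
    qed
    also have "\<dots> = (1 / 32) *\<^sub>R ((pj c' SV * pj c (T8 g) * pj z SH * pj v SL) * (1 + Fg 9 10))"
    proof -
      have c: "Fg 9 10 * SV = SV * Fg 9 10" "Fg 9 10 * T8 g = T8 g * Fg 9 10" "Fg 9 10 * SH = SH * Fg 9 10" "Fg 9 10 * SL = SL * Fg 9 10"
        "SV * T8 g = T8 g * SV" "SV * SH = SH * SV" "SV * SL = SL * SV"
        by (simp_all add: T_defs cl)
      have k: "pj c' SV * pj d T = pj d T * pj c' SV" if "SV * T = T * SV" for d T
        using that by (intro pj_commute) (simp add: pj_def algebra_simps)
      have "pj c' SV * (pj c (T8 g) * pj z SH * pj v SL) = (pj c (T8 g) * pj z SH * pj v SL) * pj c' SV"
        by (intro commute_mult k c)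
      then have r: "pj c (T8 g) * pj z SH * pj v SL * pj c' SV = pj c' SV * pj c (T8 g) * pj z SH * pj v SL"
        by (simp only: mult.assoc)
      have "Fg 9 10 * (pj c' SV * pj c (T8 g) * pj z SH * pj v SL) = pj c' SV * pj c (T8 g) * pj z SH * pj v SL * Fg 9 10"
        by (intro commute_mult pj_commute c)
      then have "(1 + Fg 9 10) * (pj c' SV * pj c (T8 g) * pj z SH * pj v SL) = pj c' SV * pj c (T8 g) * pj z SH * pj v SL * (1 + Fg 9 10)"
        by (simp only: distrib_left distrib_right mult_1_left mult_1_right)
      then show ?thesis unfolding r by simp
    qed
    finally have "ub 7 9 ((1 / 32) *\<^sub>R ((1 - ?F) * W)) = stab g v z c * ((1 / 2) *\<^sub>R (1 + Fg 9 10))"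
      unfolding stab_eq_VTHL using True by simp
    then show ?thesis unfolding 1 using True by (simp add: x_z_v_def)
  qed
qed

end

section \<open>The ancilla states as density matrices\<close>

definition err :: "bool \<Rightarrow> bool \<Rightarrow> bool \<Rightarrow> complex mat" where
  "err a b c = (if a then majorana 4 1 * majorana 4 3 else 1\<^sub>m 16) * ((if b then majorana 4 1 * majorana 4 5 else 1\<^sub>m 16)
     * (if c then majorana 4 1 * majorana 4 8 else 1\<^sub>m 16))"

definition vec8 :: "bool \<Rightarrow> bool \<Rightarrow> bool \<Rightarrow> complex mat" where "vec8 a b c = err a b c * a8"

definition st8 :: "bool \<Rightarrow> bool \<Rightarrow> bool \<Rightarrow> complex mat" where "st8 a b c = proj (vec8 a b c)"

lemma ket_carrier: "ket b \<in> carrier_mat 2 1" by (simp add: ket_def)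
lemmas ket_carriers [simp] = ket_carrier ket_carrier[simplified]

lemma kets_carrier: "kets bs \<in> carrier_mat (2 ^ length bs) 1"
proof -
  have "tensor (map ket bs) \<in> carrier_mat (2 ^ length (map ket bs)) (1 ^ length (map ket bs))"
    by (rule tensor_carrier) auto
  then show ?thesis by (simp add: kets_def)
qed

lemma a8_carrier: "a8 \<in> carrier_mat 16 1"
  using kets_carrier[of "[0, 0, 0, 0]"] kets_carrier[of "[1, 1, 1, 1]"] by (simp add: a8_def)

lemma ket_adj_ket: "b < 2 \<Longrightarrow> c < 2 \<Longrightarrow> ket b * mat_adjoint (ket c) = E2 (b = 1) (c = 1)"
  by (rule eq_mat2I) (auto simp: ket_def E2_def scalar_prod_def less_2_cases_iff intro!: mult_carrier_mat[of _ 2 1 _ 2] adj_carrier)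

lemma kets_adj_kets:
  assumes "length bs = length cs" "\<And>b. b \<in> set bs \<union> set cs \<Longrightarrow> b < 2"
  shows "kets bs * mat_adjoint (kets cs) = tensor (map2 (\<lambda>b c. E2 (b = 1) (c = 1)) bs cs)"
proof -
  have "kets bs * mat_adjoint (kets cs) = tensor (map2 (*) (map ket bs) (map mat_adjoint (map ket cs)))"
    unfolding kets_def tensor_adj using assms(1) by (intro tensor_mult[of _ _ 2 1 2]) auto
  also have "map2 (*) (map ket bs) (map mat_adjoint (map ket cs)) = map2 (\<lambda>b c. E2 (b = 1) (c = 1)) bs cs"
    using assms by (induction bs cs rule: list_induct2) (auto simp: ket_adj_ket)
  finally show ?thesis .
qed

lemma proj_a8:
  "proj a8 = complex_of_real (1 / 2) \<cdot>\<^sub>m ((tensor (replicate 4 (E2 False False)) + tensor (replicate 4 (E2 False True)))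
     + (tensor (replicate 4 (E2 True False)) + tensor (replicate 4 (E2 True True))))"
proof -
  let ?k0 = "kets [0, 0, 0, 0]" and ?k1 = "kets [1, 1, 1, 1]"
  let ?s = "complex_of_real (1 / sqrt 2)"
  have c: "?k0 \<in> carrier_mat 16 1" "?k1 \<in> carrier_mat 16 1" 
    using kets_carrier[of "[0, 0, 0, 0]"] kets_carrier[of "[1, 1, 1, 1]"] by simp_all
  then have ca: "mat_adjoint ?k0 \<in> carrier_mat 1 16" "mat_adjoint ?k1 \<in> carrier_mat 1 16" by auto
  have e: "tensor (replicate 4 (E2 False False)) = ?k0 * mat_adjoint ?k0" "tensor (replicate 4 (E2 False True)) = ?k0 * mat_adjoint ?k1"
    "tensor (replicate 4 (E2 True False)) = ?k1 * mat_adjoint ?k0" "tensor (replicate 4 (E2 True True)) = ?k1 * mat_adjoint ?k1"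
    by (subst kets_adj_kets; force simp: numeral_eq_Suc)+
  have ss: "?s * ?s = complex_of_real (1 / 2)" by (simp flip: of_real_mult)
  have "proj a8 = ?s \<cdot>\<^sub>m (?k0 + ?k1) * (?s \<cdot>\<^sub>m (mat_adjoint ?k0 + mat_adjoint ?k1))"
    unfolding proj_def a8_def adj_smult using c by (simp add: adj_add[of _ 16 1])
  also have "\<dots> = (?s * ?s) \<cdot>\<^sub>m ((?k0 + ?k1) * (mat_adjoint ?k0 + mat_adjoint ?k1))"
    using mult_smult_assoc_mat[OF add_carrier_mat[OF c(2), of ?k0], of "?s \<cdot>\<^sub>m (mat_adjoint ?k0 + mat_adjoint ?k1)" 16 ?s]
      mult_smult_distrib[OF add_carrier_mat[OF c(2), of ?k0] add_carrier_mat[OF ca(2), of "mat_adjoint ?k0"], of ?s] ca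
    by (simp add: smult_smult_mat)
  also have "(?k0 + ?k1) * (mat_adjoint ?k0 + mat_adjoint ?k1)
     = (?k0 * mat_adjoint ?k0 + ?k0 * mat_adjoint ?k1) + (?k1 * mat_adjoint ?k0 + ?k1 * mat_adjoint ?k1)"
    using c ca add_mult_distrib_mat[OF c, of "mat_adjoint ?k0 + mat_adjoint ?k1" 16]
      mult_add_distrib_mat[OF c(1) ca] mult_add_distrib_mat[OF c(2) ca] add_carrier_mat[OF ca(2), of "mat_adjoint ?k0"]
    by simp
  finally show ?thesis unfolding e ss .
qed

lemma gam_pair_X: "gam (2 * k + 2) * gam (2 * k + 3) = J * (sX k * sX (Suc k))"
proof -
  have r: "Zs 0 (Suc k) = Zs 0 k * sZ k"
    using sites_append[of 0 "replicate k sigma_z" "[sigma_z]"] by (simp add: replicate_append_same)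
  have c: "sY k * Zs 0 k = Zs 0 k * sY k" by (rule sites_commute[symmetric]) simp
  have g: "gam (2 * k + 2) = Zs 0 k * sY k" "gam (2 * k + 3) = Zs 0 (Suc k) * sX (Suc k)"
    by (simp_all add: gam_def pauli_def)
  have "gam (2 * k + 2) * gam (2 * k + 3) = Zs 0 k * (sY k * Zs 0 k) * sZ k * sX (Suc k)"
    unfolding g r by (simp only: mult.assoc)
  also have "\<dots> = (Zs 0 k * Zs 0 k) * (sY k * sZ k) * sX (Suc k)" unfolding c by (simp only: mult.assoc)
  finally show ?thesis by (simp add: Zs_sq site_sigma_mult mult.assoc)
qed

lemma site_E2:
  "site k (E2 False False) = (1 / 2) *\<^sub>R (1 + sZ k)" "site k (E2 True True) = (1 / 2) *\<^sub>R (1 - sZ k)"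
  "site k (E2 False True) = (1 / 2) *\<^sub>R (1 + sZ k) * sX k" "site k (E2 True False) = (1 / 2) *\<^sub>R (1 - sZ k) * sX k"
proof -
  have p: "E2 False False = proj (ket 0)" "E2 True True = proj (ket 1)"
    by (rule eq_mat2I; simp add: proj_ket_index E2_def)+
  show 1: "site k (E2 False False) = (1 / 2) *\<^sub>R (1 + sZ k)" "site k (E2 True True) = (1 / 2) *\<^sub>R (1 - sZ k)"
    by (simp_all only: p site_proj_ket)
  have "E2 False True = E2 False False * sigma_x" "E2 True False = E2 True True * sigma_x"
    by (rule eq_mat2I; simp add: E2_def mult_index2 sigma_index mult_carrier_mat[of _ 2 2 _ 2] del: index_mult_mat(1))+
  then show "site k (E2 False True) = (1 / 2) *\<^sub>R (1 + sZ k) * sX k" "site k (E2 True False) = (1 / 2) *\<^sub>R (1 - sZ k) * sX k"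
    by (simp_all add: site_mult[symmetric] 1)
qed

lemma emb_replicate4:
  "M \<in> carrier_mat 2 2 \<Longrightarrow> emb n 4 (tensor (replicate 4 M)) = site n M * site (n + 1) M * site (n + 2) M * site (n + 3) M"
  using emb_tensor[of "replicate 4 M" n] by (simp add: numeral_eq_Suc mult.assoc)

lemma interleave4:
  fixes p0 p1 p2 p3 x0 x1 x2 x3 :: op
  assumes "x0 * p1 = p1 * x0" "x0 * p2 = p2 * x0" "x0 * p3 = p3 * x0" "x1 * p2 = p2 * x1" "x1 * p3 = p3 * x1" "x2 * p3 = p3 * x2"
  shows "(p0 * x0) * (p1 * x1) * (p2 * x2) * (p3 * x3) = (p0 * p1 * p2 * p3) * (x0 * x1 * x2 * x3)"
proof -
  have a: "x * (p * y) = p * (x * y)" if "x * p = p * x" for x p y :: op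
    using that by (simp only: mult.assoc[symmetric])
  show ?thesis
    by (simp only: mult.assoc a[OF assms(1)] a[OF assms(2)] a[OF assms(3)] a[OF assms(4)] a[OF assms(5)] a[OF assms(6)] assms)
qed

text \<open>All signs +1 or all signs -1 means that neighbouring signs agree: the projectors onto
  the two strings 0000 and 1111 combine into parity projectors of neighbours.\<close>

lemma even_projector_sum:
  fixes z0 z1 z2 z3 :: op
  assumes "z1 * z0 = z0 * z1" "z2 * z0 = z0 * z2" "z3 * z0 = z0 * z3" "z2 * z1 = z1 * z2" "z3 * z1 = z1 * z3" "z3 * z2 = z2 * z3"
    "z0 * z0 = 1" "z1 * z1 = 1" "z2 * z2 = 1" "z3 * z3 = 1"
  shows "(1 + z0) * (1 + z1) * (1 + z2) * (1 + z3) + (1 - z0) * (1 - z1) * (1 - z2) * (1 - z3)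
    = 2 *\<^sub>R ((1 + z0 * z1) * (1 + z1 * z2) * (1 + z2 * z3))"
proof -
  have a: "x * (p * y) = p * (x * y)" if "x * p = p * x" for x p y :: op
    using that by (simp only: mult.assoc[symmetric])
  have b: "x * (x * y) = y" if "x * x = 1" for x y :: op
    using that by (simp only: mult.assoc[symmetric] mult_1_left)
  show ?thesis
    by (simp add: algebra_simps assms a[OF assms(1)] a[OF assms(2)] a[OF assms(3)] a[OF assms(4)] a[OF assms(5)] a[OF assms(6)]
       b[OF assms(7)] b[OF assms(8)] b[OF assms(9)] b[OF assms(10)] scaleR_2)
qed

text \<open>\<open>a8\<close> is a GHZ state, stabilized by the products of Z on neighbouring sites
  and by X on all four; gluing the sites turns these into quartic Majorana monomials.\<close>

lemma emb_proj_a8: "emb n 4 (proj a8) = stab (gm (2 * n)) False False False"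
proof -
  interpret clifford "gm (2 * n)" by (rule clifford_gm)
  let ?z = "\<lambda>k. sZ (n + k)" and ?x = "\<lambda>k. sX (n + k)"
  have zc: "?z i * ?z j = ?z j * ?z i" for i j by (cases "i = j") (auto intro!: site_commute)
  have zx: "?z i * ?x j = ?x j * ?z i" "?x i * ?x j = ?x j * ?x i" if "i \<noteq> j" for i j using that by (auto intro!: site_commute)
  have zz: "?z i * ?z i = 1" for i by (simp add: site_sigma_mult)
  define XX where "XX = ?x 0 * ?x 1 * ?x 2 * ?x 3"
  let ?P = "(1 + ?z 0) * (1 + ?z 1) * (1 + ?z 2) * (1 + ?z 3)" and ?M = "(1 - ?z 0) * (1 - ?z 1) * (1 - ?z 2) * (1 - ?z 3)"
  have car: "tensor (replicate 4 (E2 b c)) \<in> cm 4" for b c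
  proof -
    have "tensor (replicate 4 (E2 b c)) \<in> carrier_mat (2 ^ length (replicate 4 (E2 b c))) (2 ^ length (replicate 4 (E2 b c)))"
      by (rule tensor_carrier) auto
    then show ?thesis by simp
  qed
  have px: "?x i * (1 + ?z j) = (1 + ?z j) * ?x i" "?x i * (1 - ?z j) = (1 - ?z j) * ?x i" if "i \<noteq> j" for i j
    using zx(1)[of j i] that by (simp_all add: algebra_simps)
  have t: "emb n 4 (tensor (replicate 4 (E2 False False))) = (1 / 16) *\<^sub>R ?P"
    "emb n 4 (tensor (replicate 4 (E2 True True))) = (1 / 16) *\<^sub>R ?M"
    "emb n 4 (tensor (replicate 4 (E2 False True))) = (1 / 16) *\<^sub>R (?P * XX)"
    "emb n 4 (tensor (replicate 4 (E2 True False))) = (1 / 16) *\<^sub>R (?M * XX)"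
  proof -
    have i: "((1 + ?z 0) * ?x 0) * ((1 + ?z 1) * ?x 1) * ((1 + ?z 2) * ?x 2) * ((1 + ?z 3) * ?x 3) = ?P * XX"
      "((1 - ?z 0) * ?x 0) * ((1 - ?z 1) * ?x 1) * ((1 - ?z 2) * ?x 2) * ((1 - ?z 3) * ?x 3) = ?M * XX"
      unfolding XX_def by (rule interleave4; rule px; simp)+
    show "emb n 4 (tensor (replicate 4 (E2 False False))) = (1 / 16) *\<^sub>R ?P"
    "emb n 4 (tensor (replicate 4 (E2 True True))) = (1 / 16) *\<^sub>R ?M"
    "emb n 4 (tensor (replicate 4 (E2 False True))) = (1 / 16) *\<^sub>R (?P * XX)"
    "emb n 4 (tensor (replicate 4 (E2 True False))) = (1 / 16) *\<^sub>R (?M * XX)"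
      unfolding i[symmetric] by (simp_all add: emb_replicate4 site_E2)
  qed
  have half: "sc (complex_of_real (1 / 2)) * Y = (1 / 2) *\<^sub>R Y" for Y by (rule sc_scaleR)
  have "emb n 4 (proj a8) = (1 / 32) *\<^sub>R ((?P + ?M) * (1 + XX))"
    unfolding proj_a8 by (simp only: emb_smult emb_add car add_carrier_mat half t) (simp add: algebra_simps)
  also have "?P + ?M = 2 *\<^sub>R ((1 + ?z 0 * ?z 1) * (1 + ?z 1 * ?z 2) * (1 + ?z 2 * ?z 3))"
    by (intro even_projector_sum zc zz)
  finally have e: "emb n 4 (proj a8) = (1 / 16) *\<^sub>R ((1 + ?z 0 * ?z 1) * (1 + ?z 1 * ?z 2) * (1 + ?z 2 * ?z 3) * (1 + XX))"
    by simp
  let ?g = "gm (2 * n)"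
  have gz: "?g 1 * ?g 2 = J * ?z 0" "?g 3 * ?g 4 = J * ?z 1" "?g 5 * ?g 6 = J * ?z 2" "?g 7 * ?g 8 = J * ?z 3"
    using gam_pair_Z[of n] gam_pair_Z[of "n + 1"] gam_pair_Z[of "n + 2"] gam_pair_Z[of "n + 3"] by (simp_all add: eval_nat_numeral)
  have gx: "?g 2 * ?g 3 = J * (?x 0 * ?x 1)" "?g 6 * ?g 7 = J * (?x 2 * ?x 3)"
    using gam_pair_X[of n] gam_pair_X[of "n + 2"] by (simp_all add: eval_nat_numeral)
  have w: "?g a * ?g b * ?g c * ?g d = - (A * B)" if "?g a * ?g b = J * A" "?g c * ?g d = J * B" for a b c d A B
  proof -
    have "?g a * ?g b * ?g c * ?g d = (?g a * ?g b) * (?g c * ?g d)" by (simp only: mult.assoc)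
    also have "\<dots> = J * (A * J) * B" unfolding that by (simp only: mult.assoc)
    also have "A * J = J * A" by (rule J_central)
    finally show ?thesis by (simp add: mult.assoc J_J')
  qed
  have "1 - ?g 1 * ?g 2 * ?g 3 * ?g 4 = 1 + ?z 0 * ?z 1" "1 - ?g 3 * ?g 4 * ?g 5 * ?g 6 = 1 + ?z 1 * ?z 2"
    "1 - ?g 5 * ?g 6 * ?g 7 * ?g 8 = 1 + ?z 2 * ?z 3" "1 - ?g 2 * ?g 3 * ?g 6 * ?g 7 = 1 + XX"
    unfolding XX_def w[OF gz(1,2)] w[OF gz(2,3)] w[OF gz(3,4)] w[OF gx] by (simp_all add: mult.assoc)
  then show ?thesis unfolding e stab_eq_Z by (simp only:)
qed

lemma proj_mult: "K \<in> carrier_mat a b \<Longrightarrow> v \<in> carrier_mat b 1 \<Longrightarrow> proj (K * v) = conj_by K (proj v)"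
proof -
  assume K: "K \<in> carrier_mat a b" and v: "v \<in> carrier_mat b 1"
  have K': "mat_adjoint K \<in> carrier_mat b a" and v': "mat_adjoint v \<in> carrier_mat 1 b" using K v by auto
  have "(K * v) * (mat_adjoint v * mat_adjoint K) = K * (v * (mat_adjoint v * mat_adjoint K))"
    by (rule assoc_mult_mat[OF K v]) (rule mult_carrier_mat[OF v' K'])
  also have "v * (mat_adjoint v * mat_adjoint K) = v * mat_adjoint v * mat_adjoint K"
    by (rule assoc_mult_mat[OF v v' K', symmetric])
  also have "K * (v * mat_adjoint v * mat_adjoint K) = K * (v * mat_adjoint v) * mat_adjoint K"
    by (rule assoc_mult_mat[OF K mult_carrier_mat[OF v v'] K', symmetric])
  finally show ?thesis unfolding proj_def conj_by_def using K v by (simp add: adj_mult[of K a b v 1])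
qed

lemma proj_carrier: "v \<in> carrier_mat a 1 \<Longrightarrow> proj v \<in> carrier_mat a a"
  unfolding proj_def by (rule mult_carrier_mat[of _ a 1]) (auto intro: adj_carrier)

lemma err_factor_carrier:
  assumes "1 \<le> p" "p \<le> 8" "1 \<le> q" "q \<le> 8"
  shows "(if a then majorana 4 p * majorana 4 q else 1\<^sub>m 16) \<in> cm 4"
  using pair_carrier[of p 4 q] assms by auto

lemma vec8_eq:
  "vec8 a b c = (if a then majorana 4 1 * majorana 4 3 else 1\<^sub>m 16) * ((if b then majorana 4 1 * majorana 4 5 else 1\<^sub>m 16)
     * ((if c then majorana 4 1 * majorana 4 8 else 1\<^sub>m 16) * a8))"
proof -
  let ?A = "if a then majorana 4 1 * majorana 4 3 else 1\<^sub>m 16" and ?B = "if b then majorana 4 1 * majorana 4 5 else 1\<^sub>m 16"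
    and ?C = "if c then majorana 4 1 * majorana 4 8 else 1\<^sub>m 16"
  have "?A \<in> carrier_mat 16 16" "?B \<in> carrier_mat 16 16" "?C \<in> carrier_mat 16 16"
    using err_factor_carrier[of 1 3 a] err_factor_carrier[of 1 5 b] err_factor_carrier[of 1 8 c] by simp_all
  then show ?thesis unfolding vec8_def err_def
    using a8_carrier by (simp only: assoc_mult_mat[of _ 16 16 _ 16 _ 1] mult_carrier_mat[of _ 16 16 _ 16])
qed

lemma err_factor_unitary:
  assumes "1 \<le> p" "p \<le> 8" "1 \<le> q" "q \<le> 8" "p \<noteq> q"
  shows "mat_adjoint (if a then majorana 4 p * majorana 4 q else 1\<^sub>m 16) * (if a then majorana 4 p * majorana 4 q else 1\<^sub>m 16) = 1\<^sub>m 16"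
proof (cases a)
  case True
  have c: "majorana 4 q * majorana 4 p \<in> cm 4" "majorana 4 p * majorana 4 q \<in> cm 4"
    using pair_carrier[of q 4 p] pair_carrier[of p 4 q] assms by simp_all
  have "majorana 4 q * majorana 4 p * (majorana 4 p * majorana 4 q) = 1\<^sub>m (2 ^ 4)"
  proof (rule emb_inject[of _ 4 _ 0])
    show "emb 0 4 (majorana 4 q * majorana 4 p * (majorana 4 p * majorana 4 q)) = emb 0 4 (1\<^sub>m (2 ^ 4))"
    proof -
      have "gam q * gam p * (gam p * gam q) = gam q * (gam p * gam p) * gam q" by (simp only: mult.assoc)
      then show ?thesis using assms c emb_pair[of q 4 p 0] emb_pair[of p 4 q 0]
        by (simp add: emb_mult[OF c] gam_sq del: power_numeral)
    qed
  qed (use c in \<open>auto intro: mult_carrier_mat\<close>)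
  then show ?thesis using True assms by (simp add: pair_adj)
qed simp

lemma vec8_carrier: "vec8 a b c \<in> carrier_mat 16 1"
proof -
  have "err a b c \<in> carrier_mat 16 16"
    unfolding err_def using err_factor_carrier[of 1 3 a] err_factor_carrier[of 1 5 b] err_factor_carrier[of 1 8 c]
    by (intro mult_carrier_mat[of _ 16 16]) simp_all
  then show ?thesis unfolding vec8_def by (rule mult_carrier_mat) (rule a8_carrier)
qed

lemma kets_inner:
  assumes "length bs = length cs" "\<And>b. b \<in> set bs \<union> set cs \<Longrightarrow> b < 2"
  shows "mat_adjoint (kets bs) * kets cs = tensor (map2 (\<lambda>b c. if b = c then 1\<^sub>m 1 else 0\<^sub>m 1 1) bs cs)"
proof -
  have i: "mat_adjoint (ket b) * ket c = (if b = c then 1\<^sub>m 1 else 0\<^sub>m 1 1)" if "b < 2" "c < 2" for b c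
    using that by (intro eq_matI) (auto simp: ket_def scalar_prod_def less_2_cases_iff numeral_2_eq_2)
  have "mat_adjoint (kets bs) * kets cs = tensor (map2 (*) (map mat_adjoint (map ket bs)) (map ket cs))"
    unfolding kets_def tensor_adj using assms(1) by (intro tensor_mult[of _ _ 1 2 1]) auto
  also have "map2 (*) (map mat_adjoint (map ket bs)) (map ket cs) = map2 (\<lambda>b c. if b = c then 1\<^sub>m 1 else 0\<^sub>m 1 1) bs cs"
    using assms by (induction bs cs rule: list_induct2) (auto simp: i)
  finally show ?thesis .
qed

lemma a8_norm: "mat_adjoint a8 * a8 = 1\<^sub>m 1"
proof -
  let ?k0 = "kets [0, 0, 0, 0]" and ?k1 = "kets [1, 1, 1, 1]"
  let ?s = "complex_of_real (1 / sqrt 2)"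
  have c: "?k0 \<in> carrier_mat 16 1" "?k1 \<in> carrier_mat 16 1"
    using kets_carrier[of "[0, 0, 0, 0]"] kets_carrier[of "[1, 1, 1, 1]"] by simp_all
  then have ca: "mat_adjoint ?k0 \<in> carrier_mat 1 16" "mat_adjoint ?k1 \<in> carrier_mat 1 16" by auto
  have ss: "?s * ?s = 1 / 2" by (simp flip: of_real_mult)
  have i: "mat_adjoint ?k0 * ?k0 = 1\<^sub>m 1" "mat_adjoint ?k1 * ?k1 = 1\<^sub>m 1" "mat_adjoint ?k0 * ?k1 = 0\<^sub>m 1 1" "mat_adjoint ?k1 * ?k0 = 0\<^sub>m 1 1"
    by (subst kets_inner; auto intro!: eq_matI simp: kron_def)+
  have "mat_adjoint a8 * a8 = ?s \<cdot>\<^sub>m (mat_adjoint ?k0 + mat_adjoint ?k1) * (?s \<cdot>\<^sub>m (?k0 + ?k1))"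
    unfolding a8_def adj_smult using c by (simp add: adj_add[of _ 16 1])
  also have "\<dots> = (?s * ?s) \<cdot>\<^sub>m ((mat_adjoint ?k0 + mat_adjoint ?k1) * (?k0 + ?k1))"
    using mult_smult_assoc_mat[OF add_carrier_mat[OF ca(2), of "mat_adjoint ?k0"], of "?s \<cdot>\<^sub>m (?k0 + ?k1)" 1 ?s]
      mult_smult_distrib[OF add_carrier_mat[OF ca(2), of "mat_adjoint ?k0"] add_carrier_mat[OF c(2), of "?k0"], of ?s] c
    by (simp add: smult_smult_mat)
  also have "(mat_adjoint ?k0 + mat_adjoint ?k1) * (?k0 + ?k1) = (1\<^sub>m 1 + 0\<^sub>m 1 1) + (0\<^sub>m 1 1 + 1\<^sub>m 1)"
    using add_mult_distrib_mat[OF ca, of "?k0 + ?k1" 1]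
      mult_add_distrib_mat[OF ca(1) c] mult_add_distrib_mat[OF ca(2) c] add_carrier_mat[OF c(2), of "?k0"] i
    by simp
  also have "(?s * ?s) \<cdot>\<^sub>m \<dots> = 1\<^sub>m 1"
    unfolding ss by (rule eq_matI) auto
  finally show ?thesis .
qed

lemma norm_unitary:
  fixes K v :: "complex mat"
  assumes "K \<in> carrier_mat n n" "v \<in> carrier_mat n 1" "mat_adjoint K * K = 1\<^sub>m n"
  shows "mat_adjoint (K * v) * (K * v) = mat_adjoint v * v"
proof -
  have K': "mat_adjoint K \<in> carrier_mat n n" and v': "mat_adjoint v \<in> carrier_mat 1 n" using assms by auto
  have "mat_adjoint (K * v) * (K * v) = mat_adjoint v * (mat_adjoint K * (K * v))"
    using assoc_mult_mat[OF v' K' mult_carrier_mat[OF assms(1,2)]] assms by (simp add: adj_mult[of K n n v 1])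
  also have "mat_adjoint K * (K * v) = v"
    using assoc_mult_mat[OF K' assms(1,2)] assms by simp
  finally show ?thesis .
qed

lemma vec8_norm: "mat_adjoint (vec8 a b c) * vec8 a b c = 1\<^sub>m 1"
proof -
  have c: "(if x then majorana 4 p * majorana 4 q else 1\<^sub>m 16) \<in> carrier_mat 16 16"
     if "1 \<le> p" "p \<le> 8" "1 \<le> q" "q \<le> 8" for x p q
    using err_factor_carrier[OF that, of x] by simp
  let ?E = "\<lambda>x q. if x then majorana 4 1 * majorana 4 q else 1\<^sub>m 16"
  have C: "?E c 8 * a8 \<in> carrier_mat 16 1" by (rule mult_carrier_mat[OF c a8_carrier]) auto
  have B: "?E b 5 * (?E c 8 * a8) \<in> carrier_mat 16 1" by (rule mult_carrier_mat[OF c C]) auto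
  have "mat_adjoint (vec8 a b c) * vec8 a b c = mat_adjoint (?E b 5 * (?E c 8 * a8)) * (?E b 5 * (?E c 8 * a8))"
    unfolding vec8_eq by (rule norm_unitary[OF c B err_factor_unitary]) auto
  also have "\<dots> = mat_adjoint (?E c 8 * a8) * (?E c 8 * a8)"
    by (rule norm_unitary[OF c C err_factor_unitary]) auto
  also have "\<dots> = mat_adjoint a8 * a8"
    by (rule norm_unitary[OF c a8_carrier err_factor_unitary]) auto
  finally show ?thesis by (simp add: a8_norm)
qed

lemma st8_carrier: "st8 a b c \<in> cm 4"
  using proj_carrier[OF vec8_carrier] by (simp add: st8_def)

lemma mat_tr_st8: "mat_tr (st8 a b c) = 1"
  unfolding st8_def proj_def
  unfolding mat_tr_comm[OF vec8_carrier adj_carrier[OF vec8_carrier], of a b c a b c] vec8_norm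
  by (simp add: mat_tr_def)

text \<open>Links the algebraic projectors to actual pure states of four pairs; in particular each
  of them has rank one and trace 1.\<close>

lemma emb_st8: "emb n 4 (st8 a b c) = stab (gm (2 * n)) a b c"
proof -
  interpret clifford "gm (2 * n)" by (rule clifford_gm)
  have c: "(if x then majorana 4 p * majorana 4 q else 1\<^sub>m 16) \<in> carrier_mat 16 16"
     if "1 \<le> p" "p \<le> 8" "1 \<le> q" "q \<le> 8" for x p q
    using err_factor_carrier[OF that, of x] by simp
  have e: "emb n 4 (conj_by (if x then majorana 4 1 * majorana 4 q else 1\<^sub>m 16) M) = (if x then conj_pair 1 q else id) (emb n 4 M)"
    if "M \<in> cm 4" "2 \<le> q" "q \<le> 8" for x q M
  proof (cases x)
    case True
    then show ?thesis
      using that pair_carrier[of 1 4 q] emb_pair[of 1 4 q n] emb_pair[of q 4 1 n]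
      by (simp add: emb_conj_by pair_adj conj_pair_def del: power_numeral)
  next
    case False
    then show ?thesis using that emb_conj_by[of "1\<^sub>m 16" 4 M n] emb_one[of n 4] by simp
  qed
  have C: "conj_by (if x then majorana 4 p * majorana 4 q else 1\<^sub>m 16) M \<in> cm 4" if "M \<in> cm 4" "1 \<le> p" "p \<le> 8" "1 \<le> q" "q \<le> 8" for x p q M
    using conj_by_carrier[OF c[OF that(2-5)]] that(1) by simp
  have a: "proj a8 \<in> cm 4" using proj_carrier[OF a8_carrier] by simp
  have "st8 a b c = conj_by (if a then majorana 4 1 * majorana 4 3 else 1\<^sub>m 16) (conj_by (if b then majorana 4 1 * majorana 4 5 else 1\<^sub>m 16)
      (conj_by (if c then majorana 4 1 * majorana 4 8 else 1\<^sub>m 16) (proj a8)))"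
  proof -
    let ?E = "\<lambda>x q. if x then majorana 4 1 * majorana 4 q else 1\<^sub>m 16"
    have Cc: "?E c 8 * a8 \<in> carrier_mat 16 1" by (rule mult_carrier_mat[OF c a8_carrier]) auto
    have B: "?E b 5 * (?E c 8 * a8) \<in> carrier_mat 16 1" by (rule mult_carrier_mat[OF c Cc]) auto
    have "proj (vec8 a b c) = conj_by (?E a 3) (proj (?E b 5 * (?E c 8 * a8)))"
      unfolding vec8_eq by (rule proj_mult[OF c B]) auto
    also have "proj (?E b 5 * (?E c 8 * a8)) = conj_by (?E b 5) (proj (?E c 8 * a8))"
      by (rule proj_mult[OF c Cc]) auto
    also have "proj (?E c 8 * a8) = conj_by (?E c 8) (proj a8)"
      by (rule proj_mult[OF c a8_carrier]) auto
    finally show ?thesis by (simp add: st8_def)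
  qed
  then have "emb n 4 (st8 a b c) = faults 1 3 5 8 a b c (emb n 4 (proj a8))"
    by (simp add: e C a faults_def del: One_nat_def power_numeral)
  then show ?thesis unfolding emb_proj_a8 stab_faults[symmetric] .
qed

section \<open>Preparation procedures\<close>

type_synonym dist = "bool \<Rightarrow> bool \<Rightarrow> bool \<Rightarrow> real"

definition tot :: "dist \<Rightarrow> real" where "tot p = (\<Sum>a\<in>UNIV. \<Sum>b\<in>UNIV. \<Sum>c\<in>UNIV. p a b c)"

definition fault_mixture :: "nat \<Rightarrow> dist \<Rightarrow> op" where
  "fault_mixture n p = (\<Sum>a\<in>UNIV. \<Sum>b\<in>UNIV. \<Sum>c\<in>UNIV. p a b c *\<^sub>R stab (gm (2 * n)) a b c)"

lemma run_op_fault_mixture: "run_op \<rho> K n (X * fault_mixture m p) = (\<Sum>a\<in>UNIV. \<Sum>b\<in>UNIV. \<Sum>c\<in>UNIV. p a b c *\<^sub>R run_op \<rho> K n (X * stab (gm (2 * m)) a b c))"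
  unfolding fault_mixture_def sum_distrib_left run_op_sum mult_scaleR_right run_op_scaleR ..

text \<open>A preparation procedure for the (subnormalized) mixture \<open>p\<close> of error states is a program with a
  continuation for success, which gets the new particles, and one for failure, which does not.\<close>

definition prep :: "complex mat \<Rightarrow> dist \<Rightarrow> bool" where
  "prep \<rho> p \<longleftrightarrow> (\<forall>a b c. 0 \<le> p a b c) \<and> tot p \<le> 1 \<and>
     (\<exists>G. (\<forall>n Ks Kf m. well_formed Ks (n + 4) m \<longrightarrow> well_formed Kf n m \<longrightarrow> well_formed (G n Ks Kf) n m) \<and>
       (\<forall>n Ks Kf X. X \<in> loc n \<longrightarrow>
          run_op \<rho> (G n Ks Kf) n X = run_op \<rho> Ks (n + 4) (X * fault_mixture n p) + (1 - tot p) *\<^sub>R run_op \<rho> Kf n X))"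

lemma prepI:
  assumes "\<And>a b c. 0 \<le> p a b c" "tot p \<le> 1"
    "\<And>n Ks Kf m. well_formed Ks (n + 4) m \<Longrightarrow> well_formed Kf n m \<Longrightarrow> well_formed (G n Ks Kf) n m"
    "\<And>n Ks Kf X. X \<in> loc n \<Longrightarrow> run_op \<rho> (G n Ks Kf) n X = run_op \<rho> Ks (n + 4) (X * fault_mixture n p) + (1 - tot p) *\<^sub>R run_op \<rho> Kf n X"
  shows "prep \<rho> p"
  unfolding prep_def using assms by blast

lemma tot_lin: "tot (\<lambda>a b c. r * p a b c + s * q a b c) = r * tot p + s * tot q"
  by (simp add: tot_def UNIV_bool algebra_simps)

lemma fault_mixture_lin: "fault_mixture n (\<lambda>a b c. r * p a b c + s * q a b c) = r *\<^sub>R fault_mixture n p + s *\<^sub>R fault_mixture n q"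
  by (simp add: fault_mixture_def UNIV_bool algebra_simps)

lemma prep_mix:
  assumes "prep \<rho> p" "prep \<rho> q" "0 \<le> r" "r \<le> 1"
  shows "prep \<rho> (\<lambda>a b c. r * p a b c + (1 - r) * q a b c)"
proof -
  obtain G where G: "\<And>n Ks Kf m. well_formed Ks (n + 4) m \<Longrightarrow> well_formed Kf n m \<Longrightarrow> well_formed (G n Ks Kf) n m"
    "\<And>n Ks Kf X. X \<in> loc n \<Longrightarrow> run_op \<rho> (G n Ks Kf) n X = run_op \<rho> Ks (n + 4) (X * fault_mixture n p) + (1 - tot p) *\<^sub>R run_op \<rho> Kf n X"
    using assms(1) unfolding prep_def by blast
  obtain H where H: "\<And>n Ks Kf m. well_formed Ks (n + 4) m \<Longrightarrow> well_formed Kf n m \<Longrightarrow> well_formed (H n Ks Kf) n m"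
    "\<And>n Ks Kf X. X \<in> loc n \<Longrightarrow> run_op \<rho> (H n Ks Kf) n X = run_op \<rho> Ks (n + 4) (X * fault_mixture n q) + (1 - tot q) *\<^sub>R run_op \<rho> Kf n X"
    using assms(2) unfolding prep_def by blast
  show ?thesis
  proof (rule prepI[where G = "\<lambda>n Ks Kf. Coin r (G n Ks Kf) (H n Ks Kf)"])
    show "0 \<le> r * p a b c + (1 - r) * q a b c" for a b c using assms by (simp add: prep_def)
    show "tot (\<lambda>a b c. r * p a b c + (1 - r) * q a b c) \<le> 1"
      unfolding tot_lin using assms by (intro convex_bound_le) (auto simp: prep_def)
    show "well_formed (Coin r (G n Ks Kf) (H n Ks Kf)) n m" if "well_formed Ks (n + 4) m" "well_formed Kf n m" for n Ks Kf m
      using G(1)[OF that] H(1)[OF that] assms by simp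
    show "run_op \<rho> (Coin r (G n Ks Kf) (H n Ks Kf)) n X = run_op \<rho> Ks (n + 4) (X * fault_mixture n (\<lambda>a b c. r * p a b c + (1 - r) * q a b c))
      + (1 - tot (\<lambda>a b c. r * p a b c + (1 - r) * q a b c)) *\<^sub>R run_op \<rho> Kf n X" if "X \<in> loc n" for n Ks Kf X
    proof -
      have l: "run_op \<rho> Ks (n + 4) (X * (u *\<^sub>R fault_mixture n p + v *\<^sub>R fault_mixture n q)) = u *\<^sub>R run_op \<rho> Ks (n + 4) (X * fault_mixture n p) + v *\<^sub>R run_op \<rho> Ks (n + 4) (X * fault_mixture n q)" for u v
        by (simp add: run_op_add run_op_scaleR distrib_left)
      show ?thesis
        unfolding tot_lin fault_mixture_lin l run_op.simps G(2)[OF that] H(2)[OF that] by (simp add: algebra_simps)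
    qed
  qed
qed

text \<open>The second procedure is run as the failure continuation of the first, so the failure
  weights multiply.\<close>

lemma prep_retry:
  assumes "prep \<rho> p" "prep \<rho> q"
  shows "prep \<rho> (\<lambda>a b c. 1 * p a b c + (1 - tot p) * q a b c)"
proof -
  obtain G where G: "\<And>n Ks Kf m. well_formed Ks (n + 4) m \<Longrightarrow> well_formed Kf n m \<Longrightarrow> well_formed (G n Ks Kf) n m"
    "\<And>n Ks Kf X. X \<in> loc n \<Longrightarrow> run_op \<rho> (G n Ks Kf) n X = run_op \<rho> Ks (n + 4) (X * fault_mixture n p) + (1 - tot p) *\<^sub>R run_op \<rho> Kf n X"
    using assms(1) unfolding prep_def by blast
  obtain H where H: "\<And>n Ks Kf m. well_formed Ks (n + 4) m \<Longrightarrow> well_formed Kf n m \<Longrightarrow> well_formed (H n Ks Kf) n m"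
    "\<And>n Ks Kf X. X \<in> loc n \<Longrightarrow> run_op \<rho> (H n Ks Kf) n X = run_op \<rho> Ks (n + 4) (X * fault_mixture n q) + (1 - tot q) *\<^sub>R run_op \<rho> Kf n X"
    using assms(2) unfolding prep_def by blast
  have t: "tot p \<le> 1" "tot q \<le> 1" using assms by (simp_all add: prep_def)
  show ?thesis
  proof (rule prepI[where G = "\<lambda>n Ks Kf. G n Ks (H n Ks Kf)"])
    show "0 \<le> 1 * p a b c + (1 - tot p) * q a b c" for a b c using assms by (simp add: prep_def)
    have "(1 - tot p) * (1 - tot q) \<ge> 0" using t by simp
    then show "tot (\<lambda>a b c. 1 * p a b c + (1 - tot p) * q a b c) \<le> 1"
      unfolding tot_lin by (simp add: algebra_simps)
    show "well_formed (G n Ks (H n Ks Kf)) n m" if "well_formed Ks (n + 4) m" "well_formed Kf n m" for n Ks Kf m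
      using G(1) H(1) that by blast
    show "run_op \<rho> (G n Ks (H n Ks Kf)) n X = run_op \<rho> Ks (n + 4) (X * fault_mixture n (\<lambda>a b c. 1 * p a b c + (1 - tot p) * q a b c))
      + (1 - tot (\<lambda>a b c. 1 * p a b c + (1 - tot p) * q a b c)) *\<^sub>R run_op \<rho> Kf n X" if "X \<in> loc n" for n Ks Kf X
    proof -
      have l: "run_op \<rho> Ks (n + 4) (X * (u *\<^sub>R fault_mixture n p + v *\<^sub>R fault_mixture n q)) = u *\<^sub>R run_op \<rho> Ks (n + 4) (X * fault_mixture n p) + v *\<^sub>R run_op \<rho> Ks (n + 4) (X * fault_mixture n q)" for u v
        by (simp add: run_op_add run_op_scaleR distrib_left)
      show ?thesis
        unfolding tot_lin fault_mixture_lin l run_op.simps G(2)[OF that] H(2)[OF that] by (simp add: algebra_simps)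
    qed
  qed
qed

section \<open>Relabelling the faults by braids\<close>

definition unbraidP :: "nat \<Rightarrow> nat \<Rightarrow> protocol \<Rightarrow> protocol" where
  "unbraidP p q K = Braid p q (flipP p q K)"

text \<open>The fourth power of a braid gate is -1, so three braids act as the inverse of
  one.\<close>

lemma run_op_unbraidP:
  assumes "1 \<le> p" "1 \<le> q" "p \<noteq> q"
  shows "run_op \<rho> (unbraidP p q K) n X = run_op \<rho> K n ((1 / 2) *\<^sub>R ((1 + gam p * gam q) * X * (1 - gam p * gam q)))"
proof -
  let ?k = "gam p * gam q"
  have a: "gam q * gam p = - ?k" using assms by (intro gam_anti) auto
  have kk: "?k * ?k = -1"
  proof -
    have "?k * ?k = gam p * (gam q * gam p) * gam q" by (simp only: mult.assoc)
    also have "\<dots> = - (gam p * gam p * (gam q * gam q))" unfolding a by (simp add: mult.assoc)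
    finally show ?thesis by (simp add: gam_sq)
  qed
  have "?k * (1 - ?k) = 1 + ?k" "(1 + ?k) * (- ?k) = 1 - ?k"
    by (simp_all add: left_diff_distrib right_diff_distrib distrib_left distrib_right kk)
  then have "?k * ((1 - ?k) * X * (1 + ?k)) * - ?k = (1 + ?k) * X * (1 - ?k)"
    by (metis mult.assoc)
  then show ?thesis
    unfolding unbraidP_def run_op.simps run_op_flipP[OF assms] conj_gam_def a mult_scaleR_right mult_scaleR_left by (simp only:)
qed

lemma flipP_wf: "1 \<le> p \<Longrightarrow> p < q \<Longrightarrow> q \<le> 2 * n \<Longrightarrow> well_formed (flipP p q K) n m = well_formed K n m"
  by (simp add: flipP_def)

lemma unbraidP_wf: "1 \<le> p \<Longrightarrow> p < q \<Longrightarrow> q \<le> 2 * n \<Longrightarrow> well_formed (unbraidP p q K) n m = well_formed K n m"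
  by (simp add: unbraidP_def flipP_wf)

lemma loc_conj:
  fixes X Z k :: op
  assumes "X * k = k * X"
  shows "r *\<^sub>R ((1 + k) * (X * Z) * (1 - k)) = X * (r *\<^sub>R ((1 + k) * Z * (1 - k)))"
    "r *\<^sub>R ((1 - k) * (X * Z) * (1 + k)) = X * (r *\<^sub>R ((1 - k) * Z * (1 + k)))"
proof -
  have "(1 + k) * X = X * (1 + k)" "(1 - k) * X = X * (1 - k)" using assms by (simp_all add: algebra_simps)
  then have "(1 + k) * (X * Z) = X * ((1 + k) * Z)" "(1 - k) * (X * Z) = X * ((1 - k) * Z)"
    by (simp_all only: mult.assoc[symmetric])
  then show "r *\<^sub>R ((1 + k) * (X * Z) * (1 - k)) = X * (r *\<^sub>R ((1 + k) * Z * (1 - k)))"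
    "r *\<^sub>R ((1 - k) * (X * Z) * (1 + k)) = X * (r *\<^sub>R ((1 - k) * Z * (1 + k)))"
    by (simp_all only: mult.assoc mult_scaleR_right)
qed

text \<open>Braids inserted before the success continuation change the fault labels at no cost in
  weight; the sum condition on \<open>q\<close> records the reindexing.\<close>

lemma prep_perm:
  assumes p: "prep \<rho> p"
    and W: "\<And>n K m. well_formed (W n K) (n + 4) m = well_formed K (n + 4) m"
    and R: "\<And>n K X a b c. X \<in> loc n \<Longrightarrow> run_op \<rho> (W n K) (n + 4) (X * stab (gm (2 * n)) a b c) = run_op \<rho> K (n + 4) (X * t n a b c)"
    and q: "\<And>n. (\<Sum>a\<in>UNIV. \<Sum>b\<in>UNIV. \<Sum>c\<in>UNIV. p a b c *\<^sub>R t n a b c) = fault_mixture n q" "tot q = tot p" "\<And>a b c. 0 \<le> q a b c"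
  shows "prep \<rho> q"
proof -
  obtain G where G: "\<And>n Ks Kf m. well_formed Ks (n + 4) m \<Longrightarrow> well_formed Kf n m \<Longrightarrow> well_formed (G n Ks Kf) n m"
    "\<And>n Ks Kf X. X \<in> loc n \<Longrightarrow> run_op \<rho> (G n Ks Kf) n X = run_op \<rho> Ks (n + 4) (X * fault_mixture n p) + (1 - tot p) *\<^sub>R run_op \<rho> Kf n X"
    using p unfolding prep_def by blast
  show ?thesis
  proof (rule prepI[where G = "\<lambda>n Ks Kf. G n (W n Ks) Kf"])
    show "well_formed (G n (W n Ks) Kf) n m" if "well_formed Ks (n + 4) m" "well_formed Kf n m" for n Ks Kf m
      using G(1) that W by blast
    show "run_op \<rho> (G n (W n Ks) Kf) n X = run_op \<rho> Ks (n + 4) (X * fault_mixture n q) + (1 - tot q) *\<^sub>R run_op \<rho> Kf n X" if "X \<in> loc n" for n Ks Kf X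
    proof -
      have "run_op \<rho> (W n Ks) (n + 4) (X * fault_mixture n p) = run_op \<rho> Ks (n + 4) (X * fault_mixture n q)"
        unfolding run_op_fault_mixture R[OF that] q(1)[symmetric] sum_distrib_left run_op_sum mult_scaleR_right run_op_scaleR ..
      then show ?thesis using G(2)[OF that] q(2) by simp
    qed
  qed (use p q in \<open>auto simp: prep_def\<close>)
qed

lemma prep_swap_ac: "prep \<rho> p \<Longrightarrow> prep \<rho> (\<lambda>a b c. p c b a)"
proof (rule prep_perm[where p = p and W = "\<lambda>n K. unbraidP (2 * n + 1) (2 * n + 6) (Braid (2 * n + 2) (2 * n + 5) K)" and t = "\<lambda>n a b c. stab (gm (2 * n)) c b a"])
  fix n K X a b c assume X: "X \<in> loc n"
  interpret clifford "gm (2 * n)" by (rule clifford_gm)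
  show "run_op \<rho> (unbraidP (2 * n + 1) (2 * n + 6) (Braid (2 * n + 2) (2 * n + 5) K)) (n + 4) (X * stab (gm (2 * n)) a b c)
     = run_op \<rho> K (n + 4) (X * stab (gm (2 * n)) c b a)"
  proof -
    have k: "X * (gam (2 * n + 1) * gam (2 * n + 6)) = gam (2 * n + 1) * gam (2 * n + 6) * X"
      "X * (gam (2 * n + 2) * gam (2 * n + 5)) = gam (2 * n + 2) * gam (2 * n + 5) * X"
      by (intro loc_commute_pair[OF X]; simp)+
    show ?thesis
      by (subst run_op_unbraidP; (simp only: run_op.simps loc_conj[OF k(1)] loc_conj[OF k(2)] stab_perm_ac)?; simp?)
  qed
qed (auto simp: unbraidP_wf prep_def tot_def fault_mixture_def UNIV_bool)

lemma prep_swap_bc: "prep \<rho> p \<Longrightarrow> prep \<rho> (\<lambda>a b c. p a c b)"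
proof (rule prep_perm[where p = p and W = "\<lambda>n K. unbraidP (2 * n + 1) (2 * n + 4) (Braid (2 * n + 2) (2 * n + 3) K)" and t = "\<lambda>n a b c. stab (gm (2 * n)) a c b"])
  fix n K X a b c assume X: "X \<in> loc n"
  interpret clifford "gm (2 * n)" by (rule clifford_gm)
  show "run_op \<rho> (unbraidP (2 * n + 1) (2 * n + 4) (Braid (2 * n + 2) (2 * n + 3) K)) (n + 4) (X * stab (gm (2 * n)) a b c)
     = run_op \<rho> K (n + 4) (X * stab (gm (2 * n)) a c b)"
  proof -
    have k: "X * (gam (2 * n + 1) * gam (2 * n + 4)) = gam (2 * n + 1) * gam (2 * n + 4) * X"
      "X * (gam (2 * n + 2) * gam (2 * n + 3)) = gam (2 * n + 2) * gam (2 * n + 3) * X"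
      by (intro loc_commute_pair[OF X]; simp)+
    show ?thesis
      by (subst run_op_unbraidP; (simp only: run_op.simps loc_conj[OF k(1)] loc_conj[OF k(2)] stab_perm_bc)?; simp?)
  qed
qed (auto simp: unbraidP_wf prep_def tot_def fault_mixture_def UNIV_bool)

lemma prep_add_ac: "prep \<rho> p \<Longrightarrow> prep \<rho> (\<lambda>a b c. p (a \<noteq> c) b c)"
proof (rule prep_perm[where p = p and W = "\<lambda>n K. Braid (2 * n + 1) (2 * n + 3) (Braid (2 * n + 5) (2 * n + 7) K)" and t = "\<lambda>n a b c. stab (gm (2 * n)) (a \<noteq> c) b c"])
  fix n K X a b c assume X: "X \<in> loc n"
  interpret clifford "gm (2 * n)" by (rule clifford_gm)
  show "run_op \<rho> (Braid (2 * n + 1) (2 * n + 3) (Braid (2 * n + 5) (2 * n + 7) K)) (n + 4) (X * stab (gm (2 * n)) a b c)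
     = run_op \<rho> K (n + 4) (X * stab (gm (2 * n)) (a \<noteq> c) b c)"
  proof -
    have k: "X * (gam (2 * n + 1) * gam (2 * n + 3)) = gam (2 * n + 1) * gam (2 * n + 3) * X"
      "X * (gam (2 * n + 5) * gam (2 * n + 7)) = gam (2 * n + 5) * gam (2 * n + 7) * X"
      by (intro loc_commute_pair[OF X]; simp)+
    show ?thesis
      by (simp only: run_op.simps loc_conj[OF k(1)] loc_conj[OF k(2)] stab_perm_add)
  qed
qed (auto simp: prep_def tot_def fault_mixture_def UNIV_bool)

definition unif :: "real \<Rightarrow> real \<Rightarrow> dist" where "unif x q a b c = (if a \<or> b \<or> c then q else x)"

text \<open>This permutation of the seven faults has order seven.\<close>

lemma prep_cycle: "prep \<rho> p \<Longrightarrow> prep \<rho> (\<lambda>a b c. p b c (a \<noteq> c))"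
  by (drule prep_swap_ac, drule prep_swap_bc, drule prep_add_ac) simp

text \<open>\<open>(a, b, c)\<close> to \<open>(b, c, a + c)\<close> is the companion map of the
  primitive polynomial x^3 + x^2 + 1 over the field with two elements, so its powers permute the
  seven nonzero patterns transitively. Coins with bias 1/2, 2/3, ..., 6/7 give all seven
  relabellings the same weight.\<close>

lemma prep_unif:
  assumes "prep \<rho> p"
  shows "prep \<rho> (unif (p False False False) ((tot p - p False False False) / 7))"
proof -
  note p1 = prep_cycle[OF assms]
  note p2 = prep_cycle[OF p1]
  note p3 = prep_cycle[OF p2]
  note p4 = prep_cycle[OF p3]
  note p5 = prep_cycle[OF p4]
  note p6 = prep_cycle[OF p5]
  note q1 = prep_mix[OF assms p1, of "1 / 2"]
  note q2 = prep_mix[OF q1 p2, of "2 / 3"]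
  note q3 = prep_mix[OF q2 p3, of "3 / 4"]
  note q4 = prep_mix[OF q3 p4, of "4 / 5"]
  note q5 = prep_mix[OF q4 p5, of "5 / 6"]
  note q6 = prep_mix[OF q5 p6, of "6 / 7"]
  show ?thesis
    by (rule back_subst[where P = "prep \<rho>", OF q6])
       (simp_all add: fun_eq_iff all_bool_eq unif_def tot_def UNIV_bool field_simps)
qed

section \<open>Traces of local operators\<close>

lemma locm_uminus: "X \<in> locm n k \<Longrightarrow> - X \<in> locm n k"
  using locm_scaleR[of X n k "-1"] by simp

lemma locm_pair: "1 \<le> p \<Longrightarrow> p \<le> 2 * k \<Longrightarrow> 1 \<le> q \<Longrightarrow> q \<le> 2 * k \<Longrightarrow> gam (2 * n + p) * gam (2 * n + q) \<in> locm n k"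
  using locm_emb[OF pair_carrier[of p k q], of n] by (simp add: emb_pair)

lemma locm_Suc: "X \<in> locm n k \<Longrightarrow> X \<in> locm n (Suc k)"
proof -
  assume "X \<in> locm n k"
  then obtain A where A: "A \<in> cm k" "X = emb n k A" by (auto simp: locm_def)
  then have "emb n (Suc k) (A \<otimes>\<^sub>K 1\<^sub>m 2) = X" by (simp add: emb_kron_site)
  moreover have "A \<otimes>\<^sub>K 1\<^sub>m 2 \<in> cm (Suc k)" using kron_carrier[OF A(1) one_carrier_mat[of 2]] by (simp add: mult.commute)
  ultimately show ?thesis using locm_emb by metis
qed

lemma locm_stab: "stab (gm (2 * n)) a b c \<in> locm n 4"
  using locm_emb[OF st8_carrier[of a b c], of n] by (simp only: emb_st8)

lemma locm_loc: "Z \<in> locm n k \<Longrightarrow> Z \<in> loc (n + k)"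
proof -
  assume "Z \<in> locm n k"
  then obtain A where A: "A \<in> cm k" "Z = emb n k A" by (auto simp: locm_def)
  have "emb 0 (n + k) (1\<^sub>m (2 ^ n) \<otimes>\<^sub>K A) = Z"
    using A by (subst emb_kron) auto
  moreover have "1\<^sub>m (2 ^ n) \<otimes>\<^sub>K A \<in> cm (n + k)" using kron_carrier[OF one_carrier_mat A(1)] by (simp add: power_add)
  ultimately show ?thesis using locm_emb by metis
qed

lemma ptrs_add: "ptrs n k (X + Y) = ptrs n k X + ptrs n k Y"
  by (induction k arbitrary: X Y) (simp_all add: ptr_add)

lemma ptrs_scaleR: "ptrs n k (r *\<^sub>R X) = r *\<^sub>R ptrs n k X"
  by (induction k arbitrary: X) (simp_all add: ptr_scaleR)

lemma ptrs_locm: "Z \<in> locm n k \<Longrightarrow> X \<in> loc n \<Longrightarrow> ptrs n k (X * Z) = X * ptrs n k Z"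
proof -
  assume "Z \<in> locm n k" "X \<in> loc n"
  then obtain A where A: "A \<in> cm k" "Z = emb n k A" by (auto simp: locm_def)
  show ?thesis
    unfolding A(2) using ptrs_emb[OF _ A(1), of n X] ptrs_emb[OF _ A(1), of n 1] loc_site[OF \<open>X \<in> loc n\<close>] by simp
qed

lemma ptrs_comm: "Z \<in> locm n k \<Longrightarrow> W \<in> locm n k \<Longrightarrow> ptrs n k (Z * W) = ptrs n k (W * Z)"
proof -
  assume "Z \<in> locm n k" "W \<in> locm n k"
  then obtain A B where AB: "A \<in> cm k" "Z = emb n k A" "B \<in> cm k" "W = emb n k B" by (auto simp: locm_def)
  have "ptrs n k (emb n k C) = sc (mat_tr C)" if "C \<in> cm k" for C
    using ptrs_emb[OF _ that, of n 1] by simp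
  then show ?thesis
    using AB mat_tr_comm[OF AB(1,3)] by (simp add: emb_mult[symmetric] mult_carrier_mat[of _ "2^k" "2^k"])
qed

lemma ptrs_conj:
  assumes "u \<in> locm n k" "v \<in> locm n k" "Z \<in> locm n k" "v * u = 1"
  shows "ptrs n k (u * Z * v) = ptrs n k Z"
  using ptrs_comm[OF locm_mult[OF assms(1,3)] assms(2)] assms(4) by (simp add: mult.assoc[symmetric])

lemma ptrs_conj_half:
  assumes "u \<in> locm n k" "v \<in> locm n k" "Z \<in> locm n k" "v * u = 2"
  shows "ptrs n k ((1 / 2) *\<^sub>R (u * Z * v)) = ptrs n k Z"
proof -
  have "ptrs n k (u * Z * v) = ptrs n k (2 *\<^sub>R Z)"
    using ptrs_comm[OF locm_mult[OF assms(1,3)] assms(2)] assms(4) by (simp add: mult.assoc[symmetric] scaleR_2 mult_2)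
  then show ?thesis by (simp add: ptrs_scaleR)
qed

lemma ptrs_stab: "ptrs n 4 (stab (gm (2 * n)) a b c) = 1"
  using ptrs_emb[of n 1, OF _ st8_carrier[of a b c]] by (simp add: emb_st8 mat_tr_st8)

lemma stab_site: "k \<ge> n + 4 \<Longrightarrow> stab (gm (2 * n)) a b c * site k M = site k M * stab (gm (2 * n)) a b c"
  unfolding emb_st8[symmetric] by (rule site_emb_commute) simp

section \<open>The parity round as a preparation procedure\<close>

definition parity_round :: "dist \<Rightarrow> dist \<Rightarrow> dist" where
  "parity_round p q a b c = (\<Sum>x\<in>UNIV. \<Sum>y\<in>UNIV. p x y c * q (a \<noteq> (x \<noteq> c)) (b \<noteq> (y \<noteq> c)) c)"

definition discard5 :: "protocol \<Rightarrow> protocol" where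
  "discard5 K = Discard (Discard (Discard (Discard (Discard K))))"

lemma run_op_discard5: "run_op \<rho> (discard5 K) (n + 5) X = run_op \<rho> K n (ptrs n 5 X)"
  by (simp add: discard5_def eval_nat_numeral)

text \<open>Outcome +1 means that the third bits differ; then the ancilla and the fresh pair, five
  pairs in all, are thrown away. Otherwise only the restored fresh pair is.\<close>

definition checkP :: "nat \<Rightarrow> protocol \<Rightarrow> protocol \<Rightarrow> protocol" where
  "checkP n Ks Kf = Measure (2 * n + 7) (2 * n + 10) (discard5 Kf) (unbraidP (2 * n + 7) (2 * n + 9) (Discard Ks))"

text \<open>The data modes of the noisy gate: particles 1, 3, 5 of the first ancilla and the second
  particle of the fresh pair.\<close>

definition rds :: "nat \<Rightarrow> nat list" where "rds n = [2 * n + 1, 2 * n + 3, 2 * n + 5, 2 * n + 10]"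

lemma site_ket0_F: "site (n + 4) (proj (ket 0)) = (1 / 2) *\<^sub>R (1 + - (J * gam (2 * n + 9) * gam (2 * n + 10)))"
proof -
  have "gam (2 * n + 9) * gam (2 * n + 10) = J * sZ (n + 4)"
    using gam_pair_Z[of "n + 4"] by (simp add: algebra_simps)
  then show ?thesis by (simp add: site_proj_ket mult.assoc J_J')
qed

text \<open>The accepted branch is \<open>round_out\<close>. In the rejected branch everything new
  is discarded, so only its weight has to be found.\<close>

lemma run_op_checkP:
  assumes X: "X \<in> loc n"
  shows "run_op \<rho> (checkP n Ks Kf) (n + 5) (gate (rds n) (data_faults (rds n) a' b' c' (X * (stab (gm (2 * n)) a b c * site (n + 4) (proj (ket 0))))))
    = (if c = c' then run_op \<rho> Ks (n + 4) (X * stab (gm (2 * n)) (a \<noteq> (a' \<noteq> c)) (b \<noteq> (b' \<noteq> c)) c) else run_op \<rho> Kf n X)"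
proof -
  define g where "g = gm (2 * n)"
  interpret clifford g unfolding g_def by (rule clifford_gm)
  have g: "gam (2 * n + i) = g i" for i by (simp add: g_def)
  have Xg: "X * (g i * g j) = g i * g j * X" if "1 \<le> i" "1 \<le> j" for i j
    unfolding g_def by (rule loc_commute_pair[OF X that])
  have pl: "g i * g j \<in> locm n 5" if "1 \<le> i" "i \<le> 10" "1 \<le> j" "j \<le> 10" for i j
    unfolding g_def using that by (intro locm_pair) auto
  define S where "S = stab g a b c * site (n + 4) (proj (ket 0))"
  have S: "S = stab g a b c * ((1 / 2) *\<^sub>R (1 + Fg 9 10))"
    unfolding S_def site_ket0_F g ..
  have Sl: "S \<in> locm n 5"
    unfolding S using pl[of 9 10] locm_Suc[OF locm_stab[of n a b c]]
    by (auto intro!: locm_mult locm_scaleR locm_add locm_minus locm_consts locm_uminus simp: g_def mult.assoc)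
  have cjX: "conj_pair 1 j (X * Z) = X * conj_pair 1 j Z" if "1 \<le> j" for j Z
  proof -
    have "conj_pair 1 j (X * Z) = (g 1 * g j * X) * Z * (g j * g 1)" unfolding conj_pair_def by (simp only: mult.assoc)
    also have "\<dots> = (X * (g 1 * g j)) * Z * (g j * g 1)" using Xg[of 1 j] that by simp
    finally show ?thesis unfolding conj_pair_def by (simp only: mult.assoc)
  qed
  have data_faults: "data_faults (rds n) a' b' c' Z = erd a' b' c' Z" for Z
    unfolding data_faults_def erd_def conj_gam_def[abs_def] conj_pair_def[abs_def] rds_def by (simp add: g del: One_nat_def)
  have erX: "erd a' b' c' (X * Z) = X * erd a' b' c' Z" for Z
    unfolding erd_def by (simp add: cjX del: One_nat_def)
  have gt: "gate (rds n) Z = (1 / 2) *\<^sub>R ((1 - J * P4) * Z * (1 + J * P4))" for Z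
    unfolding gate_def rds_def by (simp add: g del: One_nat_def)
  have XP: "X * (J * P4) = J * P4 * X"
    using commute_mult[OF J_central commute_mult[OF Xg[of 1 3] Xg[of 5 10]]] by (simp add: mult.assoc del: One_nat_def)
  define Z where "Z = (1 / 2) *\<^sub>R ((1 - J * P4) * erd a' b' c' S * (1 + J * P4))"
  have in_eq: "gate (rds n) (data_faults (rds n) a' b' c' (X * (stab (gm (2 * n)) a b c * site (n + 4) (proj (ket 0))))) = X * Z"
    unfolding g_def[symmetric] S_def[symmetric] data_faults erX gt loc_conj(2)[OF XP] Z_def ..
  let ?F = "Fg 7 10"
  have XF: "X * ?F = ?F * X"
    using commute_mult[OF J_central Xg[of 7 10]] by (simp add: mult.assoc)
  have F2: "Fo (2 * n + 7) (2 * n + 10) = ?F" by (simp add: Fo_def g)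
  have sand: "(1 / 4) *\<^sub>R ((1 + ?F) * (X * Z) * (1 + ?F)) = X * ((1 / 4) *\<^sub>R ((1 + ?F) * Z * (1 + ?F)))"
    "(1 / 4) *\<^sub>R ((1 - ?F) * (X * Z) * (1 - ?F)) = X * ((1 / 4) *\<^sub>R ((1 - ?F) * Z * (1 - ?F)))"
  proof -
    have "(1 + ?F) * X = X * (1 + ?F)" "(1 - ?F) * X = X * (1 - ?F)" using XF by (simp_all only: distrib_left distrib_right left_diff_distrib right_diff_distrib mult_1_left mult_1_right)
    then have "(1 + ?F) * (X * Z) = X * ((1 + ?F) * Z)" "(1 - ?F) * (X * Z) = X * ((1 - ?F) * Z)"
      by (simp_all only: mult.assoc[symmetric])
    then show "(1 / 4) *\<^sub>R ((1 + ?F) * (X * Z) * (1 + ?F)) = X * ((1 / 4) *\<^sub>R ((1 + ?F) * Z * (1 + ?F)))"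
     "(1 / 4) *\<^sub>R ((1 - ?F) * (X * Z) * (1 - ?F)) = X * ((1 / 4) *\<^sub>R ((1 - ?F) * Z * (1 - ?F)))"
      by (simp_all only: mult.assoc mult_scaleR_right)
  qed
  define Zp Zm where "Zp = (1 / 4) *\<^sub>R ((1 + ?F) * Z * (1 + ?F))" and "Zm = (1 / 4) *\<^sub>R ((1 - ?F) * Z * (1 - ?F))"
  let ?s = "stab g (a \<noteq> (a' \<noteq> c)) (b \<noteq> (b' \<noteq> c)) c"
  have out: "ub 7 9 Zm = (if c = c' then ?s * site (n + 4) (proj (ket 0)) else 0)"
    unfolding Zm_def Z_def S round_out site_ket0_F g ..
  \<comment> \<open>The branch weights follow from the invariance of the trace.\<close>
  have Pl: "J * P4 \<in> locm n 5"
    using locm_mult[OF pl[of 1 3] pl[of 5 10]] by (auto intro!: locm_mult locm_consts simp: mult.assoc)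
  have El: "erd a' b' c' S \<in> locm n 5" and Et: "ptrs n 5 (erd a' b' c' S) = ptrs n 5 S"
  proof -
    have l: "conj_pair 1 j W \<in> locm n 5" if "W \<in> locm n 5" "1 \<le> j" "j \<le> 10" for j W
      unfolding conj_pair_def using that by (intro locm_mult pl) auto
    have t: "ptrs n 5 (conj_pair 1 j W) = ptrs n 5 W" if "W \<in> locm n 5" "1 \<le> j" "j \<le> 10" for j W
      unfolding conj_pair_def using that by (intro ptrs_conj pl) (auto simp: mult.assoc sq sq')
    show "erd a' b' c' S \<in> locm n 5" "ptrs n 5 (erd a' b' c' S) = ptrs n 5 S"
      unfolding erd_def using Sl by (simp_all add: l t del: One_nat_def)
  qed
  have Zl: "Z \<in> locm n 5" and Zt: "ptrs n 5 Z = ptrs n 5 S"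
  proof -
    show "Z \<in> locm n 5" unfolding Z_def by (intro locm_scaleR locm_mult locm_minus locm_add locm_consts Pl El)
    have "(1 + J * P4) * (1 - J * P4) = 2" by (simp add: cl algebra_simps)
    then show "ptrs n 5 Z = ptrs n 5 S"
      unfolding Z_def Et[symmetric] by (intro ptrs_conj_half locm_minus locm_add locm_consts Pl El)
  qed
  have Fl: "?F \<in> locm n 5" using pl[of 7 10] by (auto intro!: locm_uminus locm_mult locm_consts simp: mult.assoc)
  have Zpl: "Zp \<in> locm n 5" "Zm \<in> locm n 5"
    unfolding Zp_def Zm_def by (intro locm_scaleR locm_mult locm_minus locm_add locm_consts Fl Zl)+
  have tS: "ptrs n 5 (stab g x y z * site (n + 4) (proj (ket 0))) = 1" for x y z
  proof -
    have "ptrs n 5 (stab g x y z * site (n + 4) (proj (ket 0))) = ptrs n 4 (ptr (n + 4) (stab g x y z * site (n + 4) (proj (ket 0))))"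
      by (simp add: eval_nat_numeral)
    also have "ptr (n + 4) (stab g x y z * site (n + 4) (proj (ket 0))) = stab g x y z"
      unfolding g_def by (intro ptr_drop_ket stab_site) auto
    finally show ?thesis unfolding g_def ptrs_stab .
  qed
  have tm: "ptrs n 5 Zm = (if c = c' then 1 else 0)"
  proof -
    have "ptrs n 5 (ub 7 9 Zm) = ptrs n 5 Zm"
      using braid_inverse(1)[of 7 9] by (intro ptrs_conj_half locm_minus locm_add locm_consts pl Zpl) auto
    then show ?thesis unfolding out using tS ptrs_scaleR[of n 5 0 0] by auto
  qed
  \<comment> \<open>The rejected state itself is not computed: both outcomes together keep the trace
    of \<open>Z\<close>, so its weight is the complement of the accepted one.\<close>
  have tp: "ptrs n 5 Zp = (if c = c' then 0 else 1)"
  proof -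
    have FF: "?F * ?F = 1" by (simp add: cl)
    have "Zp + Zm = (1 / 2) *\<^sub>R (Z + ?F * Z * ?F)"
    proof -
      have "(1 + ?F) * Z * (1 + ?F) + (1 - ?F) * Z * (1 - ?F) = 2 *\<^sub>R (Z + ?F * Z * ?F)"
        by (simp only: distrib_left distrib_right left_diff_distrib right_diff_distrib mult_1_left mult_1_right) (simp add: scaleR_2)
      then have "Zp + Zm = (1 / 4) *\<^sub>R (2 *\<^sub>R (Z + ?F * Z * ?F))" unfolding Zp_def Zm_def by (simp only: scaleR_add_right[symmetric])
      then show ?thesis by simp
    qed
    moreover have "ptrs n 5 (?F * Z * ?F) = ptrs n 5 Z" by (intro ptrs_conj Fl Zl FF)
    ultimately have "ptrs n 5 Zp + ptrs n 5 Zm = ptrs n 5 Z"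
      unfolding ptrs_add[symmetric] by (simp add: ptrs_scaleR ptrs_add scaleR_2[symmetric] del: ptrs.simps)
    also have "\<dots> = 1" unfolding Zt S_def tS ..
    finally show ?thesis unfolding tm by (auto split: if_splits)
  qed
  have "run_op \<rho> (checkP n Ks Kf) (n + 5) (X * Z) = run_op \<rho> (discard5 Kf) (n + 5) (X * Zp) + run_op \<rho> (Discard Ks) (n + 5) (X * ub 7 9 Zm)"
  proof -
    have k: "X * (g 7 * g 9) = g 7 * g 9 * X" by (rule Xg) auto
    show ?thesis
      unfolding checkP_def run_op.simps F2 sand Zp_def[symmetric] Zm_def[symmetric]
      by (subst run_op_unbraidP; (simp only: loc_conj[OF k] g)?; (simp; fail)?)
  qed
  also have "run_op \<rho> (discard5 Kf) (n + 5) (X * Zp) = (if c = c' then 0 else run_op \<rho> Kf n X)"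
    unfolding run_op_discard5 ptrs_locm[OF Zpl(1) X] tp by simp
  also have "run_op \<rho> (Discard Ks) (n + 5) (X * ub 7 9 Zm) = (if c = c' then run_op \<rho> Ks (n + 4) (X * ?s) else 0)"
  proof (cases "c = c'")
    case True
    have pt: "ptr (n + 4) (X * (?s * site (n + 4) (proj (ket 0)))) = X * ?s"
    proof -
      have "X * ?s * site (n + 4) M = site (n + 4) M * (X * ?s)" for M
        by (intro mult_commute loc_site[OF X] stab_site[of n, folded g_def]) auto
      then show ?thesis using ptr_drop_ket[of "X * ?s" "n + 4" 0] by (simp add: mult.assoc)
    qed
    have n5: "n + 5 - 1 = n + 4" by simp
    show ?thesis unfolding out run_op.simps n5 if_P[OF True] pt ..
  next
    case False
    then show ?thesis unfolding out using ptr_scaleR[of "n + 4" 0 0] by simp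
  qed
  finally show ?thesis unfolding in_eq g_def by simp
qed

lemma tele_wf:
  assumes ds: "distinct_modes (2 * n) ds" and K: "well_formed K n m"
  shows "well_formed (tele n ds K) (n + 4) m"
proof -
  have d: "1 \<le> ds ! i" "ds ! i \<le> 2 * n" if "i < 4" for i using distinct_modes_nth[OF ds that] by auto
  have "well_formed (mstep good p q r s t u L) N m"
    if "well_formed L N m" "1 \<le> p" "p < q" "q \<le> 2 * N" "1 \<le> r" "r < s" "s \<le> 2 * N" "1 \<le> t" "t < u" "u \<le> 2 * N" for good p q r s t u L N
    using that by (simp add: mstep_def corrP_def flipP_wf)
  then show ?thesis
    unfolding tele_def Let_def using K d[of 0] d[of 1] d[of 2] d[of 3] by (simp del: One_nat_def)
qed

text \<open>Bookkeeping for two independent fault patterns: pairs with equal third bits are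
  regrouped by their outcome, and the remaining weight goes to the failure value
  \<open>k\<close>.\<close>

lemma parity_round_sum:
  fixes v :: "bool \<Rightarrow> bool \<Rightarrow> bool \<Rightarrow> 'a :: real_vector"
  shows "(\<Sum>x\<in>UNIV. \<Sum>y\<in>UNIV. \<Sum>z\<in>UNIV. p x y z *\<^sub>R (\<Sum>a\<in>UNIV. \<Sum>b\<in>UNIV. \<Sum>c\<in>UNIV. q a b c *\<^sub>R
      (if z = c then v (x \<noteq> (a \<noteq> z)) (y \<noteq> (b \<noteq> z)) z else k)))
    = (\<Sum>a\<in>UNIV. \<Sum>b\<in>UNIV. \<Sum>c\<in>UNIV. parity_round p q a b c *\<^sub>R v a b c) + (tot p * tot q - tot (parity_round p q)) *\<^sub>R k"
  unfolding parity_round_def tot_def UNIV_bool by (simp add: algebra_simps)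

lemma parity_round_nonneg: "(\<And>a b c. 0 \<le> p a b c) \<Longrightarrow> (\<And>a b c. 0 \<le> q a b c) \<Longrightarrow> 0 \<le> parity_round p q a b c"
  unfolding parity_round_def by (intro sum_nonneg mult_nonneg_nonneg) auto

lemma tot_parity_round_le:
  assumes "\<And>a b c. 0 \<le> p a b c" "\<And>a b c. 0 \<le> q a b c"
  shows "tot (parity_round p q) \<le> tot p * tot q"
proof -
  let ?P = "\<lambda>c. \<Sum>a\<in>UNIV. \<Sum>b\<in>UNIV. p a b c" and ?Q = "\<lambda>c. \<Sum>a\<in>UNIV. \<Sum>b\<in>UNIV. q a b c"
  have "tot p * tot q = tot (parity_round p q) + ?P True * ?Q False + ?P False * ?Q True"
    unfolding parity_round_def tot_def UNIV_bool by (simp add: algebra_simps)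
  moreover have "0 \<le> ?P c" "0 \<le> ?Q c" for c using assms by (auto intro!: sum_nonneg)
  ultimately show ?thesis by simp
qed

text \<open>The first ancilla and a fresh pair are data for a gate that consumes the second ancilla.
  If the second preparation fails, the first ancilla and the pair are discarded, so failure always
  leaves just the input, as \<open>prep\<close> demands.\<close>

lemma prep_parity_round:
  assumes p: "prep \<rho> p" and q: "prep \<rho> q"
  shows "prep \<rho> (parity_round p q)"
proof -
  obtain G where G: "\<And>n Ks Kf m. well_formed Ks (n + 4) m \<Longrightarrow> well_formed Kf n m \<Longrightarrow> well_formed (G n Ks Kf) n m"
    "\<And>n Ks Kf X. X \<in> loc n \<Longrightarrow> run_op \<rho> (G n Ks Kf) n X = run_op \<rho> Ks (n + 4) (X * fault_mixture n p) + (1 - tot p) *\<^sub>R run_op \<rho> Kf n X"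
    using p unfolding prep_def by blast
  obtain H where H: "\<And>n Ks Kf m. well_formed Ks (n + 4) m \<Longrightarrow> well_formed Kf n m \<Longrightarrow> well_formed (H n Ks Kf) n m"
    "\<And>n Ks Kf X. X \<in> loc n \<Longrightarrow> run_op \<rho> (H n Ks Kf) n X = run_op \<rho> Ks (n + 4) (X * fault_mixture n q) + (1 - tot q) *\<^sub>R run_op \<rho> Kf n X"
    using q unfolding prep_def by blast
  have nn: "0 \<le> p a b c" "0 \<le> q a b c" "tot p \<le> 1" "tot q \<le> 1" for a b c using p q by (simp_all add: prep_def)
  have t0: "0 \<le> tot p" "0 \<le> tot q" unfolding tot_def by (intro sum_nonneg nn)+
  let ?K = "\<lambda>n Ks Kf. H (n + 5) (tele (n + 5) (rds n) (checkP n Ks Kf)) (discard5 Kf)"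
  have ok: "distinct_modes (2 * (n + 5)) (rds n)" for n by (auto simp: distinct_modes_def rds_def)
  show ?thesis
  proof (rule prepI[where G = "\<lambda>n Ks Kf. G n (Prepare (?K n Ks Kf)) Kf"])
    show "0 \<le> parity_round p q a b c" for a b c using nn by (intro parity_round_nonneg)
    show "tot (parity_round p q) \<le> 1"
      using tot_parity_round_le[of p q] nn mult_mono[OF nn(3,4)] t0 by fastforce
    show "well_formed (G n (Prepare (?K n Ks Kf)) Kf) n m" if w: "well_formed Ks (n + 4) m" "well_formed Kf n m" for n Ks Kf m
    proof -
      have d: "well_formed (discard5 Kf) (n + 5) m" using w by (simp add: discard5_def eval_nat_numeral)
      have "well_formed (checkP n Ks Kf) (n + 5) m"
        using w d by (simp add: checkP_def unbraidP_wf add.commute[of n])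
      then have "well_formed (tele (n + 5) (rds n) (checkP n Ks Kf)) (n + 5 + 4) m" by (rule tele_wf[OF ok])
      then have "well_formed (?K n Ks Kf) (n + 5) m" using d by (rule H(1))
      moreover have "n + 4 + 1 = n + 5" by simp
      ultimately show ?thesis using w by (intro G(1)) (simp_all only: well_formed.simps)
    qed
    fix n Ks Kf X assume X: "X \<in> loc n"
    define y where "y a b c = X * (stab (gm (2 * n)) a b c * site (n + 4) (proj (ket 0)))" for a b c
    define Y where "Y = (\<Sum>a\<in>UNIV. \<Sum>b\<in>UNIV. \<Sum>c\<in>UNIV. p a b c *\<^sub>R y a b c)"
    have yl: "y a b c \<in> loc (n + 5)" for a b c
    proof -
      have "stab (gm (2 * n)) a b c \<in> loc (n + 4)" by (rule locm_loc[OF locm_stab])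
      moreover have "site (n + 4) (proj (ket 0)) \<in> loc (n + 5)"
      proof -
        have "emb (n + 4) (Suc 0) (proj (ket 0)) \<in> locm (n + 4) (Suc 0)" by (rule locm_emb) simp
        then have "site (n + 4) (proj (ket 0)) \<in> loc (n + 4 + Suc 0)"
          using locm_loc by (metis emb_site proj_ket_carrier)
        moreover have "n + 4 + Suc 0 = n + 5" by simp
        ultimately show ?thesis by metis
      qed
      ultimately show ?thesis unfolding y_def using X by (auto intro!: locm_mult intro: loc_mono)
    qed
    then have Yl: "Y \<in> loc (n + 5)" unfolding Y_def by (intro loc_sum locm_scaleR)
    have fy: "run_op \<rho> (discard5 Kf) (n + 5) (y a b c) = run_op \<rho> Kf n X" for a b c
    proof -
      have l: "stab (gm (2 * n)) a b c * site (n + 4) (proj (ket 0)) \<in> locm n 5"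
        using locm_Suc[OF locm_stab[of n a b c]] locm_pair[of 9 5 10 n]
        by (auto simp: site_ket0_F mult.assoc intro!: locm_mult locm_scaleR locm_add locm_consts locm_uminus locm_minus)
      have "ptrs n 5 (stab (gm (2 * n)) a b c * site (n + 4) (proj (ket 0))) = ptrs n 4 (ptr (n + 4) (stab (gm (2 * n)) a b c * site (n + 4) (proj (ket 0))))"
        by (simp add: eval_nat_numeral)
      also have "ptr (n + 4) (stab (gm (2 * n)) a b c * site (n + 4) (proj (ket 0))) = stab (gm (2 * n)) a b c"
        by (intro ptr_drop_ket stab_site) auto
      finally show ?thesis unfolding run_op_discard5 y_def ptrs_locm[OF l X] by (simp add: ptrs_stab)
    qed
    have n41: "n + 4 + 1 = n + 5" by simp
    have "X * fault_mixture n p * site (n + 4) (proj (ket 0)) = Y"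
      unfolding fault_mixture_def Y_def y_def by (simp add: sum_distrib_left sum_distrib_right mult.assoc)
    then have "run_op \<rho> (G n (Prepare (?K n Ks Kf)) Kf) n X = run_op \<rho> (?K n Ks Kf) (n + 5) Y + (1 - tot p) *\<^sub>R run_op \<rho> Kf n X"
      unfolding G(2)[OF X] run_op.simps n41 by (simp only:)
    also have "run_op \<rho> (?K n Ks Kf) (n + 5) Y = run_op \<rho> (tele (n + 5) (rds n) (checkP n Ks Kf)) (n + 5 + 4) (Y * fault_mixture (n + 5) q) + (1 - tot q) *\<^sub>R run_op \<rho> (discard5 Kf) (n + 5) Y"
      by (rule H(2)[OF Yl])
    also have "run_op \<rho> (discard5 Kf) (n + 5) Y = tot p *\<^sub>R run_op \<rho> Kf n X"
      unfolding Y_def run_op_sum run_op_scaleR fy tot_def by (simp add: scaleR_sum_left)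
    also have "run_op \<rho> (tele (n + 5) (rds n) (checkP n Ks Kf)) (n + 5 + 4) (Y * fault_mixture (n + 5) q)
      = (\<Sum>x\<in>UNIV. \<Sum>y\<in>UNIV. \<Sum>z\<in>UNIV. p x y z *\<^sub>R (\<Sum>a\<in>UNIV. \<Sum>b\<in>UNIV. \<Sum>c\<in>UNIV. q a b c *\<^sub>R
      (if z = c then run_op \<rho> Ks (n + 4) (X * stab (gm (2 * n)) (x \<noteq> (a \<noteq> z)) (y \<noteq> (b \<noteq> z)) z) else run_op \<rho> Kf n X)))"
      unfolding run_op_fault_mixture Y_def sum_distrib_right run_op_sum mult_scaleR_left run_op_scaleR run_op_tele[OF ok yl]
      unfolding y_def run_op_checkP[OF X] ..
    also have "\<dots> = (\<Sum>a\<in>UNIV. \<Sum>b\<in>UNIV. \<Sum>c\<in>UNIV. parity_round p q a b c *\<^sub>R run_op \<rho> Ks (n + 4) (X * stab (gm (2 * n)) a b c))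
      + (tot p * tot q - tot (parity_round p q)) *\<^sub>R run_op \<rho> Kf n X"
      by (rule parity_round_sum)
    \<comment> \<open>The three ways to fail, with weights \<open>1 - tot p\<close>,
      \<open>tot p * (1 - tot q)\<close> and \<open>tot p * tot q - tot (parity_round p q)\<close>,
      add up to the required weight.\<close>
    finally show "run_op \<rho> (G n (Prepare (?K n Ks Kf)) Kf) n X = run_op \<rho> Ks (n + 4) (X * fault_mixture n (parity_round p q)) + (1 - tot (parity_round p q)) *\<^sub>R run_op \<rho> Kf n X"
      unfolding run_op_fault_mixture by (simp add: algebra_simps)
  qed
qed

text \<open>The weight of \<open>a8\<close> and the total weight after three rounds that start from weight \<open>1\<close> for \<open>a8\<close> and
  weight \<open>r\<close> for every fault.\<close>

definition good3 :: "real \<Rightarrow> real" where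
  "good3 r = (let A = 1 + 3 * r\<^sup>2; B = 2 * r + 2 * r\<^sup>2; C = 4 * r\<^sup>2 in
     (A\<^sup>2 + B\<^sup>2 + 2 * C\<^sup>2)\<^sup>2 + (2 * (A + B) * C)\<^sup>2 + (2 * B\<^sup>2 + 2 * C\<^sup>2)\<^sup>2 + (4 * B * C)\<^sup>2)"

definition total3 :: "real \<Rightarrow> real" where
  "total3 r = (let A = 1 + 3 * r\<^sup>2; B = 2 * r + 2 * r\<^sup>2; C = 4 * r\<^sup>2 in
     (A\<^sup>2 + B\<^sup>2 + 2 * C\<^sup>2 + 2 * (A + B) * C + (2 * B\<^sup>2 + 2 * C\<^sup>2) + 4 * B * C)\<^sup>2
     + (2 * A * B + 2 * C\<^sup>2 + 2 * (A + B) * C + (2 * B\<^sup>2 + 2 * C\<^sup>2) + 4 * B * C)\<^sup>2)"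

definition swapac :: "dist \<Rightarrow> dist" where "swapac p = (\<lambda>a b c. p c b a)"
definition swapbc :: "dist \<Rightarrow> dist" where "swapbc p = (\<lambda>a b c. p a c b)"

text \<open>\<open>parity_round\<close> always inspects the third bit; the swaps bring first the
  original bit \<open>a\<close> and then the original bit \<open>b\<close> to that place.\<close>

definition three :: "dist \<Rightarrow> dist" where
  "three p = (let p1 = swapac (parity_round p p); p2 = swapbc (parity_round p1 p1) in parity_round p2 p2)"

lemma prep_three: "prep \<rho> p \<Longrightarrow> prep \<rho> (three p)"
proof -
  assume p: "prep \<rho> p"
  have p1: "prep \<rho> (swapac (parity_round p p))"
    unfolding swapac_def by (rule prep_swap_ac[OF prep_parity_round[OF p p]])
  have p2: "prep \<rho> (swapbc (parity_round (swapac (parity_round p p)) (swapac (parity_round p p))))"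
    unfolding swapbc_def by (rule prep_swap_bc[OF prep_parity_round[OF p1 p1]])
  show ?thesis
    unfolding three_def Let_def by (rule prep_parity_round[OF p2 p2])
qed

lemma three_unif:
  "three (unif x (x * r)) False False False = x ^ 8 * good3 r" "tot (three (unif x (x * r))) = x ^ 8 * total3 r"
proof -
  \<comment> \<open>After the first round and the swap only three weights occur, up to
    \<open>x\<^sup>2\<close>: \<open>A\<close> without fault, \<open>B\<close> for the other
    patterns with first bit unset, \<open>C\<close> when it is set. The second round leaves five
    weights in the same way, up to \<open>x ^ 4\<close>.\<close>
  define A B C where "A = 1 + 3 * r\<^sup>2" and "B = 2 * r + 2 * r\<^sup>2" and "C = 4 * r\<^sup>2"
  define p1 where "p1 = (\<lambda>a b c. if a then x\<^sup>2 * C else if b \<or> c then x\<^sup>2 * B else x\<^sup>2 * A)"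
  have p1: "swapac (parity_round (unif x (x * r)) (unif x (x * r))) = p1"
  proof (intro ext)
    fix a b c show "swapac (parity_round (unif x (x * r)) (unif x (x * r))) a b c = p1 a b c"
      by (cases a; cases b; cases c; simp add: swapac_def parity_round_def unif_def p1_def UNIV_bool A_def B_def C_def power2_eq_square algebra_simps)
  qed
  define D X Z E W where "D = A\<^sup>2 + B\<^sup>2 + 2 * C\<^sup>2" and "X = 2 * (A + B) * C" and "Z = 2 * A * B + 2 * C\<^sup>2"
    and "E = 4 * B * C" and "W = 2 * B\<^sup>2 + 2 * C\<^sup>2"
  define p2 where "p2 = (\<lambda>a b c. if b then (if a then x ^ 4 * W else x ^ 4 * E) else if a then x ^ 4 * X else if c then x ^ 4 * Z else x ^ 4 * D)"
  have p2: "swapbc (parity_round p1 p1) = p2"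
  proof (intro ext)
    fix a b c show "swapbc (parity_round p1 p1) a b c = p2 a b c"
      by (cases a; cases b; cases c; simp add: swapbc_def parity_round_def p1_def p2_def UNIV_bool D_def X_def Z_def E_def W_def eval_nat_numeral algebra_simps)
  qed
  have F: "good3 r = D\<^sup>2 + X\<^sup>2 + W\<^sup>2 + E\<^sup>2" "total3 r = (D + X + W + E)\<^sup>2 + (Z + X + W + E)\<^sup>2"
    unfolding good3_def total3_def Let_def A_def[symmetric] B_def[symmetric] C_def[symmetric]
    by (simp_all add: D_def X_def Z_def E_def W_def mult.assoc)
  have q: "x ^ 4 * u * (x ^ 4 * v) = x ^ 8 * (u * v)" for u v :: real
    by (simp add: eval_nat_numeral)
  show "three (unif x (x * r)) False False False = x ^ 8 * good3 r"
    unfolding three_def Let_def p1 p2 F parity_round_def UNIV_bool p2_def by (simp add: q power2_eq_square distrib_left)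
  show "tot (three (unif x (x * r))) = x ^ 8 * total3 r"
    unfolding three_def Let_def p1 p2 F parity_round_def UNIV_bool p2_def tot_def by (simp add: q power2_eq_square distrib_left distrib_right)
qed

text \<open>After the averaging each fault has a seventh of the bad weight
  \<open>total3 r - good3 r\<close>; this is its ratio to the good weight.\<close>

definition phi :: "real \<Rightarrow> real" where "phi r = (total3 r / good3 r - 1) / 7"

lemma good3_eq: "good3 r = 1 + 20 * r ^ 2 + 16 * r ^ 3 + 318 * r ^ 4 + 672 * r ^ 5 + 3780 * r ^ 6 + 5328 * r ^ 7 + 6249 * r ^ 8"
  unfolding good3_def Let_def by (simp add: power2_eq_square eval_nat_numeral algebra_simps)

lemma total3_eq: "total3 r = 1 + 68 * r ^ 2 + 304 * r ^ 3 + 1998 * r ^ 4 + 8032 * r ^ 5 + 25364 * r ^ 6 + 46320 * r ^ 7 + 48985 * r ^ 8"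
  unfolding total3_def Let_def by (simp add: power2_eq_square eval_nat_numeral algebra_simps)

lemma good3_pos: "0 \<le> r \<Longrightarrow> 1 \<le> good3 r"
  unfolding good3_eq by simp

lemma phi_nonneg: "0 \<le> r \<Longrightarrow> 0 \<le> phi r"
proof -
  assume r: "0 \<le> r"
  have "good3 r \<le> total3 r"
    unfolding good3_eq total3_eq using r by (intro add_mono mult_right_mono) auto
  then show ?thesis using good3_pos[OF r] by (simp add: phi_def le_divide_eq)
qed

text \<open>Comparing \<open>total3\<close> with \<open>good3\<close> times
  \<open>1 + 7 * (0.98 * r)\<close>, the only positive terms of the difference are those of degree 1
  and 9; at the right end of the interval the linear one still outweighs the rest.\<close>

lemma phi_contract:
  assumes "0 \<le> r" "r \<le> 0.0876"
  shows "phi r \<le> 0.98 * r"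
proof -
  have b: "r ^ k \<le> 0.0876 ^ k" for k by (intro power_mono assms)
  have "total3 r \<le> good3 r * (1 + 7 * (0.98 * r))"
  proof -
    \<comment> \<open>This is the difference
      \<open>good3 r * (1 + 7 * (0.98 * r)) - total3 r\<close> divided by \<open>r\<close>, without
      its last term; 7 - 0.14 is 7 * 0.98. All terms but the constant are negative, so bounding the
      powers of \<open>r\<close> at 0.0876 suffices.\<close>
    have "0 \<le> 7 - 0.14 - 48 * r ^ 1 - 150.8 * r ^ 2 - 1570.24 * r ^ 3 - 5178.52 * r ^ 4 - 16974.08 * r ^ 5 - 15061.2 * r ^ 6 - 6185.92 * r ^ 7"
      using b[of 1] b[of 2] b[of 3] b[of 4] b[of 5] b[of 6] b[of 7] by (simp add: eval_nat_numeral del: power_Suc)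
        (simp add: power_Suc)?
    then have "0 \<le> r * (7 - 0.14 - 48 * r ^ 1 - 150.8 * r ^ 2 - 1570.24 * r ^ 3 - 5178.52 * r ^ 4 - 16974.08 * r ^ 5 - 15061.2 * r ^ 6 - 6185.92 * r ^ 7)
       + 42868.14 * r ^ 9"
      using assms(1) by (intro add_nonneg_nonneg mult_nonneg_nonneg) auto
    then show ?thesis unfolding good3_eq total3_eq by (simp add: eval_nat_numeral algebra_simps)
  qed
  then have "total3 r / good3 r \<le> 1 + 7 * (0.98 * r)"
    using good3_pos[OF assms(1)] by (simp add: divide_le_eq mult.commute)
  moreover have "(a - 1) / 7 \<le> u" if "a \<le> 1 + 7 * u" for a u :: real
    using that by simp
  ultimately show ?thesis unfolding phi_def by blast
qed

lemma prep_step: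
  assumes "prep \<rho> (unif x (x * r))" "0 < x" "0 \<le> r"
  shows "\<exists>y. 0 < y \<and> prep \<rho> (unif y (y * phi r))"
proof -
  define y where "y = x ^ 8 * good3 r"
  have F: "1 \<le> good3 r" by (rule good3_pos[OF assms(3)])
  have "prep \<rho> (unif y ((x ^ 8 * total3 r - y) / 7))"
    using prep_unif[OF prep_three[OF assms(1)]] unfolding three_unif y_def .
  moreover have "(x ^ 8 * total3 r - y) / 7 = y * phi r"
    using F by (simp add: y_def phi_def field_simps)
  moreover have "0 < y" using F assms(2) by (simp add: y_def)
  ultimately show ?thesis by auto
qed

lemma prep_iterate:
  assumes "prep \<rho> (unif x (x * r))" "0 < x" "0 \<le> r" "r \<le> 0.0876"
  shows "\<exists>y s. 0 < y \<and> 0 \<le> s \<and> s \<le> 0.98 ^ k * r \<and> prep \<rho> (unif y (y * s))"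
proof (induction k)
  case 0
  then show ?case using assms by auto
next
  case (Suc k)
  then obtain y s where ys: "0 < y" "0 \<le> s" "s \<le> 0.98 ^ k * r" "prep \<rho> (unif y (y * s))" by blast
  have "(0.98 :: real) ^ k \<le> 1" by (rule power_le_one) auto
  then have "0.98 ^ k * r \<le> r" using assms(3) by (simp add: mult_left_le_one_le)
  then have "phi s \<le> 0.98 * s" using ys assms(4) by (intro phi_contract) auto
  moreover have "0.98 * s \<le> 0.98 ^ Suc k * r" using ys(3) by simp
  ultimately show ?case using prep_step[OF ys(4,1,2)] phi_nonneg[OF ys(2)] by force
qed

lemma prep_zero: "prep \<rho> (\<lambda>a b c. 0)"
  by (rule prepI[where G = "\<lambda>n Ks Kf. Kf"]) (auto simp: tot_def fault_mixture_def)

text \<open>Repeating up to \<open>k\<close> times raises a total weight \<open>t\<close> to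
  \<open>1 - (1 - t) ^ k\<close> and keeps the ratios between the fault patterns.\<close>

lemma prep_repeat:
  assumes "prep \<rho> p"
  shows "prep \<rho> (\<lambda>a b c. (\<Sum>i<k. (1 - tot p) ^ i) * p a b c)"
proof (induction k)
  case 0
  then show ?case using prep_zero by simp
next
  case (Suc k)
  have "(\<Sum>i<Suc k. (1 - tot p) ^ i) = 1 + (1 - tot p) * (\<Sum>i<k. (1 - tot p) ^ i)"
    by (simp add: sum.lessThan_Suc_shift sum_distrib_left del: sum.lessThan_Suc)
  then have "(\<lambda>a b c. (\<Sum>i<Suc k. (1 - tot p) ^ i) * p a b c) = (\<lambda>a b c. 1 * p a b c + (1 - tot p) * ((\<Sum>i<k. (1 - tot p) ^ i) * p a b c))"
    by (simp only: distrib_right mult.assoc)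
  then show ?case using prep_retry[OF assms Suc] by metis
qed

lemma tot_unif: "tot (unif x q) = x + 7 * q"
  by (simp add: tot_def unif_def UNIV_bool)

text \<open>The iteration improves the ratio of faults but may leave only a tiny success
  probability; repetition then restores the weight without changing the ratio.\<close>

lemma prep_good:
  assumes p: "prep \<rho> p" "tot p = 1" "0.62 < p False False False" and d: "0 < \<delta>"
  shows "\<exists>q. prep \<rho> q \<and> 1 - \<delta> \<le> q False False False"
proof -
  define x where "x = p False False False"
  define r where "r = (1 - x) / 7 / x"
  have x: "0.62 < x" "x \<le> 1"
  proof -
    have nn: "0 \<le> p a b c" for a b c using p(1) by (simp add: prep_def)
    have "tot p = x + ((p True False False + p False True False + p True True False + p False False True)
        + (p True False True + p False True True + p True True True))"
      by (simp add: tot_def UNIV_bool x_def)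
    moreover have "0 \<le> (p True False False + p False True False + p True True False + p False False True)
        + (p True False True + p False True True + p True True True)"
      by (intro add_nonneg_nonneg nn)
    ultimately show "x \<le> 1" using p(2) by linarith
  qed (use p(3) in \<open>simp add: x_def\<close>)
  \<comment> \<open>For \<open>x > 0.62\<close> the ratio is less than 0.38 / (7 * 0.62), which is
    below 0.0876.\<close>
  have r: "0 \<le> r" "r \<le> 0.0876" "(1 - x) / 7 = x * r"
    using x by (simp_all add: r_def field_simps)
  have "prep \<rho> (unif x (x * r))"
    using prep_unif[OF p(1)] unfolding p(2) x_def[symmetric] r(3) .
  note it = prep_iterate[OF this _ r(1,2)]
  have "(\<lambda>k. 0.98 ^ k * r) \<longlonglongrightarrow> 0 * r"
    by (intro tendsto_mult LIMSEQ_power_zero tendsto_const) simp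
  \<comment> \<open>Half of \<delta> is spent on the seven faults and half on the final failure
    probability: (1 - \<delta> / 2) / (1 + \<delta> / 2) is at least 1 - \<delta>.\<close>
  then have "eventually (\<lambda>k. 0.98 ^ k * r < \<delta> / 14) sequentially"
    using d by (intro order_tendstoD) auto
  then obtain k where k: "0.98 ^ k * r < \<delta> / 14" by (auto simp: eventually_sequentially)
  obtain y s where ys: "0 < y" "0 \<le> s" "s \<le> 0.98 ^ k * r" "prep \<rho> (unif y (y * s))"
    using it[of k] x by auto
  define t where "t = tot (unif y (y * s))"
  have t: "t = y * (1 + 7 * s)" by (simp add: t_def tot_unif algebra_simps)
  have t01: "0 < t" "t \<le> 1" using ys t by (auto simp: prep_def t_def)
  have "(\<lambda>k. (1 - t) ^ k) \<longlonglongrightarrow> 0" using t01 by (intro LIMSEQ_power_zero) auto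
  then have "eventually (\<lambda>k. (1 - t) ^ k < \<delta> / 2) sequentially"
    using d by (intro order_tendstoD) auto
  then obtain l where l: "(1 - t) ^ l < \<delta> / 2" by (auto simp: eventually_sequentially)
  have "(\<Sum>i<l. (1 - t) ^ i) = (1 - (1 - t) ^ l) / t"
    using t01 by (simp add: sum_gp_strict)
  then have "(\<Sum>i<l. (1 - t) ^ i) * y = (1 - (1 - t) ^ l) / (1 + 7 * s)"
    using ys(1,2) unfolding t by simp
  moreover have "1 - \<delta> \<le> (1 - (1 - t) ^ l) / (1 + 7 * s)"
  proof -
    have s: "7 * s < \<delta> / 2" using ys(3) k by simp
    have "(1 - \<delta>) * (1 + 7 * s) \<le> 1 - (1 - t) ^ l"
    proof (cases "\<delta> \<le> 1")
      case True
      then have "(1 - \<delta>) * (1 + 7 * s) \<le> (1 - \<delta>) * (1 + \<delta> / 2)" using s by (intro mult_left_mono) auto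
      also have "\<dots> \<le> 1 - \<delta> / 2" using d by (simp add: algebra_simps)
      finally show ?thesis using l by linarith
    next
      case False
      then have "(1 - \<delta>) * (1 + 7 * s) \<le> 0" using ys(2) by (intro mult_nonpos_nonneg) auto
      moreover have "(1 - t) ^ l \<le> 1" using t01 by (intro power_le_one) auto
      ultimately show ?thesis by linarith
    qed
    then show ?thesis using ys(2) by (simp add: le_divide_eq)
  qed
  moreover have "prep \<rho> (\<lambda>a b c. (\<Sum>i<l. (1 - t) ^ i) * unif y (y * s) a b c)"
    using prep_repeat[OF ys(4), of l] by (simp add: t_def)
  ultimately show ?thesis by (intro exI[of _ "\<lambda>a b c. (\<Sum>i<l. (1 - t) ^ i) * unif y (y * s) a b c"]) (simp add: unif_def)
qed

section \<open>The supplied state\<close>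

lemma proj_sandwich:
  assumes "v \<in> carrier_mat n 1" "\<rho> \<in> carrier_mat n n"
  shows "proj v * \<rho> * proj v = (mat_adjoint v * \<rho> * v) $$ (0, 0) \<cdot>\<^sub>m proj v"
proof -
  have v': "mat_adjoint v \<in> carrier_mat 1 n" using assms(1) by auto
  have r: "mat_adjoint v * \<rho> \<in> carrier_mat 1 n" by (rule mult_carrier_mat[OF v' assms(2)])
  have c: "mat_adjoint v * \<rho> * v \<in> carrier_mat 1 1" by (rule mult_carrier_mat[OF r assms(1)])
  then have e: "mat_adjoint v * \<rho> * v = (mat_adjoint v * \<rho> * v) $$ (0, 0) \<cdot>\<^sub>m 1\<^sub>m 1"
    by (intro eq_matI) auto
  have "proj v * \<rho> * proj v = v * (mat_adjoint v * \<rho>) * (v * mat_adjoint v)"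
    unfolding proj_def using assoc_mult_mat[OF assms(1) v' assms(2)] by simp
  also have "\<dots> = v * (mat_adjoint v * \<rho> * (v * mat_adjoint v))"
    by (rule assoc_mult_mat[OF assms(1) r mult_carrier_mat[OF assms(1) v']])
  also have "mat_adjoint v * \<rho> * (v * mat_adjoint v) = mat_adjoint v * \<rho> * v * mat_adjoint v"
    by (rule assoc_mult_mat[OF r assms(1) v', symmetric])
  also have "\<dots> = (mat_adjoint v * \<rho> * v) $$ (0, 0) \<cdot>\<^sub>m mat_adjoint v"
    by (subst e) (use v' in \<open>simp add: mult_smult_assoc_mat[of _ 1 1 _ n] left_mult_one_mat[OF v'] del: One_nat_def\<close>)
  also have "v * \<dots> = (mat_adjoint v * \<rho> * v) $$ (0, 0) \<cdot>\<^sub>m (v * mat_adjoint v)"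
    by (rule mult_smult_distrib[OF assms(1) v'])
  finally show ?thesis by (simp add: proj_def)
qed

lemma expectation_nonneg:
  assumes \<rho>: "\<rho> \<in> carrier_mat N N" "mat_adjoint \<rho> = \<rho>"
    and pos: "\<forall>u \<in> carrier_vec N. Re ((\<rho> *\<^sub>v u) \<bullet>c u) \<ge> 0" and v: "v \<in> carrier_mat N 1"
  shows "\<exists>r\<ge>0. (mat_adjoint v * \<rho> * v) $$ (0, 0) = complex_of_real r"
proof -
  let ?e = "(mat_adjoint v * \<rho> * v) $$ (0, 0)"
  have v': "mat_adjoint v \<in> carrier_mat 1 N" using v by auto
  have assoc: "mat_adjoint v * \<rho> * v = mat_adjoint v * (\<rho> * v)" by (rule assoc_mult_mat[OF v' \<rho>(1) v])
  have rv: "\<rho> * v \<in> carrier_mat N 1" by (rule mult_carrier_mat[OF \<rho>(1) v])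
  have "?e = (\<rho> *\<^sub>v col v 0) \<bullet>c col v 0"
    unfolding assoc using v \<rho> rv
    by (auto simp: scalar_prod_def mult.commute intro!: sum.cong)
  then have 1: "Re ?e \<ge> 0" using pos v by (auto intro: col_carrier_vec)
  have "mat_adjoint (mat_adjoint v * \<rho> * v) = mat_adjoint v * \<rho> * v"
    unfolding assoc using v v' \<rho> rv by (simp add: adj_mult[OF v' rv] adj_mult[OF \<rho>(1) v] assoc)
  then have "cnj ?e = ?e"
    using v \<rho> adj_index[of 0 "mat_adjoint v * \<rho> * v" 0] by simp
  then have "?e = complex_of_real (Re ?e)" by (simp add: complex_eq_iff)
  then show ?thesis using 1 by blast
qed

context clifford
begin

definition Qp :: op where "Qp = g 1 * g 2 * (g 3 * g 4) * (g 5 * g 6) * (g 7 * g 8)"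

lemma Qp_comm: "Qp * T3 g = T3 g * Qp" "Qp * T5 g = T5 g * Qp" "Qp * T8 g = T8 g * Qp"
  by (simp_all add: Qp_def T_defs cl)

text \<open>\<open>Qp\<close> is the product of the four stabilizers, so the factor belonging to
  \<open>T1\<close> can be traded for the projector onto even parity.\<close>

lemma stab_eq_Q: "stab g a b c = (1 / 16) *\<^sub>R (pj a (T3 g) * pj b (T5 g) * pj c (T8 g) * (1 + Qp))"
  unfolding stab_def T_defs Qp_def
  by (cases a; cases b; cases c; simp add: pj_def cl algebra_simps)

definition twirl :: "op \<Rightarrow> op \<Rightarrow> op" where "twirl T Z = (1 / 2) *\<^sub>R (Z + T * Z * T)"

lemma twirl_pj: "twirl T Z = (1 / 4) *\<^sub>R (\<Sum>a\<in>UNIV. pj a T * Z * pj a T)"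
  by (simp add: twirl_def pj_def UNIV_bool algebra_simps flip: scaleR_add_left)

text \<open>Random stabilizers erase the coherences between different signs of \<open>T3\<close>,
  \<open>T5\<close>, \<open>T8\<close>. Within the even sector each sign pattern leaves a single
  state, so an even \<open>Z\<close> becomes diagonal in the fault basis.\<close>

lemma twirl_stab:
  assumes "Qp * Z = Z" "Z * Qp = Z"
  shows "twirl (T8 g) (twirl (T5 g) (twirl (T3 g) Z)) = (\<Sum>a\<in>UNIV. \<Sum>b\<in>UNIV. \<Sum>c\<in>UNIV. stab g a b c * Z * stab g a b c)"
proof -
  let ?A = "\<lambda>a. pj a (T3 g)" and ?B = "\<lambda>b. pj b (T5 g)" and ?C = "\<lambda>c. pj c (T8 g)"
  have c: "?B b * ?A a = ?A a * ?B b" "?C c * ?A a = ?A a * ?C c" "?C c * ?B b = ?B b * ?C c" for a b c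
    using T_comm by (simp_all add: pj_def algebra_simps)
  have Q: "(1 + Qp) * ?A a = ?A a * (1 + Qp)" "(1 + Qp) * ?B b = ?B b * (1 + Qp)" "(1 + Qp) * ?C c = ?C c * (1 + Qp)" for a b c
    using Qp_comm by (simp_all add: pj_def algebra_simps)
  have ZZ: "(1 + Qp) * Z * (1 + Qp) = 4 *\<^sub>R Z"
  proof -
    have "(4 :: real) *\<^sub>R Z = 2 *\<^sub>R (2 *\<^sub>R Z)" by simp
    then have "4 *\<^sub>R Z = Z + Z + (Z + Z)" by (simp only: scaleR_2)
    then show ?thesis using assms by (simp add: distrib_left distrib_right add_ac)
  qed
  have s: "stab g a b c * Z * stab g a b c = (1 / 64) *\<^sub>R (?C c * (?B b * (?A a * Z * ?A a) * ?B b) * ?C c)" for a b c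
  proof -
    have l: "stab g a b c = (1 / 16) *\<^sub>R (?C c * ?B b * ?A a * (1 + Qp))"
    proof -
      have "?A a * ?B b * ?C c = ?C c * (?A a * ?B b)" by (rule commute_mult[symmetric]; simp only: c)
      also have "?C c * (?A a * ?B b) = ?C c * (?B b * ?A a)" by (simp only: c)
      finally have "?A a * ?B b * ?C c = ?C c * ?B b * ?A a" by (simp only: mult.assoc)
      then show ?thesis unfolding stab_eq_Q by (simp only:)
    qed
    have r: "stab g a b c = (1 / 16) *\<^sub>R ((1 + Qp) * (?A a * ?B b * ?C c))"
    proof -
      have "(1 + Qp) * (?A a * ?B b * ?C c) = ?A a * ?B b * ?C c * (1 + Qp)" by (intro commute_mult Q)
      then show ?thesis unfolding stab_eq_Q by simp
    qed
    have "stab g a b c * Z * stab g a b c = ((1 / 16) *\<^sub>R (?C c * ?B b * ?A a * (1 + Qp))) * Z * ((1 / 16) *\<^sub>R ((1 + Qp) * (?A a * ?B b * ?C c)))"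
      by (subst l, subst r) simp
    also have "\<dots> = (1 / 256) *\<^sub>R (?C c * ?B b * ?A a * ((1 + Qp) * Z * (1 + Qp)) * (?A a * ?B b * ?C c))"
      by (simp add: mult.assoc)
    also have "\<dots> = (1 / 64) *\<^sub>R (?C c * (?B b * (?A a * Z * ?A a) * ?B b) * ?C c)"
      unfolding ZZ by (simp add: mult.assoc)
    finally show ?thesis .
  qed
  show ?thesis
    unfolding s twirl_pj
    by (simp add: UNIV_bool algebra_simps)
qed

end

definition twirlP :: "nat \<Rightarrow> nat \<Rightarrow> nat \<Rightarrow> nat \<Rightarrow> protocol \<Rightarrow> protocol" where
  "twirlP p q r s K = Coin (1 / 2) K (corrP p q r s K)"

lemma twirlP_wf:
  "1 \<le> p \<Longrightarrow> p < q \<Longrightarrow> q \<le> 2 * n \<Longrightarrow> 1 \<le> r \<Longrightarrow> r < s \<Longrightarrow> s \<le> 2 * n \<Longrightarrow> well_formed (twirlP p q r s K) n m = well_formed K n m"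
  by (simp add: twirlP_def corrP_def flipP_wf)

lemma run_op_twirlP:
  assumes "1 \<le> p" "1 \<le> q" "p \<noteq> q" "1 \<le> r" "1 \<le> s" "r \<noteq> s"
  shows "run_op \<rho> (twirlP p q r s K) n X = run_op \<rho> K n ((1 / 2) *\<^sub>R (X + conj_gam p q (conj_gam r s X)))"
  using assms by (simp add: twirlP_def corrP_def run_op_flipP run_op_add run_op_scaleR scaleR_add_right)

lemma emb_parity: "parity_op 4 \<in> cm 4" "emb n 4 (parity_op 4) = clifford.Qp (gm (2 * n))"
proof -
  interpret clifford "gm (2 * n)" by (rule clifford_gm)
  have "tensor (replicate 4 sigma_z) \<in> carrier_mat (2 ^ length (replicate 4 sigma_z)) (2 ^ length (replicate 4 sigma_z))"
    by (rule tensor_carrier) auto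
  then show "parity_op 4 \<in> cm 4" by (simp add: parity_op_def)
  let ?g = "gm (2 * n)"
  have gz: "?g 1 * ?g 2 = J * sZ n" "?g 3 * ?g 4 = J * sZ (n + 1)" "?g 5 * ?g 6 = J * sZ (n + 2)" "?g 7 * ?g 8 = J * sZ (n + 3)"
    using gam_pair_Z[of n] gam_pair_Z[of "n + 1"] gam_pair_Z[of "n + 2"] gam_pair_Z[of "n + 3"] by (simp_all add: eval_nat_numeral)
  have "Qp = sZ n * sZ (n + 1) * sZ (n + 2) * sZ (n + 3)"
    unfolding Qp_def gz using J_central'[of "sZ n"] J_central'[of "sZ (n + 1)"] J_central'[of "sZ (n + 2)"]
    by (simp add: mult.assoc J_J')
  then show "emb n 4 (parity_op 4) = Qp"
    unfolding parity_op_def by (simp add: emb_replicate4)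
qed

text \<open>The weights are the expectations of the supplied state in the eight fault states; since
  the sandwich of a state between rank-one projectors is a multiple of the projector, the twirled
  state is the corresponding mixture.\<close>

lemma prep_init:
  assumes d: "density_op 4 \<rho>" and par: "parity_op 4 * \<rho> = \<rho>" "\<rho> * parity_op 4 = \<rho>"
  shows "\<exists>p. prep \<rho> p \<and> tot p = 1 \<and> (mat_adjoint a8 * \<rho> * a8) $$ (0, 0) = complex_of_real (p False False False)"
proof -
  have \<rho>: "\<rho> \<in> cm 4" "mat_adjoint \<rho> = \<rho>" "mat_tr \<rho> = 1" "\<forall>u \<in> carrier_vec (2 ^ 4). Re ((\<rho> *\<^sub>v u) \<bullet>c u) \<ge> 0"
    using d by (auto simp: density_op_def mat_tr_def)
  have "\<exists>r\<ge>0. (mat_adjoint (vec8 a b c) * \<rho> * vec8 a b c) $$ (0, 0) = complex_of_real r" for a b c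
    using \<rho>(1,4) vec8_carrier[of a b c] by (intro expectation_nonneg[of _ "2 ^ 4"] \<rho>(2)) auto
  then obtain p where p: "\<And>a b c. 0 \<le> p a b c"
    "\<And>a b c. (mat_adjoint (vec8 a b c) * \<rho> * vec8 a b c) $$ (0, 0) = complex_of_real (p a b c)" by metis
  have rho_stab: "stab (gm (2 * n)) a b c * emb n 4 \<rho> * stab (gm (2 * n)) a b c = p a b c *\<^sub>R stab (gm (2 * n)) a b c" for n a b c
  proof -
    have "st8 a b c * \<rho> * st8 a b c = complex_of_real (p a b c) \<cdot>\<^sub>m st8 a b c"
      unfolding st8_def using proj_sandwich[OF vec8_carrier, of \<rho> a b c] \<rho>(1) p(2) by simp
    then have "emb n 4 (st8 a b c * \<rho> * st8 a b c) = emb n 4 (complex_of_real (p a b c) \<cdot>\<^sub>m st8 a b c)" by simp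
    then show ?thesis
      using st8_carrier[of a b c] \<rho>(1) mult_carrier_mat[OF st8_carrier[of a b c] \<rho>(1)]
      by (simp only: emb_mult emb_smult emb_st8 sc_scaleR)
  qed
  define tw where "tw n Z = clifford.twirl (T8 (gm (2 * n))) (clifford.twirl (T5 (gm (2 * n))) (clifford.twirl (T3 (gm (2 * n))) Z))" for n Z
  have tw: "tw n (emb n 4 \<rho>) = fault_mixture n p" for n
  proof -
    interpret clifford "gm (2 * n)" by (rule clifford_gm)
    have "Qp * emb n 4 \<rho> = emb n 4 \<rho>" "emb n 4 \<rho> * Qp = emb n 4 \<rho>"
      using par emb_mult[OF emb_parity(1) \<rho>(1), of n] emb_mult[OF \<rho>(1) emb_parity(1), of n] by (simp_all add: emb_parity)
    then show ?thesis unfolding tw_def twirl_stab fault_mixture_def rho_stab[symmetric] by (rule twirl_stab)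
  qed
  \<comment> \<open>The trace is evaluated at \<open>n = 0\<close>: twirling preserves it, and each
    of the eight projectors has trace 1.\<close>
  have tot: "tot p = 1"
  proof -
    interpret clifford "gm (2 * 0)" by (rule clifford_gm)
    have l: "T3 (gm (2 * 0)) \<in> locm 0 4" "T5 (gm (2 * 0)) \<in> locm 0 4" "T8 (gm (2 * 0)) \<in> locm 0 4"
    proof -
      let ?g = "gm (2 * 0)"
      have e: "T3 ?g = - (?g 2 * ?g 3 * (?g 6 * ?g 7))" "T5 ?g = - (?g 2 * ?g 4 * (?g 5 * ?g 7))" "T8 ?g = ?g 2 * ?g 4 * (?g 6 * ?g 8)"
        unfolding T_defs by (simp_all only: mult.assoc)
      show "T3 ?g \<in> locm 0 4" "T5 ?g \<in> locm 0 4" "T8 ?g \<in> locm 0 4"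
        unfolding e by (intro locm_uminus locm_mult locm_pair; simp)+
    qed
    have "ptrs 0 4 (twirl T Z) = ptrs 0 4 Z \<and> twirl T Z \<in> locm 0 4" if "T \<in> locm 0 4" "Z \<in> locm 0 4" "T * T = 1" for T Z
      unfolding twirl_def using that ptrs_conj[OF that(1,1,2,3)]
      by (auto simp: ptrs_scaleR ptrs_add scaleR_2[symmetric] simp del: ptrs.simps intro!: locm_scaleR locm_add locm_mult)
    then have "ptrs 0 4 (tw 0 (emb 0 4 \<rho>)) = ptrs 0 4 (emb 0 4 \<rho>)"
      unfolding tw_def using l T_sq locm_emb[OF \<rho>(1), of 0] by simp
    also have "\<dots> = 1" using ptrs_emb[OF _ \<rho>(1), of 0 1] \<rho>(3) by simp
    also have "ptrs 0 4 (tw 0 (emb 0 4 \<rho>)) = tot p *\<^sub>R 1"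
    proof -
      have s: "ptrs 0 4 (\<Sum>x\<in>A. f x) = (\<Sum>x\<in>A. ptrs 0 4 (f x))" if "finite A" for A :: "bool set" and f
        using that by (induction A) (auto simp: ptrs_add simp del: ptrs.simps intro: ptrs_scaleR[of 0 4 0 0, simplified])
      show ?thesis unfolding tw fault_mixture_def
        by (simp only: s[OF finite] ptrs_scaleR ptrs_stab tot_def scaleR_sum_left)
    qed
    finally have "tot p *\<^sub>R (1 :: op) = 1 *\<^sub>R 1" by simp
    then show ?thesis by (simp only: scaleR_cancel_right) simp
  qed
  let ?W = "\<lambda>n K. twirlP (2 * n + 2) (2 * n + 3) (2 * n + 6) (2 * n + 7) (twirlP (2 * n + 2) (2 * n + 4) (2 * n + 5) (2 * n + 7)
     (twirlP (2 * n + 2) (2 * n + 4) (2 * n + 6) (2 * n + 8) K))"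
  have "prep \<rho> p"
  proof (rule prepI[where G = "\<lambda>n Ks Kf. Supply (?W n Ks)"])
    fix n Ks Kf X assume X: "X \<in> loc n"
    interpret clifford "gm (2 * n)" by (rule clifford_gm)
    have X2: "X * (gam (2 * n + i) * gam (2 * n + j)) = gam (2 * n + i) * gam (2 * n + j) * X" if "1 \<le> i" "1 \<le> j" for i j
      by (rule loc_commute_pair[OF X that])
    have step: "(1 / 2) *\<^sub>R (X * Z + conj_gam (2 * n + i) (2 * n + j) (conj_gam (2 * n + k) (2 * n + l) (X * Z))) = X * twirl T Z"
      if "1 \<le> i" "1 \<le> j" "1 \<le> k" "1 \<le> l"
        "gam (2 * n + i) * gam (2 * n + j) * (gam (2 * n + k) * gam (2 * n + l)) = S" "gam (2 * n + l) * gam (2 * n + k) * (gam (2 * n + j) * gam (2 * n + i)) = S"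
        "T = S \<or> T = - S" for i j k l T S Z
    proof -
      have "conj_gam (2 * n + i) (2 * n + j) (conj_gam (2 * n + k) (2 * n + l) (X * Z)) =
          (gam (2 * n + i) * gam (2 * n + j) * (gam (2 * n + k) * gam (2 * n + l))) * X * Z * (gam (2 * n + l) * gam (2 * n + k) * (gam (2 * n + j) * gam (2 * n + i)))"
        unfolding conj_gam_def by (simp only: mult.assoc)
      also have "\<dots> = S * X * Z * S" unfolding that(5,6) ..
      also have "S * X = X * S"
        unfolding that(5)[symmetric] by (rule commute_mult[symmetric]; rule X2[OF that(1,2)] X2[OF that(3,4)])
      also have "X * S * Z * S = X * (T * Z * T)" using that(7) by (auto simp: mult.assoc)
      finally show ?thesis unfolding twirl_def by (simp only: distrib_left mult_scaleR_right)
    qed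
    have s3: "(1 / 2) *\<^sub>R (X * Z + conj_gam (2 * n + 2) (2 * n + 3) (conj_gam (2 * n + 6) (2 * n + 7) (X * Z))) = X * twirl (T3 (gm (2 * n))) Z" for Z
      by (rule step[OF _ _ _ _ refl G_rev(2)]) (simp_all add: T_defs mult.assoc)
    have s5: "(1 / 2) *\<^sub>R (X * Z + conj_gam (2 * n + 2) (2 * n + 4) (conj_gam (2 * n + 5) (2 * n + 7) (X * Z))) = X * twirl (T5 (gm (2 * n))) Z" for Z
      by (rule step[OF _ _ _ _ refl G_rev(3)]) (simp_all add: T_defs mult.assoc)
    have s8: "(1 / 2) *\<^sub>R (X * Z + conj_gam (2 * n + 2) (2 * n + 4) (conj_gam (2 * n + 6) (2 * n + 8) (X * Z))) = X * twirl (T8 (gm (2 * n))) Z" for Z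
      by (rule step[OF _ _ _ _ refl G_rev(4)]) (simp_all add: T_defs mult.assoc)
    have "run_op \<rho> (Supply (?W n Ks)) n X = run_op \<rho> Ks (n + 4) (X * tw n (emb n 4 \<rho>))"
    proof -
      have r: "run_op \<rho> (twirlP (2 * n + 2) (2 * n + 3) (2 * n + 6) (2 * n + 7) K) N Y = run_op \<rho> K N ((1 / 2) *\<^sub>R (Y + conj_gam (2 * n + 2) (2 * n + 3) (conj_gam (2 * n + 6) (2 * n + 7) Y)))"
        "run_op \<rho> (twirlP (2 * n + 2) (2 * n + 4) (2 * n + 5) (2 * n + 7) K) N Y = run_op \<rho> K N ((1 / 2) *\<^sub>R (Y + conj_gam (2 * n + 2) (2 * n + 4) (conj_gam (2 * n + 5) (2 * n + 7) Y)))"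
        "run_op \<rho> (twirlP (2 * n + 2) (2 * n + 4) (2 * n + 6) (2 * n + 8) K) N Y = run_op \<rho> K N ((1 / 2) *\<^sub>R (Y + conj_gam (2 * n + 2) (2 * n + 4) (conj_gam (2 * n + 6) (2 * n + 8) Y)))"
        for K N Y by (rule run_op_twirlP; simp)+
      show ?thesis by (simp only: run_op.simps r s3 s5 s8 tw_def)
    qed
    then show "run_op \<rho> (Supply (?W n Ks)) n X = run_op \<rho> Ks (n + 4) (X * fault_mixture n p) + (1 - tot p) *\<^sub>R run_op \<rho> Kf n X"
      unfolding tw tot by simp
  qed (use p(1) tot in \<open>auto simp: twirlP_wf\<close>)
  moreover have "vec8 False False False = a8"
    unfolding vec8_eq using a8_carrier by simp
  ultimately show ?thesis using tot p(2)[of False False False] by auto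
qed

section \<open>Density operators under isometries and mixtures\<close>

lemma inner_adjoint:
  fixes V :: "complex mat"
  assumes "V \<in> carrier_mat a b" "w \<in> carrier_vec b" "v \<in> carrier_vec a"
  shows "(V *\<^sub>v w) \<bullet>c v = w \<bullet>c (mat_adjoint V *\<^sub>v v)"
proof -
  have "(V *\<^sub>v w) \<bullet>c v = (\<Sum>i = 0..<a. \<Sum>j = 0..<b. V $$ (i, j) * w $ j * cnj (v $ i))"
    using assms by (simp add: scalar_prod_def sum_distrib_right)
  also have "\<dots> = (\<Sum>j = 0..<b. \<Sum>i = 0..<a. V $$ (i, j) * w $ j * cnj (v $ i))"
    by (rule sum.swap)
  also have "\<dots> = w \<bullet>c (mat_adjoint V *\<^sub>v v)"
    using assms by (simp add: scalar_prod_def sum_distrib_left mult_ac)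
  finally show ?thesis .
qed

lemma adj_conj_by:
  assumes "V \<in> carrier_mat a b" "\<rho> \<in> carrier_mat b b" "mat_adjoint \<rho> = \<rho>"
  shows "mat_adjoint (conj_by V \<rho>) = conj_by V \<rho>"
proof -
  have V': "mat_adjoint V \<in> carrier_mat b a" using assms(1) by simp
  have "mat_adjoint (V * \<rho> * mat_adjoint V) = V * (\<rho> * mat_adjoint V)"
    using assms by (simp add: adj_mult[OF mult_carrier_mat[OF assms(1,2)] V'] adj_mult[OF assms(1,2)])
  then show ?thesis
    unfolding conj_by_def using assoc_mult_mat[OF assms(1,2) V'] by simp
qed

lemma density_conj_by:
  assumes \<rho>: "density_op n \<rho>" and V: "V \<in> carrier_mat (2 ^ m) (2 ^ n)" "mat_adjoint V * V = 1\<^sub>m (2 ^ n)"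
  shows "density_op m (conj_by V \<rho>)"
proof -
  have r: "\<rho> \<in> cm n" "mat_adjoint \<rho> = \<rho>" "mat_tr \<rho> = 1" "\<And>v. v \<in> carrier_vec (2 ^ n) \<Longrightarrow> Re ((\<rho> *\<^sub>v v) \<bullet>c v) \<ge> 0"
    using \<rho> by (auto simp: density_op_def mat_tr_def)
  have V': "mat_adjoint V \<in> carrier_mat (2 ^ n) (2 ^ m)" using V(1) by simp
  have Vr: "V * \<rho> \<in> carrier_mat (2 ^ m) (2 ^ n)" by (rule mult_carrier_mat[OF V(1) r(1)])
  have c: "conj_by V \<rho> \<in> cm m" by (rule conj_by_carrier[OF V(1) r(1)])
  have "Re ((conj_by V \<rho> *\<^sub>v v) \<bullet>c v) \<ge> 0" if v: "v \<in> carrier_vec (2 ^ m)" for v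
  proof -
    have u: "mat_adjoint V *\<^sub>v v \<in> carrier_vec (2 ^ n)" using V' v by (rule mult_mat_vec_carrier)
    have "conj_by V \<rho> *\<^sub>v v = V *\<^sub>v (\<rho> *\<^sub>v (mat_adjoint V *\<^sub>v v))"
      unfolding conj_by_def using assoc_mult_mat_vec[OF Vr V' v] assoc_mult_mat_vec[OF V(1) r(1) u] by simp
    then have "(conj_by V \<rho> *\<^sub>v v) \<bullet>c v = (\<rho> *\<^sub>v (mat_adjoint V *\<^sub>v v)) \<bullet>c (mat_adjoint V *\<^sub>v v)"
      using inner_adjoint[OF V(1) mult_mat_vec_carrier[OF r(1) u] v] by simp
    then show ?thesis using r(4)[OF u] by simp
  qed
  moreover have "mat_tr (conj_by V \<rho>) = 1"
  proof -
    have "mat_tr (V * \<rho> * mat_adjoint V) = mat_tr (mat_adjoint V * (V * \<rho>))" by (rule mat_tr_comm[OF Vr V'])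
    also have "mat_adjoint V * (V * \<rho>) = \<rho>" using assoc_mult_mat[OF V' V(1) r(1)] V(2) r(1) by simp
    finally show ?thesis using r(3) by (simp add: conj_by_def)
  qed
  ultimately show ?thesis
    using c adj_conj_by[OF V(1) r(1,2)] by (simp add: density_op_def mat_tr_def)
qed

definition mmix :: "nat \<Rightarrow> 'k set \<Rightarrow> ('k \<Rightarrow> real) \<Rightarrow> ('k \<Rightarrow> complex mat) \<Rightarrow> complex mat" where
  "mmix n S w A = mat (2 ^ n) (2 ^ n) (\<lambda>(i, j). \<Sum>k\<in>S. complex_of_real (w k) * A k $$ (i, j))"

lemma mmix_carrier [simp]: "mmix n S w A \<in> cm n"
  by (simp add: mmix_def)

lemma emb_mmix:
  assumes "finite S" "\<And>k. k \<in> S \<Longrightarrow> A k \<in> cm n"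
  shows "emb m n (mmix n S w A) = (\<Sum>k\<in>S. w k *\<^sub>R emb m n (A k))"
  using assms
proof (induction S rule: finite_induct)
  case empty
  have "mmix n {} w A = 0 \<cdot>\<^sub>m 1\<^sub>m (2 ^ n)" by (rule eq_matI) (auto simp: mmix_def)
  then show ?case by (simp add: emb_smult)
next
  case (insert x S)
  have "mmix n (insert x S) w A = complex_of_real (w x) \<cdot>\<^sub>m A x + mmix n S w A"
    using insert(1,2) insert(4)[of x] by (intro eq_matI) (auto simp: mmix_def)
  then show ?case using insert by (simp add: emb_add emb_smult sc_scaleR)
qed

lemma density_mmix:
  assumes S: "finite S" and A: "\<And>k. k \<in> S \<Longrightarrow> density_op n (A k)" and w: "\<And>k. k \<in> S \<Longrightarrow> 0 \<le> w k" "sum w S = 1"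
  shows "density_op n (mmix n S w A)"
proof -
  have c: "A k \<in> cm n" "mat_adjoint (A k) = A k" "(\<Sum>i<2 ^ n. A k $$ (i, i)) = 1"
    "\<And>v. v \<in> carrier_vec (2 ^ n) \<Longrightarrow> Re ((A k *\<^sub>v v) \<bullet>c v) \<ge> 0" if "k \<in> S" for k
    using A[OF that] by (auto simp: density_op_def)
  have "mat_adjoint (mmix n S w A) = mmix n S w A"
  proof (rule eq_matI)
    fix i j assume "i < dim_row (mmix n S w A)" "j < dim_col (mmix n S w A)"
    then have ij: "i < 2 ^ n" "j < 2 ^ n" by (simp_all add: mmix_def)
    have "cnj (A k $$ (j, i)) = A k $$ (i, j)" if "k \<in> S" for k
      using adj_index[of i "A k" j] c(1,2)[OF that] ij by simp
    then show "mat_adjoint (mmix n S w A) $$ (i, j) = mmix n S w A $$ (i, j)"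
      using ij by (auto simp: mmix_def intro!: sum.cong)
  qed (simp_all add: mmix_def)
  moreover have "Re ((mmix n S w A *\<^sub>v v) \<bullet>c v) \<ge> 0" if v: "v \<in> carrier_vec (2 ^ n)" for v
  proof -
    have "(mmix n S w A *\<^sub>v v) \<bullet>c v = (\<Sum>i = 0..<2 ^ n. \<Sum>j = 0..<2 ^ n. \<Sum>k\<in>S. complex_of_real (w k) * (A k $$ (i, j) * v $ j * cnj (v $ i)))"
      using v by (simp add: scalar_prod_def mmix_def sum_distrib_right mult.assoc)
    also have "\<dots> = (\<Sum>i = 0..<2 ^ n. \<Sum>k\<in>S. \<Sum>j = 0..<2 ^ n. complex_of_real (w k) * (A k $$ (i, j) * v $ j * cnj (v $ i)))"
      by (intro sum.cong refl sum.swap)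
    also have "\<dots> = (\<Sum>k\<in>S. \<Sum>i = 0..<2 ^ n. \<Sum>j = 0..<2 ^ n. complex_of_real (w k) * (A k $$ (i, j) * v $ j * cnj (v $ i)))"
      by (rule sum.swap)
    also have "\<dots> = (\<Sum>k\<in>S. complex_of_real (w k) * ((A k *\<^sub>v v) \<bullet>c v))"
    proof (intro sum.cong refl)
      fix k assume "k \<in> S"
      then have "(A k *\<^sub>v v) \<bullet>c v = (\<Sum>i = 0..<2 ^ n. \<Sum>j = 0..<2 ^ n. A k $$ (i, j) * v $ j * cnj (v $ i))"
        using v c(1)[of k] by (simp add: scalar_prod_def sum_distrib_right)
      then show "(\<Sum>i = 0..<2 ^ n. \<Sum>j = 0..<2 ^ n. complex_of_real (w k) * (A k $$ (i, j) * v $ j * cnj (v $ i)))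
         = complex_of_real (w k) * ((A k *\<^sub>v v) \<bullet>c v)"
        by (simp add: sum_distrib_left)
    qed
    finally have "Re ((mmix n S w A *\<^sub>v v) \<bullet>c v) = (\<Sum>k\<in>S. w k * Re ((A k *\<^sub>v v) \<bullet>c v))"
      by simp
    then show ?thesis using c(4)[OF _ v] w(1) by (auto intro!: sum_nonneg)
  qed
  moreover have "(\<Sum>i<2 ^ n. mmix n S w A $$ (i, i)) = 1"
  proof -
    have "(\<Sum>i<2 ^ n. mmix n S w A $$ (i, i)) = (\<Sum>i<2 ^ n. \<Sum>k\<in>S. complex_of_real (w k) * A k $$ (i, i))"
      by (simp add: mmix_def)
    also have "\<dots> = (\<Sum>k\<in>S. complex_of_real (w k) * (\<Sum>i<2 ^ n. A k $$ (i, i)))"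
      by (subst sum.swap) (simp add: sum_distrib_left)
    also have "\<dots> = complex_of_real (sum w S)" using c(3) by simp
    finally show ?thesis using w(2) by simp
  qed
  ultimately show ?thesis by (simp add: density_op_def)
qed

text \<open>The branches other than \<open>k0\<close> are renormalized into one error state.\<close>

lemma density_split:
  fixes w :: "'k :: finite \<Rightarrow> real"
  assumes A: "\<And>k. density_op n (A k)" and w: "\<And>k. 0 \<le> w k" "sum w UNIV = 1" and k0: "1 - \<delta> \<le> w k0"
  shows "\<exists>p \<tau>. 0 \<le> p \<and> p \<le> \<delta> \<and> p \<le> 1 \<and> density_op n \<tau> \<and>
    mmix n UNIV w A = complex_of_real (1 - p) \<cdot>\<^sub>m A k0 + complex_of_real p \<cdot>\<^sub>m \<tau>"
proof -
  let ?S = "UNIV - {k0}" and ?p = "1 - w k0"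
  have s: "sum w UNIV = w k0 + sum w ?S" by (rule sum.remove) auto
  have p: "sum w ?S = ?p" using w(2) s by simp
  have p0: "0 \<le> ?p" unfolding p[symmetric] using w(1) by (intro sum_nonneg)
  have c: "A k \<in> cm n" for k using A[of k] by (simp add: density_op_def)
  show ?thesis
  proof (cases "?p = 0")
    \<comment> \<open>No weight is left outside \<open>k0\<close>, so renormalizing would divide by
      0; \<open>A k0\<close> itself serves as the state of weight 0.\<close>
    case True
    then have z: "w k = 0" if "k \<noteq> k0" for k
      using p that w(1) sum_nonneg_eq_0_iff[of ?S w] by auto
    have "mmix n UNIV w A = complex_of_real (1 - 0) \<cdot>\<^sub>m A k0 + complex_of_real 0 \<cdot>\<^sub>m A k0"
    proof (rule eq_matI)
      fix i j assume "i < dim_row (complex_of_real (1 - 0) \<cdot>\<^sub>m A k0 + complex_of_real 0 \<cdot>\<^sub>m A k0)" "j < dim_col (complex_of_real (1 - 0) \<cdot>\<^sub>m A k0 + complex_of_real 0 \<cdot>\<^sub>m A k0)"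
      then have ij: "i < 2 ^ n" "j < 2 ^ n" using c[of k0] by auto
      have "(\<Sum>k\<in>UNIV. complex_of_real (w k) * A k $$ (i, j)) = complex_of_real (w k0) * A k0 $$ (i, j) + (\<Sum>k\<in>?S. complex_of_real (w k) * A k $$ (i, j))"
        by (rule sum.remove) auto
      also have "(\<Sum>k\<in>?S. complex_of_real (w k) * A k $$ (i, j)) = 0" using z by (intro sum.neutral) auto
      finally show "mmix n UNIV w A $$ (i, j) = (complex_of_real (1 - 0) \<cdot>\<^sub>m A k0 + complex_of_real 0 \<cdot>\<^sub>m A k0) $$ (i, j)"
        using ij c[of k0] True by (simp add: mmix_def)
    qed (use c[of k0] in \<open>auto simp: mmix_def\<close>)
    then show ?thesis using A[of k0] k0 True by (intro exI[of _ 0] exI[of _ "A k0"]) auto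
  next
    case False
    define \<tau> where "\<tau> = mmix n ?S (\<lambda>k. w k / ?p) A"
    have "density_op n \<tau>"
      unfolding \<tau>_def using p0 False w(1) p by (intro density_mmix A) (auto simp: sum_divide_distrib[symmetric])
    moreover have "mmix n UNIV w A = complex_of_real (1 - ?p) \<cdot>\<^sub>m A k0 + complex_of_real ?p \<cdot>\<^sub>m \<tau>"
    proof (rule eq_matI)
      fix i j assume "i < dim_row (complex_of_real (1 - ?p) \<cdot>\<^sub>m A k0 + complex_of_real ?p \<cdot>\<^sub>m \<tau>)" "j < dim_col (complex_of_real (1 - ?p) \<cdot>\<^sub>m A k0 + complex_of_real ?p \<cdot>\<^sub>m \<tau>)"
      then have ij: "i < 2 ^ n" "j < 2 ^ n" by (auto simp: \<tau>_def mmix_def)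
      have pc: "complex_of_real ?p \<noteq> 0" using False by (simp only: of_real_eq_0_iff not_False_eq_True)
      have "(\<Sum>k\<in>UNIV. complex_of_real (w k) * A k $$ (i, j)) = complex_of_real (w k0) * A k0 $$ (i, j) + (\<Sum>k\<in>?S. complex_of_real (w k) * A k $$ (i, j))"
        by (rule sum.remove) auto
      also have "(\<Sum>k\<in>?S. complex_of_real (w k) * A k $$ (i, j)) = complex_of_real ?p * (\<Sum>k\<in>?S. complex_of_real (w k / ?p) * A k $$ (i, j))"
        unfolding sum_distrib_left of_real_divide by (intro sum.cong refl) (use pc in \<open>simp del: of_real_diff\<close>)
      finally show "mmix n UNIV w A $$ (i, j) = (complex_of_real (1 - ?p) \<cdot>\<^sub>m A k0 + complex_of_real ?p \<cdot>\<^sub>m \<tau>) $$ (i, j)"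
        using ij c[of k0] by (simp add: mmix_def \<tau>_def)
    qed (auto simp: mmix_def \<tau>_def)
    moreover have "?p \<le> \<delta>" "?p \<le> 1" using k0 w(1)[of k0] by auto
    ultimately show ?thesis using p0 by blast
  qed
qed

section \<open>Operations on encoded states\<close>

text \<open>The basis vector for \<open>b, b\<close> has index
  \<open>2 * b + b = 3 * b\<close>.\<close>

lemma encode1_eq: "encode1 = mat 4 2 (\<lambda>(i, j). if i = 3 * j then 1 else 0)"
proof (rule eq_matI)
  have c: "kets [0, 0] \<in> carrier_mat 4 1" "kets [1, 1] \<in> carrier_mat 4 1"
    using kets_carrier[of "[0, 0]"] kets_carrier[of "[1, 1]"] by simp_all
  fix i j assume "i < dim_row (mat 4 2 (\<lambda>(i, j). if i = 3 * j then 1 else 0 :: complex))" "j < dim_col (mat 4 2 (\<lambda>(i, j). if i = 3 * j then 1 else 0 :: complex))"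
  then have "i = 0 \<or> i = 1 \<or> i = 2 \<or> i = 3" "j = 0 \<or> j = 1" by auto
  then show "encode1 $$ (i, j) = mat 4 2 (\<lambda>(i, j). if i = 3 * j then 1 else 0) $$ (i, j)"
    using c by (elim disjE; simp add: encode1_def scalar_prod_def kets_def kron_def ket_def)
qed (auto simp: encode1_def kets_def ket_def)

lemma encode1_carrier: "encode1 \<in> carrier_mat 4 2"
  by (simp add: encode1_eq)

lemma sum4: "(\<Sum>k = 0..<4. f k) = f 0 + f (Suc 0) + f 2 + f (3 :: nat)" for f :: "nat \<Rightarrow> complex"
  by (simp add: eval_nat_numeral)

lemma sum2: "(\<Sum>k = 0..<2. f k) = f 0 + f (Suc 0 :: nat)" for f :: "nat \<Rightarrow> complex"
  by (simp add: eval_nat_numeral)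

lemma encode1_isometry: "mat_adjoint encode1 * encode1 = 1\<^sub>m 2"
  by (rule eq_mat2I) (auto simp: encode1_eq scalar_prod_def sum4 intro!: mult_carrier_mat[of _ 2 4 _ 2])

lemma sigma_kron_carrier: "sigma_z \<otimes>\<^sub>K 1\<^sub>m 2 \<in> carrier_mat 4 4" "sigma_x \<otimes>\<^sub>K sigma_x \<in> carrier_mat 4 4"
  using kron_carrier[OF sigma_carrier(3) one_carrier_mat[of 2]] kron_carrier[OF sigma_carrier(1,1)] by simp_all

text \<open>Z on one site and X on both sites of a block are the logical Z and X; they are the two
  operators that pairs of neighbouring particles generate.\<close>

lemma encode1_intertwine:
  "(sigma_z \<otimes>\<^sub>K 1\<^sub>m 2) * encode1 = encode1 * sigma_z" "(sigma_x \<otimes>\<^sub>K sigma_x) * encode1 = encode1 * sigma_x"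
proof -
  have e: "A = B" if "A \<in> carrier_mat 4 2" "B \<in> carrier_mat 4 2" "\<forall>i\<in>{0, 1, 2, 3}. \<forall>j\<in>{0, 1}. A $$ (i, j) = B $$ (i, j)" for A B :: "complex mat"
  proof (rule eq_matI)
    fix i j assume "i < dim_row B" "j < dim_col B"
    then have "i \<in> {0, 1, 2, 3}" "j \<in> {0, 1}" using that(2) by auto
    then show "A $$ (i, j) = B $$ (i, j)" using that(3) by blast
  qed (use that in auto)
  note c = mult_carrier_mat[OF sigma_kron_carrier(1) encode1_carrier] mult_carrier_mat[OF sigma_kron_carrier(2) encode1_carrier]
    mult_carrier_mat[OF encode1_carrier sigma_carrier(3)] mult_carrier_mat[OF encode1_carrier sigma_carrier(1)]
  show "(sigma_z \<otimes>\<^sub>K 1\<^sub>m 2) * encode1 = encode1 * sigma_z"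
    by (rule e[OF c(1,3)]) (simp add: encode1_eq scalar_prod_def sum4 sum2 sigma_index)
  show "(sigma_x \<otimes>\<^sub>K sigma_x) * encode1 = encode1 * sigma_x"
    by (rule e[OF c(2,4)]) (simp add: encode1_eq scalar_prod_def sum4 sum2 sigma_index)
qed

lemma four_pow: "(4 :: nat) ^ n = 2 ^ (2 * n)"
  by (simp add: power_mult)

lemma tensor_replicate_one: "tensor (replicate n (1\<^sub>m d)) = 1\<^sub>m (d ^ n)"
  by (induction n) simp_all

lemma encoder_carrier: "encoder N \<in> carrier_mat (2 ^ (2 * N)) (2 ^ N)"
proof -
  have "tensor (replicate N encode1) \<in> carrier_mat (4 ^ length (replicate N encode1)) (2 ^ length (replicate N encode1))"
    by (rule tensor_carrier) (auto simp: encode1_carrier)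
  then show ?thesis by (simp add: encoder_def four_pow)
qed

lemma encoder_isometry: "mat_adjoint (encoder N) * encoder N = 1\<^sub>m (2 ^ N)"
proof -
  have "mat_adjoint (encoder N) * encoder N = tensor (map2 (*) (replicate N (mat_adjoint encode1)) (replicate N encode1))"
    unfolding encoder_def tensor_adj map_replicate
    by (rule tensor_mult[of _ _ 2 4 2]) (auto simp: encode1_carrier)
  also have "map2 (*) (replicate N (mat_adjoint encode1)) (replicate N encode1) = replicate N (1\<^sub>m 2)"
    by (simp add: zip_replicate encode1_isometry map_replicate_const)
  finally show ?thesis by (simp add: tensor_replicate_one)
qed

definition on_block :: "nat \<Rightarrow> nat \<Rightarrow> complex mat \<Rightarrow> complex mat" where
  "on_block N i M = tensor (replicate i (1\<^sub>m 4) @ [M] @ replicate (N - 1 - i) (1\<^sub>m 4))"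

lemma on_block_carrier:
  assumes "i < N" "M \<in> carrier_mat 4 4"
  shows "on_block N i M \<in> cm (2 * N)"
proof -
  have "on_block N i M \<in> carrier_mat (4 ^ length (replicate i (1\<^sub>m 4 :: complex mat) @ [M] @ replicate (N - 1 - i) (1\<^sub>m 4)))
      (4 ^ length (replicate i (1\<^sub>m 4 :: complex mat) @ [M] @ replicate (N - 1 - i) (1\<^sub>m 4)))"
    unfolding on_block_def by (rule tensor_carrier) (use assms in auto)
  then show ?thesis using assms by (simp add: four_pow)
qed

lemma on_qubit_carrier:
  assumes "i < N" "M \<in> carrier_mat 2 2"
  shows "on_qubit N i M \<in> cm N"
proof -
  have "on_qubit N i M \<in> carrier_mat (2 ^ length (replicate i (1\<^sub>m 2 :: complex mat) @ [M] @ replicate (N - 1 - i) (1\<^sub>m 2)))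
      (2 ^ length (replicate i (1\<^sub>m 2 :: complex mat) @ [M] @ replicate (N - 1 - i) (1\<^sub>m 2)))"
    unfolding on_qubit_def by (rule tensor_carrier) (use assms in auto)
  then show ?thesis using assms by simp
qed

lemma on_block_encoder:
  assumes "i < N" "M \<in> carrier_mat 4 4" "L \<in> carrier_mat 2 2" "M * encode1 = encode1 * L"
  shows "on_block N i M * encoder N = encoder N * on_qubit N i L"
proof -
  let ?k = "N - 1 - i"
  have N: "replicate N encode1 = replicate i encode1 @ [encode1] @ replicate ?k encode1"
    using assms(1) by (simp flip: replicate_Suc replicate_add)
  have "on_block N i M * encoder N = tensor (map2 (*) (replicate i (1\<^sub>m 4) @ [M] @ replicate ?k (1\<^sub>m 4)) (replicate i encode1 @ [encode1] @ replicate ?k encode1))"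
    unfolding on_block_def encoder_def N by (rule tensor_mult[of _ _ 4 4 2]) (use assms encode1_carrier in auto)
  also have "map2 (*) (replicate i (1\<^sub>m 4) @ [M] @ replicate ?k (1\<^sub>m 4)) (replicate i encode1 @ [encode1] @ replicate ?k encode1)
     = map2 (*) (replicate i encode1 @ [encode1] @ replicate ?k encode1) (replicate i (1\<^sub>m 2) @ [L] @ replicate ?k (1\<^sub>m 2))"
    using assms(4) encode1_carrier by (simp add: zip_replicate map_replicate_const)
  also have "tensor \<dots> = encoder N * on_qubit N i L"
    unfolding on_qubit_def encoder_def N by (rule tensor_mult[of _ _ 4 2 2, symmetric]) (use assms encode1_carrier in auto)
  finally show ?thesis .
qed

lemma emb_on_block:
  assumes "i < N" "M \<in> carrier_mat 4 4"
  shows "emb 0 (2 * N) (on_block N i M) = emb (2 * i) 2 M"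
proof -
  have M: "M \<in> cm 2" using assms(2) by simp
  have k: "2 * N = 2 * i + (2 + 2 * (N - 1 - i))" using assms(1) by simp
  have o: "(1\<^sub>m (4 ^ i) :: complex mat) = 1\<^sub>m (2 ^ (2 * i))" "(1\<^sub>m (4 ^ (N - 1 - i)) :: complex mat) = 1\<^sub>m (2 ^ (2 * (N - 1 - i)))"
    by (simp_all add: four_pow)
  have r: "M \<otimes>\<^sub>K 1\<^sub>m (2 ^ (2 * (N - 1 - i))) \<in> cm (2 + 2 * (N - 1 - i))"
    using kron_carrier[OF M one_carrier_mat[of "2 ^ (2 * (N - 1 - i))"]] by (simp add: power_add)
  have "on_block N i M = 1\<^sub>m (2 ^ (2 * i)) \<otimes>\<^sub>K (M \<otimes>\<^sub>K 1\<^sub>m (2 ^ (2 * (N - 1 - i))))"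
    unfolding on_block_def by (simp add: tensor_append tensor_replicate_one four_pow)
  then have "emb 0 (2 * N) (on_block N i M) = emb 0 (2 * i) (1\<^sub>m (2 ^ (2 * i))) * emb (0 + 2 * i) (2 + 2 * (N - 1 - i)) (M \<otimes>\<^sub>K 1\<^sub>m (2 ^ (2 * (N - 1 - i))))"
    unfolding k using emb_kron[OF one_carrier_mat r, of 0 "2 * i"] k by simp
  also have "\<dots> = emb (2 * i) 2 M"
    using emb_kron[OF M one_carrier_mat, of "2 * i" "2 * (N - 1 - i)"] by simp
  finally show ?thesis .
qed

lemma emb_on_qubit:
  assumes "i < N" "M \<in> carrier_mat 2 2"
  shows "emb 0 N (on_qubit N i M) = site i M"
proof -
  let ?l = "replicate i (1\<^sub>m 2) @ [M] @ replicate (N - 1 - i) (1\<^sub>m 2)"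
  have "emb 0 (length ?l) (tensor ?l) = sites 0 ?l"
    by (rule emb_tensor) (use assms in auto)
  then show ?thesis using assms by (simp add: on_qubit_def sites_append)
qed

text \<open>\<open>K\<close> acts on encoded states as \<open>L\<close> does on the logical ones.\<close>

definition acts_logically :: "nat \<Rightarrow> complex mat \<Rightarrow> complex mat \<Rightarrow> bool" where
  "acts_logically N K L \<longleftrightarrow> K \<in> cm (2 * N) \<and> L \<in> cm N \<and> K * encoder N = encoder N * L"

lemma acts_logically_mult:
  assumes "acts_logically N K L" "acts_logically N K' L'" shows "acts_logically N (K * K') (L * L')"
proof -
  have c: "K \<in> cm (2 * N)" "K' \<in> cm (2 * N)" "L \<in> cm N" "L' \<in> cm N" using assms by (simp_all add: acts_logically_def)
  have e: "encoder N \<in> carrier_mat (2 ^ (2 * N)) (2 ^ N)" by (rule encoder_carrier)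
  have "K * K' * encoder N = K * (encoder N * L')"
    using assoc_mult_mat[OF c(1,2) e] assms(2) by (simp add: acts_logically_def)
  also have "\<dots> = encoder N * L * L'" using assoc_mult_mat[OF c(1) e c(4)] assms(1) by (simp add: acts_logically_def)
  also have "\<dots> = encoder N * (L * L')" by (rule assoc_mult_mat[OF e c(3,4)])
  finally show ?thesis using c by (simp add: acts_logically_def mult_carrier_mat[OF c(1,2)] mult_carrier_mat[OF c(3,4)])
qed

lemma acts_logically_one: "acts_logically N (1\<^sub>m (2 ^ (2 * N))) (1\<^sub>m (2 ^ N))"
  using encoder_carrier[of N] by (simp add: acts_logically_def)

lemma acts_logically_add:
  assumes "acts_logically N K L" "acts_logically N K' L'" shows "acts_logically N (K + K') (L + L')"
  using assms add_mult_distrib_mat[of K "2 ^ (2 * N)" "2 ^ (2 * N)" K' "encoder N" "2 ^ N"]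
    mult_add_distrib_mat[of "encoder N" "2 ^ (2 * N)" "2 ^ N" L "2 ^ N" L'] encoder_carrier[of N]
  by (simp add: acts_logically_def)

lemma acts_logically_smult:
  assumes "acts_logically N K L" shows "acts_logically N (a \<cdot>\<^sub>m K) (a \<cdot>\<^sub>m L)"
  using assms mult_smult_assoc_mat[of K "2 ^ (2 * N)" "2 ^ (2 * N)" "encoder N" "2 ^ N" a]
    mult_smult_distrib[of "encoder N" "2 ^ (2 * N)" "2 ^ N" L "2 ^ N" a] encoder_carrier[of N]
  by (simp add: acts_logically_def)

lemma pair_on_block:
  assumes "q < N"
  shows "majorana (2 * N) (4 * q + 1) * majorana (2 * N) (4 * q + 2) = \<i> \<cdot>\<^sub>m on_block N q (sigma_z \<otimes>\<^sub>K 1\<^sub>m 2)"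
    "majorana (2 * N) (4 * q + 2) * majorana (2 * N) (4 * q + 3) = \<i> \<cdot>\<^sub>m on_block N q (sigma_x \<otimes>\<^sub>K sigma_x)"
proof -
  note c = on_block_carrier[OF assms sigma_kron_carrier(1)] on_block_carrier[OF assms sigma_kron_carrier(2)]
  have e: "emb (2 * q) 2 (A \<otimes>\<^sub>K B) = site (2 * q) A * site (Suc (2 * q)) B" if "A \<in> carrier_mat 2 2" "B \<in> carrier_mat 2 2" for A B
    using emb_kron_site[of A 1 B "2 * q"] that by (simp add: emb_site numeral_2_eq_2)
  have p: "4 * q + 1 \<le> 2 * (2 * N)" "4 * q + 2 \<le> 2 * (2 * N)" "4 * q + 3 \<le> 2 * (2 * N)" using assms by auto
  have "gam (4 * q + 1) * gam (4 * q + 2) = J * sZ (2 * q)" "gam (4 * q + 2) * gam (4 * q + 3) = J * (sX (2 * q) * sX (Suc (2 * q)))"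
    using gam_pair_Z[of "2 * q"] gam_pair_X[of "2 * q"] by simp_all
  then have "emb 0 (2 * N) (majorana (2 * N) (4 * q + 1) * majorana (2 * N) (4 * q + 2)) = emb 0 (2 * N) (\<i> \<cdot>\<^sub>m on_block N q (sigma_z \<otimes>\<^sub>K 1\<^sub>m 2))"
    "emb 0 (2 * N) (majorana (2 * N) (4 * q + 2) * majorana (2 * N) (4 * q + 3)) = emb 0 (2 * N) (\<i> \<cdot>\<^sub>m on_block N q (sigma_x \<otimes>\<^sub>K sigma_x))"
    using emb_pair[of "4 * q + 1" "2 * N" "4 * q + 2" 0] emb_pair[of "4 * q + 2" "2 * N" "4 * q + 3" 0] p c
    by (simp_all add: emb_smult emb_on_block[OF assms] sigma_kron_carrier e J_def)
  then show "majorana (2 * N) (4 * q + 1) * majorana (2 * N) (4 * q + 2) = \<i> \<cdot>\<^sub>m on_block N q (sigma_z \<otimes>\<^sub>K 1\<^sub>m 2)"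
    "majorana (2 * N) (4 * q + 2) * majorana (2 * N) (4 * q + 3) = \<i> \<cdot>\<^sub>m on_block N q (sigma_x \<otimes>\<^sub>K sigma_x)"
    using p c by (auto intro!: emb_inject[of _ "2 * N" _ 0] pair_carrier)
qed

lemma acts_logically_pair:
  assumes "q < N"
  shows "acts_logically N (majorana (2 * N) (4 * q + 1) * majorana (2 * N) (4 * q + 2)) (\<i> \<cdot>\<^sub>m on_qubit N q sigma_z)"
    "acts_logically N (majorana (2 * N) (4 * q + 2) * majorana (2 * N) (4 * q + 3)) (\<i> \<cdot>\<^sub>m on_qubit N q sigma_x)"
  unfolding pair_on_block[OF assms]
  by (intro acts_logically_smult; simp add: acts_logically_def on_block_carrier on_qubit_carrier sigma_kron_carrier assms on_block_encoder encode1_intertwine)+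

lemma scaleR_half_two: "(1 / 2) *\<^sub>R (2 :: op) = 1"
  using scaleR_2[of "1 :: op"] by (metis one_add_one scaleR_half_double)

text \<open>Besides identifying the intended gate, this shows that any branch given by such a map
  sends states to states.\<close>

definition realizes :: "nat \<Rightarrow> (op \<Rightarrow> op) \<Rightarrow> complex mat \<Rightarrow> bool" where
  "realizes n f K \<longleftrightarrow> K \<in> cm n \<and> mat_adjoint K * K = 1\<^sub>m (2 ^ n) \<and> (\<forall>A \<in> cm n. f (emb 0 n A) = emb 0 n (conj_by K A))"

lemma conj_by_mult:
  assumes "L \<in> carrier_mat a b" "K \<in> carrier_mat b c" "A \<in> carrier_mat c c"
  shows "conj_by (L * K) A = conj_by L (conj_by K A)"
proof -
  have L': "mat_adjoint L \<in> carrier_mat b a" and K': "mat_adjoint K \<in> carrier_mat c b" using assms by simp_all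
  have KA: "K * A \<in> carrier_mat b c" by (rule mult_carrier_mat[OF assms(2,3)])
  have "L * K * A * (mat_adjoint K * mat_adjoint L) = L * (K * A) * (mat_adjoint K * mat_adjoint L)"
    using assoc_mult_mat[OF assms] by simp
  also have "\<dots> = L * (K * A * (mat_adjoint K * mat_adjoint L))"
    by (rule assoc_mult_mat[OF assms(1) KA mult_carrier_mat[OF K' L']])
  also have "K * A * (mat_adjoint K * mat_adjoint L) = K * A * mat_adjoint K * mat_adjoint L"
    by (rule assoc_mult_mat[OF KA K' L', symmetric])
  also have "L * (K * A * mat_adjoint K * mat_adjoint L) = L * (K * A * mat_adjoint K) * mat_adjoint L"
    by (rule assoc_mult_mat[OF assms(1) mult_carrier_mat[OF KA K'] L', symmetric])
  finally show ?thesis unfolding conj_by_def using assms by (simp add: adj_mult[of L a b K c])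
qed

lemma realizes_comp:
  assumes "realizes n f K" "realizes n g L"
  shows "realizes n (\<lambda>X. g (f X)) (L * K)"
proof -
  have c: "K \<in> cm n" "L \<in> cm n" using assms by (simp_all add: realizes_def)
  have a: "mat_adjoint K \<in> cm n" "mat_adjoint L \<in> cm n" using c by simp_all
  have "mat_adjoint (L * K) * (L * K) = mat_adjoint K * (mat_adjoint L * (L * K))"
    using assoc_mult_mat[OF a(1,2) mult_carrier_mat[OF c(2,1)]] c by (simp add: adj_mult[of L "2^n" "2^n" K "2^n"])
  also have "mat_adjoint L * (L * K) = K"
    using assoc_mult_mat[OF a(2) c(2,1)] assms(2) c by (simp add: realizes_def)
  finally show ?thesis
    using assms mult_carrier_mat[OF c(2,1)] by (auto simp: realizes_def conj_by_mult[OF c(2,1)] conj_by_carrier)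
qed

lemma realizes_id: "realizes n (\<lambda>X. X) (1\<^sub>m (2 ^ n))"
  by (auto simp: realizes_def conj_by_def)

lemma realizesI:
  assumes "K \<in> cm n" "emb 0 n (mat_adjoint K) * emb 0 n K = 1" "\<And>X. f X = emb 0 n K * X * emb 0 n (mat_adjoint K)"
  shows "realizes n f K"
proof -
  have a: "mat_adjoint K \<in> cm n" using assms(1) by simp
  have "mat_adjoint K * K = 1\<^sub>m (2 ^ n)"
    by (rule emb_inject[of _ n _ 0]) (use assms(2) in \<open>simp_all add: emb_mult[OF a assms(1)] mult_carrier_mat[OF a assms(1)]\<close>)
  then show ?thesis using assms by (auto simp: realizes_def emb_conj_by)
qed

lemma gam_inverse:
  assumes "1 \<le> p" "1 \<le> q" "p \<noteq> q"
  shows "(1 + gam p * gam q) * (1 - gam p * gam q) = 2"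
proof -
  have "gam p * gam q * (gam p * gam q) = - 1"
  proof -
    have "gam p * gam q * (gam p * gam q) = gam p * (gam q * gam p) * gam q" by (simp only: mult.assoc)
    also have "\<dots> = - (gam p * gam p * (gam q * gam q))" using gam_anti[OF assms(2,1)] assms(3) by (simp add: mult.assoc)
    finally show ?thesis by (simp add: gam_sq)
  qed
  then show ?thesis by (simp add: left_diff_distrib right_diff_distrib distrib_left distrib_right)
qed

abbreviation braid_op :: "nat \<Rightarrow> nat \<Rightarrow> op \<Rightarrow> op" where
  "braid_op p q X \<equiv> (1 / 2) *\<^sub>R ((1 - gam p * gam q) * X * (1 + gam p * gam q))"

lemma realizes_braid:
  assumes "1 \<le> p" "p < q" "q \<le> 2 * n"
  shows "realizes n (braid_op p q) (braid_gate n p q)"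
proof (rule realizesI)
  note e = emb_braid_gate(2,3)[OF assms, of 0, simplified]
  show "braid_gate n p q \<in> cm n" by (rule emb_braid_gate(1)[OF assms])
  show "emb 0 n (mat_adjoint (braid_gate n p q)) * emb 0 n (braid_gate n p q) = 1"
    unfolding e using gam_inverse[of p q] assms by (simp add: scaleR_half_two)
  show "braid_op p q X = emb 0 n (braid_gate n p q) * X * emb 0 n (mat_adjoint (braid_gate n p q))" for X
    unfolding e by simp
qed

lemma realizes_conj_gam:
  assumes "1 \<le> p" "p \<le> 2 * n" "1 \<le> q" "q \<le> 2 * n"
  shows "realizes n (conj_gam p q) (majorana n p * majorana n q)"
proof (rule realizesI)
  note e = emb_pair[OF assms, of 0, simplified] emb_pair[OF assms(3,4,1,2), of 0, simplified]
  show "majorana n p * majorana n q \<in> cm n" by (rule pair_carrier[OF assms])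
  have "gam q * gam p * (gam p * gam q) = gam q * (gam p * gam p) * gam q" by (simp only: mult.assoc)
  then show "emb 0 n (mat_adjoint (majorana n p * majorana n q)) * emb 0 n (majorana n p * majorana n q) = 1"
    unfolding pair_adj[OF assms] e by (simp add: gam_sq)
  show "conj_gam p q X = emb 0 n (majorana n p * majorana n q) * X * emb 0 n (mat_adjoint (majorana n p * majorana n q))" for X
    unfolding pair_adj[OF assms] e conj_gam_def ..
qed

text \<open>Existence is enough, because a faulty branch only has to output some state.\<close>

lemma realizes_data_faults:
  assumes "distinct_modes (2 * n) ds"
  shows "\<exists>K. realizes n (data_faults ds a b c) K"
proof -
  have d: "1 \<le> ds ! i" "ds ! i \<le> 2 * n" if "i < 4" for i using distinct_modes_nth[OF assms that] by auto
  have r: "\<exists>K. realizes n (if x then conj_gam (ds ! 0) (ds ! i) else id) K" if "i < 4" for x i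
    using realizes_conj_gam[of "ds ! 0" n "ds ! i"] d[of 0] d[OF that] realizes_id[of n] by (auto simp: id_def)
  obtain K1 K2 K3 where "realizes n (if a then conj_gam (ds ! 0) (ds ! 1) else id) K1" "realizes n (if b then conj_gam (ds ! 0) (ds ! 2) else id) K2"
    "realizes n (if c then conj_gam (ds ! 0) (ds ! 3) else id) K3"
    using r[of 1 a] r[of 2 b] r[of 3 c] by auto
  from realizes_comp[OF realizes_comp[OF this(3,2)] this(1)] show ?thesis
    unfolding data_faults_def[abs_def] by blast
qed

definition gate_mat :: "nat \<Rightarrow> nat list \<Rightarrow> complex mat" where
  "gate_mat n ds = complex_of_real (1 / sqrt 2) \<cdot>\<^sub>m (1\<^sub>m (2 ^ n) + (- \<i>) \<cdot>\<^sub>m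
     (majorana n (ds ! 0) * majorana n (ds ! 1) * (majorana n (ds ! 2) * majorana n (ds ! 3))))"

lemma realizes_gate:
  assumes "distinct_modes (2 * n) ds"
  shows "realizes n (gate ds) (gate_mat n ds)"
proof (rule realizesI)
  interpret clifford "fam (2 * n) ds" by (rule clifford_fam[OF assms])
  let ?g = "fam (2 * n) ds"
  have g: "gam (ds ! 0) = ?g 9" "gam (ds ! 1) = ?g 10" "gam (ds ! 2) = ?g 11" "gam (ds ! 3) = ?g 12"
    by (simp_all add: fam_def)
  have d: "1 \<le> ds ! i" "ds ! i \<le> 2 * n" if "i < 4" for i using distinct_modes_nth[OF assms that] by auto
  let ?A = "majorana n (ds ! 0) * majorana n (ds ! 1)" and ?B = "majorana n (ds ! 2) * majorana n (ds ! 3)"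
  let ?A' = "majorana n (ds ! 1) * majorana n (ds ! 0)" and ?B' = "majorana n (ds ! 3) * majorana n (ds ! 2)"
  have c: "?A \<in> cm n" "?B \<in> cm n" "?A' \<in> cm n" "?B' \<in> cm n" using d by (auto intro!: pair_carrier)
  have ab: "?A * ?B \<in> cm n" "?B' * ?A' \<in> cm n" by (rule mult_carrier_mat[OF c(1,2)], rule mult_carrier_mat[OF c(4,3)])
  have adj: "mat_adjoint ?A = ?A'" "mat_adjoint ?B = ?B'" using d by (auto intro!: pair_adj)
  have eA: "emb 0 n ?A = ?g 9 * ?g 10" "emb 0 n ?B = ?g 11 * ?g 12" "emb 0 n ?A' = ?g 10 * ?g 9" "emb 0 n ?B' = ?g 12 * ?g 11"
    using d emb_pair[of "ds ! 0" n "ds ! 1" 0] emb_pair[of "ds ! 2" n "ds ! 3" 0] emb_pair[of "ds ! 1" n "ds ! 0" 0] emb_pair[of "ds ! 3" n "ds ! 2" 0]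
    by (simp_all add: g del: One_nat_def)
  show "gate_mat n ds \<in> cm n" unfolding gate_mat_def using ab by simp
  have i: "sc (- \<i>) = - J" "sc \<i> = J" by (simp_all add: J_def sc_minus)
  have e1: "emb 0 n (gate_mat n ds) = (1 / sqrt 2) *\<^sub>R (1 - J * (?g 9 * ?g 10 * ?g 11 * ?g 12))"
    unfolding gate_mat_def using ab(1) emb_mult[OF c(1,2), of 0]
    by (simp add: emb_smult[of _ n] emb_add[of _ n] sc_scaleR i eA mult.assoc del: of_real_divide One_nat_def)
  have "mat_adjoint (gate_mat n ds) = complex_of_real (1 / sqrt 2) \<cdot>\<^sub>m (1\<^sub>m (2 ^ n) + \<i> \<cdot>\<^sub>m (?B' * ?A'))"
    unfolding gate_mat_def adj_smult using ab by (simp add: adj_add[of _ "2^n" "2^n"] adj_smult adj_mult[OF c(1,2)] adj del: One_nat_def)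
  moreover have "?g 12 * ?g 11 * (?g 10 * ?g 9) = ?g 9 * ?g 10 * ?g 11 * ?g 12" by (simp add: cl)
  ultimately have e2: "emb 0 n (mat_adjoint (gate_mat n ds)) = (1 / sqrt 2) *\<^sub>R (1 + J * (?g 9 * ?g 10 * ?g 11 * ?g 12))"
    using ab(2) emb_mult[OF c(4,3), of 0]
    by (simp add: emb_smult[of _ n] emb_add[of _ n] sc_scaleR i eA del: of_real_divide One_nat_def)
  have sq: "J * (?g 9 * ?g 10 * ?g 11 * ?g 12) * (J * (?g 9 * ?g 10 * ?g 11 * ?g 12)) = - 1"
    by (simp add: cl)
  have "(1 + Y) * (1 - Y) = 2" if "Y * Y = - 1" for Y :: op
    using that by (simp add: left_diff_distrib right_diff_distrib distrib_left distrib_right)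
  from this[OF sq] have "(1 + J * (?g 9 * ?g 10 * ?g 11 * ?g 12)) * (1 - J * (?g 9 * ?g 10 * ?g 11 * ?g 12)) = 2" .
  then show "emb 0 n (mat_adjoint (gate_mat n ds)) * emb 0 n (gate_mat n ds) = 1"
    unfolding e1 e2 by (simp add: scaleR_half_two)
  show "gate ds X = emb 0 n (gate_mat n ds) * X * emb 0 n (mat_adjoint (gate_mat n ds))" for X
    unfolding e1 e2 gate_def g by simp
qed

lemma acts_logically_braid:
  assumes "q < N"
  shows "acts_logically N (braid_gate (2 * N) (4 * q + 1) (4 * q + 2)) (complex_of_real (1 / sqrt 2) \<cdot>\<^sub>m (1\<^sub>m (2 ^ N) + (- 1) \<cdot>\<^sub>m (\<i> \<cdot>\<^sub>m on_qubit N q sigma_z)))"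
    "acts_logically N (braid_gate (2 * N) (4 * q + 2) (4 * q + 3)) (complex_of_real (1 / sqrt 2) \<cdot>\<^sub>m (1\<^sub>m (2 ^ N) + (- 1) \<cdot>\<^sub>m (\<i> \<cdot>\<^sub>m on_qubit N q sigma_x)))"
proof -
  have e: "braid_gate (2 * N) (4 * q + 1) (4 * q + 2) = complex_of_real (1 / sqrt 2) \<cdot>\<^sub>m (1\<^sub>m (2 ^ (2 * N)) + (- 1) \<cdot>\<^sub>m (majorana (2 * N) (4 * q + 1) * majorana (2 * N) (4 * q + 2)))"
    "braid_gate (2 * N) (4 * q + 2) (4 * q + 3) = complex_of_real (1 / sqrt 2) \<cdot>\<^sub>m (1\<^sub>m (2 ^ (2 * N)) + (- 1) \<cdot>\<^sub>m (majorana (2 * N) (4 * q + 2) * majorana (2 * N) (4 * q + 3)))"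
    using assms by (intro braid_gate_eq; simp)+
  show "acts_logically N (braid_gate (2 * N) (4 * q + 1) (4 * q + 2)) (complex_of_real (1 / sqrt 2) \<cdot>\<^sub>m (1\<^sub>m (2 ^ N) + (- 1) \<cdot>\<^sub>m (\<i> \<cdot>\<^sub>m on_qubit N q sigma_z)))"
    unfolding e(1) by (intro acts_logically_smult acts_logically_add acts_logically_one acts_logically_pair assms)
  show "acts_logically N (braid_gate (2 * N) (4 * q + 2) (4 * q + 3)) (complex_of_real (1 / sqrt 2) \<cdot>\<^sub>m (1\<^sub>m (2 ^ N) + (- 1) \<cdot>\<^sub>m (\<i> \<cdot>\<^sub>m on_qubit N q sigma_x)))"
    unfolding e(2) by (intro acts_logically_smult acts_logically_add acts_logically_one acts_logically_pair assms)
qed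

text \<open>The monomial is a product of two logical operators \<open>\<i> Z\<close>, one for each
  qubit, so the gate becomes the rotation \<open>(1 + \<i> Z Z) / sqrt 2\<close>.\<close>

lemma acts_logically_gate:
  assumes "i < N" "j < N"
  shows "acts_logically N (gate_mat (2 * N) [4 * i + 1, 4 * i + 2, 4 * j + 1, 4 * j + 2])
    (complex_of_real (1 / sqrt 2) \<cdot>\<^sub>m (1\<^sub>m (2 ^ N) + (- \<i>) \<cdot>\<^sub>m ((\<i> \<cdot>\<^sub>m on_qubit N i sigma_z) * (\<i> \<cdot>\<^sub>m on_qubit N j sigma_z))))"
proof -
  have l: "[a, b, c, d] ! 0 = a" "[a, b, c, d] ! 1 = b" "[a, b, c, d] ! 2 = c" "[a, b, c, d] ! 3 = d" for a b c d :: nat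
    by simp_all
  show ?thesis
    unfolding gate_mat_def l by (intro acts_logically_smult acts_logically_add acts_logically_one acts_logically_mult acts_logically_pair assms)
qed

lemma conj_by_phase:
  assumes "L \<in> carrier_mat a b" "\<rho> \<in> carrier_mat b b" "u * cnj u = 1"
  shows "conj_by (u \<cdot>\<^sub>m L) \<rho> = conj_by L \<rho>"
proof -
  have L': "mat_adjoint L \<in> carrier_mat b a" using assms(1) by simp
  have Lr: "L * \<rho> \<in> carrier_mat a b" by (rule mult_carrier_mat[OF assms(1,2)])
  have "(u \<cdot>\<^sub>m L) * \<rho> * (cnj u \<cdot>\<^sub>m mat_adjoint L) = (u \<cdot>\<^sub>m (L * \<rho>)) * (cnj u \<cdot>\<^sub>m mat_adjoint L)"
    using mult_smult_assoc_mat[OF assms(1,2)] by simp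
  also have "\<dots> = u \<cdot>\<^sub>m (cnj u \<cdot>\<^sub>m (L * \<rho> * mat_adjoint L))"
    using mult_smult_assoc_mat[OF Lr, of "cnj u \<cdot>\<^sub>m mat_adjoint L" a u] mult_smult_distrib[OF Lr L', of "cnj u"] L' by simp
  also have "\<dots> = L * \<rho> * mat_adjoint L"
    unfolding smult_smult_mat assms(3) by (rule eq_matI) auto
  finally show ?thesis by (simp add: conj_by_def adj_smult)
qed

lemma conj_by_encoder:
  assumes "acts_logically N K (u \<cdot>\<^sub>m L)" "L \<in> cm N" "u * cnj u = 1" "\<rho> \<in> cm N"
  shows "conj_by K (conj_by (encoder N) \<rho>) = conj_by (encoder N) (conj_by L \<rho>)"
proof -
  have K: "K \<in> cm (2 * N)" "K * encoder N = encoder N * (u \<cdot>\<^sub>m L)" using assms(1) by (simp_all add: acts_logically_def)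
  have uL: "u \<cdot>\<^sub>m L \<in> cm N" using assms(2) by simp
  show ?thesis
    unfolding conj_by_mult[OF K(1) encoder_carrier assms(4), symmetric] K(2)
      conj_by_mult[OF encoder_carrier uL assms(4)] conj_by_phase[OF assms(2,4,3)] ..
qed

lemma density_carrier: "density_op n \<rho> \<Longrightarrow> \<rho> \<in> cm n"
  by (simp add: density_op_def)

lemma implementable_braids:
  assumes "\<rho>\<^sub>8 \<in> cm 4" "0 < \<delta>"
    and wf: "well_formed P (2 * N) (2 * N)" and run: "\<And>X. run_op \<rho>\<^sub>8 P (2 * N) X = f X" and f: "realizes (2 * N) f K"
    and K: "acts_logically N K (u \<cdot>\<^sub>m L)" "L \<in> cm N" "u * cnj u = 1"
  shows "implementable \<rho>\<^sub>8 N L \<delta>"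
  unfolding implementable_def
proof (intro exI[of _ P] conjI allI impI wf)
  fix \<rho> assume r: "density_op N \<rho>"
  then have rc: "\<rho> \<in> cm N" by (rule density_carrier)
  have d0: "density_op (2 * N) (conj_by (encoder N) \<rho>)"
    by (rule density_conj_by[OF r encoder_carrier encoder_isometry])
  let ?\<rho> = "conj_by (encoder N) \<rho>" and ?\<tau> = "conj_by (encoder N) (conj_by L \<rho>)"
  have c: "?\<rho> \<in> cm (2 * N)" by (rule density_carrier[OF d0])
  have Kc: "K \<in> cm (2 * N)" "mat_adjoint K * K = 1\<^sub>m (2 ^ (2 * N))" using f by (simp_all add: realizes_def)
  have "run \<rho>\<^sub>8 P (2 * N) ?\<rho> \<in> cm (2 * N)" "emb 0 (2 * N) (run \<rho>\<^sub>8 P (2 * N) ?\<rho>) = emb 0 (2 * N) (conj_by K ?\<rho>)"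
    using run_emb[OF assms(1) wf c] f c by (simp_all add: run realizes_def)
  then have e: "run \<rho>\<^sub>8 P (2 * N) ?\<rho> = ?\<tau>"
    unfolding conj_by_encoder[OF K rc, symmetric] by (intro emb_inject[of _ "2 * N" _ 0] conj_by_carrier[OF Kc(1) c])
  have d: "density_op (2 * N) ?\<tau>"
    unfolding conj_by_encoder[OF K rc, symmetric] by (rule density_conj_by[OF d0 Kc])
  then have "?\<tau> \<in> cm (2 * N)" by (rule density_carrier)
  then have "?\<tau> = complex_of_real (1 - 0) \<cdot>\<^sub>m ?\<tau> + complex_of_real 0 \<cdot>\<^sub>m ?\<tau>"
    by (intro eq_matI) auto
  then show "\<exists>p \<tau>. 0 \<le> p \<and> p \<le> \<delta> \<and> p \<le> 1 \<and> density_op (2 * N) \<tau> \<and>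
      run \<rho>\<^sub>8 P (2 * N) ?\<rho> = complex_of_real (1 - p) \<cdot>\<^sub>m ?\<tau> + complex_of_real p \<cdot>\<^sub>m \<tau>"
    using d e assms(2) by (intro exI[of _ 0] exI[of _ ?\<tau>]) auto
qed

section \<open>Hadamard and phase gates from braids\<close>

abbreviation zrot :: "nat \<Rightarrow> nat \<Rightarrow> complex mat" where
  "zrot N q \<equiv> complex_of_real (1 / sqrt 2) \<cdot>\<^sub>m (1\<^sub>m (2 ^ N) + (- 1) \<cdot>\<^sub>m (\<i> \<cdot>\<^sub>m on_qubit N q sigma_z))"
abbreviation xrot :: "nat \<Rightarrow> nat \<Rightarrow> complex mat" where
  "xrot N q \<equiv> complex_of_real (1 / sqrt 2) \<cdot>\<^sub>m (1\<^sub>m (2 ^ N) + (- 1) \<cdot>\<^sub>m (\<i> \<cdot>\<^sub>m on_qubit N q sigma_x))"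

lemma emb_rot:
  assumes "q < N"
  shows "emb 0 N (zrot N q) = (1 / sqrt 2) *\<^sub>R (1 - J * sZ q)" "emb 0 N (xrot N q) = (1 / sqrt 2) *\<^sub>R (1 - J * sX q)"
    "zrot N q \<in> cm N" "xrot N q \<in> cm N"
proof -
  have m1: "sc (- 1) = - 1" using sc_minus[of 1] by simp
  show "zrot N q \<in> cm N" "xrot N q \<in> cm N" using on_qubit_carrier[OF assms] by simp_all
  show "emb 0 N (zrot N q) = (1 / sqrt 2) *\<^sub>R (1 - J * sZ q)" "emb 0 N (xrot N q) = (1 / sqrt 2) *\<^sub>R (1 - J * sX q)"
    using on_qubit_carrier[OF assms] assms
    by (simp_all add: emb_smult[of _ N] emb_add[of _ N] emb_on_qubit sc_scaleR m1 J_def[symmetric] del: of_real_divide)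
qed

text \<open>Logically a quarter turn about z, one about x and one about z again: the Euler
  decomposition of the Hadamard gate up to the phase \<open>- \<i>\<close>.\<close>

definition hadP :: "nat \<Rightarrow> protocol \<Rightarrow> protocol" where
  "hadP q K = Braid (4 * q + 1) (4 * q + 2) (Braid (4 * q + 2) (4 * q + 3) (Braid (4 * q + 1) (4 * q + 2) K))"

definition had_op :: "nat \<Rightarrow> op \<Rightarrow> op" where
  "had_op q X = braid_op (4 * q + 1) (4 * q + 2) (braid_op (4 * q + 2) (4 * q + 3) (braid_op (4 * q + 1) (4 * q + 2) X))"

abbreviation had_mat :: "nat \<Rightarrow> nat \<Rightarrow> complex mat" where
  "had_mat N q \<equiv> braid_gate (2 * N) (4 * q + 1) (4 * q + 2) * (braid_gate (2 * N) (4 * q + 2) (4 * q + 3) * braid_gate (2 * N) (4 * q + 1) (4 * q + 2))"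

lemma run_op_hadP: "run_op \<rho> (hadP q K) n X = run_op \<rho> K n (had_op q X)"
  by (simp add: hadP_def had_op_def)

lemma hadP_wf: "q < N \<Longrightarrow> well_formed (hadP q K) (2 * N) m = well_formed K (2 * N) m"
  by (simp add: hadP_def)

lemma realizes_had: "q < N \<Longrightarrow> realizes (2 * N) (had_op q) (had_mat N q)"
proof -
  assume "q < N"
  then have b: "realizes (2 * N) (braid_op (4 * q + 1) (4 * q + 2)) (braid_gate (2 * N) (4 * q + 1) (4 * q + 2))"
     "realizes (2 * N) (braid_op (4 * q + 2) (4 * q + 3)) (braid_gate (2 * N) (4 * q + 2) (4 * q + 3))"
    by (intro realizes_braid; simp)+
  show ?thesis
    unfolding had_op_def[abs_def] by (rule realizes_comp[OF realizes_comp[OF b(1,2)] b(1)])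
qed

lemma site_hadamard: "site q hadamard = (1 / sqrt 2) *\<^sub>R (sX q + sZ q)" "hadamard \<in> carrier_mat 2 2"
proof -
  show c: "hadamard \<in> carrier_mat 2 2" by (rule carrier_matI) (simp_all add: hadamard_def mat_of_rows_list_def)
  have "hadamard = complex_of_real (1 / sqrt 2) \<cdot>\<^sub>m (sigma_x + sigma_z)"
    by (rule eq_mat2I) (use c in \<open>simp_all add: hadamard_def mat_of_rows_list_def sigma_index\<close>)
  from arg_cong[OF this, of "site q"] show "site q hadamard = (1 / sqrt 2) *\<^sub>R (sX q + sZ q)"
    by (simp only: site_smult[of "sigma_x + sigma_z"] site_add sigma_carrier add_carrier_mat sc_scaleR)
qed

lemma zxz: "(1 - J * sZ q) * ((1 - J * sX q) * (1 - J * sZ q)) = - (2 *\<^sub>R (J * (sX q + sZ q)))"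
proof -
  have j: "sZ q * J = J * sZ q" "sX q * J = J * sX q" "sZ q * (J * y) = J * (sZ q * y)" "sX q * (J * y) = J * (sX q * y)" for y
    by (rule J_central J_central')+
  show ?thesis
    by (simp add: algebra_simps j J_J' J_J site_sigma_mult scaleR_2 mult.assoc)
qed

lemma had_logical:
  assumes "q < N"
  shows "zrot N q * (xrot N q * zrot N q) = (- \<i>) \<cdot>\<^sub>m on_qubit N q hadamard"
proof (rule emb_inject[of _ N _ 0])
  note c = emb_rot(3,4)[OF assms] and h = on_qubit_carrier[OF assms site_hadamard(2)]
  show "zrot N q * (xrot N q * zrot N q) \<in> cm N" by (rule mult_carrier_mat[OF c(1) mult_carrier_mat[OF c(2,1)]])
  show "(- \<i>) \<cdot>\<^sub>m on_qubit N q hadamard \<in> cm N" using h by simp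
  have "emb 0 N (zrot N q * (xrot N q * zrot N q)) = (1 / sqrt 2) *\<^sub>R ((1 / sqrt 2) *\<^sub>R ((1 / sqrt 2) *\<^sub>R ((1 - J * sZ q) * ((1 - J * sX q) * (1 - J * sZ q)))))"
    unfolding emb_mult[OF c(1) mult_carrier_mat[OF c(2,1)]] emb_mult[OF c(2,1)] emb_rot(1,2)[OF assms] by simp
  also have "\<dots> = - ((1 / sqrt 2) *\<^sub>R (J * (sX q + sZ q)))"
    unfolding zxz by simp
  also have "\<dots> = emb 0 N ((- \<i>) \<cdot>\<^sub>m on_qubit N q hadamard)"
    unfolding emb_smult[OF h] emb_on_qubit[OF assms site_hadamard(2)] site_hadamard(1) by (simp add: sc_minus J_def)
  finally show "emb 0 N (zrot N q * (xrot N q * zrot N q)) = emb 0 N ((- \<i>) \<cdot>\<^sub>m on_qubit N q hadamard)" .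
qed

lemma acts_logically_had: "q < N \<Longrightarrow> acts_logically N (had_mat N q) ((- \<i>) \<cdot>\<^sub>m on_qubit N q hadamard)"
  unfolding had_logical[symmetric] by (intro acts_logically_mult acts_logically_braid)

lemma implementable_hadamard:
  assumes "\<rho>\<^sub>8 \<in> cm 4" "0 < \<delta>" "i < N"
  shows "implementable \<rho>\<^sub>8 N (on_qubit N i hadamard) \<delta>"
proof (rule implementable_braids[OF assms(1,2)])
  show "well_formed (hadP i Done) (2 * N) (2 * N)" by (simp add: hadP_wf assms)
  show "run_op \<rho>\<^sub>8 (hadP i Done) (2 * N) X = had_op i X" for X by (simp add: run_op_hadP)
  show "realizes (2 * N) (had_op i) (had_mat N i)" by (rule realizes_had[OF assms(3)])
  show "acts_logically N (had_mat N i) ((- \<i>) \<cdot>\<^sub>m on_qubit N i hadamard)" by (rule acts_logically_had[OF assms(3)])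
  show "on_qubit N i hadamard \<in> cm N" by (rule on_qubit_carrier[OF assms(3) site_hadamard(2)])
qed simp

lemma phase_carrier: "phase_gate \<in> carrier_mat 2 2"
  by (rule carrier_matI) (simp_all add: phase_gate_def mat_of_rows_list_def)

lemma site_phase: "site q phase_gate = (1 / 2) *\<^sub>R ((1 + J) + (1 - J) * sZ q)"
proof -
  have "phase_gate = ((1 + \<i>) / 2) \<cdot>\<^sub>m 1\<^sub>m 2 + ((1 - \<i>) / 2) \<cdot>\<^sub>m sigma_z"
    by (rule eq_mat2I) (use phase_carrier in \<open>simp_all add: phase_gate_def mat_of_rows_list_def sigma_index field_simps\<close>)
  from arg_cong[OF this, of "site q"] have p: "site q phase_gate = sc ((1 + \<i>) / 2) + sc ((1 - \<i>) / 2) * sZ q"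
    by (simp only: site_add site_smult sigma_carrier one_carrier_mat smult_carrier_mat site_one mult_1_right)
  have "(1 + \<i>) / 2 = complex_of_real (1 / 2) * (1 + \<i>)" "(1 - \<i>) / 2 = complex_of_real (1 / 2) * (1 + - \<i>)"
    by simp_all
  moreover have "sc (1 + - \<i>) = 1 - J" using sc_add[of 1 "- \<i>"] by (simp add: sc_minus J_def)
  ultimately have "sc ((1 + \<i>) / 2) = (1 / 2) *\<^sub>R (1 + J)" "sc ((1 - \<i>) / 2) = (1 / 2) *\<^sub>R (1 - J)"
    by (simp_all only: sc_mult sc_scaleR sc_add[of 1 \<i>] sc_1 J_def)
  with p show ?thesis by (simp add: scaleR_add_right)
qed

text \<open>The phase by which the braid \<open>(1 - \<i> Z) / sqrt 2\<close> differs from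
  \<open>diag(1, \<i>)\<close>.\<close>

definition ph :: complex where "ph = complex_of_real (1 / sqrt 2) * (1 - \<i>)"

lemma ph_unit: "ph * cnj ph = 1"
proof -
  have "complex_of_real (1 / sqrt 2) * complex_of_real (1 / sqrt 2) = 1 / 2"
    by (simp flip: of_real_mult)
  moreover have "(1 - \<i>) * cnj (1 - \<i>) = 2" by (simp add: algebra_simps)
  moreover have "ph * cnj ph = complex_of_real (1 / sqrt 2) * complex_of_real (1 / sqrt 2) * ((1 - \<i>) * cnj (1 - \<i>))"
    by (simp add: ph_def)
  ultimately show ?thesis by simp
qed

lemma sc_ph: "sc ph = (1 / sqrt 2) *\<^sub>R (1 - J)"
  unfolding ph_def sc_mult sc_scaleR using sc_add[of 1 "- \<i>"] by (simp add: sc_minus J_def)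

lemma phase_logical:
  assumes "q < N"
  shows "zrot N q = ph \<cdot>\<^sub>m on_qubit N q phase_gate"
proof (rule emb_inject[of _ N _ 0])
  note h = on_qubit_carrier[OF assms phase_carrier]
  show "zrot N q \<in> cm N" by (rule emb_rot(3)[OF assms])
  show "ph \<cdot>\<^sub>m on_qubit N q phase_gate \<in> cm N" using h by simp
  have "(1 - J) * (1 + J) = 2" "(1 - J) * ((1 - J) * sZ q) = - (2 *\<^sub>R (J * sZ q))"
    by (simp_all add: algebra_simps J_J J_J' scaleR_2)
  then have "(1 - J) * ((1 + J) + (1 - J) * sZ q) = 2 *\<^sub>R (1 - J * sZ q)"
    by (simp add: distrib_left scaleR_2 algebra_simps)
  then show "emb 0 N (zrot N q) = emb 0 N (ph \<cdot>\<^sub>m on_qubit N q phase_gate)"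
    unfolding emb_rot(1)[OF assms] emb_smult[OF h] emb_on_qubit[OF assms phase_carrier] site_phase sc_ph by simp
qed

lemma implementable_phase:
  assumes "\<rho>\<^sub>8 \<in> cm 4" "0 < \<delta>" "i < N"
  shows "implementable \<rho>\<^sub>8 N (on_qubit N i phase_gate) \<delta>"
proof (rule implementable_braids[OF assms(1,2)])
  show "well_formed (Braid (4 * i + 1) (4 * i + 2) Done) (2 * N) (2 * N)" using assms(3) by simp
  show "run_op \<rho>\<^sub>8 (Braid (4 * i + 1) (4 * i + 2) Done) (2 * N) X = braid_op (4 * i + 1) (4 * i + 2) X" for X by simp
  show "realizes (2 * N) (braid_op (4 * i + 1) (4 * i + 2)) (braid_gate (2 * N) (4 * i + 1) (4 * i + 2))"
    using assms(3) by (intro realizes_braid) auto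
  show "acts_logically N (braid_gate (2 * N) (4 * i + 1) (4 * i + 2)) (ph \<cdot>\<^sub>m on_qubit N i phase_gate)"
    unfolding phase_logical[OF assms(3), symmetric] by (rule acts_logically_braid[OF assms(3)])
  show "on_qubit N i phase_gate \<in> cm N" by (rule on_qubit_carrier[OF assms(3) phase_carrier])
  show "ph * cnj ph = 1" by (rule ph_unit)
qed

section \<open>The controlled NOT\<close>

abbreviation zz_gate :: "nat \<Rightarrow> nat \<Rightarrow> nat \<Rightarrow> complex mat" where
  "zz_gate N i j \<equiv> complex_of_real (1 / sqrt 2) \<cdot>\<^sub>m (1\<^sub>m (2 ^ N) + (- \<i>) \<cdot>\<^sub>m ((\<i> \<cdot>\<^sub>m on_qubit N i sigma_z) * (\<i> \<cdot>\<^sub>m on_qubit N j sigma_z)))"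

lemma emb_zz_gate:
  assumes "i < N" "j < N"
  shows "zz_gate N i j \<in> cm N" "emb 0 N (zz_gate N i j) = (1 / sqrt 2) *\<^sub>R (1 + J * (sZ i * sZ j))"
proof -
  have z: "on_qubit N q sigma_z \<in> cm N" "\<i> \<cdot>\<^sub>m on_qubit N q sigma_z \<in> cm N"
    "emb 0 N (\<i> \<cdot>\<^sub>m on_qubit N q sigma_z) = J * sZ q" if "q < N" for q
    using on_qubit_carrier[OF that sigma_carrier(3)] by (simp_all add: emb_smult[of _ N] emb_on_qubit that J_def)
  have c: "(\<i> \<cdot>\<^sub>m on_qubit N i sigma_z) * (\<i> \<cdot>\<^sub>m on_qubit N j sigma_z) \<in> cm N"
    by (rule mult_carrier_mat[OF z(2)[OF assms(1)] z(2)[OF assms(2)]])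
  have i: "sc (- \<i>) = - J" by (simp add: J_def sc_minus)
  have j: "sZ i * (J * y) = J * (sZ i * y)" for y by (rule J_central')
  show "zz_gate N i j \<in> cm N" using c by simp
  show "emb 0 N (zz_gate N i j) = (1 / sqrt 2) *\<^sub>R (1 + J * (sZ i * sZ j))"
    using c emb_mult[OF z(2)[OF assms(1)] z(2)[OF assms(2)], of 0]
    by (simp add: emb_smult[of _ N] emb_add[of _ N] sc_scaleR i z(3) assms mult.assoc j J_J' del: of_real_divide)
qed

lemma cnot_carrier:
  assumes "i < N" "j < N"
  shows "cnot N i j \<in> cm N"
    "emb 0 N (cnot N i j) = (1 / 2) *\<^sub>R (1 + sZ i + sX j - sZ i * sX j)"
proof -
  note p = proj_ket_carrier
  note c = on_qubit_carrier[OF assms(1) p] on_qubit_carrier[OF assms(2) sigma_carrier(1)]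
  note m = mult_carrier_mat[OF c(1,2)]
  show "cnot N i j \<in> cm N" unfolding cnot_def by (rule add_carrier_mat[OF m])
  show "emb 0 N (cnot N i j) = (1 / 2) *\<^sub>R (1 + sZ i + sX j - sZ i * sX j)"
    unfolding cnot_def emb_add[OF c(1) m] emb_mult[OF c(1,2)] emb_on_qubit[OF assms(1) p] emb_on_qubit[OF assms(2) sigma_carrier(1)] site_proj_ket
    by (simp add: algebra_simps flip: scaleR_add_right scaleR_diff_right)
qed

text \<open>\<open>W\<close> and \<open>Z\<close> are the Pauli Z of control and target,
  \<open>X\<close> is the Pauli X of the target. The two Z rotations and the ZZ rotation form a
  controlled Z up to a phase; the Hadamards of the target, proportional to \<open>X + Z\<close>,
  turn it into the controlled NOT.\<close>

lemma cz_op: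
  fixes X Z W :: op
  assumes c: "W * X = X * W" "W * Z = Z * W" and s: "W * W = 1" "X * X = 1" "Z * Z = 1" "Z * X = - (X * Z)"
  shows "J * (X + Z) * ((1 - J * Z) * ((1 - J * W) * ((1 + J * (W * Z)) * (J * (X + Z))))) = - (4 *\<^sub>R ((1 - J) * ((1 / 2) *\<^sub>R (1 + W + X - W * X))))"
proof -
  have j: "X * J = J * X" "Z * J = J * Z" "W * J = J * W" "X * (J * y) = J * (X * y)" "Z * (J * y) = J * (Z * y)" "W * (J * y) = J * (W * y)" for y
    by (rule J_central J_central')+
  have a: "W * (X * y) = X * (W * y)" "W * (Z * y) = Z * (W * y)" "W * (W * y) = y" "X * (X * y) = y" "Z * (Z * y) = y" "Z * (X * y) = - (X * (Z * y))" for y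
    using c s by (simp_all flip: mult.assoc)
  have "(1 - J * Z) * ((1 - J * W) * (1 + J * (W * Z))) = (1 - J) * (1 + W + Z - W * Z)"
    by (simp add: distrib_left distrib_right left_diff_distrib right_diff_distrib mult.assoc j a c s J_J J_J')
  moreover have "(X + Z) * ((1 + W + Z - W * Z) * (X + Z)) = 2 *\<^sub>R (1 + W + X - W * X)"
    by (simp add: distrib_left distrib_right left_diff_distrib right_diff_distrib mult.assoc a c s scaleR_2)
  moreover have "J * (X + Z) * ((1 - J * Z) * ((1 - J * W) * ((1 + J * (W * Z)) * (J * (X + Z)))))
     = J * J * ((X + Z) * ((1 - J * Z) * ((1 - J * W) * (1 + J * (W * Z))) * (X + Z)))"
    by (simp only: mult.assoc J_central'[of "X + Z"] J_central'[of "1 - J * Z"] J_central'[of "1 - J * W"] J_central'[of "1 + J * (W * Z)"])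
  moreover have "(X + Z) * ((1 - J) * (1 + W + Z - W * Z) * (X + Z)) = (1 - J) * ((X + Z) * ((1 + W + Z - W * Z) * (X + Z)))"
    using J_central[of "X + Z"] by (simp add: mult.assoc[symmetric] right_diff_distrib left_diff_distrib)
  ultimately show ?thesis by (simp add: J_J)
qed

text \<open>The five factors belong to two Hadamards, two Z rotations and one ZZ rotation; the 4
  comes from \<open>cz_op\<close>.\<close>

lemma sqrt2_fifth: "(1 / sqrt 2) *\<^sub>R ((1 / sqrt 2) *\<^sub>R ((1 / sqrt 2) *\<^sub>R ((1 / sqrt 2) *\<^sub>R ((1 / sqrt 2) *\<^sub>R (4 *\<^sub>R Y))))) = (1 / sqrt 2) *\<^sub>R Y" for Y :: op
  by simp

abbreviation H_log :: "nat \<Rightarrow> nat \<Rightarrow> complex mat" where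
  "H_log N j \<equiv> (- \<i>) \<cdot>\<^sub>m on_qubit N j hadamard"

lemma emb_H_log:
  assumes "j < N"
  shows "H_log N j \<in> cm N" "emb 0 N (H_log N j) = - ((1 / sqrt 2) *\<^sub>R (J * (sX j + sZ j)))"
  using on_qubit_carrier[OF assms site_hadamard(2)]
  by (simp_all add: emb_smult[of _ N] emb_on_qubit[OF assms site_hadamard(2)] site_hadamard(1) sc_minus J_def)

lemma cnot_logical:
  assumes "i < N" "j < N" "i \<noteq> j"
  shows "H_log N j * (zrot N j * (zrot N i * (zz_gate N i j * H_log N j))) = (- ph) \<cdot>\<^sub>m cnot N i j"
proof (rule emb_inject[of _ N _ 0])
  note h = emb_H_log[OF assms(2)] and g = emb_zz_gate[OF assms(1,2)] and z = emb_rot(1,3)[OF assms(1)] emb_rot(1,3)[OF assms(2)]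
    and c = cnot_carrier[OF assms(1,2)]
  note m1 = mult_carrier_mat[OF g(1) h(1)]
  note m2 = mult_carrier_mat[OF z(2) m1]
  note m3 = mult_carrier_mat[OF z(4) m2]
  show "H_log N j * (zrot N j * (zrot N i * (zz_gate N i j * H_log N j))) \<in> cm N" by (rule mult_carrier_mat[OF h(1) m3])
  show "(- ph) \<cdot>\<^sub>m cnot N i j \<in> cm N" using c(1) by simp
  have op: "J * (sX j + sZ j) * ((1 - J * sZ j) * ((1 - J * sZ i) * ((1 + J * (sZ i * sZ j)) * (J * (sX j + sZ j)))))
      = - (4 *\<^sub>R ((1 - J) * ((1 / 2) *\<^sub>R (1 + sZ i + sX j - sZ i * sX j))))"
    by (rule cz_op) (simp_all add: site_sigma_mult site_commute[OF assms(3)])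
  have "emb 0 N (H_log N j * (zrot N j * (zrot N i * (zz_gate N i j * H_log N j))))
    = (1 / sqrt 2) *\<^sub>R ((1 / sqrt 2) *\<^sub>R ((1 / sqrt 2) *\<^sub>R ((1 / sqrt 2) *\<^sub>R ((1 / sqrt 2) *\<^sub>R
       (J * (sX j + sZ j) * ((1 - J * sZ j) * ((1 - J * sZ i) * ((1 + J * (sZ i * sZ j)) * (J * (sX j + sZ j))))))))))"
    unfolding emb_mult[OF h(1) m3] emb_mult[OF z(4) m2] emb_mult[OF z(2) m1] emb_mult[OF g(1) h(1)] h(2) g(2) z(1,3)
    by (simp only: mult_scaleR_left mult_scaleR_right mult_minus_left mult_minus_right minus_minus scaleR_minus_right)
  also have "\<dots> = - ((1 / sqrt 2) *\<^sub>R ((1 - J) * ((1 / 2) *\<^sub>R (1 + sZ i + sX j - sZ i * sX j))))"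
    unfolding op scaleR_minus_right sqrt2_fifth ..
  also have "\<dots> = emb 0 N ((- ph) \<cdot>\<^sub>m cnot N i j)"
    unfolding emb_smult[OF c(1)] c(2) sc_minus sc_ph by (simp only: mult_scaleR_left mult_minus_left)
  finally show "emb 0 N (H_log N j * (zrot N j * (zrot N i * (zz_gate N i j * H_log N j)))) = emb 0 N ((- ph) \<cdot>\<^sub>m cnot N i j)" .
qed

text \<open>Indexes the branches of the protocol: \<open>None\<close> for a failed preparation,
  \<open>Some\<close> of a fault pattern otherwise.\<close>

lemma sum_option_triple:
  fixes f :: "(bool \<times> bool \<times> bool) option \<Rightarrow> 'x :: comm_monoid_add"
  shows "sum f UNIV = (\<Sum>a\<in>UNIV. \<Sum>b\<in>UNIV. \<Sum>c\<in>UNIV. f (Some (a, b, c))) + f None"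
proof -
  have "sum f UNIV = f None + sum f (range Some)" by (simp add: UNIV_option_conv)
  also have "sum f (range Some) = (\<Sum>s\<in>UNIV \<times> UNIV \<times> UNIV. f (Some s))" by (subst sum.reindex) simp_all
  also have "\<dots> = (\<Sum>a\<in>UNIV. \<Sum>b\<in>UNIV. \<Sum>c\<in>UNIV. f (Some (a, b, c)))"
    by (simp only: sum.cartesian_product')
  finally show ?thesis by (simp add: add.commute)
qed

text \<open>The output is a mixture of nine unitary images of the input; the fault-free one is the
  controlled NOT and has weight at least 1 - \<delta>.\<close>

lemma implementable_cnot:
  assumes \<rho>: "density_op 4 \<rho>\<^sub>8" "parity_op 4 * \<rho>\<^sub>8 = \<rho>\<^sub>8" "\<rho>\<^sub>8 * parity_op 4 = \<rho>\<^sub>8"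
    and \<epsilon>: "complex_of_real \<epsilon>\<^sub>8 = 1 - (mat_adjoint a8 * \<rho>\<^sub>8 * a8) $$ (0, 0)" "\<epsilon>\<^sub>8 < 0.38"
    and \<delta>: "0 < \<delta>" and ij: "i < N" "j < N" "i \<noteq> j"
  shows "implementable \<rho>\<^sub>8 N (cnot N i j) \<delta>"
proof -
  obtain p where p: "prep \<rho>\<^sub>8 p" "tot p = 1" "(mat_adjoint a8 * \<rho>\<^sub>8 * a8) $$ (0, 0) = complex_of_real (p False False False)"
    using prep_init[OF \<rho>] by blast
  have "complex_of_real \<epsilon>\<^sub>8 = complex_of_real (1 - p False False False)" using \<epsilon>(1) p(3) by simp
  then have "0.62 < p False False False" using \<epsilon>(2) unfolding of_real_eq_iff by simp
  then obtain q where q: "prep \<rho>\<^sub>8 q" "1 - \<delta> \<le> q False False False"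
    using prep_good[OF p(1,2) _ \<delta>] by blast
  from q(1) obtain G where q0: "\<And>a b c. 0 \<le> q a b c" "tot q \<le> 1"
    and wf: "\<And>n Ks Kf m. well_formed Ks (n + 4) m \<Longrightarrow> well_formed Kf n m \<Longrightarrow> well_formed (G n Ks Kf) n m"
    and run: "\<And>n Ks Kf X. X \<in> loc n \<Longrightarrow> run_op \<rho>\<^sub>8 (G n Ks Kf) n X = run_op \<rho>\<^sub>8 Ks (n + 4) (X * fault_mixture n q) + (1 - tot q) *\<^sub>R run_op \<rho>\<^sub>8 Kf n X"
    unfolding prep_def by blast
  define ds where "ds = [4 * i + 1, 4 * i + 2, 4 * j + 1, 4 * j + 2]"
  have ds: "distinct_modes (2 * (2 * N)) ds"
  proof -
    have "4 * i + 1 \<noteq> 4 * j + 2" "4 * i + 2 \<noteq> 4 * j + 1" by presburger+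
    then show ?thesis using ij by (auto simp: distinct_modes_def ds_def)
  qed
  define L where "L = Braid (4 * i + 1) (4 * i + 2) (Braid (4 * j + 1) (4 * j + 2) (hadP j Done))"
  define post where "post X = had_op j (braid_op (4 * j + 1) (4 * j + 2) (braid_op (4 * i + 1) (4 * i + 2) X))" for X
  \<comment> \<open>If no ancilla can be prepared, the protocol stops after the first Hadamard. This
    branch counts as an error, but it still outputs a state of the right size.\<close>
  define P where "P = hadP j (G (2 * N) (tele (2 * N) ds L) Done)"
  define f where "f a b c X = post (gate ds (data_faults ds a b c (had_op j X)))" for a b c X
  let ?B = "\<lambda>i. braid_gate (2 * N) (4 * i + 1) (4 * i + 2)"
  let ?K = "had_mat N j * (?B j * (?B i * (gate_mat (2 * N) ds * had_mat N j)))"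
  have L: "well_formed L (2 * N) (2 * N)" using ij by (simp add: L_def hadP_wf)
  have wfP: "well_formed P (2 * N) (2 * N)"
    unfolding P_def hadP_wf[OF ij(2)] by (rule wf[OF tele_wf[OF ds L]]) simp
  have runP: "run_op \<rho>\<^sub>8 P (2 * N) X = (\<Sum>a\<in>UNIV. \<Sum>b\<in>UNIV. \<Sum>c\<in>UNIV. q a b c *\<^sub>R f a b c X) + (1 - tot q) *\<^sub>R had_op j X"
    if "had_op j X \<in> loc (2 * N)" for X
    unfolding P_def run_op_hadP run[OF that] run_op_fault_mixture run_op_tele[OF ds that] by (simp add: L_def run_op_hadP f_def post_def)
  have had: "realizes (2 * N) (had_op j) (had_mat N j)" by (rule realizes_had[OF ij(2)])
  have b: "realizes (2 * N) (braid_op (4 * k + 1) (4 * k + 2)) (?B k)" if "k < N" for k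
    using that by (intro realizes_braid) auto
  note g = realizes_gate[OF ds]
  have FFF: "realizes (2 * N) (f False False False) ?K"
    using realizes_comp[OF realizes_comp[OF realizes_comp[OF realizes_comp[OF had g] b[OF ij(1)]] b[OF ij(2)]] had]
    unfolding f_def[abs_def] post_def by (simp add: data_faults_def)
  have "\<exists>K. realizes (2 * N) (f a b c) K" for a b c
  proof -
    obtain E where "realizes (2 * N) (data_faults ds a b c) E" using realizes_data_faults[OF ds] by blast
    from realizes_comp[OF realizes_comp[OF realizes_comp[OF realizes_comp[OF realizes_comp[OF had this] g] b[OF ij(1)]] b[OF ij(2)]] had]
    show ?thesis unfolding f_def[abs_def] post_def by blast
  qed
  then obtain K' where K': "\<And>a b c. realizes (2 * N) (f a b c) (K' a b c)" by metis
  define F where "F s = (case s of None \<Rightarrow> had_op j | Some (a, b, c) \<Rightarrow> f a b c)" for s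
  \<comment> \<open>The fault-free branch gets the explicit unitary \<open>?K\<close>, whose logical
    action is known; for a faulty branch any realizing unitary will do.\<close>
  define K where "K s = (case s of None \<Rightarrow> had_mat N j | Some (a, b, c) \<Rightarrow> if a \<or> b \<or> c then K' a b c else ?K)" for s
  define w where "w s = (case s of None \<Rightarrow> 1 - tot q | Some (a, b, c) \<Rightarrow> q a b c)" for s
  have K: "realizes (2 * N) (F s) (K s)" for s
    using had FFF K' by (auto simp: F_def K_def split: option.split)
  have KI: "acts_logically N ?K ((- ph) \<cdot>\<^sub>m cnot N i j)"
    unfolding cnot_logical[OF ij, symmetric] ds_def by (intro acts_logically_mult acts_logically_had acts_logically_braid acts_logically_gate ij)
  show ?thesis unfolding implementable_def
  proof (intro exI[of _ P] conjI allI impI wfP)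
    fix \<rho> assume r: "density_op N \<rho>"
    then have rc: "\<rho> \<in> cm N" by (rule density_carrier)
    let ?\<rho> = "conj_by (encoder N) \<rho>"
    have d0: "density_op (2 * N) ?\<rho>"
      by (rule density_conj_by[OF r encoder_carrier encoder_isometry])
    have c: "?\<rho> \<in> cm (2 * N)" by (rule density_carrier[OF d0])
    define A where "A s = conj_by (K s) ?\<rho>" for s
    have Kc: "K s \<in> cm (2 * N)" "mat_adjoint (K s) * K s = 1\<^sub>m (2 ^ (2 * N))" "F s (emb 0 (2 * N) ?\<rho>) = emb 0 (2 * N) (A s)" for s
      using K[of s] c by (simp_all add: realizes_def A_def)
    have A: "density_op (2 * N) (A s)" for s
      unfolding A_def by (rule density_conj_by[OF d0 Kc(1,2)])
    have l: "had_op j (emb 0 (2 * N) ?\<rho>) \<in> loc (2 * N)"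
      using Kc(3)[of None] density_carrier[OF A[of None]] by (simp add: F_def locm_emb)
    have o: "run \<rho>\<^sub>8 P (2 * N) ?\<rho> \<in> cm (2 * N)" "emb 0 (2 * N) (run \<rho>\<^sub>8 P (2 * N) ?\<rho>) = run_op \<rho>\<^sub>8 P (2 * N) (emb 0 (2 * N) ?\<rho>)"
      using run_emb[OF density_carrier[OF \<rho>(1)] wfP c] by simp_all
    have "emb 0 (2 * N) (mmix (2 * N) UNIV w A) = (\<Sum>s\<in>UNIV. w s *\<^sub>R F s (emb 0 (2 * N) ?\<rho>))"
      by (subst emb_mmix) (simp_all add: density_carrier[OF A] Kc(3))
    also have "\<dots> = emb 0 (2 * N) (run \<rho>\<^sub>8 P (2 * N) ?\<rho>)"
      unfolding o(2) runP[OF l] sum_option_triple by (simp add: w_def F_def)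
    finally have m: "run \<rho>\<^sub>8 P (2 * N) ?\<rho> = mmix (2 * N) UNIV w A"
      by (intro emb_inject[of _ "2 * N" _ 0] o(1)) simp_all
    have w: "0 \<le> w s" "sum w UNIV = 1" "1 - \<delta> \<le> w (Some (False, False, False))" for s
      using q0 q(2) by (auto simp: w_def sum_option_triple tot_def split: option.split)
    have "A (Some (False, False, False)) = conj_by (encoder N) (conj_by (cnot N i j) \<rho>)"
      unfolding A_def K_def using conj_by_encoder[OF KI cnot_carrier(1)[OF ij(1,2)] _ rc] ph_unit by simp
    with density_split[of "2 * N" A w \<delta>, OF A w] show "\<exists>p \<tau>. 0 \<le> p \<and> p \<le> \<delta> \<and> p \<le> 1 \<and> density_op (2 * N) \<tau> \<and>
      run \<rho>\<^sub>8 P (2 * N) ?\<rho> = complex_of_real (1 - p) \<cdot>\<^sub>m conj_by (encoder N) (conj_by (cnot N i j) \<rho>) + complex_of_real p \<cdot>\<^sub>m \<tau>"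
      unfolding m by simp
  qed
qed

theorem mainTheorem2:
  fixes \<rho>\<^sub>8 :: "complex mat" and \<epsilon>\<^sub>8 :: real
  assumes "density_op 4 \<rho>\<^sub>8"
    and "parity_op 4 * \<rho>\<^sub>8 = \<rho>\<^sub>8" and "\<rho>\<^sub>8 * parity_op 4 = \<rho>\<^sub>8"
    and "complex_of_real \<epsilon>\<^sub>8 = 1 - (mat_adjoint a8 * \<rho>\<^sub>8 * a8) $$ (0, 0)"
    and "\<epsilon>\<^sub>8 < 0.38"
  shows "\<forall>\<delta>>0. \<forall>N.
      (\<forall>i<N. \<forall>j<N. i \<noteq> j \<longrightarrow> implementable \<rho>\<^sub>8 N (cnot N i j) \<delta>) \<and>
      (\<forall>i<N. implementable \<rho>\<^sub>8 N (on_qubit N i hadamard) \<delta>) \<and>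
      (\<forall>i<N. implementable \<rho>\<^sub>8 N (on_qubit N i phase_gate) \<delta>)"
  using implementable_cnot[OF assms] implementable_hadamard[OF density_carrier[OF assms(1)]]
    implementable_phase[OF density_carrier[OF assms(1)]]
  by blast

end
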